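(* The class of languages recognisable in polynomial time by an $\mathrm{ASRAM}[+,\leftarrow,\mathit{Bool}]$ equals PSPACE, the class of languages recognisable by a Turing machine using space polynomial in the input length.
   Context: A $\mathrm{RAM}[\mathit{op}]$ is a unit-cost random access machine with registers holding nonnegative integers, direct and indirect addressing, conditional jumps, an equality comparator, and the operations in $\mathit{op}$ each costing one time unit. Here $+$ is addition, $a\leftarrow b=a\cdot 2^b$ (left shift), and $\mathit{Bool}$ denotes the bitwise Boolean operations. The input integer is placed in $R[0]$, all other registers are $0$; as a language acceptor the machine accepts iff $R[0]\neq 0$ at termination. ALS set: a nonempty set $\mathbf{S}$ of infinite integer sequences such that for every $i$ and every $\{A_k\}\in\mathbf{S}$ there is $\{B_k\}\in\mathbf{S}$ with $B_i=A_i+1$ and $B_j=A_j$ for all $j<i$. ASRAM: an $\mathrm{ASRAM}[\mathit{op}]$ is a $\mathrm{RAM}[\mathit{op}]$ program that may also call a pseudofunction $\mathit{ALN}()$ returning an integer. It computes $f$ if for each input $\mathit{inp}$ there is an ALS set $\mathbf{S}$ such that for every $\{A_i\}\in\mathbf{S}$, replacing the $i$-th invocation of $\mathit{ALN}()$ by $A_i$ yields a RAM computing $f(\mathit{inp})$. It recognises a language $L$ if it computes a function that is nonzero exactly on $L$. Its running time on $\mathit{inp}$ is the worst case over all sequences $\{A_i\}$ of the running time of the resulting RAM; polynomial time is measured in the bit-length of the input. *)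

theory Defs
  imports Main
begin

fun bits :: "nat \<Rightarrow> bool list" where
  "bits n = (if n = 0 then [] else odd n # bits (n div 2))"

definition bitlen :: "nat \<Rightarrow> nat" where
  "bitlen n = length (bits n)"

text \<open>Bitwise application of a Boolean function f (with f False False = False,
  enforced by well-formedness of programs) to two nonnegative integers.\<close>
definition bitop :: "(bool \<Rightarrow> bool \<Rightarrow> bool) \<Rightarrow> nat \<Rightarrow> nat \<Rightarrow> nat" where
  "bitop f a b = (\<Sum>i<Suc (a + b). if f (bit a i) (bit b i) then 2 ^ i else 0)"

datatype instr =
    Const nat nat
  | Copy nat nat
  | Load nat nat
  | Store nat nat
  | Add nat nat nat
  | Shl nat nat nat
  | BoolOp "bool \<Rightarrow> bool \<Rightarrow> bool" nat nat nat
  | Jeq nat nat nat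
  | Halt
  | ALN nat

type_synonym program = "instr list"

record config =
  pc :: nat
  regs :: "nat \<Rightarrow> nat"
  ncalls :: nat

definition wf_program :: "program \<Rightarrow> bool" where
  "wf_program P \<longleftrightarrow> (\<forall>ins \<in> set P. \<forall>f i j k. ins = BoolOp f i j k \<longrightarrow> \<not> f False False)"

definition halted :: "program \<Rightarrow> config \<Rightarrow> bool" where
  "halted P c \<longleftrightarrow> pc c \<ge> length P \<or> P ! pc c = Halt"

definition step :: "program \<Rightarrow> (nat \<Rightarrow> nat) \<Rightarrow> config \<Rightarrow> config" where
  "step P A c = (if halted P c then c else
     (let R = regs c; n = pc c + 1 in
      case P ! pc c of
        Const i v \<Rightarrow> c\<lparr>pc := n, regs := R(i := v)\<rparr>
      | Copy i j \<Rightarrow> c\<lparr>pc := n, regs := R(i := R j)\<rparr>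
      | Load i j \<Rightarrow> c\<lparr>pc := n, regs := R(i := R (R j))\<rparr>
      | Store i j \<Rightarrow> c\<lparr>pc := n, regs := R(R i := R j)\<rparr>
      | Add i j k \<Rightarrow> c\<lparr>pc := n, regs := R(i := R j + R k)\<rparr>
      | Shl i j k \<Rightarrow> c\<lparr>pc := n, regs := R(i := R j * 2 ^ R k)\<rparr>
      | BoolOp f i j k \<Rightarrow> c\<lparr>pc := n, regs := R(i := bitop f (R j) (R k))\<rparr>
      | Jeq i j t \<Rightarrow> c\<lparr>pc := (if R i = R j then t else n)\<rparr>
      | Halt \<Rightarrow> c
      | ALN i \<Rightarrow> c\<lparr>pc := n, regs := R(i := A (ncalls c)), ncalls := Suc (ncalls c)\<rparr>))"

definition init_config :: "nat \<Rightarrow> config" where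
  "init_config inp = \<lparr>pc = 0, regs = (\<lambda>_. 0)(0 := inp), ncalls = 0\<rparr>"

definition run :: "program \<Rightarrow> (nat \<Rightarrow> nat) \<Rightarrow> nat \<Rightarrow> nat \<Rightarrow> config" where
  "run P A inp t = (step P A ^^ t) (init_config inp)"

definition ALS :: "(nat \<Rightarrow> nat) set \<Rightarrow> bool" where
  "ALS S \<longleftrightarrow> S \<noteq> {} \<and>
     (\<forall>i. \<forall>A \<in> S. \<exists>B \<in> S. B i = A i + 1 \<and> (\<forall>j<i. B j = A j))"

definition asram_computes :: "program \<Rightarrow> (nat \<Rightarrow> nat) \<Rightarrow> bool" where
  "asram_computes P f \<longleftrightarrow>
     (\<forall>inp. \<exists>S. ALS S \<and>
        (\<forall>A \<in> S. \<exists>t. halted P (run P A inp t) \<and> regs (run P A inp t) 0 = f inp))"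

definition asram_recognises :: "program \<Rightarrow> nat set \<Rightarrow> bool" where
  "asram_recognises P L \<longleftrightarrow> (\<exists>f. asram_computes P f \<and> (\<forall>x. f x \<noteq> 0 \<longleftrightarrow> x \<in> L))"

definition asram_poly_time :: "program \<Rightarrow> bool" where
  "asram_poly_time P \<longleftrightarrow>
     (\<exists>c k. \<forall>inp A. halted P (run P A inp (c * (bitlen inp + 1) ^ k)))"

definition ASRAM_PTIME :: "nat set set" where
  "ASRAM_PTIME = {L. \<exists>P. wf_program P \<and> asram_poly_time P \<and> asram_recognises P L}"

text \<open>States are 0..<nst, tape symbols 0..<nsym; 0 is the blank, 1 and 2 encode
  the input bits False and True. Moves are -1, 0, 1.\<close>
record TM =
  nst :: nat
  nsym :: nat
  dlt :: "nat \<Rightarrow> nat \<Rightarrow> nat \<times> nat \<times> int"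
  q0 :: nat
  qacc :: nat
  qrej :: nat

definition wf_tm :: "TM \<Rightarrow> bool" where
  "wf_tm M \<longleftrightarrow> nsym M \<ge> 3 \<and> q0 M < nst M \<and> qacc M < nst M \<and> qrej M < nst M \<and>
     qacc M \<noteq> qrej M \<and>
     (\<forall>q < nst M. \<forall>a < nsym M. case dlt M q a of (q', b, d) \<Rightarrow>
        q' < nst M \<and> b < nsym M \<and> d \<in> {-1, 0, 1})"

type_synonym tm_conf = "nat \<times> (int \<Rightarrow> nat) \<times> int"

definition tm_step :: "TM \<Rightarrow> tm_conf \<Rightarrow> tm_conf" where
  "tm_step M cf = (case cf of (q, tp, h) \<Rightarrow>
     if q = qacc M \<or> q = qrej M then (q, tp, h)
     else (case dlt M q (tp h) of (q', b, d) \<Rightarrow> (q', tp(h := b), h + d)))"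

definition tm_init :: "TM \<Rightarrow> bool list \<Rightarrow> tm_conf" where
  "tm_init M w = (q0 M,
     \<lambda>i. if 0 \<le> i \<and> i < int (length w) then (if w ! nat i then 2 else 1) else 0, 0)"

definition tm_run :: "TM \<Rightarrow> bool list \<Rightarrow> nat \<Rightarrow> tm_conf" where
  "tm_run M w t = (tm_step M ^^ t) (tm_init M w)"

definition tm_decides_in_space :: "TM \<Rightarrow> bool list set \<Rightarrow> (nat \<Rightarrow> nat) \<Rightarrow> bool" where
  "tm_decides_in_space M L s \<longleftrightarrow>
     (\<forall>w. (\<exists>t. (fst (tm_run M w t) = qacc M \<or> fst (tm_run M w t) = qrej M) \<and>
              (fst (tm_run M w t) = qacc M \<longleftrightarrow> w \<in> L)) \<and>
          (\<forall>t. \<bar>snd (snd (tm_run M w t))\<bar> \<le> int (s (length w))))"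

definition PSPACE :: "bool list set set" where
  "PSPACE = {L. \<exists>M c k. wf_tm M \<and> tm_decides_in_space M L (\<lambda>n. c * (n + 1) ^ k)}"

end

theory Submission
  imports Defs "HOL-Library.Nat_Bijection"
begin

text \<open>A language recognised by an ASRAM in polynomial time is in PSPACE because the values of \<open>ALN\<close> may be taken to be
  powers of two with exponents that grow so fast that they behave as formally independent large numbers.
  The registers then contain values of straight-line programs over such numbers. These are too large to be written
  down, but their nonzero bits lie near polynomially many symbolic positions, and whether two nodes of the program are equal
  is the outcome of a game of polynomial length about single bits, including guessed carry chains. Such games are decided in
  polynomial space, so the run can be simulated with nodes instead of numbers.

  Conversely, a Boolean function of \<open>V\<close> variables is stored as a number with \<open>2\<^sup>V\<close> bits, on which the
  operations act in parallel. Savitch's formula for the configuration reached after \<open>2\<^sup>m\<close> steps is a quantified Boolean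
  formula of polynomial size. Its matrix is evaluated by bitwise operations and its quantifiers are eliminated one by one,
  each with one shift by a power of two.\<close>

text \<open>Addition at most doubles the number of ones, so a short run may create exponentially
  many ones, but carry chains are no longer than that and their length fits into an offset of
  polynomially many bits. A bit position is therefore coded by such an offset and the set of nodes
  whose shift amounts the bit has collected. The obstacle is that comparing two such positions is
  again a comparison of huge numbers. Two facts resolve it: the exponents of the \<open>ALN\<close>
  values are so far apart that equal positions collect the same ones, and what remains is a sum of
  values of earlier nodes, whose bits need only positions over fewer nodes. Every such descent
  lowers a level, and this bounds the length of the game. Powers of two are chosen because each has
  a single one, and an ALS set allows every entry to be raised arbitrarily, at the price of losing
  control over the later entries. In the converse direction \<open>ALN\<close> is never called: the
  left shift alone supplies the power, and the absence of a right shift is why eliminated variables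
  are kept at true.\<close>

declare bits.simps [simp del]

section \<open>Numbers as bit lists, least significant bit first\<close>

lemma bits_0 [simp]: "bits 0 = []"
  by (simp add: bits.simps)

lemma bits_pos: "n > 0 \<Longrightarrow> bits n = odd n # bits (n div 2)"
  by (subst bits.simps) simp

fun val :: "bool list \<Rightarrow> nat" where
  "val [] = 0"
| "val (b # l) = of_bool b + 2 * val l"

lemma val_bits [simp]: "val (bits n) = n"
proof (induction n rule: less_induct)
  case (less n)
  show ?case
  proof (cases "n = 0")
    case False
    then have "bits n = odd n # bits (n div 2)" by (simp add: bits_pos)
    moreover have "val (bits (n div 2)) = n div 2" using less False by auto
    ultimately show ?thesis by (cases "odd n") (auto elim!: evenE oddE)
  qed simp
qed

text \<open>A numeral without leading zeros ends in True. All other words code no number, and the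
  constructed Turing machine has to reject them.\<close>

lemma bits_val_iff: "bits (val w) = w \<longleftrightarrow> (w = [] \<or> last w)"
proof (induction w)
  case (Cons b w)
  have "val w > 0" if "w \<noteq> []" "last w"
    using that by (induction w) (auto split: if_splits)
  moreover have "val w = 0" if "bits (val w) \<noteq> w" "b = False" "val (b#w) = 0" using that by simp
  ultimately show ?case using Cons
    by (cases "val (b # w) = 0") (auto simp: bits_pos of_bool_def split: if_splits)
qed simp

lemma bitlen_le_iff: "bitlen n \<le> k \<longleftrightarrow> n < 2 ^ k"
proof (induction k arbitrary: n)
  case 0
  then show ?case by (simp add: bitlen_def bits.simps)
next
  case (Suc k)
  show ?case
  proof (cases "n = 0")
    case False
    then have "bitlen n = Suc (bitlen (n div 2))" by (simp add: bitlen_def bits_pos)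
    then show ?thesis using Suc[of "n div 2"] by (auto simp: less_mult_imp_div_less)
  qed (simp add: bitlen_def)
qed

lemma less_two_power_bitlen: "n < 2 ^ bitlen n"
  using bitlen_le_iff by blast

section \<open>While programs on registers and their simulation by Turing machines\<close>

text \<open>Time is of no concern for space, so counter programs suffice: each primitive is one
  sweep of a Turing machine over a binary counter.\<close>

datatype cmd = CInc nat | CDec nat | CSeq cmd cmd | CWhile nat cmd

text \<open>The cap \<open>B\<close> on the register contents is the only resource that is tracked;
  its bit length becomes the space bound of the simulating machine.\<close>

inductive ex :: "nat \<Rightarrow> cmd \<Rightarrow> (nat \<Rightarrow> nat) \<Rightarrow> (nat \<Rightarrow> nat) \<Rightarrow> bool" for B where
  CInc: "s v < B \<Longrightarrow> ex B (CInc v) s (s(v := Suc (s v)))"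
| CDec: "s v > 0 \<Longrightarrow> ex B (CDec v) s (s(v := s v - 1))"
| CSeq: "ex B a s s' \<Longrightarrow> ex B b s' s'' \<Longrightarrow> ex B (CSeq a b) s s''"
| CWhile0: "s v = 0 \<Longrightarrow> ex B (CWhile v c) s s"
| CWhile1: "s v \<noteq> 0 \<Longrightarrow> ex B c s s' \<Longrightarrow> ex B (CWhile v c) s' s'' \<Longrightarrow> ex B (CWhile v c) s s''"

fun vars :: "cmd \<Rightarrow> nat set" where
  "vars (CInc v) = {v}"
| "vars (CDec v) = {v}"
| "vars (CSeq a b) = vars a \<union> vars b"
| "vars (CWhile v c) = insert v (vars c)"

lemma finite_vars: "finite (vars c)"
  by (induction c) auto

text \<open>\<open>Go k\<close> works off the pending commands \<open>k\<close> with the head moving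
  right, \<open>Ret v k\<close> first walks back along track \<open>v\<close>, and
  \<open>Chk b\<close> scans the input for canonicity, where \<open>b\<close> is the last bit
  seen.\<close>

datatype ctl = Chk bool | Go "cmd list" | Ret nat "cmd list" | Acc | Rej

text \<open>A tape symbol packs one ternary digit per register, 0 for blank and 1, 2 for the bits.
  Track 0 is the lowest digit, so the prescribed input symbols 0, 1, 2 already form a tape with the
  input in register 0 and all other registers blank.\<close>

fun code :: "nat \<Rightarrow> (nat \<Rightarrow> nat) \<Rightarrow> nat" where
  "code 0 d = 0"
| "code (Suc n) d = d 0 + 3 * code n (\<lambda>i. d (Suc i))"

fun dig :: "nat \<Rightarrow> nat \<Rightarrow> nat" where
  "dig a 0 = a mod 3"
| "dig a (Suc i) = dig (a div 3) i"

lemma dig_less: "dig a i < 3"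
  by (induction a i rule: dig.induct) auto

lemma dig_code: "i < n \<Longrightarrow> (\<And>j. d j < 3) \<Longrightarrow> dig (code n d) i = d i"
proof (induction n arbitrary: d i)
  case (Suc n)
  have "d 0 < 3" using Suc.prems by blast
  then have "(d 0 + 3 * m) mod 3 = d 0" "(d 0 + 3 * m) div 3 = m" for m by auto
  moreover have "dig (code n (\<lambda>i. d (Suc i))) j = d (Suc j)" if "j < n" for j
    using Suc.IH[OF that, of "\<lambda>i. d (Suc i)"] Suc.prems(2) by blast
  ultimately show ?case using Suc.prems(1)
    by (cases i) (simp_all only: code.simps dig.simps Suc_less_eq)
qed simp

lemma code_less: "(\<And>j. d j < 3) \<Longrightarrow> code n d < 3 ^ n"
proof (induction n arbitrary: d)
  case (Suc n)
  have "d 0 < 3" by (rule Suc.prems)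
  moreover have "code n (\<lambda>i. d (Suc i)) < 3 ^ n" by (rule Suc.IH) (rule Suc.prems)
  ultimately show ?case unfolding code.simps power_Suc by linarith
qed simp

lemma code_cong: "(\<And>j. j < n \<Longrightarrow> d j = d' j) \<Longrightarrow> code n d = code n d'"
proof (induction n arbitrary: d d')
  case (Suc n)
  have "d 0 = d' 0" by (rule Suc.prems) simp
  moreover have "code n (\<lambda>i. d (Suc i)) = code n (\<lambda>i. d' (Suc i))"
    by (rule Suc.IH) (rule Suc.prems, simp)
  ultimately show ?case by (simp only: code.simps)
qed simp

declare dig.simps [simp del]

lemma code_zero: "code n (\<lambda>_. 0) = 0"
  by (induction n) auto

definition digit :: "bool list \<Rightarrow> nat \<Rightarrow> nat" where
  "digit l i = (if i < length l then if l ! i then 2 else 1 else 0)"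

lemma digit_less: "digit l i < 3"
  by (simp add: digit_def)

fun binc :: "bool list \<Rightarrow> bool list" where
  "binc [] = [True]"
| "binc (False # l) = True # l"
| "binc (True # l) = False # binc l"

fun bdec :: "bool list \<Rightarrow> bool list" where
  "bdec [] = []"
| "bdec (True # l) = False # l"
| "bdec (False # l) = True # bdec l"

lemma val_binc: "val (binc l) = Suc (val l)"
  by (induction l rule: binc.induct) auto

lemma val_bdec: "val l > 0 \<Longrightarrow> val (bdec l) = val l - 1"
  by (induction l rule: bdec.induct) auto

lemma length_bdec: "length (bdec l) = length l"
  by (induction l rule: bdec.induct) auto

text \<open>A track grows only if all its bits are one, so a track of at most \<open>K\<close> cells
  stays within them as long as the new value is below \<open>2 ^ K\<close>, although leading zeros
  are never removed.\<close>

lemma length_binc: "length (binc l) = length l \<or> (length (binc l) = Suc (length l) \<and> Suc (val l) = 2 ^ length l)"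
  by (induction l rule: binc.induct) auto

lemma binc_nonempty [simp]: "binc l \<noteq> []"
  by (induction l rule: binc.induct) auto

section \<open>The simulating machine and the correctness of its sweeps\<close>

locale sim =
  fixes N :: nat and c0 :: cmd
  assumes vars_less: "\<And>v. v \<in> vars c0 \<Longrightarrow> v < N" and N2: "N \<ge> 2"
begin

definition put :: "nat \<Rightarrow> nat \<Rightarrow> nat \<Rightarrow> nat" where
  "put a v x = code N ((dig a)(v := x))"

text \<open>Cell -1 is blank on every track and serves as the left end marker for
  \<open>Ret\<close>. The empty command list starts the final test, which searches the output
  register 1 for a one.\<close>

fun dl :: "ctl \<Rightarrow> nat \<Rightarrow> ctl \<times> nat \<times> int" where
  "dl (Chk b) a = (if dig a 0 = 0 then (if b then (Ret 0 [c0], a, -1) else (Rej, a, 0))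
      else (Chk (dig a 0 = 2), a, 1))"
| "dl (Go []) a = (if dig a 1 = 0 then (Rej, a, 0) else if dig a 1 = 1 then (Go [], a, 1) else (Acc, a, 0))"
| "dl (Go (CInc v # k)) a = (if dig a v = 2 then (Go (CInc v # k), put a v 1, 1)
      else (Ret v k, put a v 2, -1))"
| "dl (Go (CDec v # k)) a = (if dig a v = 1 then (Go (CDec v # k), put a v 2, 1)
      else if dig a v = 2 then (Ret v k, put a v 1, -1) else (Rej, a, 0))"
| "dl (Go (CSeq x y # k)) a = (Go (x # y # k), a, 0)"
| "dl (Go (CWhile v x # k)) a = (if dig a v = 1 then (Go (CWhile v x # k), a, 1)
      else if dig a v = 2 then (Ret v (x # CWhile v x # k), a, -1) else (Ret v k, a, -1))"
| "dl (Ret v k) a = (if dig a v = 0 then (Go k, a, 1) else (Ret v k, a, -1))"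
| "dl Acc a = (Acc, a, 0)"
| "dl Rej a = (Rej, a, 0)"

type_synonym conf = "ctl \<times> (int \<Rightarrow> nat) \<times> int"

definition astep :: "conf \<Rightarrow> conf" where
  "astep cf = (case cf of (q, tp, h) \<Rightarrow>
     if q = Acc \<or> q = Rej then (q, tp, h)
     else (case dl q (tp h) of (q', b, d) \<Rightarrow> (q', tp(h := b), h + d)))"

text \<open>Only the source of a step is required to have its head in range; the last configuration
  of a run is bounded separately.\<close>

definition st :: "nat \<Rightarrow> conf \<Rightarrow> conf \<Rightarrow> bool" where
  "st K x y \<longleftrightarrow> y = astep x \<and> \<bar>snd (snd x)\<bar> \<le> int K"

abbreviation sts :: "nat \<Rightarrow> conf \<Rightarrow> conf \<Rightarrow> bool" where
  "sts K \<equiv> (st K)\<^sup>*\<^sup>*"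

definition TT :: "(nat \<Rightarrow> bool list) \<Rightarrow> int \<Rightarrow> nat" where
  "TT tr i = (if i < 0 then 0 else code N (\<lambda>r. digit (tr r) (nat i)))"

lemma dig_TT: "v < N \<Longrightarrow> dig (TT tr (int i)) v = digit (tr v) i"
  by (simp add: TT_def dig_code digit_less)

lemma dig_TT_neg: "v < N \<Longrightarrow> dig (TT tr (-1)) v = 0"
  using dig_code[of v N "\<lambda>_. 0"] by (simp add: TT_def code_zero)

lemma put_TT:
  assumes "v < N" "h < length (tr v)"
  shows "(TT tr)(int h := put (TT tr (int h)) v (if b then 2 else 1)) = TT (tr(v := (tr v)[h := b]))"
proof
  fix i :: int
  show "((TT tr)(int h := put (TT tr (int h)) v (if b then 2 else 1))) i = TT (tr(v := (tr v)[h := b])) i"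
    using assms by (auto simp: put_def TT_def dig_code digit_less intro!: code_cong)
      (auto simp: digit_def nth_list_update)
qed

lemma put_TT_app:
  assumes "v < N" "h = length (tr v)"
  shows "(TT tr)(int h := put (TT tr (int h)) v (if b then 2 else 1)) = TT (tr(v := tr v @ [b]))"
proof
  fix i :: int
  show "((TT tr)(int h := put (TT tr (int h)) v (if b then 2 else 1))) i = TT (tr(v := tr v @ [b])) i"
    using assms by (auto simp: put_def TT_def dig_code digit_less intro!: code_cong)
      (auto simp: digit_def nth_append)
qed

lemma stsI: "astep x = y \<Longrightarrow> \<bar>snd (snd x)\<bar> \<le> int K \<Longrightarrow> sts K y z \<Longrightarrow> sts K x z"
  by (rule converse_rtranclp_into_rtranclp[of "st K"]) (auto simp: st_def)

lemma ret_sim: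
  assumes "v < N" "h \<le> length (tr v)" "h \<le> Suc K"
  shows "sts (Suc K) (Ret v k, TT tr, int h - 1) (Go k, TT tr, 0)"
  using assms(2,3)
proof (induction h)
  case 0
  show ?case
    by (rule stsI[OF _ _ rtranclp.rtrancl_refl]) (auto simp: astep_def dig_TT_neg assms)
next
  case (Suc h)
  have d: "dig (TT tr (int h)) v \<noteq> 0" using Suc.prems assms(1) by (simp add: dig_TT digit_def)
  show ?case
    by (rule stsI[where y="(Ret v k, TT tr, int h - 1)"]) (use Suc d in \<open>auto simp: astep_def\<close>)
qed

text \<open>\<open>l1\<close> is the part of the track behind the head and \<open>l2\<close> the
  part still to be processed; the induction follows the carry through \<open>l2\<close>.\<close>

lemma inc_sim:
  assumes "v < N" "tr v = l1 @ l2" "length l1 + length (binc l2) \<le> Suc K"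
  shows "sts (Suc K) (Go (CInc v # k), TT tr, int (length l1)) (Go k, TT (tr(v := l1 @ binc l2)), 0)"
  using assms(2,3)
proof (induction l2 arbitrary: l1 tr rule: binc.induct)
  case 1
  have "put (TT tr (int (length l1))) v 2 = put (TT tr (int (length l1))) v (if True then 2 else 1)" by simp
  note p = put_TT_app[of v "length l1" tr True, OF assms(1), folded this]
  show ?case unfolding binc.simps
    apply (rule stsI[OF _ _ ret_sim[where h="length l1" and v=v and tr="tr(v := l1 @ [True])"]])
    using 1 assms(1) p by (auto simp: astep_def dig_TT digit_def)
next
  case (2 l)
  note p = put_TT[of v "length l1" tr True, OF assms(1)]
  show ?case unfolding binc.simps
    apply (rule stsI[OF _ _ ret_sim[where h="length l1" and v=v and tr="tr(v := l1 @ True # l)"]])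
    using 2 assms(1) p by (auto simp: astep_def dig_TT digit_def)
next
  case (3 l)
  note p = put_TT[of v "length l1" tr False, OF assms(1)]
  have "sts (Suc K) (Go (CInc v # k), TT (tr(v := (l1 @ [False]) @ l)), int (length (l1 @ [False])))
     (Go k, TT ((tr(v := (l1 @ [False]) @ l))(v := (l1 @ [False]) @ binc l)), 0)"
    by (rule 3) (use 3(2-) in auto)
  then have "sts (Suc K) (Go (CInc v # k), TT (tr(v := l1 @ False # l)), int (length l1) + 1)
     (Go k, TT (tr(v := l1 @ binc (True # l))), 0)" by (simp add: add.commute)
  then show ?case
    by (rule stsI[rotated 2]) (use 3(2-) assms(1) p in \<open>auto simp: astep_def dig_TT digit_def\<close>)
qed

lemma dec_sim:
  assumes "v < N" "tr v = l1 @ l2" "val l2 > 0" "length l1 + length l2 \<le> Suc K"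
  shows "sts (Suc K) (Go (CDec v # k), TT tr, int (length l1)) (Go k, TT (tr(v := l1 @ bdec l2)), 0)"
  using assms(2-)
proof (induction l2 arbitrary: l1 tr rule: bdec.induct)
  case 1
  then show ?case by simp
next
  case (2 l)
  note p = put_TT[of v "length l1" tr False, OF assms(1)]
  show ?case unfolding bdec.simps
    apply (rule stsI[OF _ _ ret_sim[where h="length l1" and v=v and tr="tr(v := l1 @ False # l)"]])
    using 2 assms(1) p by (auto simp: astep_def dig_TT digit_def)
next
  case (3 l)
  note p = put_TT[of v "length l1" tr True, OF assms(1)]
  have "sts (Suc K) (Go (CDec v # k), TT (tr(v := (l1 @ [True]) @ l)), int (length (l1 @ [True])))
     (Go k, TT ((tr(v := (l1 @ [True]) @ l))(v := (l1 @ [True]) @ bdec l)), 0)"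
    by (rule 3) (use 3(2-) in auto)
  then have "sts (Suc K) (Go (CDec v # k), TT (tr(v := l1 @ True # l)), int (length l1) + 1)
     (Go k, TT (tr(v := l1 @ bdec (False # l))), 0)" by (simp add: add.commute)
  then show ?case
    by (rule stsI[rotated 2]) (use 3(2-) assms(1) p in \<open>auto simp: astep_def dig_TT digit_def\<close>)
qed

lemma while_sim:
  assumes "v < N" "tr v = l1 @ l2" "length l1 + length l2 \<le> K"
  shows "sts (Suc K) (Go (CWhile v c # k), TT tr, int (length l1))
    (Go (if val l2 > 0 then c # CWhile v c # k else k), TT tr, 0)"
  using assms(2-)
proof (induction l2 arbitrary: l1)
  case Nil
  show ?case
    apply (rule stsI[OF _ _ ret_sim[where h="length l1" and v=v]])
    using Nil assms(1) by (auto simp: astep_def dig_TT digit_def)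
next
  case (Cons b l)
  show ?case
  proof (cases b)
    case True
    show ?thesis
      apply (rule stsI[OF _ _ ret_sim[where h="length l1" and v=v]])
      using Cons.prems True assms(1) by (auto simp: astep_def dig_TT digit_def)
  next
    case False
    have "sts (Suc K) (Go (CWhile v c # k), TT tr, int (length (l1 @ [b])))
      (Go (if val l > 0 then c # CWhile v c # k else k), TT tr, 0)"
      by (rule Cons.IH) (use Cons.prems in auto)
    then have "sts (Suc K) (Go (CWhile v c # k), TT tr, int (length l1) + 1)
      (Go (if val (b # l) > 0 then c # CWhile v c # k else k), TT tr, 0)" using False by (simp add: add.commute)
    then show ?thesis
      by (rule stsI[rotated 2]) (use Cons.prems False assms(1) in \<open>auto simp: astep_def dig_TT digit_def\<close>)
  qed
qed

lemma test_sim: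
  assumes "tr 1 = l1 @ l2" "length l1 + length l2 \<le> K"
  shows "\<exists>tp h. \<bar>h\<bar> \<le> int (Suc K) \<and> sts (Suc K) (Go [], TT tr, int (length l1)) (if val l2 > 0 then Acc else Rej, tp, h)"
  using assms
proof (induction l2 arbitrary: l1)
  case Nil
  have "sts (Suc K) (Go [], TT tr, int (length l1)) (Rej, TT tr, int (length l1))"
    by (rule stsI[OF _ _ rtranclp.rtrancl_refl]) (use N2 Nil in \<open>auto simp: astep_def dig_TT digit_def\<close>)
  then show ?case using Nil by (intro exI[of _ "TT tr"] exI[of _ "int (length l1)"]) auto
next
  case (Cons b l)
  show ?case
  proof (cases b)
    case True
    have "sts (Suc K) (Go [], TT tr, int (length l1)) (Acc, TT tr, int (length l1))"
      by (rule stsI[OF _ _ rtranclp.rtrancl_refl]) (use N2 Cons.prems True in \<open>auto simp: astep_def dig_TT digit_def\<close>)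
    then show ?thesis using Cons.prems True by (intro exI[of _ "TT tr"] exI[of _ "int (length l1)"]) auto
  next
    case False
    obtain tp h where h: "\<bar>h\<bar> \<le> int (Suc K)" "sts (Suc K) (Go [], TT tr, int (length (l1 @ [b]))) (if val l > 0 then Acc else Rej, tp, h)"
      using Cons.IH[of "l1 @ [b]"] Cons.prems by auto
    have "sts (Suc K) (Go [], TT tr, int (length l1)) (if val l > 0 then Acc else Rej, tp, h)"
      by (rule stsI[OF _ _ h(2)]) (use N2 Cons.prems False in \<open>auto simp: astep_def dig_TT digit_def\<close>)
    then show ?thesis using False h(1) by (intro exI[of _ tp] exI[of _ h]) auto
  qed
qed

text \<open>The tracks represent the registers by value only and may carry leading zeros. Their
  length is therefore bounded separately, and \<open>B < 2 ^ K\<close> excludes growth beyond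
  \<open>K\<close>.\<close>

lemma ex_sim:
  assumes "ex B c s s'" "vars c \<subseteq> {..<N}" "B < 2 ^ K"
    "\<And>v. v < N \<Longrightarrow> val (tr v) = s v \<and> length (tr v) \<le> K"
  shows "\<exists>tr'. (\<forall>v<N. val (tr' v) = s' v \<and> length (tr' v) \<le> K) \<and>
    sts (Suc K) (Go (c # k), TT tr, 0) (Go k, TT tr', 0)"
  using assms
proof (induction arbitrary: tr k rule: ex.induct)
  case (CInc s v)
  have v: "v < N" "val (tr v) = s v" "length (tr v) \<le> K" using CInc by auto
  have l: "length (binc (tr v)) \<le> K"
  proof (rule ccontr)
    assume "\<not> ?thesis"
    then have "Suc (val (tr v)) = 2 ^ K" using length_binc[of "tr v"] v by auto
    then show False using CInc v by auto
  qed
  have "sts (Suc K) (Go (CInc v # k), TT tr, 0) (Go k, TT (tr(v := binc (tr v))), 0)"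
    using inc_sim[OF v(1), of tr "[]" "tr v" K k] l by simp
  moreover define tr' where "tr' = tr(v := binc (tr v))"
  moreover have "\<forall>u<N. val (tr' u) = (s(v := Suc (s v))) u \<and> length (tr' u) \<le> K"
    using CInc v l by (auto simp: val_binc tr'_def)
  ultimately show ?case by blast
next
  case (CDec s v)
  have v: "v < N" "val (tr v) = s v" "length (tr v) \<le> K" using CDec by auto
  have "sts (Suc K) (Go (CDec v # k), TT tr, 0) (Go k, TT (tr(v := bdec (tr v))), 0)"
    using dec_sim[OF v(1), of tr "[]" "tr v" K k] v CDec.hyps by simp
  moreover define tr' where "tr' = tr(v := bdec (tr v))"
  moreover have "\<forall>u<N. val (tr' u) = (s(v := s v - 1)) u \<and> length (tr' u) \<le> K"
    using CDec v by (auto simp: val_bdec length_bdec tr'_def)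
  ultimately show ?case by blast
next
  case (CSeq a s s' b s'')
  have "\<exists>tr'. (\<forall>v<N. val (tr' v) = s' v \<and> length (tr' v) \<le> K) \<and>
    sts (Suc K) (Go (a # b # k), TT tr, 0) (Go (b # k), TT tr', 0)"
    by (rule CSeq.IH) (use CSeq.prems in auto)
  then obtain tr' where t: "\<forall>v<N. val (tr' v) = s' v \<and> length (tr' v) \<le> K"
     "sts (Suc K) (Go (a # b # k), TT tr, 0) (Go (b # k), TT tr', 0)" by blast
  have "\<exists>tr''. (\<forall>v<N. val (tr'' v) = s'' v \<and> length (tr'' v) \<le> K) \<and>
    sts (Suc K) (Go (b # k), TT tr', 0) (Go k, TT tr'', 0)"
    by (rule CSeq.IH) (use CSeq.prems t in auto)
  then obtain tr'' where t'': "\<forall>v<N. val (tr'' v) = s'' v \<and> length (tr'' v) \<le> K"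
     "sts (Suc K) (Go (b # k), TT tr', 0) (Go k, TT tr'', 0)" by blast
  have "sts (Suc K) (Go (CSeq a b # k), TT tr, 0) (Go k, TT tr'', 0)"
    by (rule stsI[where y="(Go (a # b # k), TT tr, 0)"])
      (use t(2) t''(2) in \<open>auto simp: astep_def\<close>)
  then show ?case using t''(1) by blast
next
  case (CWhile0 s v c)
  then have "val (tr v) = 0" "length (tr v) \<le> K" "v < N" by auto
  then have "sts (Suc K) (Go (CWhile v c # k), TT tr, 0) (Go k, TT tr, 0)"
    using while_sim[of v tr "[]" "tr v" K c k] by simp
  then show ?case using CWhile0 by blast
next
  case (CWhile1 s v c s' s'')
  have "val (tr v) > 0" "length (tr v) \<le> K" "v < N" using CWhile1.prems CWhile1.hyps by auto
  then have w: "sts (Suc K) (Go (CWhile v c # k), TT tr, 0) (Go (c # CWhile v c # k), TT tr, 0)"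
    using while_sim[of v tr "[]" "tr v" K c k] by simp
  have "\<exists>tr'. (\<forall>v<N. val (tr' v) = s' v \<and> length (tr' v) \<le> K) \<and>
    sts (Suc K) (Go (c # CWhile v c # k), TT tr, 0) (Go (CWhile v c # k), TT tr', 0)"
    by (rule CWhile1.IH) (use CWhile1.prems in auto)
  then obtain tr' where t: "\<forall>v<N. val (tr' v) = s' v \<and> length (tr' v) \<le> K"
     "sts (Suc K) (Go (c # CWhile v c # k), TT tr, 0) (Go (CWhile v c # k), TT tr', 0)" by blast
  have "\<exists>tr''. (\<forall>v<N. val (tr'' v) = s'' v \<and> length (tr'' v) \<le> K) \<and>
    sts (Suc K) (Go (CWhile v c # k), TT tr', 0) (Go k, TT tr'', 0)"
    by (rule CWhile1.IH) (use CWhile1.prems t in auto)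
  then obtain tr'' where t'': "\<forall>v<N. val (tr'' v) = s'' v \<and> length (tr'' v) \<le> K"
     "sts (Suc K) (Go (CWhile v c # k), TT tr', 0) (Go k, TT tr'', 0)" by blast
  show ?case using w t(2) t'' by (meson rtranclp_trans)
qed

lemma chk_sim:
  assumes "tr 0 = l1 @ l2" "length l1 + length l2 \<le> K"
  shows "(if (if l2 = [] then b else last l2) then sts (Suc K) (Chk b, TT tr, int (length l1)) (Go [c0], TT tr, 0)
    else \<exists>h. \<bar>h\<bar> \<le> int (Suc K) \<and> sts (Suc K) (Chk b, TT tr, int (length l1)) (Rej, TT tr, h))"
  using assms
proof (induction l2 arbitrary: l1 b)
  case Nil
  show ?case
  proof (cases b)
    case True
    show ?thesis using True
      apply simp
      apply (rule stsI[OF _ _ ret_sim[where h="length l1" and v=0]])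
      using Nil N2 by (auto simp: astep_def dig_TT digit_def)
  next
    case False
    have "sts (Suc K) (Chk b, TT tr, int (length l1)) (Rej, TT tr, int (length l1))"
      by (rule stsI[OF _ _ rtranclp.rtrancl_refl]) (use N2 Nil \<open>\<not> b\<close> in \<open>auto simp: astep_def dig_TT digit_def\<close>)
    then show ?thesis using False Nil by (auto intro!: exI[of _ "int (length l1)"])
  qed
next
  case (Cons a l)
  have s: "astep (Chk b, TT tr, int (length l1)) = (Chk a, TT tr, int (length (l1 @ [a])))"
    using Cons.prems N2 by (auto simp: astep_def dig_TT digit_def)
  have "\<And>z. sts (Suc K) (Chk a, TT tr, int (length (l1 @ [a]))) z \<Longrightarrow> sts (Suc K) (Chk b, TT tr, int (length l1)) z"
    by (rule stsI[OF s]) (use Cons.prems in auto)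
  moreover have "(if (if l = [] then a else last l) then sts (Suc K) (Chk a, TT tr, int (length (l1@[a]))) (Go [c0], TT tr, 0)
    else \<exists>h. \<bar>h\<bar> \<le> int (Suc K) \<and> sts (Suc K) (Chk a, TT tr, int (length (l1@[a]))) (Rej, TT tr, h))"
    by (rule Cons.IH) (use Cons.prems in auto)
  ultimately show ?case by (auto split: if_splits)
qed

definition inp_tr :: "bool list \<Rightarrow> nat \<Rightarrow> bool list" where
  "inp_tr w = (\<lambda>_. [])(0 := w)"

lemma run_sim:
  assumes "bits (val w) = w \<Longrightarrow> ex B c0 ((\<lambda>_. 0)(0 := val w)) s'"
    "B < 2 ^ K" "length w \<le> K"
  shows "\<exists>tp h. \<bar>h\<bar> \<le> int (Suc K) \<and>
    sts (Suc K) (Chk True, TT (inp_tr w), 0) (if bits (val w) = w \<and> s' 1 > 0 then Acc else Rej, tp, h)"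
proof (cases "bits (val w) = w")
  case False
  then show ?thesis using chk_sim[of "inp_tr w" "[]" w K True] assms(3) by (auto simp: inp_tr_def bits_val_iff)
next
  case True
  then have c: "sts (Suc K) (Chk True, TT (inp_tr w), 0) (Go [c0], TT (inp_tr w), 0)"
    using chk_sim[of "inp_tr w" "[]" w K True] assms(3) by (auto simp: inp_tr_def bits_val_iff split: if_splits)
  have "\<exists>tr'. (\<forall>v<N. val (tr' v) = s' v \<and> length (tr' v) \<le> K) \<and>
    sts (Suc K) (Go (c0 # []), TT (inp_tr w), 0) (Go [], TT tr', 0)"
    by (rule ex_sim[OF assms(1)[OF True]]) (use vars_less assms in \<open>auto simp: inp_tr_def\<close>)
  then obtain tr' where t: "\<forall>v<N. val (tr' v) = s' v \<and> length (tr' v) \<le> K"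
     "sts (Suc K) (Go (c0 # []), TT (inp_tr w), 0) (Go [], TT tr', 0)" by blast
  have t1: "length (tr' 1) \<le> K" "val (tr' 1) = s' 1" using t(1) N2 by auto
  obtain tp h where "\<bar>h\<bar> \<le> int (Suc K)" "sts (Suc K) (Go [], TT tr', 0) (if s' 1 > 0 then Acc else Rej, tp, h)"
    using test_sim[of tr' "[]" "tr' 1" K] t1 by auto
  with c t(2) True show ?thesis by (intro exI[of _ tp] exI[of _ h]) (auto intro: rtranclp_trans)
qed

text \<open>The command lists that can be pending. A loop pushes its body in front of itself and
  every command leads only to its own subterms, so there are finitely many, which makes the control
  of the machine finite.\<close>

fun conts :: "cmd \<Rightarrow> cmd list \<Rightarrow> cmd list set" where
  "conts (CInc v) k = {CInc v # k}"
| "conts (CDec v) k = {CDec v # k}"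
| "conts (CSeq a b) k = {CSeq a b # k} \<union> conts a (b # k) \<union> conts b k"
| "conts (CWhile v c) k = {CWhile v c # k} \<union> conts c (CWhile v c # k)"

fun good :: "cmd list set \<Rightarrow> cmd list \<Rightarrow> bool" where
  "good S [] = True"
| "good S (CInc v # k) = (v < N \<and> k \<in> S)"
| "good S (CDec v # k) = (v < N \<and> k \<in> S)"
| "good S (CSeq a b # k) = (a # b # k \<in> S)"
| "good S (CWhile v c # k) = (v < N \<and> k \<in> S \<and> c # CWhile v c # k \<in> S)"

lemma good_mono: "good S k \<Longrightarrow> S \<subseteq> S' \<Longrightarrow> good S' k"
  by (cases "(S, k)" rule: good.cases) auto

lemma in_conts: "c # k \<in> conts c k"
  by (cases c) auto

lemma conts_good: "vars c \<subseteq> {..<N} \<Longrightarrow> k' \<in> conts c k \<Longrightarrow> good (insert k (conts c k)) k'"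
proof (induction c arbitrary: k k')
  case (CSeq a b)
  consider "k' = CSeq a b # k" | "k' \<in> conts a (b # k)" | "k' \<in> conts b k" using CSeq.prems by auto
  then show ?case
  proof cases
    case 1
    then show ?thesis using in_conts[of a "b # k"] by simp
  next
    case 2
    then show ?thesis using CSeq.IH(1)[of k' "b # k"] CSeq.prems in_conts[of b k]
      by (auto elim!: good_mono)
  next
    case 3
    then show ?thesis using CSeq.IH(2)[of k' k] CSeq.prems
      by (auto elim!: good_mono)
  qed
next
  case (CWhile v c)
  consider "k' = CWhile v c # k" | "k' \<in> conts c (CWhile v c # k)" using CWhile.prems by auto
  then show ?case
  proof cases
    case 1
    then show ?thesis using in_conts[of c "CWhile v c # k"] CWhile.prems by simp
  next
    case 2
    then show ?thesis using CWhile.IH[of k' "CWhile v c # k"] CWhile.prems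
      by (auto elim!: good_mono)
  qed
qed auto

lemma finite_conts: "finite (conts c k)"
  by (induction c arbitrary: k) auto

definition KK :: "cmd list set" where "KK = insert [] (conts c0 [])"

definition Q :: "ctl set" where
  "Q = {Chk True, Chk False, Acc, Rej} \<union> Go ` KK \<union> (\<lambda>(v, k). Ret v k) ` ({..<N} \<times> KK)"

lemma finite_Q: "finite Q"
  by (simp add: Q_def KK_def finite_conts)

lemma good_KK: "k \<in> KK \<Longrightarrow> good KK k"
  using conts_good[of c0 k "[]"] vars_less by (auto simp: KK_def)

lemma dl_Q: "q \<in> Q \<Longrightarrow> fst (dl q a) \<in> Q"
  using N2 in_conts[of c0 "[]"]
  by (cases "(q, a)" rule: dl.cases) (auto simp: Q_def KK_def[symmetric] image_iff dest!: good_KK, auto simp: KK_def)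

lemma put_less: "x < 3 \<Longrightarrow> put a v x < 3 ^ N"
  unfolding put_def by (rule code_less) (auto simp: dig_less)

lemma dl_sym: "a < 3 ^ N \<Longrightarrow> fst (snd (dl q a)) < 3 ^ N"
  by (cases "(q, a)" rule: dl.cases) (auto simp: put_less)

lemma dl_mov: "snd (snd (dl q a)) \<in> {-1, 0, 1}"
  by (cases "(q, a)" rule: dl.cases) auto

text \<open>The control states are numbered by a map \<open>f\<close> that is injective on
  \<open>Q\<close> only, so agreement of the two step functions carries the invariant that the state
  stays in \<open>Q\<close>.\<close>

lemma TM_exists:
  "\<exists>M f. wf_tm M \<and> f (Chk True) = q0 M \<and> f Acc = qacc M \<and> f Rej = qrej M \<and>
    (\<forall>q\<in>Q. (f q = qacc M) = (q = Acc) \<and> (f q = qrej M) = (q = Rej)) \<and>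
    (\<forall>q\<in>Q. \<forall>tp h. (case astep (q, tp, h) of (q', tp', h') \<Rightarrow> tm_step M (f q, tp, h) = (f q', tp', h') \<and> q' \<in> Q))"
proof -
  obtain f where f: "bij_betw f Q {..<card Q}"
    using ex_bij_betw_finite_nat[OF finite_Q] by (auto simp: atLeast0LessThan)
  define g where "g = inv_into Q f"
  have inj: "inj_on f Q" using f by (rule bij_betw_imp_inj_on)
  have gf: "g (f q) = q" if "q \<in> Q" for q using that inj by (simp add: g_def)
  have fl: "f q < card Q" if "q \<in> Q" for q using f that by (auto simp: bij_betw_def)
  have gQ: "g n \<in> Q" if "n < card Q" for n using f that by (metis bij_betw_def g_def inv_into_into lessThan_iff)
  have A: "Chk True \<in> Q" "Acc \<in> Q" "Rej \<in> Q" by (auto simp: Q_def)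
  define M where "M = \<lparr>nst = card Q, nsym = 3 ^ N,
    dlt = (\<lambda>q a. case dl (g q) a of (q', b, d) \<Rightarrow> (f q', b, d)),
    q0 = f (Chk True), qacc = f Acc, qrej = f Rej\<rparr>"
  have "(3::nat) ^ 1 \<le> 3 ^ N" by (rule power_increasing) (use N2 in auto)
  moreover have "f Acc \<noteq> f Rej" using inj A by (auto simp: inj_on_def)
  moreover have "f (fst (dl (g q) a)) < card Q \<and> fst (snd (dl (g q) a)) < 3 ^ N \<and> snd (snd (dl (g q) a)) \<in> {- 1, 0, 1}"
    if "q < card Q" "a < 3 ^ N" for q a
    using dl_Q[OF gQ[OF that(1)], of a] dl_sym[OF that(2), of "g q"] dl_mov[of "g q" a] fl by blast
  ultimately have wf: "wf_tm M" using A fl by (simp add: wf_tm_def M_def case_prod_unfold)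
  have ff: "(f q = f q') = (q = q')" if "q \<in> Q" "q' \<in> Q" for q q' using inj that by (auto simp: inj_on_def)
  have "(case astep (q, tp, h) of (q', tp', h') \<Rightarrow> tm_step M (f q, tp, h) = (f q', tp', h') \<and> q' \<in> Q)"
    if "q \<in> Q" for q tp h
    using that dl_Q[OF that, of "tp h"] A by (auto simp: astep_def tm_step_def M_def gf ff split: prod.splits)
  with wf ff A show ?thesis by (intro exI[of _ M] exI[of _ f]) (simp add: M_def)
qed

lemma sts_funpow:
  assumes "sts K x y"
  shows "\<exists>n. (astep ^^ n) x = y \<and> (\<forall>i<n. \<bar>snd (snd ((astep ^^ i) x))\<bar> \<le> int K)"
  using assms
proof (induction rule: converse_rtranclp_induct)
  case base
  show ?case by (rule exI[of _ 0]) simp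
next
  case (step x z)
  then obtain n where n: "(astep ^^ n) z = y" "\<forall>i<n. \<bar>snd (snd ((astep ^^ i) z))\<bar> \<le> int K" by blast
  have z: "z = astep x" "\<bar>snd (snd x)\<bar> \<le> int K" using step by (auto simp: st_def)
  have s: "(astep ^^ Suc i) x = (astep ^^ i) z" for i using z by (simp add: funpow_swap1)
  show ?case
  proof (intro exI[of _ "Suc n"] conjI allI impI)
    fix i assume "i < Suc n"
    then show "\<bar>snd (snd ((astep ^^ i) x))\<bar> \<le> int K" using n(2) z(2) s by (cases i) (auto simp del: funpow.simps(2))
  qed (use s n in simp)
qed

text \<open>Words that are not canonical numerals are rejected by \<open>Chk\<close>, so the program
  has to behave well on numbers only. A configuration that accepts or rejects is a fixed point,
  hence the head bound of the finite run holds forever.\<close>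

theorem decides:
  assumes "\<And>x. \<exists>s'. ex (Bd (bitlen x)) c0 ((\<lambda>_. 0)(0 := x)) s' \<and> (s' 1 \<noteq> 0 \<longleftrightarrow> x \<in> L)"
    "\<And>n. n \<le> KB n \<and> Bd n < 2 ^ KB n" "\<And>n. Suc (KB n) \<le> c * (n + 1) ^ k"
  shows "bits ` L \<in> PSPACE"
proof -
  obtain M f where Mf: "wf_tm M" "f (Chk True) = q0 M" "f Acc = qacc M" "f Rej = qrej M"
    "\<forall>q\<in>Q. (f q = qacc M) = (q = Acc) \<and> (f q = qrej M) = (q = Rej)"
    "\<forall>q\<in>Q. \<forall>tp h. (case astep (q, tp, h) of (q', tp', h') \<Rightarrow> tm_step M (f q, tp, h) = (f q', tp', h') \<and> q' \<in> Q)"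
    using TM_exists by blast
  have "tm_decides_in_space M (bits ` L) (\<lambda>n. c * (n + 1) ^ k)"
    unfolding tm_decides_in_space_def
  proof
    fix w :: "bool list"
    define n where "n = length w"
    define x0 where "x0 = (Chk True, TT (inp_tr w), 0::int)"
    obtain s' where s': "ex (Bd (bitlen (val w))) c0 ((\<lambda>_. 0)(0 := val w)) s'" "s' 1 \<noteq> 0 \<longleftrightarrow> val w \<in> L"
      using assms(1) by blast
    have bl: "bits (val w) = w \<Longrightarrow> bitlen (val w) = n" by (simp add: bitlen_def n_def)
    have e: "bits (val w) = w \<Longrightarrow> ex (Bd n) c0 ((\<lambda>_. 0)(0 := val w)) s'" using s'(1) bl by simp
    obtain tp h where th: "\<bar>h\<bar> \<le> int (Suc (KB n))"
      "sts (Suc (KB n)) x0 (if bits (val w) = w \<and> s' 1 > 0 then Acc else Rej, tp, h)"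
      using run_sim[OF e, of "KB n"] assms(2)[of n] unfolding x0_def n_def by blast
    obtain m where m: "(astep ^^ m) x0 = (if bits (val w) = w \<and> s' 1 > 0 then Acc else Rej, tp, h)"
      "\<forall>i<m. \<bar>snd (snd ((astep ^^ i) x0))\<bar> \<le> int (Suc (KB n))"
      using sts_funpow[OF th(2)] by blast
    have w: "w \<in> bits ` L \<longleftrightarrow> bits (val w) = w \<and> val w \<in> L" by force
    have eq: "(case (astep ^^ t) x0 of (q', tp', h') \<Rightarrow> tm_run M w t = (f q', tp', h') \<and> q' \<in> Q)" for t
    proof (induction t)
      case 0
      have "tm_init M w = (f (Chk True), TT (inp_tr w), 0)"
      proof -
        obtain N' where N': "N = Suc N'" using N2 by (cases N) auto
        have z: "code N' (\<lambda>i. digit (inp_tr w (Suc i)) j) = 0" for j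
          using code_cong[of N' "\<lambda>i. digit (inp_tr w (Suc i)) j" "\<lambda>_. 0"] by (simp add: code_zero inp_tr_def digit_def)
        have c: "code N (\<lambda>r. digit (inp_tr w r) j) = digit w j" for j
          unfolding N' code.simps z by (simp add: inp_tr_def)
        show ?thesis by (auto simp: tm_init_def Mf TT_def fun_eq_iff c) (auto simp: digit_def)
      qed
      then show ?case by (auto simp: tm_run_def x0_def Q_def)
    next
      case (Suc t)
      obtain q' tp' h' where q: "(astep ^^ t) x0 = (q', tp', h')" by (cases "(astep ^^ t) x0")
      then have "tm_run M w t = (f q', tp', h')" "q' \<in> Q" using Suc by auto
      then have r: "tm_run M w (Suc t) = tm_step M (f q', tp', h')" by (simp add: tm_run_def)
      have a: "(astep ^^ Suc t) x0 = astep (q', tp', h')" using q by simp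
      show ?case unfolding r a by (rule Mf(6)[rule_format, OF \<open>q' \<in> Q\<close>])
    qed
    have fin: "(astep ^^ (m + j)) x0 = (astep ^^ m) x0" for j
      by (induction j) (auto simp: m(1), auto simp: astep_def)
    have "\<bar>snd (snd ((astep ^^ t) x0))\<bar> \<le> int (Suc (KB n))" for t
    proof (cases "t < m")
      case False
      then obtain j where "t = m + j" by (metis le_Suc_ex not_less)
      then show ?thesis using fin m(1) th(1) by simp
    qed (use m(2) in auto)
    then have "\<bar>snd (snd (tm_run M w t))\<bar> \<le> int (Suc (KB n))" for t
      using eq[of t] by (auto split: prod.splits) (metis snd_conv)
    moreover have "int (Suc (KB n)) \<le> int (c * (length w + 1) ^ k)" using assms(3)[of n] unfolding n_def of_nat_le_iff .
    ultimately have sp: "\<forall>t. \<bar>snd (snd (tm_run M w t))\<bar> \<le> int (c * (length w + 1) ^ k)" using order_trans by blast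
    have "fst (tm_run M w m) = (if w \<in> bits ` L then qacc M else qrej M)"
      using eq[of m] m(1) s'(2) w Mf by auto
    moreover have "qacc M \<noteq> qrej M" using Mf(1) by (simp add: wf_tm_def)
    ultimately show "(\<exists>t. (fst (tm_run M w t) = qacc M \<or> fst (tm_run M w t) = qrej M) \<and> (fst (tm_run M w t) = qacc M) = (w \<in> bits ` L)) \<and>
         (\<forall>t. \<bar>snd (snd (tm_run M w t))\<bar> \<le> int (c * (length w + 1) ^ k))"
      using sp by (auto intro!: exI[of _ m] split: if_splits)
  qed
  with Mf(1) show ?thesis unfolding PSPACE_def by blast
qed

end

section \<open>Functions computable with registers of polynomial bit length\<close>

lemma bitlen_mono: "m \<le> n \<Longrightarrow> bitlen m \<le> bitlen n"
  by (meson bitlen_le_iff le_less_trans less_two_power_bitlen)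

lemma bitlen_add: "bitlen (a + b) \<le> bitlen a + bitlen b"
proof -
  have "a + b + 1 \<le> (a + 1) * (b + 1)" by simp
  also have "\<dots> \<le> 2 ^ bitlen a * 2 ^ bitlen b"
    by (rule mult_le_mono) (use less_two_power_bitlen in \<open>auto simp: Suc_le_eq\<close>)
  finally show ?thesis by (simp add: bitlen_le_iff power_add)
qed

lemma bitlen_mult: "bitlen (a * b) \<le> bitlen a + bitlen b"
proof (cases "a = 0 \<or> b = 0")
  case False
  have "a * b < 2 ^ bitlen a * 2 ^ bitlen b"
    by (rule mult_strict_mono) (use less_two_power_bitlen False in auto)
  then show ?thesis by (simp add: bitlen_le_iff power_add)
qed (auto simp: bitlen_def)

lemma bitlen_pow2: "bitlen (2 ^ n) = Suc n"
proof (rule antisym)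
  show "bitlen (2 ^ n) \<le> Suc n" by (simp add: bitlen_le_iff)
  show "Suc n \<le> bitlen (2 ^ n)" using less_two_power_bitlen[of "2 ^ n"] by simp
qed

lemma bitlen_0 [simp]: "bitlen 0 = 0" by (simp add: bitlen_def)

lemma bitlen_le_self: "bitlen n \<le> n"
  by (simp add: bitlen_le_iff)

definition lk :: "nat \<Rightarrow> (nat \<Rightarrow> nat) \<Rightarrow> nat" where
  "lk k e = (\<Sum>i<k. bitlen (e i))"

text \<open>The bound concerns the value of \<open>g\<close> itself; sizes of numbers are handled by
  applying it to \<open>bitlen\<close>. The distinction matters for powers of two, whose exponent
  must be polynomial and not only of polynomial length.\<close>

definition pol :: "nat \<Rightarrow> ((nat \<Rightarrow> nat) \<Rightarrow> nat) \<Rightarrow> bool" where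
  "pol k g \<longleftrightarrow> (\<exists>c d. \<forall>e. g e \<le> c * (lk k e + 1) ^ d)"

lemma pol_mono: "pol k g \<Longrightarrow> (\<And>e. f e \<le> g e) \<Longrightarrow> pol k f"
  unfolding pol_def by (meson order_trans)

lemma pol_const: "pol k (\<lambda>e. c)"
  unfolding pol_def by (rule exI[of _ c], rule exI[of _ 0]) simp

lemma pol_lk: "pol k (lk k)"
  unfolding pol_def by (rule exI[of _ 1], rule exI[of _ 1]) simp

lemma pol_bitlen_var: "i < k \<Longrightarrow> pol k (\<lambda>e. bitlen (e i))"
  by (rule pol_mono[OF pol_lk]) (auto simp: lk_def intro: member_le_sum)

lemma pol_add:
  assumes "pol k f" "pol k g" shows "pol k (\<lambda>e. f e + g e)"
proof -
  obtain c d c' d' where 1: "\<forall>e. f e \<le> c * (lk k e + 1) ^ d" and 2: "\<forall>e. g e \<le> c' * (lk k e + 1) ^ d'"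
    using assms unfolding pol_def by blast
  have "f e + g e \<le> (c + c') * (lk k e + 1) ^ (d + d')" for e
  proof -
    have "(lk k e + 1) ^ d \<le> (lk k e + 1) ^ (d + d')" "(lk k e + 1) ^ d' \<le> (lk k e + 1) ^ (d + d')"
      by (auto intro!: power_increasing)
    then have "c * (lk k e + 1) ^ d + c' * (lk k e + 1) ^ d' \<le> (c + c') * (lk k e + 1) ^ (d + d')"
      unfolding add_mult_distrib by (intro add_mono mult_le_mono) auto
    with 1 2 show ?thesis by (meson add_mono order_trans)
  qed
  then show ?thesis unfolding pol_def by blast
qed

lemma pol_mult:
  assumes "pol k f" "pol k g" shows "pol k (\<lambda>e. f e * g e)"
proof -
  obtain c d c' d' where 1: "\<forall>e. f e \<le> c * (lk k e + 1) ^ d" and 2: "\<forall>e. g e \<le> c' * (lk k e + 1) ^ d'"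
    using assms unfolding pol_def by blast
  have "f e * g e \<le> (c * c') * (lk k e + 1) ^ (d + d')" for e
    using mult_le_mono[OF 1[rule_format, of e] 2[rule_format, of e]]
    by (simp add: power_add mult_ac)
  then show ?thesis unfolding pol_def by blast
qed

lemma pol_power: "pol k f \<Longrightarrow> pol k (\<lambda>e. f e ^ n)"
  by (induction n) (auto intro: pol_mult pol_const)

lemma pol_sum: "(\<And>i. i < (n::nat) \<Longrightarrow> pol k (f i)) \<Longrightarrow> pol k (\<lambda>e. \<Sum>i<n. f i e)"
proof (induction n)
  case (Suc n)
  then show ?case by (simp add: pol_add)
qed (simp add: pol_const)

lemma pol_subst:
  assumes "pol m f" "\<And>i. i < m \<Longrightarrow> pol k (\<lambda>e. bitlen (g e i))"
  shows "pol k (\<lambda>e. f (g e))"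
proof -
  obtain c d where 1: "\<forall>e. f e \<le> c * (lk m e + 1) ^ d" using assms unfolding pol_def by blast
  have "pol k (\<lambda>e. c * (lk m (g e) + 1) ^ d)"
    unfolding lk_def by (intro pol_mult pol_power pol_add pol_const pol_sum assms)
  then show ?thesis by (rule pol_mono) (use 1 in blast)
qed

definition dep :: "nat \<Rightarrow> ((nat \<Rightarrow> nat) \<Rightarrow> nat) \<Rightarrow> bool" where
  "dep k f \<longleftrightarrow> (\<forall>e e'. (\<forall>i<k. e i = e' i) \<longrightarrow> f e = f e')"

lemma depD: "dep k f \<Longrightarrow> (\<And>i. i < k \<Longrightarrow> e i = e' i) \<Longrightarrow> f e = f e'"
  unfolding dep_def by blast

section \<open>Register programs for clearing, moving and copying\<close>

definition clr :: "nat \<Rightarrow> cmd" where "clr v = CWhile v (CDec v)"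

lemma ex_clr: "ex B (clr v) s (s(v := 0))"
proof (induction "s v" arbitrary: s)
  case 0
  then have "s(v := 0) = s" by auto
  then show ?case unfolding clr_def using ex.CWhile0[of s v] 0 by simp
next
  case (Suc n)
  have "ex B (clr v) (s(v := s v - 1)) (s(v := s v - 1, v := 0))"
    by (rule Suc(1)) (use Suc(2) in simp)
  then show ?case unfolding clr_def
    by (intro ex.CWhile1[of s v B _ "s(v := s v - 1)"] ex.CDec) (use Suc(2) in auto)
qed

definition mov :: "nat \<Rightarrow> nat \<Rightarrow> cmd" where "mov a b = CWhile a (CSeq (CDec a) (CInc b))"

lemma ex_mov: "a \<noteq> b \<Longrightarrow> s a + s b \<le> B \<Longrightarrow> ex B (mov a b) s (s(a := 0, b := s a + s b))"
proof (induction "s a" arbitrary: s)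
  case 0
  then have "s(a := 0, b := s a + s b) = s" by auto
  moreover have "ex B (mov a b) s s" unfolding mov_def by (rule ex.CWhile0) (use 0 in simp)
  ultimately show ?case by metis
next
  case (Suc n)
  define s1 where "s1 = s(a := s a - 1, b := Suc (s b))"
  have "ex B (mov a b) s1 (s1(a := 0, b := s1 a + s1 b))"
    by (rule Suc(1)) (use Suc(2-) in \<open>auto simp: s1_def\<close>)
  also have "s1(a := 0, b := s1 a + s1 b) = s(a := 0, b := s a + s b)"
    using Suc(2-) by (auto simp: s1_def)
  finally have 1: "ex B (mov a b) s1 (s(a := 0, b := s a + s b))" .
  have "ex B (CDec a) s (s(a := s a - 1))" using Suc(2) by (intro ex.CDec) auto
  moreover have "ex B (CInc b) (s(a := s a - 1)) s1"
    using ex.CInc[of "s(a := s a - 1)" b B] Suc(2-) by (simp add: s1_def)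
  ultimately have "ex B (CSeq (CDec a) (CInc b)) s s1" by (rule ex.CSeq)
  then show ?case unfolding mov_def by (rule ex.CWhile1[rotated]) (use 1 Suc(2) in \<open>auto simp: mov_def\<close>)
qed

definition cpy :: "nat \<Rightarrow> nat \<Rightarrow> nat \<Rightarrow> cmd" where
  "cpy a b t = CSeq (CWhile a (CSeq (CDec a) (CSeq (CInc b) (CInc t)))) (mov t a)"

lemma ex_cpy:
  assumes "a \<noteq> b" "a \<noteq> t" "b \<noteq> t" "s t = 0" "s b = 0" "s a \<le> B"
  shows "ex B (cpy a b t) s (s(b := s a))"
proof -
  have "ex B (CWhile a (CSeq (CDec a) (CSeq (CInc b) (CInc t)))) s (s(a := 0, b := s a + s b, t := s a + s t))"
    if "s a + s b \<le> B" "s a + s t \<le> B" for s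
    using that
  proof (induction "s a" arbitrary: s)
    case 0
    then have "s(a := 0, b := s a + s b, t := s a + s t) = s" by auto
    moreover have "ex B (CWhile a (CSeq (CDec a) (CSeq (CInc b) (CInc t)))) s s" by (rule ex.CWhile0) (use 0 in simp)
    ultimately show ?case by metis
  next
    case (Suc n)
    define s1 where "s1 = s(a := s a - 1, b := Suc (s b), t := Suc (s t))"
    have "ex B (CWhile a (CSeq (CDec a) (CSeq (CInc b) (CInc t)))) s1 (s1(a := 0, b := s1 a + s1 b, t := s1 a + s1 t))"
      by (rule Suc(1)) (use Suc(2-) assms(1-3) in \<open>auto simp: s1_def\<close>)
    also have "s1(a := 0, b := s1 a + s1 b, t := s1 a + s1 t) = s(a := 0, b := s a + s b, t := s a + s t)"
      using Suc(2-) assms(1-3) by (auto simp: s1_def fun_eq_iff)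
    finally have 1: "ex B (CWhile a (CSeq (CDec a) (CSeq (CInc b) (CInc t)))) s1 (s(a := 0, b := s a + s b, t := s a + s t))" .
    have "ex B (CDec a) s (s(a := s a - 1))" using Suc(2) by (intro ex.CDec) auto
    moreover have "ex B (CInc b) (s(a := s a - 1)) (s(a := s a - 1, b := Suc (s b)))"
      using ex.CInc[of "s(a := s a - 1)" b B] Suc(2-) assms(1-3) by simp
    moreover have "ex B (CInc t) (s(a := s a - 1, b := Suc (s b))) s1"
      using ex.CInc[of "s(a := s a - 1, b := Suc (s b))" t B] Suc(2-) assms(1-3) by (simp add: s1_def)
    ultimately have "ex B (CSeq (CDec a) (CSeq (CInc b) (CInc t))) s s1" by (blast intro: ex.CSeq)
    then show ?case by (rule ex.CWhile1[rotated]) (use 1 Suc(2) in auto)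
  qed
  from this[of s] have 1: "ex B (CWhile a (CSeq (CDec a) (CSeq (CInc b) (CInc t)))) s (s(a := 0, b := s a, t := s a))"
    using assms by simp
  have "ex B (mov t a) (s(a := 0, b := s a, t := s a)) (s(b := s a))"
  proof -
    have "(s(a := 0, b := s a, t := s a))(t := 0, a := s a) = s(b := s a)" using assms by auto
    then show ?thesis using ex_mov[of t a "s(a := 0, b := s a, t := s a)" B] assms by simp
  qed
  with 1 show ?thesis unfolding cpy_def by (rule ex.CSeq)
qed

text \<open>Registers from \<open>z\<close> on are scratch space, zero before and after, and the
  final state differs from the initial one in \<open>out\<close> only. Programs can thus be composed
  without any further bookkeeping of registers.\<close>

definition realizes where
  "realizes (k::nat) f Bf \<rho> out z c \<longleftrightarrow> (\<forall>s B. (\<forall>v\<ge>z. s v = 0) \<longrightarrow> Bf (\<lambda>i. s (\<rho> i)) \<le> B \<longrightarrow>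
     ex B c s (s(out := f (\<lambda>i. s (\<rho> i)))))"

text \<open>The cap \<open>Bf\<close> accompanies \<open>f\<close> because the intermediate values
  of its program may exceed \<open>f\<close>; caps are combined by addition. A program is demanded
  for every placement of arguments and result.\<close>

definition PSb where
  "PSb k f Bf \<longleftrightarrow> dep k f \<and> dep k Bf \<and> pol k (\<lambda>e. bitlen (Bf e)) \<and> (\<forall>e. f e \<le> Bf e) \<and>
     (\<forall>\<rho> out z. (\<forall>i<k. \<rho> i < z \<and> \<rho> i \<noteq> out) \<longrightarrow> out < z \<longrightarrow> (\<exists>c. realizes k f Bf \<rho> out z c))"

lemma PSbD: "PSb k f Bf \<Longrightarrow> (\<And>i. i < k \<Longrightarrow> \<rho> i < z \<and> \<rho> i \<noteq> out) \<Longrightarrow> out < z \<Longrightarrow> \<exists>c. realizes k f Bf \<rho> out z c"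
  unfolding PSb_def by blast

lemma realizes_run:
  assumes "PSb k f Bf" "realizes k f Bf \<rho> out z c" "\<And>i. i < k \<Longrightarrow> s (\<rho> i) = e i"
    "\<And>v. v \<ge> z \<Longrightarrow> s v = 0" "Bf e \<le> B"
  shows "ex B c s (s(out := f e))"
proof -
  have d: "dep k f" "dep k Bf" using assms(1) by (auto simp: PSb_def)
  have f: "f (\<lambda>i. s (\<rho> i)) = f e" by (rule depD[OF d(1)]) (rule assms(3))
  have B: "Bf (\<lambda>i. s (\<rho> i)) = Bf e" by (rule depD[OF d(2)]) (rule assms(3))
  have "ex B c s (s(out := f (\<lambda>i. s (\<rho> i))))"
    by (rule assms(2)[unfolded realizes_def, rule_format]) (use assms(4,5) B in auto)
  then show ?thesis unfolding f .
qed

definition PS :: "nat \<Rightarrow> ((nat \<Rightarrow> nat) \<Rightarrow> nat) \<Rightarrow> bool" where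
  "PS k f \<longleftrightarrow> (\<exists>Bf. PSb k f Bf)"

lemma PS_dep: "PS k f \<Longrightarrow> dep k f"
  by (auto simp: PS_def PSb_def)

lemma PS_pol: "PS k f \<Longrightarrow> pol k (\<lambda>e. bitlen (f e))"
  unfolding PS_def PSb_def by (blast intro: pol_mono bitlen_mono)

lemma PS_zero: "PS k (\<lambda>e. 0)"
  unfolding PS_def
proof
  show "PSb k (\<lambda>e. 0) (\<lambda>e. 0)"
    by (auto simp: PSb_def dep_def pol_const realizes_def intro: ex_clr)
qed

lemma PS_Suc:
  assumes "PS k f" shows "PS k (\<lambda>e. Suc (f e))"
proof -
  obtain Bf where Bf: "PSb k f Bf" using assms by (auto simp: PS_def)
  have "PSb k (\<lambda>e. Suc (f e)) (\<lambda>e. Bf e + 1)"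
    unfolding PSb_def
  proof (intro conjI allI impI)
    show "dep k (\<lambda>e. Suc (f e))" "dep k (\<lambda>e. Bf e + 1)" using Bf unfolding PSb_def dep_def by metis+
    have "pol k (\<lambda>e. bitlen (Bf e) + bitlen 1)" using Bf by (intro pol_add pol_const) (auto simp: PSb_def)
    then show "pol k (\<lambda>e. bitlen (Bf e + 1))" by (rule pol_mono) (rule bitlen_add)
    show "Suc (f e) \<le> Bf e + 1" for e using Bf by (auto simp: PSb_def)
    fix \<rho> :: "nat \<Rightarrow> nat" and out z assume "\<forall>i<k. \<rho> i < z \<and> \<rho> i \<noteq> out" "out < z"
    then obtain c where c: "realizes k f Bf \<rho> out z c" using Bf unfolding PSb_def by blast
    have "realizes k (\<lambda>e. Suc (f e)) (\<lambda>e. Bf e + 1) \<rho> out z (CSeq c (CInc out))"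
      unfolding realizes_def
    proof (intro allI impI)
      fix s :: "nat \<Rightarrow> nat" and B assume a: "\<forall>v\<ge>z. s v = 0" "Bf (\<lambda>i. s (\<rho> i)) + 1 \<le> B"
      then have 1: "ex B c s (s(out := f (\<lambda>i. s (\<rho> i))))" using c by (auto simp: realizes_def)
      have "f (\<lambda>i. s (\<rho> i)) < B" using a Bf by (auto simp: PSb_def Suc_le_eq intro: le_less_trans)
      then have "ex B (CInc out) (s(out := f (\<lambda>i. s (\<rho> i)))) (s(out := Suc (f (\<lambda>i. s (\<rho> i)))))"
        using ex.CInc[of "s(out := f (\<lambda>i. s (\<rho> i)))" out B] by simp
      with 1 show "ex B (CSeq c (CInc out)) s (s(out := Suc (f (\<lambda>i. s (\<rho> i)))))" by (rule ex.CSeq)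
    qed
    then show "\<exists>c. realizes k (\<lambda>e. Suc (f e)) (\<lambda>e. Bf e + 1) \<rho> out z c" by blast
  qed
  then show ?thesis by (auto simp: PS_def)
qed

lemma PS_var: assumes "j < k" shows "PS k (\<lambda>e. e j)"
proof -
  have "PSb k (\<lambda>e. e j) (\<lambda>e. e j)"
    unfolding PSb_def
  proof (intro conjI allI impI)
    show "dep k (\<lambda>e. e j)" "dep k (\<lambda>e. e j)" using assms by (auto simp: dep_def)
    show "pol k (\<lambda>e. bitlen (e j))" by (rule pol_bitlen_var[OF assms])
    fix \<rho> :: "nat \<Rightarrow> nat" and out z assume r: "\<forall>i<k. \<rho> i < z \<and> \<rho> i \<noteq> out" "out < z"
    have "realizes k (\<lambda>e. e j) (\<lambda>e. e j) \<rho> out z (CSeq (clr out) (cpy (\<rho> j) out z))"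
      unfolding realizes_def
    proof (intro allI impI)
      fix s :: "nat \<Rightarrow> nat" and B assume a: "\<forall>v\<ge>z. s v = 0" "s (\<rho> j) \<le> B"
      have "ex B (cpy (\<rho> j) out z) (s(out := 0)) (s(out := 0, out := (s(out := 0)) (\<rho> j)))"
        by (rule ex_cpy) (use r a assms in force)+
      moreover have "(s(out := 0)) (\<rho> j) = s (\<rho> j)" using r assms by auto
      ultimately have "ex B (cpy (\<rho> j) out z) (s(out := 0)) (s(out := s (\<rho> j)))" by simp
      then show "ex B (CSeq (clr out) (cpy (\<rho> j) out z)) s (s(out := s (\<rho> j)))"
        by (rule ex.CSeq[OF ex_clr])
    qed
    then show "\<exists>c. realizes k (\<lambda>e. e j) (\<lambda>e. e j) \<rho> out z c" by blast
  qed auto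
  then show ?thesis by (auto simp: PS_def)
qed

lemma PS_rename:
  assumes "PS k f" "\<And>i. i < k \<Longrightarrow> r i < k'"
  shows "PS k' (\<lambda>e. f (\<lambda>i. e (r i)))"
proof -
  obtain Bf where Bf: "PSb k f Bf" using assms by (auto simp: PS_def)
  have "PSb k' (\<lambda>e. f (\<lambda>i. e (r i))) (\<lambda>e. Bf (\<lambda>i. e (r i)))"
    unfolding PSb_def
  proof (intro conjI allI impI)
    show "dep k' (\<lambda>e. f (\<lambda>i. e (r i)))" "dep k' (\<lambda>e. Bf (\<lambda>i. e (r i)))"
      using Bf assms(2) by (auto simp: PSb_def dep_def)
    show "pol k' (\<lambda>e. bitlen (Bf (\<lambda>i. e (r i))))"
      by (rule pol_subst[of k "\<lambda>e. bitlen (Bf e)" k' "\<lambda>e i. e (r i)"]) (use Bf assms(2) in \<open>auto simp: PSb_def intro: pol_bitlen_var\<close>)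
    show "f (\<lambda>i. e (r i)) \<le> Bf (\<lambda>i. e (r i))" for e using Bf by (auto simp: PSb_def)
    fix \<rho> :: "nat \<Rightarrow> nat" and out z assume "\<forall>i<k'. \<rho> i < z \<and> \<rho> i \<noteq> out" "out < z"
    then obtain c where c: "realizes k f Bf (\<lambda>i. \<rho> (r i)) out z c"
      using PSbD[OF Bf] assms(2) by metis
    then show "\<exists>c. realizes k' (\<lambda>e. f (\<lambda>i. e (r i))) (\<lambda>e. Bf (\<lambda>i. e (r i))) \<rho> out z c"
      by (auto simp: realizes_def)
  qed
  then show ?thesis by (auto simp: PS_def)
qed

text \<open>Composition in de Bruijn style: the intermediate value becomes variable 0 of
  \<open>f\<close> and is kept in the first scratch register \<open>z\<close>, which is cleared at
  the end.\<close>

lemma PS_let: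
  assumes "PS k g" "PS (Suc k) f"
  shows "PS k (\<lambda>e. f (case_nat (g e) e))"
proof -
  obtain Bg Bf where Bg: "PSb k g Bg" and Bf: "PSb (Suc k) f Bf" using assms by (auto simp: PS_def)
  let ?B = "\<lambda>e. Bg e + Bf (case_nat (g e) e)"
  have "PSb k (\<lambda>e. f (case_nat (g e) e)) ?B"
    unfolding PSb_def
  proof (intro conjI allI impI)
    have d: "case_nat (g e) e i = case_nat (g e') e' i" if "\<forall>i<k. e i = e' i" "i < Suc k" for e e' :: "nat \<Rightarrow> nat" and i
    proof -
      have "g e = g e'" using Bg that unfolding PSb_def dep_def by blast
      then show ?thesis using that by (auto split: nat.splits)
    qed
    show "dep k (\<lambda>e. f (case_nat (g e) e))"
      unfolding dep_def
    proof (intro allI impI)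
      fix e e' :: "nat \<Rightarrow> nat" assume "\<forall>i<k. e i = e' i"
      then show "f (case_nat (g e) e) = f (case_nat (g e') e')"
        using Bf d by (intro depD[of "Suc k" f]) (auto simp: PSb_def)
    qed
    show "dep k ?B"
      unfolding dep_def
    proof (intro allI impI arg_cong2[where f="(+)"])
      fix e e' :: "nat \<Rightarrow> nat" assume *: "\<forall>i<k. e i = e' i"
      then show "Bf (case_nat (g e) e) = Bf (case_nat (g e') e')"
        using Bf d by (intro depD[of "Suc k" Bf]) (auto simp: PSb_def)
      show "Bg e = Bg e'" using Bg * unfolding PSb_def dep_def by blast
    qed
    have "pol k (\<lambda>e. bitlen (Bf (case_nat (g e) e)))"
      by (rule pol_subst[of "Suc k" "\<lambda>e. bitlen (Bf e)" k "\<lambda>e. case_nat (g e) e"])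
        (use Bf in \<open>auto simp: PSb_def less_Suc_eq_0_disj intro: pol_bitlen_var PS_pol[OF assms(1)]\<close>)
    then have "pol k (\<lambda>e. bitlen (Bg e) + bitlen (Bf (case_nat (g e) e)))"
      using Bg by (intro pol_add) (auto simp: PSb_def)
    then show "pol k (\<lambda>e. bitlen (?B e))" by (rule pol_mono) (rule bitlen_add)
    show "f (case_nat (g e) e) \<le> ?B e" for e using Bf by (auto simp: PSb_def intro: trans_le_add2)
    fix \<rho> :: "nat \<Rightarrow> nat" and out z assume r: "\<forall>i<k. \<rho> i < z \<and> \<rho> i \<noteq> out" "out < z"
    have "\<exists>c. realizes k g Bg \<rho> z (Suc z) c" by (rule PSbD[OF Bg]) (use r in \<open>auto simp: less_SucI\<close>)
    then obtain c where c: "realizes k g Bg \<rho> z (Suc z) c" by blast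
    have "\<forall>i<Suc k. case_nat z \<rho> i < Suc z \<and> case_nat z \<rho> i \<noteq> out"
      using r by (auto split: nat.splits intro: less_SucI)
    then have "\<exists>c'. realizes (Suc k) f Bf (case_nat z \<rho>) out (Suc z) c'"
      by (intro PSbD[OF Bf]) (use r in \<open>auto simp: less_SucI\<close>)
    then obtain c' where c': "realizes (Suc k) f Bf (case_nat z \<rho>) out (Suc z) c'" by blast
    have "realizes k (\<lambda>e. f (case_nat (g e) e)) ?B \<rho> out z (CSeq c (CSeq c' (clr z)))"
      unfolding realizes_def
    proof (intro allI impI)
      fix s :: "nat \<Rightarrow> nat" and B assume a: "\<forall>v\<ge>z. s v = 0" "?B (\<lambda>i. s (\<rho> i)) \<le> B"
      let ?g = "g (\<lambda>i. s (\<rho> i))"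
      let ?s = "s(z := ?g)"
      have 1: "ex B c s ?s" using c a by (auto simp: realizes_def)
      have e: "?s (case_nat z \<rho> i) = case_nat ?g (\<lambda>i. s (\<rho> i)) i" if "i < Suc k" for i
        using that r by (auto split: nat.splits)
      have 2: "ex B c' ?s (?s(out := f (case_nat ?g (\<lambda>i. s (\<rho> i)))))"
        by (rule realizes_run[OF Bf c']) (use e a in auto)
      have 3: "?s(out := x, z := 0) = s(out := x)" for x using a r by auto
      have "ex B (clr z) (?s(out := x)) (s(out := x))" for x
        using ex_clr[of B z "?s(out := x)"] unfolding 3 .
      from ex.CSeq[OF 1 ex.CSeq[OF 2 this]]
      show "ex B (CSeq c (CSeq c' (clr z))) s (s(out := f (case_nat ?g (\<lambda>i. s (\<rho> i)))))" .
    qed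
    then show "\<exists>c. realizes k (\<lambda>e. f (case_nat (g e) e)) ?B \<rho> out z c" by blast
  qed
  then show ?thesis by (auto simp: PS_def)
qed

text \<open>The number of iterations may be exponential; only the intermediate values must keep
  polynomial bit length. This is where polynomial space, rather than polynomial time, enters. Of
  \<open>b\<close> only its arguments and its length are constrained, so it can be the very function
  under construction, as for addition.\<close>

lemma PS_rec:
  assumes g: "PS k g" and h: "PS (Suc (Suc k)) (\<lambda>e. h (\<lambda>i. e (Suc (Suc i))) (e 0) (e 1))"
    and m: "PS k m" and b: "dep k b" "pol k (\<lambda>e. bitlen (b e))"
    and bnd: "\<And>e n. n \<le> m e \<Longrightarrow> rec_nat (g e) (h e) n \<le> b e"
  shows "PS k (\<lambda>e. rec_nat (g e) (h e) (m e))"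
proof -
  let ?h = "\<lambda>e. h (\<lambda>i. e (Suc (Suc i))) (e 0) (e 1)"
  let ?r = "\<lambda>e. rec_nat (g e) (h e)"
  obtain Bg Bh Bm where Bg: "PSb k g Bg" and Bh: "PSb (Suc (Suc k)) ?h Bh" and Bm: "PSb k m Bm"
    using assms by (auto simp: PS_def)
  obtain c d where cd: "\<And>e. bitlen (Bh e) \<le> c * (lk (Suc (Suc k)) e + 1) ^ d"
    using Bh by (auto simp: PSb_def pol_def)
  have lk2: "lk (Suc (Suc k)) e = bitlen (e 0) + bitlen (e 1) + lk k (\<lambda>i. e (Suc (Suc i)))" for e
    unfolding lk_def sum.lessThan_Suc_shift by simp
  \<comment> \<open>Along the recursion the counter is bounded by \<open>m e\<close> and the
    accumulator by \<open>b e\<close>, so \<open>2 ^ E e\<close> dominates every cap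
    \<open>Bh\<close> that occurs.\<close>
  define E where "E e = c * (bitlen (m e) + bitlen (b e) + lk k e + 1) ^ d" for e
  let ?B = "\<lambda>e. Bg e + (Bm e + (b e + 2 ^ E e))"
  have lkd: "lk k e = lk k e'" if "\<And>i. i < k \<Longrightarrow> e i = e' i" for e e' using that by (simp add: lk_def)
  have hd: "h e n a = h e' n a" if "\<And>i. i < k \<Longrightarrow> e i = e' i" for e e' n a
    using depD[OF PS_dep[OF h], of "case_nat n (case_nat a e)" "case_nat n (case_nat a e')"] that
    by (auto split: nat.splits)
  have gd: "g e = g e'" "m e = m e'" "b e = b e'" if "\<And>i. i < k \<Longrightarrow> e i = e' i" for e e'
    using depD[OF PS_dep[OF g]] depD[OF PS_dep[OF m]] depD[OF b(1)] that by blast+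
  have rd: "?r e n = ?r e' n" if "\<And>i. i < k \<Longrightarrow> e i = e' i" for e e' n
    by (induction n) (use hd[OF that] gd(1)[OF that] in auto)
  have Bhb: "Bh (case_nat n (case_nat (?r e n) e)) \<le> ?B e" if "n \<le> m e" for e n
  proof -
    let ?x = "case_nat n (case_nat (?r e n) e)"
    have "bitlen (Bh ?x) \<le> c * (bitlen n + bitlen (?r e n) + lk k e + 1) ^ d"
      using cd[of ?x] by (simp add: lk2)
    also have "\<dots> \<le> E e" unfolding E_def
      using that bnd[of n e] by (intro mult_le_mono power_mono add_mono bitlen_mono) auto
    finally have "Bh ?x < 2 ^ E e" by (simp add: bitlen_le_iff)
    then show ?thesis by linarith
  qed
  have "PSb k (\<lambda>e. ?r e (m e)) ?B"
    unfolding PSb_def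
  proof (intro conjI allI impI)
    show "dep k (\<lambda>e. ?r e (m e))"
      unfolding dep_def
    proof (intro allI impI)
      fix e e' :: "nat \<Rightarrow> nat" assume a: "\<forall>i<k. e i = e' i"
      have "?r e (m e) = ?r e' (m e)" by (rule rd) (use a in auto)
      moreover have "m e = m e'" by (rule gd) (use a in auto)
      ultimately show "?r e (m e) = ?r e' (m e')" by simp
    qed
    show "dep k ?B"
      unfolding dep_def
    proof (intro allI impI)
      fix e e' :: "nat \<Rightarrow> nat" assume a: "\<forall>i<k. e i = e' i"
      have "Bg e = Bg e'" using Bg a by (intro depD[of k Bg]) (auto simp: PSb_def)
      moreover have "Bm e = Bm e'" using Bm a by (intro depD[of k Bm]) (auto simp: PSb_def)
      moreover have "lk k e = lk k e'" by (rule lkd) (use a in auto)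
      moreover have "m e = m e'" "b e = b e'" by (rule gd, use a in auto)+
      ultimately show "?B e = ?B e'" by (simp add: E_def)
    qed
    have "pol k (\<lambda>e. bitlen (Bg e) + (bitlen (Bm e) + (bitlen (b e) + Suc (E e))))"
      unfolding E_def Suc_eq_plus1
      by (intro pol_add pol_const pol_mult pol_power pol_lk PS_pol[OF m] b(2)) (use Bg Bm in \<open>auto simp: PSb_def\<close>)
    then show "pol k (\<lambda>e. bitlen (?B e))"
      by (rule pol_mono) (intro order_trans[OF bitlen_add] add_mono order_refl, simp add: bitlen_pow2)
    show "?r e (m e) \<le> ?B e" for e using bnd[of "m e" e] by linarith
    fix \<rho> :: "nat \<Rightarrow> nat" and out z assume r: "\<forall>i<k. \<rho> i < z \<and> \<rho> i \<noteq> out" "out < z"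
    have "\<exists>c. realizes k m Bm \<rho> z (Suc z) c" by (rule PSbD[OF Bm]) (use r in \<open>auto simp: less_SucI\<close>)
    then obtain cm where cm: "realizes k m Bm \<rho> z (Suc z) cm" by blast
    have "\<exists>c. realizes k g Bg \<rho> out (Suc z) c" by (rule PSbD[OF Bg]) (use r in \<open>auto simp: less_SucI\<close>)
    then obtain c where c: "realizes k g Bg \<rho> out (Suc z) c" by blast
    let ?\<rho> = "case_nat (Suc z) (case_nat out \<rho>)"
    have "?\<rho> i < z + 3 \<and> ?\<rho> i \<noteq> z + 2" if "i < Suc (Suc k)" for i
      using r that by (cases i; cases "i - 1") fastforce+
    then have "\<exists>c'. realizes (Suc (Suc k)) ?h Bh ?\<rho> (z + 2) (z + 3) c'"
      by (intro PSbD[OF Bh]) auto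
    then obtain c' where c': "realizes (Suc (Suc k)) ?h Bh ?\<rho> (z + 2) (z + 3) c'" by blast
    \<comment> \<open>The new value is built in \<open>z + 2\<close> since \<open>h\<close> still
      reads the old one from \<open>out\<close>. Register \<open>z\<close> counts the remaining
      rounds and \<open>z + 1\<close> supplies the recursion index.\<close>
    define body where "body = CSeq c' (CSeq (clr out) (CSeq (mov (z+2) out) (CSeq (CInc (z+1)) (CDec z))))"
    have "realizes k (\<lambda>e. ?r e (m e)) ?B \<rho> out z (CSeq cm (CSeq c (CSeq (CWhile z body) (clr (z+1)))))"
      unfolding realizes_def
    proof (intro allI impI)
      fix s :: "nat \<Rightarrow> nat" and B assume a: "\<forall>v\<ge>z. s v = 0" "?B (\<lambda>i. s (\<rho> i)) \<le> B"
      define e where "e = (\<lambda>i. s (\<rho> i))"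
      define M where "M = m e"
      define S where "S n = s(out := ?r e n, z := M - n, z + 1 := n)" for n
      have "m e \<le> Bm e" using Bm by (auto simp: PSb_def)
      then have mB: "M \<le> B" using a by (simp add: e_def M_def)
      have 1: "ex B cm s (s(z := M))"
        using cm a unfolding realizes_def e_def M_def by auto
      have env1: "(\<lambda>i. (s(z := M)) (\<rho> i)) i = e i" if "i < k" for i using that r by (auto simp: e_def)
      have "ex B c (s(z := M)) (s(z := M, out := g e))"
        by (rule realizes_run[OF Bg c]) (use env1 a in \<open>auto simp: e_def\<close>)
      moreover have "s(z := M, out := g e) = S 0"
        using r a by (auto simp: S_def fun_eq_iff)
      ultimately have 2: "ex B c (s(z := M)) (S 0)" by simp
      have body: "ex B body (S n) (S (Suc n))" if "n < M" for n
      proof -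
        have env: "(\<lambda>i. (S n) (?\<rho> i)) i = case_nat n (case_nat (?r e n) e) i" if i: "i < Suc (Suc k)" for i
        proof -
          consider "i = 0" | "i = 1" | j where "i = Suc (Suc j)" "j < k" using i by (cases i; cases "i - 1") auto
          then show ?thesis
          proof cases
            case 3
            then have "\<rho> j \<noteq> out \<and> \<rho> j < z" using r by blast
            then show ?thesis using 3 by (auto simp: S_def e_def)
          qed (use r in \<open>auto simp: S_def\<close>)
        qed
        have "Bh (case_nat n (case_nat (?r e n) e)) \<le> B" using Bhb[of n e] that a(2) unfolding e_def M_def by linarith
        then have "ex B c' (S n) ((S n)(z+2 := ?h (case_nat n (case_nat (?r e n) e))))"
          by (intro realizes_run[OF Bh c']) (use env a r in \<open>auto simp: S_def\<close>)
        then have 1: "ex B c' (S n) ((S n)(z+2 := ?r e (Suc n)))" by simp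
        define R where "R = ?r e (Suc n)"
        let ?s1 = "(S n)(z+2 := R, out := 0)"
        have "R \<le> b e" using bnd[of "Suc n" e] that by (simp add: M_def R_def)
        then have rB: "R \<le> B" using a by (simp add: e_def)
        have "?s1 (z+2) = R" "?s1 out = 0" using r by auto
        then have 3: "ex B (mov (z+2) out) ?s1 (?s1(z+2 := 0, out := R))"
          using ex_mov[of "z+2" out ?s1 B] r rB by simp
        let ?s2 = "?s1(z+2 := 0, out := R)"
        have s2: "?s2 (z+1) = n" "?s2 z = M - n" using r by (auto simp: S_def)
        have 4: "ex B (CInc (z+1)) ?s2 (?s2(z+1 := Suc n))"
          using ex.CInc[of ?s2 "z+1" B] s2 that mB by simp
        have 5: "ex B (CDec z) (?s2(z+1 := Suc n)) (?s2(z+1 := Suc n, z := M - Suc n))"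
          using ex.CDec[of "?s2(z+1 := Suc n)" z B] s2 that by simp
        have S: "?s2(z+1 := Suc n, z := M - Suc n) = S (Suc n)"
          using r a unfolding S_def R_def[symmetric] by (auto simp: fun_eq_iff)
        have 2: "ex B (clr out) ((S n)(z+2 := R)) ?s1" by (rule ex_clr)
        show ?thesis unfolding body_def
          using ex.CSeq[OF 1[folded R_def] ex.CSeq[OF 2 ex.CSeq[OF 3 ex.CSeq[OF 4 5]]]] unfolding S .
      qed
      have "ex B (CWhile z body) (S n) (S M)" if "n \<le> M" for n
        using that
      proof (induction "M - n" arbitrary: n)
        case 0
        then have "S M z = 0" "n = M" using r by (auto simp: S_def)
        then show ?case by (auto intro: ex.CWhile0)
      next
        case (Suc x)
        have "ex B (CWhile z body) (S (Suc n)) (S M)" by (rule Suc(1)) (use Suc in auto)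
        moreover have "S n z \<noteq> 0" using Suc r by (auto simp: S_def)
        ultimately show ?case using body[of n] Suc(2) by (intro ex.CWhile1[of "S n" z B body "S (Suc n)"]) auto
      qed
      then have 3: "ex B (CWhile z body) (S 0) (S M)" by simp
      have "(S M)(z+1 := 0) = s(out := ?r e M)" using r a by (auto simp: S_def fun_eq_iff)
      then have 4: "ex B (clr (z+1)) (S M) (s(out := ?r e M))" using ex_clr[of B "z+1" "S M"] by (simp only:)
      show "ex B (CSeq cm (CSeq c (CSeq (CWhile z body) (clr (z+1))))) s
        (s(out := ?r (\<lambda>i. s (\<rho> i)) (m (\<lambda>i. s (\<rho> i)))))"
        using ex.CSeq[OF 1 ex.CSeq[OF 2 ex.CSeq[OF 3 4]]] unfolding M_def e_def .
    qed
    then show "\<exists>c. realizes k (\<lambda>e. ?r e (m e)) ?B \<rho> out z c" by blast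
  qed
  then show ?thesis by (auto simp: PS_def)
qed

lemma PS_rec_PS:
  assumes "PS k g" "PS (Suc (Suc k)) (\<lambda>e. h (\<lambda>i. e (Suc (Suc i))) (e 0) (e 1))" "PS k m" "PS k b"
    and "\<And>e n. n \<le> m e \<Longrightarrow> rec_nat (g e) (h e) n \<le> b e"
  shows "PS k (\<lambda>e. rec_nat (g e) (h e) (m e))"
  by (rule PS_rec[OF assms(1-3) PS_dep[OF assms(4)] PS_pol[OF assms(4)] assms(5)])

theorem PS_PSPACE:
  assumes "PS 1 (\<lambda>e. f (e 0))" "\<And>x. f x \<noteq> 0 \<longleftrightarrow> x \<in> L"
  shows "bits ` L \<in> PSPACE"
proof -
  let ?f = "\<lambda>e. f (e 0)"
  obtain Bf where Bf: "PSb 1 ?f Bf" using assms by (auto simp: PS_def)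
  define \<rho> :: "nat \<Rightarrow> nat" where "\<rho> = (\<lambda>_. 0)"
  have "\<exists>c. realizes 1 ?f Bf \<rho> 1 2 c" by (rule PSbD[OF Bf]) (auto simp: \<rho>_def)
  then obtain c where c: "realizes 1 ?f Bf \<rho> 1 2 c" by blast
  obtain a d where ad: "\<And>e. bitlen (Bf e) \<le> a * (lk 1 e + 1) ^ d" using Bf by (auto simp: PSb_def pol_def)
  define N where "N = Suc (Max (insert 1 (vars c)))"
  interpret sim N c
  proof
    show "v < N" if "v \<in> vars c" for v using that finite_vars[of c] by (auto simp: N_def less_Suc_eq_le)
    have "1 \<le> Max (insert 1 (vars c))" using finite_vars[of c] by (intro Max_ge) auto
    then show "2 \<le> N" by (simp add: N_def)
  qed
  define KB where "KB n = n + a * (n + 1) ^ d + 1" for n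
  define Bd where "Bd n = (2::nat) ^ (a * (n + 1) ^ d)" for n :: nat
  show ?thesis
  proof (rule decides[of Bd L KB "a + 2" "Suc d"])
    fix x
    let ?s = "(\<lambda>_. 0)(0 := x) :: nat \<Rightarrow> nat"
    have "bitlen (Bf (\<lambda>i. ?s (\<rho> i))) \<le> a * (bitlen x + 1) ^ d" using ad[of "\<lambda>i. ?s (\<rho> i)"] by (simp add: lk_def \<rho>_def)
    then have "Bf (\<lambda>i. ?s (\<rho> i)) \<le> Bd (bitlen x)" by (simp add: bitlen_le_iff Bd_def)
    then have "ex (Bd (bitlen x)) c ?s (?s(1 := ?f (\<lambda>i. ?s (\<rho> i))))"
      by (intro realizes_run[OF Bf c]) auto
    then have "ex (Bd (bitlen x)) c ?s (?s(1 := f x))" by (simp add: \<rho>_def)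
    then show "\<exists>s'. ex (Bd (bitlen x)) c ?s s' \<and> (s' 1 \<noteq> 0 \<longleftrightarrow> x \<in> L)"
      by (intro exI[of _ "?s(1 := f x)"] conjI) (use assms(2) in auto)
  next
    fix n
    have "(2::nat) ^ (a * (n + 1) ^ d) < 2 ^ KB n" unfolding KB_def by (rule power_strict_increasing) auto
    then show "n \<le> KB n \<and> Bd n < 2 ^ KB n" by (simp add: KB_def Bd_def)
    have "(n+1)^d \<le> (n+1)^Suc d" by (rule power_increasing) auto
    then have "a * (n+1)^d \<le> a * (n+1)^Suc d" by (rule mult_le_mono2)
    moreover have "n + 2 \<le> 2 * (n+1)^Suc d" using power_increasing[of 1 "Suc d" "n+1"] by simp
    ultimately show "Suc (KB n) \<le> (a + 2) * (n + 1) ^ Suc d" unfolding KB_def add_mult_distrib by linarith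
  qed
qed

section \<open>Closure under composition, arithmetic, logic, bounded search and pairing\<close>

named_theorems PS_intros

definition PSp :: "nat \<Rightarrow> ((nat \<Rightarrow> nat) \<Rightarrow> bool) \<Rightarrow> bool" where
  "PSp k \<phi> \<longleftrightarrow> PS k (\<lambda>e. if \<phi> e then 1 else 0)"

lemma PS_const [PS_intros]: "PS k (\<lambda>e. n)"
  by (induction n) (auto intro: PS_zero PS_Suc)

lemmas [PS_intros] = PS_var PS_Suc

text \<open>Simultaneous substitution by repeated \<open>PS_let\<close>. With it, closure rules need
  to be proved for functions of variables only.\<close>

lemma PS_substs:
  assumes "PS (m + k) G" "\<And>i. i < m \<Longrightarrow> PS k (a i)"
  shows "PS k (\<lambda>e. G (\<lambda>i. if i < m then a i e else e (i - m)))"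
  using assms
proof (induction m arbitrary: G a)
  case (Suc m)
  have "PS (m + k) (\<lambda>e. a 0 (\<lambda>i. e (i + m)))"
    using PS_rename[OF Suc.prems(2)[of 0], of "\<lambda>i. i + m"] by simp
  then have "PS (m + k) (\<lambda>e. G (case_nat (a 0 (\<lambda>i. e (i + m))) e))"
    by (rule PS_let) (use Suc.prems(1) in simp)
  then have "PS k (\<lambda>e. G (case_nat (a 0 (\<lambda>i. if i + m < m then a (Suc (i + m)) e else e (i + m - m)))
      (\<lambda>i. if i < m then a (Suc i) e else e (i - m))))"
    by (rule Suc.IH) (use Suc.prems(2) in auto)
  moreover have "case_nat (a 0 (\<lambda>i. if i + m < m then a (Suc (i + m)) e else e (i + m - m)))
      (\<lambda>i. if i < m then a (Suc i) e else e (i - m)) = (\<lambda>i. if i < Suc m then a i e else e (i - Suc m))" for e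
    by (rule ext) (simp split: nat.split)
  ultimately show ?case by simp
qed simp

lemma PS_comp:
  assumes "PS m F" "\<And>i. i < m \<Longrightarrow> PS k (a i)"
  shows "PS k (\<lambda>e. F (\<lambda>i. a i e))"
proof -
  have "PS (m + k) F" using PS_rename[OF assms(1), of "\<lambda>i. i" "m + k"] by simp
  from PS_substs[OF this assms(2)] have "PS k (\<lambda>e. F (\<lambda>i. if i < m then a i e else e (i - m)))" by simp
  moreover have "F (\<lambda>i. if i < m then a i e else e (i - m)) = F (\<lambda>i. a i e)" for e
    by (rule depD[OF PS_dep[OF assms(1)]]) simp
  ultimately show ?thesis by simp
qed

lemma PS_comp1: "PS 1 (\<lambda>e. F (e 0)) \<Longrightarrow> PS k a \<Longrightarrow> PS k (\<lambda>e. F (a e))"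
  using PS_comp[of 1 "\<lambda>e. F (e 0)" k "\<lambda>_. a"] by simp

lemma PS_comp2: "PS 2 (\<lambda>e. F (e 0) (e 1)) \<Longrightarrow> PS k a \<Longrightarrow> PS k b \<Longrightarrow> PS k (\<lambda>e. F (a e) (b e))"
  using PS_comp[of 2 "\<lambda>e. F (e 0) (e 1)" k "\<lambda>i. if i = 0 then a else b"] by simp

lemma PS_comp3: "PS 3 (\<lambda>e. F (e 0) (e 1) (e 2)) \<Longrightarrow> PS k a \<Longrightarrow> PS k b \<Longrightarrow> PS k c \<Longrightarrow> PS k (\<lambda>e. F (a e) (b e) (c e))"
  using PS_comp[of 3 "\<lambda>e. F (e 0) (e 1) (e 2)" k "\<lambda>i. if i = 0 then a else if i = 1 then b else c"] by simp

lemma PS_comp4: "PS 4 (\<lambda>e. F (e 0) (e 1) (e 2) (e 3)) \<Longrightarrow> PS k a \<Longrightarrow> PS k b \<Longrightarrow> PS k c \<Longrightarrow> PS k d \<Longrightarrow>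
   PS k (\<lambda>e. F (a e) (b e) (c e) (d e))"
  using PS_comp[of 4 "\<lambda>e. F (e 0) (e 1) (e 2) (e 3)" k "\<lambda>i. if i = 0 then a else if i = 1 then b else if i = 2 then c else d"] by simp

lemma PSp_comp3: "PSp 3 (\<lambda>e. F (e 0) (e 1) (e 2)) \<Longrightarrow> PS k a \<Longrightarrow> PS k b \<Longrightarrow> PS k c \<Longrightarrow> PSp k (\<lambda>e. F (a e) (b e) (c e))"
  unfolding PSp_def by (rule PS_comp3[of "\<lambda>x y z. if F x y z then 1 else 0"])

lemma PSp_comp4: "PSp 4 (\<lambda>e. F (e 0) (e 1) (e 2) (e 3)) \<Longrightarrow> PS k a \<Longrightarrow> PS k b \<Longrightarrow> PS k c \<Longrightarrow> PS k d \<Longrightarrow>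
   PSp k (\<lambda>e. F (a e) (b e) (c e) (d e))"
  unfolding PSp_def by (rule PS_comp4[of "\<lambda>x y z w. if F x y z w then 1 else 0"])

lemma PS_add [PS_intros]: assumes "PS k a" "PS k b" shows "PS k (\<lambda>e. a e + b e)"
proof (rule PS_comp2[OF _ assms])
  have "PS 2 (\<lambda>e. rec_nat (e 0) (\<lambda>n a. Suc a) (e 1))"
  proof (rule PS_rec[where b = "\<lambda>e. e 0 + e 1"])
    show "dep 2 (\<lambda>e. e 0 + e 1)" by (simp add: dep_def)
    show "pol 2 (\<lambda>e. bitlen (e 0 + e 1))"
      by (rule pol_mono[OF _ bitlen_add]) (intro pol_add pol_bitlen_var, auto)
    show "n \<le> e 1 \<Longrightarrow> rec_nat (e 0) (\<lambda>n a. Suc a) n \<le> e 0 + e 1" for e n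
    proof -
      have "rec_nat (e 0) (\<lambda>n a. Suc a) n = e 0 + n" by (induction n) auto
      then show "n \<le> e 1 \<Longrightarrow> rec_nat (e 0) (\<lambda>n a. Suc a) n \<le> e 0 + e 1" by simp
    qed
  qed (intro PS_intros; simp)+
  moreover have "rec_nat x (\<lambda>n a. Suc a) y = x + y" for x y by (induction y) auto
  ultimately show "PS 2 (\<lambda>e. e 0 + e 1)" by simp
qed

lemma PS_mult [PS_intros]: assumes "PS k a" "PS k b" shows "PS k (\<lambda>e. a e * b e)"
proof (rule PS_comp2[OF _ assms])
  have r: "rec_nat 0 (\<lambda>n a. a + x) y = x * y" for x y :: nat by (induction y) auto
  have "PS 2 (\<lambda>e. rec_nat 0 (\<lambda>n a. a + e 0) (e 1))"
  proof (rule PS_rec[where b = "\<lambda>e. e 0 * e 1"])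
    show "dep 2 (\<lambda>e. e 0 * e 1)" by (simp add: dep_def)
    show "pol 2 (\<lambda>e. bitlen (e 0 * e 1))"
      by (rule pol_mono[OF _ bitlen_mult]) (intro pol_add pol_bitlen_var, auto)
  qed ((intro PS_intros; simp), (intro PS_intros; simp), (intro PS_intros; simp), simp add: r)
  then show "PS 2 (\<lambda>e. e 0 * e 1)" by (simp add: r)
qed

lemma PS_power [PS_intros]: "PS k a \<Longrightarrow> PS k (\<lambda>e. a e ^ n)"
  by (induction n) (auto intro: PS_intros)

lemma PS_diff [PS_intros]: assumes "PS k a" "PS k b" shows "PS k (\<lambda>e. a e - b e)"
proof (rule PS_comp2[OF _ assms])
  have p: "rec_nat 0 (\<lambda>n a. n) x = x - 1" for x :: nat by (cases x) auto
  have "PS 1 (\<lambda>e. rec_nat 0 (\<lambda>n a. n) (e 0))"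
    by (rule PS_rec_PS[where b = "\<lambda>e. e 0"]) ((intro PS_intros; simp)+, simp add: p)
  then have pred: "PS 1 (\<lambda>e. e 0 - 1)" by (simp add: p)
  have r: "rec_nat x (\<lambda>n a. a - 1) y = x - y" for x y :: nat by (induction y) auto
  have "PS 2 (\<lambda>e. rec_nat (e 0) (\<lambda>n a. a - 1) (e 1))"
  proof (rule PS_rec_PS[where b = "\<lambda>e. e 0"])
    show "PS (Suc (Suc 2)) (\<lambda>e. e 1 - 1)" by (rule PS_comp1[OF pred]) (intro PS_intros; simp)
  qed ((intro PS_intros; simp), (intro PS_intros; simp), (intro PS_intros; simp), simp only: r diff_le_self)
  then show "PS 2 (\<lambda>e. e 0 - e 1)" by (simp only: r)
qed

lemma PSp_eq0: "PS k a \<Longrightarrow> PSp k (\<lambda>e. a e = 0)"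
proof -
  assume "PS k a"
  then have "PS k (\<lambda>e. 1 - a e)" by (intro PS_intros)
  moreover have "1 - x = (if x = 0 then 1 else 0)" for x :: nat by simp
  ultimately show ?thesis unfolding PSp_def by simp
qed

lemma PSp_cong: "PSp k \<phi> \<Longrightarrow> (\<And>e. \<phi> e = \<psi> e) \<Longrightarrow> PSp k \<psi>"
proof -
  assume 1: "PSp k \<phi>" and 2: "\<And>e. \<phi> e = \<psi> e"
  have "\<phi> = \<psi>" by (rule ext) (rule 2)
  with 1 show ?thesis by simp
qed

lemma PSp_le [PS_intros]: "PS k a \<Longrightarrow> PS k b \<Longrightarrow> PSp k (\<lambda>e. a e \<le> b e)"
  by (rule PSp_cong[OF PSp_eq0[of k "\<lambda>e. a e - b e"]]) (auto intro: PS_intros)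

lemma PSp_less [PS_intros]: "PS k a \<Longrightarrow> PS k b \<Longrightarrow> PSp k (\<lambda>e. a e < b e)"
  by (rule PSp_cong[OF PSp_le[of k "\<lambda>e. Suc (a e)" b]]) (auto intro: PS_intros)

lemma PSp_conj [PS_intros]: "PSp k \<phi> \<Longrightarrow> PSp k \<psi> \<Longrightarrow> PSp k (\<lambda>e. \<phi> e \<and> \<psi> e)"
proof -
  assume "PSp k \<phi>" "PSp k \<psi>"
  then have "PS k (\<lambda>e. (if \<phi> e then 1 else 0) * (if \<psi> e then 1 else 0))" unfolding PSp_def by (rule PS_mult)
  moreover have "(if P then 1 else 0) * (if Q then 1 else 0) = (if P \<and> Q then 1 else 0::nat)" for P Q by simp
  ultimately show ?thesis unfolding PSp_def by simp
qed

lemma PSp_not [PS_intros]: "PSp k \<phi> \<Longrightarrow> PSp k (\<lambda>e. \<not> \<phi> e)"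
proof -
  assume "PSp k \<phi>"
  then have "PSp k (\<lambda>e. (if \<phi> e then 1 else 0::nat) = 0)" unfolding PSp_def[of k \<phi>] by (rule PSp_eq0)
  then show ?thesis by (rule PSp_cong) simp
qed

lemma PSp_disj [PS_intros]: "PSp k \<phi> \<Longrightarrow> PSp k \<psi> \<Longrightarrow> PSp k (\<lambda>e. \<phi> e \<or> \<psi> e)"
  by (rule PSp_cong[of k "\<lambda>e. \<not> (\<not> \<phi> e \<and> \<not> \<psi> e)"], (intro PSp_not PSp_conj; assumption), auto)

lemma PSp_imp [PS_intros]: "PSp k \<phi> \<Longrightarrow> PSp k \<psi> \<Longrightarrow> PSp k (\<lambda>e. \<phi> e \<longrightarrow> \<psi> e)"
  by (rule PSp_cong[of k "\<lambda>e. \<not> \<phi> e \<or> \<psi> e"], (intro PSp_not PSp_disj; assumption), auto)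

lemma PSp_iff [PS_intros]: "PSp k \<phi> \<Longrightarrow> PSp k \<psi> \<Longrightarrow> PSp k (\<lambda>e. \<phi> e = \<psi> e)"
  by (rule PSp_cong[of k "\<lambda>e. (\<phi> e \<longrightarrow> \<psi> e) \<and> (\<psi> e \<longrightarrow> \<phi> e)"]) (auto intro: PSp_conj PSp_imp)

lemma PSp_eq [PS_intros]: "PS k a \<Longrightarrow> PS k b \<Longrightarrow> PSp k (\<lambda>e. a e = b e)"
  by (rule PSp_cong[of k "\<lambda>e. a e \<le> b e \<and> b e \<le> a e"]) (auto intro: PS_intros)

lemma PSp_const [PS_intros]: "PSp k (\<lambda>e. P)"
  unfolding PSp_def by (rule PS_const)

lemma PS_if [PS_intros]: assumes "PSp k \<phi>" "PS k a" "PS k b" shows "PS k (\<lambda>e. if \<phi> e then a e else b e)"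
proof -
  have "PS k (\<lambda>e. (if \<phi> e then 1 else 0) * a e + (1 - (if \<phi> e then 1 else 0)) * b e)"
    using assms unfolding PSp_def by (intro PS_intros)
  moreover have "(if P then 1 else 0) * x + (1 - (if P then 1 else 0)) * y = (if P then x else y)" for P and x y :: nat by simp
  ultimately show ?thesis by simp
qed

lemma PSp_if [PS_intros]: "PSp k \<phi> \<Longrightarrow> PSp k a \<Longrightarrow> PSp k b \<Longrightarrow> PSp k (\<lambda>e. if \<phi> e then a e else b e)"
  by (rule PSp_cong[of k "\<lambda>e. (\<phi> e \<longrightarrow> a e) \<and> (\<not> \<phi> e \<longrightarrow> b e)"], (intro PSp_not PSp_imp PSp_conj; assumption), auto)

lemma PSp_rename: "PSp k \<phi> \<Longrightarrow> (\<And>i. i < k \<Longrightarrow> r i < k') \<Longrightarrow> PSp k' (\<lambda>e. \<phi> (\<lambda>i. e (r i)))"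
  unfolding PSp_def by (rule PS_rename[of k "\<lambda>e. if \<phi> e then 1 else 0"])

lemma PSp_ex [PS_intros]:
  assumes "PSp (Suc k) (\<lambda>e. \<phi> (\<lambda>i. e (Suc i)) (e 0))" "PS k b"
  shows "PSp k (\<lambda>e. \<exists>y<b e. \<phi> e y)"
proof -
  let ?h = "\<lambda>e n a. if \<phi> e n then 1 else a"
  have r: "rec_nat 0 (?h e) m = (if \<exists>y<m. \<phi> e y then 1 else 0)" for e m
    by (induction m) (auto simp: less_Suc_eq)
  have "PS k (\<lambda>e. rec_nat 0 (?h e) (b e))"
  proof (rule PS_rec_PS[where b = "\<lambda>_. 1"])
    have "PSp (Suc (Suc k)) (\<lambda>e. \<phi> (\<lambda>i. e (Suc (Suc i))) (e 0))"
      using PSp_rename[OF assms(1), of "\<lambda>i. if i = 0 then 0 else Suc i" "Suc (Suc k)"] by simp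
    then show "PS (Suc (Suc k)) (\<lambda>e. if \<phi> (\<lambda>i. e (Suc (Suc i))) (e 0) then 1 else e 1)"
      by (intro PS_if PS_const PS_var) auto
  qed (auto intro: PS_intros assms simp: r)
  then show ?thesis unfolding PSp_def by (simp add: r)
qed

lemma PSp_all [PS_intros]:
  assumes "PSp (Suc k) (\<lambda>e. \<phi> (\<lambda>i. e (Suc i)) (e 0))" "PS k b"
  shows "PSp k (\<lambda>e. \<forall>y<b e. \<phi> e y)"
  by (rule PSp_cong[OF PSp_not[OF PSp_ex[of k "\<lambda>e y. \<not> \<phi> e y", OF PSp_not[OF assms(1)] assms(2)]]]) auto

text \<open>Bounded minimisation with default \<open>b\<close>: the accumulator keeps pace with the
  counter until the first hit and is frozen afterwards.\<close>

definition mu :: "nat \<Rightarrow> (nat \<Rightarrow> bool) \<Rightarrow> nat" where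
  "mu b P = rec_nat 0 (\<lambda>n a. if a = n \<and> \<not> P n then Suc a else a) b"

lemma mu_le: "mu b P \<le> b"
  by (induction b) (auto simp: mu_def)

lemma mu_eq:
  assumes "P y" "\<And>x. x < y \<Longrightarrow> \<not> P x" "y < b"
  shows "mu b P = y"
proof -
  have 1: "mu n P = n" if "n \<le> y" for n
    using that by (induction n) (use assms(2) in \<open>auto simp: mu_def\<close>)
  have "mu (y + Suc d) P = y" for d
    by (induction d) (use 1[of y] assms(1) in \<open>auto simp: mu_def\<close>)
  then show ?thesis using assms(3) by (metis add_Suc_right less_imp_Suc_add)
qed

lemma PS_mu [PS_intros]:
  assumes "PSp (Suc k) (\<lambda>e. \<phi> (\<lambda>i. e (Suc i)) (e 0))" "PS k b"
  shows "PS k (\<lambda>e. mu (b e) (\<phi> e))"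
  unfolding mu_def
proof (rule PS_rec_PS[where b = b])
  have "PSp (Suc (Suc k)) (\<lambda>e. \<phi> (\<lambda>i. e (Suc (Suc i))) (e 0))"
    using PSp_rename[OF assms(1), of "\<lambda>i. if i = 0 then 0 else Suc i" "Suc (Suc k)"] by simp
  then show "PS (Suc (Suc k)) (\<lambda>e. if e 1 = e 0 \<and> \<not> \<phi> (\<lambda>i. e (Suc (Suc i))) (e 0) then Suc (e 1) else e 1)"
    by (intro PS_if PS_const PS_var PSp_conj PSp_not PSp_eq PS_Suc) auto
  show "n \<le> b e \<Longrightarrow> rec_nat 0 (\<lambda>n a. if a = n \<and> \<not> \<phi> e n then Suc a else a) n \<le> b e" for e n
    using mu_le[of n "\<phi> e"] unfolding mu_def by linarith
qed (auto intro: PS_intros assms)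

lemma PS_div [PS_intros]: assumes "PS k a" "PS k b" shows "PS k (\<lambda>e. a e div b e)"
proof (rule PS_comp2[OF _ assms])
  have "PS 2 (\<lambda>e. if e 1 = 0 then 0 else mu (Suc (e 0)) (\<lambda>q. e 0 < Suc q * e 1))"
    by (intro PS_intros) auto
  moreover have "(if y = 0 then 0 else mu (Suc x) (\<lambda>q. x < Suc q * y)) = x div y" for x y :: nat
  proof (cases "y = 0")
    case False
    have "mu (Suc x) (\<lambda>q. x < Suc q * y) = x div y"
    proof (rule mu_eq)
      show "x < Suc (x div y) * y" using False by (simp add: dividend_less_div_times)
      show "\<not> x < Suc q * y" if "q < x div y" for q
        using that False by (metis Suc_leI div_le_mono div_mult_self_is_m leD neq0_conv not_less_eq_eq nat_less_le less_mult_imp_div_less)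
    qed (simp add: le_imp_less_Suc)
    then show ?thesis using False by simp
  qed simp
  ultimately show "PS 2 (\<lambda>e. e 0 div e 1)" by (simp only:)
qed

lemma PS_mod [PS_intros]: assumes "PS k a" "PS k b" shows "PS k (\<lambda>e. a e mod b e)"
proof -
  have "PS k (\<lambda>e. a e - a e div b e * b e)" by (intro PS_intros assms)
  then show ?thesis by (simp add: minus_div_mult_eq_mod)
qed

definition shr :: "nat \<Rightarrow> nat \<Rightarrow> nat" where "shr x i = x div 2 ^ i"

lemma shr_rec: "rec_nat x (\<lambda>n a. a div 2) i = shr x i"
proof (induction i)
  case (Suc i)
  then show ?case by (simp add: shr_def div_mult2_eq[symmetric] mult.commute)
qed (simp add: shr_def)

lemma PS_shr [PS_intros]: assumes "PS k a" "PS k b" shows "PS k (\<lambda>e. shr (a e) (b e))"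
proof (rule PS_comp2[OF _ assms])
  have "PS 2 (\<lambda>e. rec_nat (e 0) (\<lambda>n a. a div 2) (e 1))"
    by (rule PS_rec_PS[where b = "\<lambda>e. e 0"]) ((intro PS_intros; simp)+, simp add: shr_rec shr_def)
  then show "PS 2 (\<lambda>e. shr (e 0) (e 1))" by (simp add: shr_rec)
qed

lemma PSp_bit [PS_intros]: assumes "PS k a" "PS k b" shows "PSp k (\<lambda>e. bit (a e) (b e))"
proof (rule PSp_cong)
  show "PSp k (\<lambda>e. shr (a e) (b e) mod 2 = 1)" by (intro PS_intros assms)
qed (simp add: bit_iff_odd shr_def odd_iff_mod_2_eq_one)

lemma PS_pow2:
  assumes "PS k f" "pol k f" shows "PS k (\<lambda>e. 2 ^ f e)"
proof -
  have r: "rec_nat (1::nat) (\<lambda>n a. a + a) m = 2 ^ m" for m :: nat by (induction m) auto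
  have "PS k (\<lambda>e. rec_nat (1::nat) (\<lambda>n a. a + a) (f e))"
  proof (rule PS_rec[where b = "\<lambda>e. 2 ^ f e"])
    show "dep k (\<lambda>e. 2 ^ f e)" using PS_dep[OF assms(1)] by (auto simp: dep_def)
    have "pol k (\<lambda>e. f e + 1)" by (intro pol_add pol_const assms)
    then show "pol k (\<lambda>e. bitlen (2 ^ f e))" by (simp add: bitlen_pow2)
  qed ((intro PS_intros assms; simp), (intro PS_intros; simp), rule assms(1), simp only: r, simp)
  then show ?thesis by (simp only: r)
qed

text \<open>A power of two that is replaced by 0 when it would exceed \<open>b\<close>. In contrast
  to \<open>PS_pow2\<close> the exponent is arbitrary, so the closure rule has no side condition and
  can be applied blindly inside large terms.\<close>

definition cpow :: "nat \<Rightarrow> nat \<Rightarrow> nat" where "cpow b j = (if 2 ^ j \<le> b then 2 ^ j else 0)"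

lemma PS_cpow [PS_intros]: assumes "PS k a" "PS k b" shows "PS k (\<lambda>e. cpow (a e) (b e))"
proof (rule PS_comp2[OF _ assms])
  let ?h = "\<lambda>b n a. if a + a \<le> b then a + a else 0"
  have r: "rec_nat (if 1 \<le> b then 1 else 0) (?h b) j = cpow b j" for b j :: nat
  proof (induction j)
    case (Suc j)
    have "(2::nat) ^ j \<le> 2 ^ j + 2 ^ j" "(1::nat) \<le> 2 ^ j" by auto
    then show ?case unfolding nat.rec(2) Suc unfolding cpow_def by (auto simp: mult_2)
  qed (simp add: cpow_def)
  have "PS 2 (\<lambda>e. rec_nat (if 1 \<le> e 0 then 1 else 0) (?h (e 0)) (e 1))"
    by (rule PS_rec_PS[where b = "\<lambda>e. e 0"]) ((intro PS_intros; simp)+, simp only: r, simp add: cpow_def)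
  then show "PS 2 (\<lambda>e. cpow (e 0) (e 1))" unfolding r .
qed

lemma PS_bitlen [PS_intros]: assumes "PS k a" shows "PS k (\<lambda>e. bitlen (a e))"
proof (rule PS_comp1[OF _ assms])
  have "PS 1 (\<lambda>e. mu (Suc (e 0)) (\<lambda>n. shr (e 0) n = 0))" by (intro PS_intros) auto
  moreover have "mu (Suc x) (\<lambda>n. shr x n = 0) = bitlen x" for x
  proof (rule mu_eq)
    show "shr x (bitlen x) = 0" by (simp add: shr_def less_two_power_bitlen)
    show "shr x n \<noteq> 0" if "n < bitlen x" for n
      using that bitlen_le_iff[of x n] by (auto simp: shr_def div_eq_0_iff)
    show "bitlen x < Suc x" using bitlen_le_self by (simp add: less_Suc_eq_le)
  qed
  ultimately show "PS 1 (\<lambda>e. bitlen (e 0))" by simp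
qed

definition pe :: "nat \<Rightarrow> nat \<Rightarrow> nat" where "pe a b = prod_encode (a, b)"
definition pf :: "nat \<Rightarrow> nat" where "pf p = fst (prod_decode p)"
definition psn :: "nat \<Rightarrow> nat" where "psn p = snd (prod_decode p)"

lemma pf_pe [simp]: "pf (pe a b) = a" and psn_pe [simp]: "psn (pe a b) = b"
  by (simp_all add: pe_def pf_def psn_def)

lemma pe_pf_psn [simp]: "pe (pf p) (psn p) = p"
  by (simp add: pe_def pf_def psn_def)

lemma le_pe: "a \<le> pe a b" "b \<le> pe a b"
  unfolding pe_def by (rule le_prod_encode_1, rule le_prod_encode_2)

lemma pe_less: "pe a b < (a + b + 1) ^ 2"
proof -
  have "triangle n \<le> n * n" for n by (induction n) auto
  then have "triangle (a + b) \<le> (a + b) * (a + b)" .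
  then show ?thesis by (simp add: pe_def prod_encode_def power2_eq_square algebra_simps)
qed

lemma triangle_eq: "triangle n = n * Suc n div 2"
  by (induction n) (auto simp: triangle_def)

lemma PS_pe [PS_intros]: assumes "PS k a" "PS k b" shows "PS k (\<lambda>e. pe (a e) (b e))"
  unfolding pe_def prod_encode_def triangle_eq prod.case by (intro PS_intros assms)

lemma PS_pf [PS_intros]: assumes "PS k a" shows "PS k (\<lambda>e. pf (a e))"
proof (rule PS_comp1[OF _ assms])
  have "PS 1 (\<lambda>e. mu (Suc (e 0)) (\<lambda>n. \<exists>y<Suc (e 0). pe n y = e 0))" by (intro PS_intros) auto
  moreover have "mu (Suc x) (\<lambda>n. \<exists>y<Suc x. pe n y = x) = pf x" for x
  proof (rule mu_eq)
    show "\<exists>y<Suc x. pe (pf x) y = x" using le_pe(2)[of "psn x" "pf x"] by (intro exI[of _ "psn x"]) simp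
    show "\<not> (\<exists>y<Suc x. pe n y = x)" if "n < pf x" for n using that by auto
    show "pf x < Suc x" using le_pe(1)[of "pf x" "psn x"] by simp
  qed
  ultimately show "PS 1 (\<lambda>e. pf (e 0))" by simp
qed

lemma PS_psn [PS_intros]: assumes "PS k a" shows "PS k (\<lambda>e. psn (a e))"
proof (rule PS_comp1[OF _ assms])
  have "PS 1 (\<lambda>e. mu (Suc (e 0)) (\<lambda>n. pe (pf (e 0)) n = e 0))" by (intro PS_intros) auto
  moreover have "mu (Suc x) (\<lambda>n. pe (pf x) n = x) = psn x" for x
  proof (rule mu_eq)
    show "\<not> pe (pf x) n = x" if "n < psn x" for n using that by (metis less_irrefl psn_pe)
    show "psn x < Suc x" using le_pe(2)[of "psn x" "pf x"] by simp
  qed simp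
  ultimately show "PS 1 (\<lambda>e. psn (e 0))" by simp
qed

section \<open>Games of polynomial length\<close>

text \<open>The sign \<open>\<tau> x y\<close> replaces the alternation of players: a move wins if
  the value of the successor equals its sign, so sign False means that the successor has to be lost
  for its own mover.\<close>

primrec gm :: "(nat \<Rightarrow> nat \<Rightarrow> bool) \<Rightarrow> (nat \<Rightarrow> nat \<Rightarrow> nat) \<Rightarrow> (nat \<Rightarrow> nat \<Rightarrow> bool) \<Rightarrow> nat \<Rightarrow> nat \<Rightarrow> nat \<Rightarrow> bool" where
  "gm L h \<tau> B 0 x = False"
| "gm L h \<tau> B (Suc r) x = (\<exists>y<B. L x y \<and> (gm L h \<tau> B r (h x y) = \<tau> x y))"

text \<open>Base of the stack code. A frame \<open>1 + x + Z * y\<close> with \<open>x < Z\<close>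
  and \<open>y \<le> B\<close> lies between 1 and \<open>Z * (B + 1)\<close>, so digits are never 0
  and the stack 0 is the empty one.\<close>

definition gW :: "nat \<Rightarrow> nat \<Rightarrow> nat" where "gW Z B = Z * (B + 1) + 1"

text \<open>One step of a depth-first evaluation on states \<open>pe mode (pe j stack)\<close>. Mode
  0 explores, modes 1 and 2 return False and True; \<open>j\<close> is the number of rounds left;
  the top frame holds a position \<open>x\<close> and the move \<open>y\<close> to be tried next.
  The empty stack is final.\<close>

definition gstep :: "(nat \<Rightarrow> nat \<Rightarrow> bool) \<Rightarrow> (nat \<Rightarrow> nat \<Rightarrow> nat) \<Rightarrow> (nat \<Rightarrow> nat \<Rightarrow> bool) \<Rightarrow> nat \<Rightarrow> nat \<Rightarrow> nat \<Rightarrow> nat" where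
  "gstep L h \<tau> B Z a =
    (if psn (psn a) = 0 then a
     else if (psn (psn a) mod gW Z B - 1) div Z \<ge> B \<or> (pf a = 0 \<and> pf (psn a) = 0)
       then pe 1 (pe (Suc (pf (psn a))) (psn (psn a) div gW Z B))
     else if pf a = 0 \<and> L ((psn (psn a) mod gW Z B - 1) mod Z) ((psn (psn a) mod gW Z B - 1) div Z)
       then pe 0 (pe (pf (psn a) - 1) (psn (psn a) * gW Z B + (1 + h ((psn (psn a) mod gW Z B - 1) mod Z) ((psn (psn a) mod gW Z B - 1) div Z))))
     else if pf a \<noteq> 0 \<and> ((pf a = 2) = \<tau> ((psn (psn a) mod gW Z B - 1) mod Z) ((psn (psn a) mod gW Z B - 1) div Z))
       then pe 2 (pe (Suc (pf (psn a))) (psn (psn a) div gW Z B))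
     else pe 0 (pe (pf (psn a)) (psn (psn a) div gW Z B * gW Z B +
       (1 + (psn (psn a) mod gW Z B - 1) mod Z + Z * (1 + (psn (psn a) mod gW Z B - 1) div Z)))))"

locale game =
  fixes L :: "nat \<Rightarrow> nat \<Rightarrow> bool" and h :: "nat \<Rightarrow> nat \<Rightarrow> nat" and \<tau> :: "nat \<Rightarrow> nat \<Rightarrow> bool" and B Z :: nat
  assumes h_less: "\<And>x y. x < Z \<Longrightarrow> y < B \<Longrightarrow> L x y \<Longrightarrow> h x y < Z"
begin

abbreviation "W \<equiv> gW Z B"
abbreviation "G \<equiv> gm L h \<tau> B"
abbreviation "S \<equiv> gstep L h \<tau> B Z"

definition fr :: "nat \<Rightarrow> nat \<Rightarrow> nat" where "fr x y = 1 + x + Z * y"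

lemma fr_less: "x < Z \<Longrightarrow> y \<le> B \<Longrightarrow> fr x y < W"
proof -
  assume "x < Z" "y \<le> B"
  then have "Z * y \<le> Z * B" by simp
  from add_less_le_mono[OF \<open>x < Z\<close> this] show ?thesis by (simp add: fr_def gW_def)
qed

lemma fr_dec:
  assumes "x < Z" "y \<le> B"
  shows "(s * W + fr x y) mod W - 1 = x + Z * y" "(s * W + fr x y) div W = s" "(x + Z * y) mod Z = x" "(x + Z * y) div Z = y"
    "s * W + fr x y \<noteq> 0"
proof -
  show "(s * W + fr x y) div W = s" by (rule div_nat_eqI) (use fr_less[OF assms] in \<open>auto simp: mult.commute\<close>)
qed (use fr_less[OF assms] assms in \<open>auto simp: fr_def\<close>)

lemma S_simps:
  assumes "x < Z" "y \<le> B"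
  shows "B \<le> y \<Longrightarrow> S (pe m (pe j (s * W + fr x y))) = pe 1 (pe (Suc j) s)"
    "S (pe 0 (pe 0 (s * W + fr x y))) = pe 1 (pe (Suc 0) s)"
    "y < B \<Longrightarrow> L x y \<Longrightarrow> S (pe 0 (pe (Suc j) (s * W + fr x y))) = pe 0 (pe j ((s * W + fr x y) * W + fr (h x y) 0))"
    "y < B \<Longrightarrow> \<not> L x y \<Longrightarrow> S (pe 0 (pe (Suc j) (s * W + fr x y))) = pe 0 (pe (Suc j) (s * W + fr x (Suc y)))"
    "y < B \<Longrightarrow> m \<noteq> 0 \<Longrightarrow> (m = 2) = \<tau> x y \<Longrightarrow> S (pe m (pe j (s * W + fr x y))) = pe 2 (pe (Suc j) s)"
    "y < B \<Longrightarrow> m \<noteq> 0 \<Longrightarrow> (m = 2) \<noteq> \<tau> x y \<Longrightarrow> S (pe m (pe j (s * W + fr x y))) = pe 0 (pe j (s * W + fr x (Suc y)))"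
  unfolding gstep_def pf_pe psn_pe fr_dec[OF assms] using fr_dec(5)[OF assms, of s]
  by (simp_all only: fr_def) auto

definition GG :: "nat \<Rightarrow> nat \<Rightarrow> nat \<Rightarrow> bool" where
  "GG j x y \<longleftrightarrow> j > 0 \<and> (\<exists>y'<B. y \<le> y' \<and> L x y' \<and> (G (j - 1) (h x y') = \<tau> x y'))"

lemma GG_0: "GG j x 0 = G j x"
  by (cases j) (auto simp: GG_def)

lemma GG_step: "y < B \<Longrightarrow> GG (Suc j) x y \<longleftrightarrow> (L x y \<and> (G j (h x y) = \<tau> x y)) \<or> GG (Suc j) x (Suc y)"
proof -
  assume y: "y < B"
  have "(\<exists>y'<B. y \<le> y' \<and> P y') \<longleftrightarrow> P y \<or> (\<exists>y'<B. Suc y \<le> y' \<and> P y')" for P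
    using y by (metis Suc_leD Suc_leI le_eq_less_or_eq order_refl)
  from this[of "\<lambda>y'. L x y' \<and> (G j (h x y') = \<tau> x y')"] show ?thesis by (simp add: GG_def)
qed

text \<open>If \<open>C\<close> bounds the time for a successor, each move costs at most
  \<open>C + 2\<close> steps and giving up costs one. The factor \<open>3 * B + 4\<close> absorbs
  \<open>B * (C + 2) + 1\<close> because \<open>C \<ge> 1\<close>.\<close>

lemma dfs:
  assumes "x < Z" "y \<le> B"
  shows "\<exists>n \<le> (3 * B + 4) ^ Suc j. (S ^^ n) (pe 0 (pe j (s * W + fr x y))) = pe (if GG j x y then 2 else 1) (pe (Suc j) s)"
  using assms
proof (induction j arbitrary: x y s)
  case 0
  show ?case by (rule exI[of _ 1]) (use S_simps(2)[OF 0] in \<open>simp add: GG_def\<close>)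
next
  case (Suc j)
  define C where "C = (3 * B + 4) ^ Suc j"
  have "\<exists>n \<le> (B - y) * (C + 2) + 1. (S ^^ n) (pe 0 (pe (Suc j) (s * W + fr x y))) = pe (if GG (Suc j) x y then 2 else 1) (pe (Suc (Suc j)) s)"
    using Suc.prems
  proof (induction "B - y" arbitrary: y)
    case 0
    then have "S (pe 0 (pe (Suc j) (s * W + fr x y))) = pe 1 (pe (Suc (Suc j)) s)" by (intro S_simps) auto
    moreover have "B \<le> y" using 0 by simp
    then have "\<not> GG (Suc j) x y" by (auto simp: GG_def)
    ultimately show ?case by (intro exI[of _ 1]) simp
  next
    case (Suc d)
    then have y: "y < B" and xz: "x < Z" and d: "d = B - Suc y" by auto
    have yB: "y \<le> B" using y by simp
    obtain n where n: "n \<le> (B - Suc y) * (C + 2) + 1"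
      "(S ^^ n) (pe 0 (pe (Suc j) (s * W + fr x (Suc y)))) = pe (if GG (Suc j) x (Suc y) then 2 else 1) (pe (Suc (Suc j)) s)"
      using Suc.hyps(1)[OF d] xz y by auto
    have bnd: "(B - y) * (C + 2) = (B - Suc y) * (C + 2) + (C + 2)"
      using y by (simp add: Suc_diff_Suc[symmetric])
    show ?case
    proof (cases "L x y")
      case False
      have "(S ^^ Suc n) (pe 0 (pe (Suc j) (s * W + fr x y))) = pe (if GG (Suc j) x y then 2 else 1) (pe (Suc (Suc j)) s)"
        unfolding funpow_Suc_right o_apply S_simps(4)[OF xz yB y False] n(2) using GG_step[OF y, where j=j and x=x] False by simp
      then show ?thesis by (intro exI[of _ "Suc n"] conjI) (use n(1) bnd in linarith, assumption)
    next
      case True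
      note p = S_simps(3)[OF xz yB y True, where j=j and s=s]
      obtain m where m: "m \<le> C" "(S ^^ m) (pe 0 (pe j ((s * W + fr x y) * W + fr (h x y) 0))) =
         pe (if G j (h x y) then 2 else 1) (pe (Suc j) (s * W + fr x y))"
        using Suc.IH[where x="h x y" and y=0 and s="s * W + fr x y"] h_less[OF xz y True] unfolding GG_0 C_def by auto
      have m1: "(S ^^ Suc m) (pe 0 (pe (Suc j) (s * W + fr x y))) = pe (if G j (h x y) then 2 else 1) (pe (Suc j) (s * W + fr x y))"
        unfolding funpow_Suc_right o_apply p m(2) ..
      show ?thesis
      proof (cases "G j (h x y) = \<tau> x y")
        case True
        then have "S (pe (if G j (h x y) then 2 else 1) (pe (Suc j) (s * W + fr x y))) = pe 2 (pe (Suc (Suc j)) s)"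
          by (intro S_simps(5)[OF xz yB y]) auto
        then have "(S ^^ Suc (Suc m)) (pe 0 (pe (Suc j) (s * W + fr x y))) = pe (if GG (Suc j) x y then 2 else 1) (pe (Suc (Suc j)) s)"
          using m1 True \<open>L x y\<close> GG_step[OF y, where j=j and x=x] by simp
        then show ?thesis by (intro exI[of _ "Suc (Suc m)"] conjI) (use m(1) bnd in linarith, assumption)
      next
        case False
        then have *: "S (pe (if G j (h x y) then 2 else 1) (pe (Suc j) (s * W + fr x y))) = pe 0 (pe (Suc j) (s * W + fr x (Suc y)))"
          by (intro S_simps(6)[OF xz yB y]) auto
        have "(S ^^ (n + Suc (Suc m))) (pe 0 (pe (Suc j) (s * W + fr x y))) = (S ^^ n) (S ((S ^^ Suc m) (pe 0 (pe (Suc j) (s * W + fr x y)))))"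
          unfolding funpow_add o_apply funpow.simps(2)[of "Suc m"] ..
        also have "\<dots> = pe (if GG (Suc j) x y then 2 else 1) (pe (Suc (Suc j)) s)"
          unfolding m1 * n(2) using GG_step[OF y, where j=j and x=x] False by simp
        finally show ?thesis by (intro exI[of _ "n + Suc (Suc m)"] conjI) (use m(1) n(1) bnd in linarith, assumption)
      qed
    qed
  qed
  moreover have "(B - y) * (C + 2) + 1 \<le> (3 * B + 4) ^ Suc (Suc j)"
  proof -
    have "1 \<le> C" unfolding C_def by simp
    then have "(B - y) * (C + 2) + 1 \<le> B * (3 * C) + 4 * C" by (intro add_mono mult_le_mono) auto
    also have "\<dots> = (3 * B + 4) ^ Suc (Suc j)" by (simp add: C_def algebra_simps)
    finally show ?thesis .
  qed
  ultimately show ?case using order_trans by blast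
qed

text \<open>The stack has room for one frame per round already used, so its code stays below a power
  of \<open>W\<close> whose exponent is at most \<open>r + 1\<close>: polynomial length despite
  exponentially many steps.\<close>

definition inv :: "nat \<Rightarrow> nat \<Rightarrow> bool" where
  "inv r a \<longleftrightarrow> pf a \<le> 2 \<and> pf (psn a) \<le> Suc r \<and> psn (psn a) < W ^ (Suc r - pf (psn a))"

lemma inv_step: assumes "inv r a" "Z > 0" shows "inv r (S a)"
proof (cases "psn (psn a) = 0")
  case False
  define m j s where "m = pf a" and "j = pf (psn a)" and "s = psn (psn a)"
  define x y t where "x = (s mod W - 1) mod Z" and "y = (s mod W - 1) div Z" and "t = s div W"
  have i: "m \<le> 2" "j \<le> Suc r" "s < W ^ (Suc r - j)" "s \<noteq> 0" using assms False by (auto simp: inv_def m_def j_def s_def)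
  then have jr: "j \<le> r" by (cases "j = Suc r") auto
  then have e: "Suc r - j = Suc (r - j)" by simp
  have j1: "j - 1 \<le> Suc r" using i(2) by linarith
  have xz: "x < Z" using assms by (simp add: x_def)
  have W0: "W > 0" by (simp add: gW_def)
  have t: "t < W ^ (r - j)" using i(3) unfolding e t_def by (simp add: less_mult_imp_div_less mult.commute)
  have fr: "t * W + fr x' y' < W ^ (Suc r - j)" if "x' < Z" "y' \<le> B" for x' y'
  proof -
    have "t * W + fr x' y' < t * W + W" using fr_less[OF that] by simp
    also have "\<dots> = Suc t * W" by simp
    also have "\<dots> \<le> W ^ (r - j) * W" using t by (intro mult_le_mono) auto
    finally show ?thesis unfolding e by (simp add: mult.commute)
  qed
  have push: "s * W + fr x' y' < W ^ (Suc r - (j - 1))" if "x' < Z" "y' \<le> B" "j \<noteq> 0" for x' y'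
  proof -
    have "s * W + fr x' y' < s * W + W" using fr_less[OF that(1,2)] by simp
    also have "\<dots> = Suc s * W" by simp
    also have "\<dots> \<le> W ^ (Suc r - j) * W" using i by (intro mult_le_mono) auto
    also have "\<dots> = W ^ Suc (Suc r - j)" by (simp add: mult.commute)
    also have "Suc (Suc r - j) = Suc r - (j - 1)" using that jr by simp
    finally show ?thesis .
  qed
  have "S a = (if y \<ge> B \<or> (m = 0 \<and> j = 0) then pe 1 (pe (Suc j) t)
     else if m = 0 \<and> L x y then pe 0 (pe (j - 1) (s * W + fr (h x y) 0))
     else if m \<noteq> 0 \<and> ((m = 2) = \<tau> x y) then pe 2 (pe (Suc j) t)
     else pe 0 (pe j (t * W + fr x (Suc y))))"
    using False unfolding gstep_def m_def j_def s_def x_def y_def t_def fr_def by simp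
  then show ?thesis
    using i jr j1 t fr[OF xz, of "Suc y"] push[OF h_less[OF xz, of y], of 0] by (simp add: inv_def not_le)
next
  case True
  then show ?thesis using assms by (simp add: gstep_def)
qed

lemma dfs_result:
  assumes "x < Z" "(3 * B + 4) ^ Suc r \<le> n"
  shows "pf ((S ^^ n) (pe 0 (pe r (1 + x)))) = 2 \<longleftrightarrow> G r x"
proof -
  obtain n0 where n0: "n0 \<le> n" "(S ^^ n0) (pe 0 (pe r (1 + x))) = pe (if G r x then 2 else 1) (pe (Suc r) 0)"
    using dfs[OF assms(1), of 0 r 0] assms(2) by (auto simp: GG_0 fr_def) (meson order_trans)
  have "(S ^^ i) (pe m (pe j 0)) = pe m (pe j 0)" for i m j
    by (induction i) (auto simp: gstep_def)
  moreover have "(S ^^ n) (pe 0 (pe r (1 + x))) = (S ^^ (n - n0)) ((S ^^ n0) (pe 0 (pe r (1 + x))))"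
    using n0(1) by (metis funpow_add le_add_diff_inverse2 o_apply)
  ultimately show ?thesis using n0 by simp
qed

lemma dfs_bound:
  assumes "x < Z"
  shows "(S ^^ n) (pe 0 (pe r (1 + x))) < (4 + (r + W ^ Suc r + 3) ^ 2) ^ 2"
proof -
  have "inv r ((S ^^ n) (pe 0 (pe r (1 + x))))"
  proof (induction n)
    case 0
    then show ?case using assms by (simp add: inv_def gW_def)
  qed (use inv_step assms in simp)
  then obtain m j s where a: "(S ^^ n) (pe 0 (pe r (1 + x))) = pe m (pe j s)" and
    i: "m \<le> 2" "j \<le> Suc r" "s < W ^ (Suc r - j)" unfolding inv_def by (metis pe_pf_psn)
  have "s \<le> W ^ Suc r" using i(3) power_increasing[of "Suc r - j" "Suc r" W] by (simp add: gW_def)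
  then have "pe j s \<le> (r + W ^ Suc r + 3) ^ 2"
    using pe_less[of j s] i(2) power_mono[of "j + s + 1" "r + W ^ Suc r + 3" 2] by linarith
  then show ?thesis unfolding a using pe_less[of m "pe j s"] i(1)
      power_mono[of "m + pe j s + 1" "4 + (r + W ^ Suc r + 3) ^ 2" 2] by linarith
qed

end

text \<open>The evaluator is iterated \<open>It e\<close> times on states capped through
  \<open>Sb e\<close>. Variable exponents are available for powers of two only, so the caller
  supplies convenient upper bounds instead of the exact powers.\<close>

lemma PSp_gm:
  assumes L: "PSp (Suc (Suc k)) (\<lambda>e. L (\<lambda>i. e (Suc (Suc i))) (e 0) (e 1))"
    and h: "PS (Suc (Suc k)) (\<lambda>e. h (\<lambda>i. e (Suc (Suc i))) (e 0) (e 1))"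
    and \<tau>: "PSp (Suc (Suc k)) (\<lambda>e. \<tau> (\<lambda>i. e (Suc (Suc i))) (e 0) (e 1))"
    and Z: "PS k Z" and B: "PS k B" and r: "PS k r" and x: "PS k x" and It: "PS k It" and Sb: "PS k Sb"
    and less: "\<And>e x y. x < Z e \<Longrightarrow> y < B e \<Longrightarrow> L e x y \<Longrightarrow> h e x y < Z e" "\<And>e. x e < Z e"
    and bounds: "\<And>e. (3 * B e + 4) ^ Suc (r e) \<le> It e" "\<And>e. gW (Z e) (B e) ^ Suc (r e) \<le> Sb e"
  shows "PSp k (\<lambda>e. gm (L e) (h e) (\<tau> e) (B e) (r e) (x e))"
proof -
  let ?S = "\<lambda>e. gstep (L e) (h e) (\<tau> e) (B e) (Z e)"
  let ?s0 = "\<lambda>e. pe 0 (pe (r e) (1 + x e))"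
  have g: "game (L e) (h e) (B e) (Z e)" for e using less(1) by unfold_locales
  have rec: "rec_nat a (\<lambda>n. f) m = (f ^^ m) a" for f :: "nat \<Rightarrow> nat" and a m by (induction m) auto
  have w: "PS (Suc (Suc k)) (\<lambda>e. F (\<lambda>i. e (Suc (Suc i))))" if "PS k F" for F
    using PS_rename[OF that, of "\<lambda>i. Suc (Suc i)" "Suc (Suc k)"] by simp
  have c: "PS (Suc (Suc k)) (\<lambda>e. F (\<lambda>i. e (Suc (Suc i))) (X e) (Y e))"
    if "PS (Suc (Suc k)) (\<lambda>e. F (\<lambda>i. e (Suc (Suc i))) (e 0) (e 1))" "PS (Suc (Suc k)) X" "PS (Suc (Suc k)) Y"
    for F :: "(nat \<Rightarrow> nat) \<Rightarrow> nat \<Rightarrow> nat \<Rightarrow> nat" and X Y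
  proof -
    have "PS (Suc (Suc k)) (if i = 0 then X else if i = 1 then Y else (\<lambda>e. e i))" if "i < Suc (Suc k)" for i
      using that \<open>PS (Suc (Suc k)) X\<close> \<open>PS (Suc (Suc k)) Y\<close> by (auto intro: PS_var)
    from PS_comp[OF that(1), where a="\<lambda>i. if i = 0 then X else if i = 1 then Y else (\<lambda>e. e i)", OF this]
    show ?thesis by simp
  qed
  have cp: "PSp (Suc (Suc k)) (\<lambda>e. F (\<lambda>i. e (Suc (Suc i))) (X e) (Y e))"
    if "PSp (Suc (Suc k)) (\<lambda>e. F (\<lambda>i. e (Suc (Suc i))) (e 0) (e 1))" "PS (Suc (Suc k)) X" "PS (Suc (Suc k)) Y" for F X Y
    using c[of "\<lambda>e x y. if F e x y then 1 else 0"] that unfolding PSp_def by blast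
  have "PS k (\<lambda>e. rec_nat (?s0 e) (\<lambda>n. ?S e) (It e))"
  proof (rule PS_rec_PS[where b = "\<lambda>e. (4 + (r e + Sb e + 3) ^ 2) ^ 2"])
    show "PS (Suc (Suc k)) (\<lambda>e. ?S (\<lambda>i. e (Suc (Suc i))) (e 1))"
      unfolding gstep_def gW_def
      by (intro PS_intros w[OF Z] w[OF B] cp[OF L] cp[OF \<tau>] c[OF h]) auto
    show "rec_nat (?s0 e) (\<lambda>n. ?S e) n \<le> (4 + (r e + Sb e + 3) ^ 2) ^ 2" for e n
    proof -
      have "rec_nat (?s0 e) (\<lambda>n. ?S e) n \<le> (4 + (r e + gW (Z e) (B e) ^ Suc (r e) + 3) ^ 2) ^ 2"
        unfolding rec using game.dfs_bound[OF g less(2)] by (rule less_imp_le)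
      also have "\<dots> \<le> (4 + (r e + Sb e + 3) ^ 2) ^ 2"
        using bounds(2)[of e] by (intro power_mono add_mono) auto
      finally show ?thesis .
    qed
  qed (intro PS_intros r x It Sb)+
  then have "PSp k (\<lambda>e. pf (rec_nat (?s0 e) (\<lambda>n. ?S e) (It e)) = 2)"
    by (intro PS_intros)
  then show ?thesis unfolding rec game.dfs_result[OF g less(2) bounds(1)] .
qed

section \<open>Sparse numbers\<close>

text \<open>A carry into position \<open>p\<close> in explicit form: it is generated at
  \<open>q\<close> and kept alive at all positions in between. This is the form in which a game can
  guess a carry (\<open>q\<close> and \<open>m\<close>) and challenge it at a single
  position.\<close>

definition cyc :: "nat \<Rightarrow> nat \<Rightarrow> nat \<Rightarrow> bool" where
  "cyc a b p \<longleftrightarrow> (\<exists>q m. m \<ge> 1 \<and> p = q + m \<and> bit a q \<and> bit b q \<and> (\<forall>x. 0 < x \<and> x < m \<longrightarrow> bit a (q + x) \<or> bit b (q + x)))"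

primrec cy :: "bool \<Rightarrow> nat \<Rightarrow> nat \<Rightarrow> nat \<Rightarrow> bool" where
  "cy c a b 0 = c"
| "cy c a b (Suc p) = (bit a p \<and> bit b p \<or> (bit a p \<or> bit b p) \<and> cy c a b p)"

lemma cyc_eq_cy: "cyc a b p = cy False a b p"
proof (induction p)
  case 0
  then show ?case by (auto simp: cyc_def)
next
  case (Suc p)
  have "cyc a b (Suc p) \<longleftrightarrow> bit a p \<and> bit b p \<or> (bit a p \<or> bit b p) \<and> cyc a b p"
  proof
    assume "cyc a b (Suc p)"
    then obtain q m where qm: "m \<ge> 1" "Suc p = q + m" "bit a q" "bit b q"
      "\<And>x. 0 < x \<Longrightarrow> x < m \<Longrightarrow> bit a (q + x) \<or> bit b (q + x)" unfolding cyc_def by blast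
    show "bit a p \<and> bit b p \<or> (bit a p \<or> bit b p) \<and> cyc a b p"
    proof (cases "m = 1")
      case True
      then show ?thesis using qm by simp
    next
      case False
      have "q + (m - 1) = p" using qm(1,2) by simp
      then have "bit a p \<or> bit b p" using qm(5)[of "m - 1"] qm(1) False by auto
      moreover have "cyc a b p" unfolding cyc_def
      proof (rule exI[of _ q], rule exI[of _ "m - 1"], intro conjI allI impI)
        show "bit a (q + x) \<or> bit b (q + x)" if "0 < x \<and> x < m - 1" for x
          by (rule qm(5)) (use that in auto)
      qed (use qm(1-4) False in auto)
      ultimately show ?thesis by blast
    qed
  next
    assume "bit a p \<and> bit b p \<or> (bit a p \<or> bit b p) \<and> cyc a b p"
    then show "cyc a b (Suc p)"
    proof
      assume "bit a p \<and> bit b p"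
      then show ?thesis unfolding cyc_def by (intro exI[of _ p] exI[of _ 1]) auto
    next
      assume *: "(bit a p \<or> bit b p) \<and> cyc a b p"
      then obtain q m where qm: "m \<ge> 1" "p = q + m" "bit a q" "bit b q"
        "\<And>x. 0 < x \<Longrightarrow> x < m \<Longrightarrow> bit a (q + x) \<or> bit b (q + x)" unfolding cyc_def by blast
      show ?thesis unfolding cyc_def
      proof (rule exI[of _ q], rule exI[of _ "Suc m"], intro conjI allI impI)
        fix x assume "0 < x \<and> x < Suc m"
        then show "bit a (q + x) \<or> bit b (q + x)" using qm(2,5) * by (cases "x = m") auto
      qed (use qm in auto)
    qed
  qed
  then show ?case using Suc by simp
qed

text \<open>The recursion defining \<open>cy\<close> peels off the top position; this one peels off
  the lowest, which is what halving the summands requires.\<close>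

lemma cy_Suc': "cy c a b (Suc p) = cy (odd a \<and> odd b \<or> (odd a \<or> odd b) \<and> c) (a div 2) (b div 2) p"
  by (induction p) (auto simp: bit_0 bit_Suc)

lemma bit_add_cy: "bit (a + b + of_bool c) p \<longleftrightarrow> ((bit a p \<noteq> bit b p) \<noteq> cy c a b p)" for a b :: nat
proof (induction p arbitrary: a b c)
  case 0
  then show ?case by (cases c) (auto simp: bit_0)
next
  case (Suc p)
  let ?c = "odd a \<and> odd b \<or> (odd a \<or> odd b) \<and> c"
  have "(a + b + of_bool c) div 2 = a div 2 + b div 2 + of_bool ?c"
    by (cases c; cases "odd a"; cases "odd b") (auto elim!: evenE oddE)
  then show ?case unfolding cy_Suc' bit_Suc using Suc[of "a div 2" "b div 2" ?c] by simp
qed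

lemma bit_add: "bit (a + b) p \<longleftrightarrow> ((bit a p \<noteq> bit b p) \<noteq> cyc a b p)" for a b :: nat
  using bit_add_cy[of a b False p] by (simp add: cyc_eq_cy)

lemma bit_imp_le: "bit x i \<Longrightarrow> 2 ^ i \<le> x" for x :: nat
  by (metis bit_iff_odd div_less dvd_0_right not_le)

lemma bit_less: "bit x i \<Longrightarrow> x < 2 ^ k \<Longrightarrow> i < k" for x :: nat
  by (meson bit_imp_le le_less_trans not_le power_increasing_iff one_less_numeral_iff semiring_norm(76))

lemma less_two_powI: "(\<And>i. bit x i \<Longrightarrow> i < k) \<Longrightarrow> x < 2 ^ k" for x :: nat
proof -
  assume "\<And>i. bit x i \<Longrightarrow> i < k"
  then have "take_bit k x = x" by (auto simp: bit_eq_iff bit_take_bit_iff)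
  then show ?thesis by (metis take_bit_nat_less_exp)
qed

section \<open>The number of ones as a measure of sparseness\<close>

definition pop :: "nat \<Rightarrow> nat" where "pop x = card {i. bit x i}"

lemma finite_bits: "finite {i. bit (x::nat) i}"
proof (rule finite_subset)
  show "{i. bit x i} \<subseteq> {..<x}"
  proof
    fix i assume "i \<in> {i. bit x i}"
    then have "2 ^ i \<le> x" using bit_imp_le by simp
    then show "i \<in> {..<x}" using less_le_trans[OF less_exp[of i]] by simp
  qed
qed simp

lemma pop_rec: "pop x = of_bool (odd x) + pop (x div 2)"
proof -
  have "{i. bit x i} = (if odd x then {0} else {}) \<union> Suc ` {i. bit (x div 2) i}"
  proof (rule set_eqI)
    fix i show "i \<in> {i. bit x i} \<longleftrightarrow> i \<in> (if odd x then {0} else {}) \<union> Suc ` {i. bit (x div 2) i}"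
      by (cases i) (auto simp: bit_0 bit_Suc)
  qed
  moreover have "card (Suc ` {i. bit (x div 2) i}) = pop (x div 2)" by (simp add: pop_def card_image)
  moreover have "finite (Suc ` {i. bit (x div 2) i})" using finite_bits by blast
  moreover have "0 \<notin> Suc ` {i. bit (x div 2) i}" by auto
  ultimately show ?thesis by (simp add: pop_def)
qed

lemma pop_0 [simp]: "pop 0 = 0" by (simp add: pop_def)

lemma pop_Suc: "pop (Suc x) \<le> Suc (pop x)"
proof (induction x rule: less_induct)
  case (less x)
  show ?case
  proof (cases "odd x")
    case True
    then have "Suc x div 2 = Suc (x div 2)" "x div 2 < x" by (auto elim!: oddE)
    then show ?thesis using less[of "x div 2"] True pop_rec[of x] pop_rec[of "Suc x"] by simp
  next
    case False
    then have "Suc x div 2 = x div 2" by simp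
    then show ?thesis using False pop_rec[of x] pop_rec[of "Suc x"] by simp
  qed
qed

lemma pop_add: "pop (a + b) \<le> pop a + pop b"
proof (induction "a + b" arbitrary: a b rule: less_induct)
  case less
  show ?case
  proof (cases "a + b = 0")
    case False
    then have "a div 2 + b div 2 < a + b" by linarith
    from less[OF this] have IH: "pop (a div 2 + b div 2) \<le> pop (a div 2) + pop (b div 2)" by simp
    have "(a + b) div 2 = a div 2 + b div 2 + of_bool (odd a \<and> odd b)"
      by (cases "odd a"; cases "odd b") (auto elim!: evenE oddE)
    then show ?thesis using IH pop_Suc[of "a div 2 + b div 2"] pop_rec[of a] pop_rec[of b] pop_rec[of "a + b"]
      by (cases "odd a"; cases "odd b") auto
  qed simp
qed

lemma pop_less_pow: "x < 2 ^ k \<Longrightarrow> pop x \<le> k"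
proof -
  assume "x < 2 ^ k"
  then have "{i. bit x i} \<subseteq> {..<k}" using bit_less by auto
  from card_mono[OF _ this] show ?thesis by (simp add: pop_def)
qed

lemma bit_mult_pow2: "bit (a * 2 ^ k) i \<longleftrightarrow> k \<le> i \<and> bit a (i - k)" for a :: nat
  by (metis bit_push_bit_iff_nat push_bit_eq_mult)

lemma pop_mult_pow2: "pop (a * 2 ^ k) = pop a"
proof -
  have "{i. bit (a * 2 ^ k) i} = (\<lambda>i. i + k) ` {i. bit a i}"
  proof (rule set_eqI)
    fix i show "i \<in> {i. bit (a * 2 ^ k) i} \<longleftrightarrow> i \<in> (\<lambda>i. i + k) ` {i. bit a i}"
      using le_add_diff_inverse2[of k i] by (auto simp: bit_mult_pow2 image_iff)
  qed
  then show ?thesis unfolding pop_def by (simp add: card_image)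
qed

lemma bit_pow2: "bit (2 ^ k :: nat) i \<longleftrightarrow> i = k"
  by (auto simp: bit_exp_iff)

lemma pop_pow2: "pop (2 ^ k) = 1"
  by (simp add: pop_def bit_pow2)

lemma bit_bitop:
  assumes "\<not> f False False"
  shows "bit (bitop f a b) i \<longleftrightarrow> f (bit a i) (bit b i)"
proof -
  let ?P = "\<lambda>i. f (bit a i) (bit b i)"
  let ?xs = "map ?P [0..<Suc (a + b)]"
  have "bitop f a b = (\<Sum>i<length ?xs. of_bool (?xs ! i) * 2 ^ i)"
    unfolding bitop_def by (rule sum.cong) (auto simp del: upt_Suc)
  also have "\<dots> = horner_sum of_bool 2 ?xs" by (simp add: horner_sum_eq_sum lessThan_atLeast0 del: upt_Suc length_map)
  finally have b: "bit (bitop f a b) i \<longleftrightarrow> i < Suc (a + b) \<and> ?P i"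
    by (auto simp: bit_horner_sum_bit_iff simp del: upt_Suc)
  have "\<not> bit a i \<and> \<not> bit b i" if "i \<ge> Suc (a + b)"
  proof -
    have "a + b < 2 ^ i" using that less_exp[of i] by linarith
    then show ?thesis using bit_imp_le[of a i] bit_imp_le[of b i] by linarith
  qed
  then show ?thesis using b assms by (cases "i < Suc (a + b)") auto
qed

lemma pop_bitop: assumes "\<not> f False False" shows "pop (bitop f a b) \<le> pop a + pop b"
proof -
  have "{i. bit (bitop f a b) i} \<subseteq> {i. bit a i} \<union> {i. bit b i}"
    using assms by (auto simp: bit_bitop) (metis (full_types))
  then have "pop (bitop f a b) \<le> card ({i. bit a i} \<union> {i. bit b i})"
    unfolding pop_def by (intro card_mono) (use finite_bits in auto)
  then show ?thesis unfolding pop_def using card_Un_le le_trans by blast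
qed

text \<open>Every position of a carry chain uses up a one of \<open>a\<close> or of
  \<open>b\<close>. Hence chains in sparse numbers are short, and each one of a sum is close to a
  one of a summand.\<close>

lemma cyc_length:
  assumes "\<And>x. x < m \<Longrightarrow> bit a (q + x) \<or> bit b (q + x)"
  shows "m \<le> pop a + pop b"
proof -
  have "(\<lambda>x. q + x) ` {..<m} \<subseteq> {i. bit a i} \<union> {i. bit b i}" using assms by auto
  then have "card ((\<lambda>x. q + x) ` {..<m}) \<le> card ({i. bit a i} \<union> {i. bit b i})"
    by (intro card_mono) (use finite_bits in auto)
  also have "\<dots> \<le> pop a + pop b" unfolding pop_def by (rule card_Un_le)
  finally show ?thesis by (simp add: card_image)
qed

text \<open>A truth table of three bits, for the pairs (True, False), (False, True) and (True, True)
  in this order. The fourth entry is fixed to False, which the well-formedness of programs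
  demands.\<close>

definition bop :: "nat \<Rightarrow> bool \<Rightarrow> bool \<Rightarrow> bool" where
  "bop c x y = (if x then if y then bit c 2 else bit c 0 else y \<and> bit c 1)"

lemma bop_FF: "\<not> bop c False False" by (simp add: bop_def)

section \<open>Straight-line programs and symbolic bit positions\<close>

text \<open>Node kinds: 0 constant, 1 addition, 2 left shift, 3 value of \<open>ALN\<close>, and \<open>4 + c\<close> the Boolean
  operation with truth table \<open>c\<close>. The values of \<open>ALN\<close> are powers of two with very large exponents.\<close>

function vv :: "(nat \<Rightarrow> nat) \<Rightarrow> (nat \<Rightarrow> nat) \<Rightarrow> (nat \<Rightarrow> nat) \<Rightarrow> (nat \<Rightarrow> nat) \<Rightarrow> nat \<Rightarrow> nat" where
  "vv K X Y Om n = (if K n = 0 then X n else if K n = 3 then 2 ^ Om n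
     else if X n < n \<and> Y n < n then
       (if K n = 1 then vv K X Y Om (X n) + vv K X Y Om (Y n)
        else if K n = 2 then vv K X Y Om (X n) * 2 ^ vv K X Y Om (Y n)
        else bitop (bop (K n - 4)) (vv K X Y Om (X n)) (vv K X Y Om (Y n)))
     else 0)"
  by pat_completeness auto
termination by (relation "measure (\<lambda>(K, X, Y, Om, n). n)") auto

declare vv.simps [simp del]

text \<open>A tower that bounds the bit positions of the nodes below \<open>n\<close> when all
  collected \<open>ALN\<close> exponents are at most \<open>z\<close>: an offset below
  \<open>2 ^ w\<close> plus at most \<open>N\<close> summands, each at most two to the previous
  bound.\<close>

primrec hs :: "nat \<Rightarrow> nat \<Rightarrow> nat \<Rightarrow> nat \<Rightarrow> nat" where
  "hs N w z 0 = z"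
| "hs N w z (Suc n) = 2 ^ w + N * 2 ^ hs N w z n"

text \<open>The amount an exponent must exceed to be independent of the earlier ones, which are at
  most \<open>z\<close>. In \<open>gap_main\<close> the three terms bound the offset, the truncated
  shift amounts and the sum of the earlier exponents.\<close>

definition gf :: "nat \<Rightarrow> nat \<Rightarrow> nat \<Rightarrow> nat" where
  "gf N w z = 2 ^ w + N * 2 ^ hs N w z N + N * z"

locale slp =
  fixes K X Y Om :: "nat \<Rightarrow> nat" and N w w0 :: nat
  assumes valid: "\<And>n. n < N \<Longrightarrow> K n \<noteq> 0 \<Longrightarrow> K n \<noteq> 3 \<Longrightarrow> X n < n \<and> Y n < n"
    and const: "\<And>n. n < N \<Longrightarrow> K n = 0 \<Longrightarrow> X n < 2 ^ w0"
    and w0: "w0 \<ge> 1" "w0 \<le> w"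
    and gap: "\<And>n. n < N \<Longrightarrow> K n = 3 \<Longrightarrow> \<exists>z. (\<forall>j<n. K j = 3 \<longrightarrow> Om j \<le> z) \<and> gf N w z < Om n"
    and big: "(2 * N + 3) * (w + (N + 1) * (w0 * 2 ^ N)) < 2 ^ w"
begin

abbreviation "v \<equiv> vv K X Y Om"

text \<open>\<open>Sm\<close> bounds the number of ones of a node: it starts with at most
  \<open>w0\<close> and at most doubles per node. \<open>Pm\<close> below bounds it for an offset of
  \<open>w\<close> bits plus the shift amounts of up to \<open>N\<close> nodes.\<close>

definition Sm where "Sm = w0 * 2 ^ N"
definition Pm where "Pm = w + (N + 1) * Sm"

lemma big': "(2 * N + 3) * Pm < 2 ^ w" using big by (simp add: Pm_def Sm_def)

definition hi :: "nat \<Rightarrow> nat" where "hi u = u div 2 ^ w"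
definition \<beta> where "\<beta> n = (if K n = 2 then v (Y n) else if K n = 3 then Om n else 0)"
text \<open>The low \<open>w\<close> bits of \<open>u\<close> are an offset, the bits above form a
  set of nodes. The position denoted is the offset plus the shift amounts of the shift nodes and the
  exponents of the \<open>ALN\<close> nodes in the set. \<open>pvs\<close> leaves the
  \<open>ALN\<close> nodes out and is itself treated as a number with bits.\<close>

definition pv :: "nat \<Rightarrow> nat" where "pv u = u mod 2 ^ w + (\<Sum>n<N. if bit (hi u) n then \<beta> n else 0)"
definition pvs :: "nat \<Rightarrow> nat" where "pvs u = u mod 2 ^ w + (\<Sum>n<N. if bit (hi u) n \<and> K n = 2 then \<beta> n else 0)"

lemma bit_hi: "bit u (w + n) \<longleftrightarrow> bit (hi u) n"
  unfolding hi_def by (metis add.commute bit_drop_bit_eq drop_bit_eq_div o_apply)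

lemma hi_less: "u < 2 ^ (w + L) \<longleftrightarrow> hi u < 2 ^ L"
  unfolding hi_def by (simp add: power_add div_less_iff_less_mult mult.commute)

lemma pv_small: "u < 2 ^ w \<Longrightarrow> pv u = u" "u < 2 ^ w \<Longrightarrow> pvs u = u"
  by (simp_all add: pv_def pvs_def hi_def)

lemma pv_add: assumes "u mod 2 ^ w + m < 2 ^ w" shows "pv (u + m) = pv u + m" "(u + m) mod 2 ^ w = u mod 2 ^ w + m"
  "u < 2 ^ (w + L) \<Longrightarrow> u + m < 2 ^ (w + L)"
proof -
  have e: "u + m = 2 ^ w * (u div 2 ^ w) + (u mod 2 ^ w + m)" by simp
  then show m: "(u + m) mod 2 ^ w = u mod 2 ^ w + m" using assms by (metis mod_less mod_mult_self4)
  have g: "(2 ^ w * a + b) div 2 ^ w = a" if "b < 2 ^ w" for a b :: nat using that by simp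
  have h: "hi (u + m) = hi u" using g[OF assms, of "u div 2 ^ w"] unfolding hi_def e[symmetric] .
  show "pv (u + m) = pv u + m" using m h by (simp add: pv_def)
  show "u < 2 ^ (w + L) \<Longrightarrow> u + m < 2 ^ (w + L)" unfolding hi_less h .
qed

lemma bit_add_top: "x < 2 ^ n \<Longrightarrow> bit (x + 2 ^ n) j \<longleftrightarrow> j = n \<or> bit x j" for x :: nat
  by (subst bit_disjunctive_add_iff) (use bit_less in \<open>auto simp: bit_pow2\<close>)

lemma top:
  assumes "u < 2 ^ (w + n)"
  shows "hi (u + 2 ^ (w + n)) = hi u + 2 ^ n" "(u + 2 ^ (w + n)) mod 2 ^ w = u mod 2 ^ w" "u + 2 ^ (w + n) < 2 ^ (w + Suc n)"
proof -
  have e: "u + 2 ^ (w + n) = u + 2 ^ n * 2 ^ w" by (simp add: power_add)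
  show "hi (u + 2 ^ (w + n)) = hi u + 2 ^ n" unfolding hi_def e by simp
  show "(u + 2 ^ (w + n)) mod 2 ^ w = u mod 2 ^ w" unfolding e by simp
qed (use assms in simp)

lemma pv_top: assumes "u < 2 ^ (w + n)" "n < N"
  shows "pv (u + 2 ^ (w + n)) = pv u + \<beta> n" "pvs (u + 2 ^ (w + n)) = pvs u + (if K n = 2 then v (Y n) else 0)"
proof -
  have nb: "\<not> bit (hi u) n" using assms hi_less bit_less by blast
  have b: "bit (hi (u + 2 ^ (w + n))) j \<longleftrightarrow> j = n \<or> bit (hi u) j" for j
    unfolding top(1)[OF assms(1)] by (rule bit_add_top) (use assms(1) hi_less in blast)
  have s: "(\<Sum>j<N. if (j = n \<or> P j) \<and> R j then f j else 0) = (\<Sum>j<N. if P j \<and> R j then f j else 0) + (if R n then f n else 0)"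
    if "\<not> P n" for P R and f :: "nat \<Rightarrow> nat"
  proof -
    have "(\<Sum>j<N. if (j = n \<or> P j) \<and> R j then f j else 0) = (\<Sum>j<N. (if P j \<and> R j then f j else 0) + (if j = n then if R n then f n else 0 else 0))"
      by (rule sum.cong) (use that in auto)
    then show ?thesis using assms(2) by (simp add: sum.distrib)
  qed
  show "pv (u + 2 ^ (w + n)) = pv u + \<beta> n"
    using s[of "bit (hi u)" "\<lambda>_. True" \<beta>, OF nb] by (simp add: pv_def b top(2)[OF assms(1)])
  show "pvs (u + 2 ^ (w + n)) = pvs u + (if K n = 2 then v (Y n) else 0)"
    using s[of "bit (hi u)" "\<lambda>n. K n = 2" \<beta>, OF nb] by (simp add: pvs_def b top(2)[OF assms(1)] \<beta>_def)
qed

text \<open>\<open>D\<close> controls that carries never overflow the offset; \<open>L\<close>, the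
  number of nodes allowed in the set, is the level on which the game descends.\<close>

definition Rep where "Rep D L = {r. \<exists>u<2 ^ (w + L). u mod 2 ^ w \<le> D \<and> pv u = r}"

lemma Rep_mono: "D \<le> D' \<Longrightarrow> L \<le> L' \<Longrightarrow> Rep D L \<subseteq> Rep D' L'"
proof -
  assume "D \<le> D'" "L \<le> L'"
  then have "(2::nat) ^ (w + L) \<le> 2 ^ (w + L')" by (intro power_increasing) auto
  then show ?thesis using \<open>D \<le> D'\<close> unfolding Rep_def by (blast intro: less_le_trans le_trans)
qed

abbreviation "bitset x \<equiv> {r. bit (x::nat) r}"

text \<open>A one of the sum is at a one of a summand or at the end of a carry chain. The chain
  starts at a common one and its length is simply added to the offset.\<close>

lemma Rep_add:
  assumes "bitset a \<subseteq> Rep D L" "bitset b \<subseteq> Rep D L" "D + (pop a + pop b) < 2 ^ w"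
  shows "bitset (a + b) \<subseteq> Rep (D + (pop a + pop b)) L"
proof
  fix r assume "r \<in> bitset (a + b)"
  then consider "bit a r \<or> bit b r" | "cyc a b r" by (auto simp: bit_add)
  then show "r \<in> Rep (D + (pop a + pop b)) L"
  proof cases
    case 1
    then show ?thesis using assms(1,2) Rep_mono[of D "D + (pop a + pop b)" L L] by auto
  next
    case 2
    then obtain q m where qm: "m \<ge> 1" "r = q + m" "bit a q" "bit b q"
        "\<And>x. 0 < x \<Longrightarrow> x < m \<Longrightarrow> bit a (q + x) \<or> bit b (q + x)" unfolding cyc_def by blast
    have "bit a (q + x) \<or> bit b (q + x)" if "x < m" for x using qm(3) qm(5)[of x] that by (cases "x = 0") auto
    then have "m \<le> pop a + pop b" by (rule cyc_length)
    moreover obtain u where u: "u < 2 ^ (w + L)" "u mod 2 ^ w \<le> D" "pv u = q" using assms(1) qm(3) by (auto simp: Rep_def)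
    ultimately have l: "u mod 2 ^ w + m < 2 ^ w" "u mod 2 ^ w + m \<le> D + (pop a + pop b)" using assms(3) by linarith+
    show ?thesis unfolding Rep_def
      by (rule CollectI, rule exI[of _ "u + m"]) (use pv_add[OF l(1)] l u qm in auto)
  qed
qed

lemma w0_le: "w0 \<le> Sm" "w \<le> Pm" "Sm \<le> Pm" "Pm < 2 ^ w" "(N + 1) * Sm \<le> Pm"
proof -
  show "w0 \<le> Sm" by (simp add: Sm_def)
  show "w \<le> Pm" "(N + 1) * Sm \<le> Pm" by (simp_all add: Pm_def)
  then show "Sm \<le> Pm" by simp
  have "3 * Pm \<le> (2 * N + 3) * Pm" by simp
  then show P: "Pm < 2 ^ w" using big' by linarith
qed

lemma v_simps:
  "K n = 0 \<Longrightarrow> v n = X n" "K n = 3 \<Longrightarrow> v n = 2 ^ Om n"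
  "n < N \<Longrightarrow> K n = 1 \<Longrightarrow> v n = v (X n) + v (Y n)"
  "n < N \<Longrightarrow> K n = 2 \<Longrightarrow> v n = v (X n) * 2 ^ v (Y n)"
  "n < N \<Longrightarrow> K n \<ge> 4 \<Longrightarrow> v n = bitop (bop (K n - 4)) (v (X n)) (v (Y n))"
  using valid[of n] by (subst vv.simps; simp)+

lemma kind_cases: "K n = 0 \<or> K n = 1 \<or> K n = 2 \<or> K n = 3 \<or> K n \<ge> 4"
  by linarith

lemma pop_v: "n < N \<Longrightarrow> pop (v n) \<le> w0 * 2 ^ n"
proof (induction n rule: less_induct)
  case (less n)
  have two: "pop (v (X n)) + pop (v (Y n)) \<le> w0 * 2 ^ n" if "K n \<noteq> 0" "K n \<noteq> 3"
  proof -
    have xy: "X n < n" "Y n < n" using valid[OF less.prems] that by auto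
    have h: "w0 * 2 ^ m \<le> w0 * 2 ^ (n - 1)" if "m < n" for m using that by (intro mult_le_mono power_increasing) auto
    have "pop (v (X n)) \<le> w0 * 2 ^ (n - 1)" "pop (v (Y n)) \<le> w0 * 2 ^ (n - 1)"
      using order_trans[OF less.IH[OF xy(1)] h[OF xy(1)]] order_trans[OF less.IH[OF xy(2)] h[OF xy(2)]] xy less.prems by auto
    moreover have "(2::nat) ^ n = 2 ^ (n - 1) + 2 ^ (n - 1)" using xy by (cases n) auto
    ultimately show ?thesis by (simp add: algebra_simps)
  qed
  consider "K n = 0" | "K n = 1" | "K n = 2" | "K n = 3" | "K n \<ge> 4" using kind_cases[of n] by auto
  then show ?case
  proof cases
    case 1
    have "pop (v n) \<le> w0" using v_simps(1)[OF 1] const[OF less.prems 1] pop_less_pow by simp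
    also have "\<dots> \<le> w0 * 2 ^ n" by simp
    finally show ?thesis .
  next
    case 2
    then show ?thesis using v_simps(3)[OF less.prems 2] pop_add[of "v (X n)" "v (Y n)"] two by simp
  next
    case 3
    then show ?thesis using v_simps(4)[OF less.prems 3] two by (simp add: pop_mult_pow2)
  next
    case 4
    have "1 \<le> w0 * 2 ^ n" using w0(1) by simp
    then show ?thesis using v_simps(2)[OF 4] by (simp add: pop_pow2)
  next
    case 5
    then show ?thesis using v_simps(5)[OF less.prems 5] pop_bitop[of "bop (K n - 4)", OF bop_FF, of "v (X n)" "v (Y n)"] two by simp
  qed
qed

lemma pop_v_Sm: "n < N \<Longrightarrow> pop (v n) \<le> Sm"
proof -
  assume n: "n < N"
  then have "w0 * 2 ^ n \<le> Sm" unfolding Sm_def by (intro mult_le_mono power_increasing) auto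
  with pop_v[OF n] show ?thesis by simp
qed

lemma Sm_bound: "n < N \<Longrightarrow> (n + 1) * Sm \<le> Pm"
proof -
  assume "n < N"
  then have "(n + 1) * Sm \<le> (N + 1) * Sm" by (intro mult_le_mono) auto
  then show ?thesis using w0_le by linarith
qed

text \<open>A shift adds its own node to the set of a position of its left operand, where only
  smaller nodes can occur. An addition raises the offset by a chain of length at most
  \<open>Sm\<close>; Boolean operations create no new positions.\<close>

lemma Rep_v: "n < N \<Longrightarrow> bitset (v n) \<subseteq> Rep ((n + 1) * Sm) (Suc n)"
proof (induction n rule: less_induct)
  case (less n)
  have IH: "bitset (v m) \<subseteq> Rep (n * Sm) n" if "m < n" for m
  proof -
    have "(m + 1) * Sm \<le> n * Sm" using that by (intro mult_le_mono) auto
    then have "Rep ((m + 1) * Sm) (Suc m) \<subseteq> Rep (n * Sm) n" using that by (intro Rep_mono) auto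
    then show ?thesis using less.IH[OF that] that less.prems by auto
  qed
  have R: "Rep (n * Sm) n \<subseteq> Rep ((n + 1) * Sm) (Suc n)" by (rule Rep_mono) auto
  consider "K n = 0" | "K n = 1" | "K n = 2" | "K n = 3" | "K n \<ge> 4" using kind_cases[of n] by auto
  then show ?case
  proof cases
    case 1
    show ?thesis
    proof
      fix r assume "r \<in> bitset (v n)"
      then have "r < w0" using bit_less[of "v n" r w0] const[OF less.prems 1] v_simps(1)[OF 1] by simp
      moreover have "w0 \<le> (n + 1) * Sm" using w0_le(1) by simp
      moreover have "r < 2 ^ w" using \<open>r < w0\<close> w0_le by linarith
      moreover have "(2::nat) ^ w \<le> 2 ^ (w + Suc n)" by (rule power_increasing) auto
      ultimately show "r \<in> Rep ((n + 1) * Sm) (Suc n)" unfolding Rep_def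
        by (intro CollectI exI[of _ r]) (auto simp: pv_small)
    qed
  next
    case 2
    then have xy: "X n < n" "Y n < n" using valid[OF less.prems] by auto
    have p: "pop (v (X n)) + pop (v (Y n)) \<le> Sm"
    proof -
      have "n \<ge> 1" using xy by simp
      have h: "w0 * 2 ^ m \<le> w0 * 2 ^ (n - 1)" if "m < n" for m using that by (intro mult_le_mono power_increasing) auto
      have "pop (v (X n)) \<le> w0 * 2 ^ (n - 1)" "pop (v (Y n)) \<le> w0 * 2 ^ (n - 1)"
        using order_trans[OF pop_v h[OF xy(1)]] order_trans[OF pop_v h[OF xy(2)]] xy less.prems by auto
      moreover have "(2::nat) ^ n = 2 ^ (n - 1) + 2 ^ (n - 1)" using xy by (cases n) auto
      ultimately have "pop (v (X n)) + pop (v (Y n)) \<le> w0 * 2 ^ n" by (simp add: algebra_simps)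
      also have "\<dots> \<le> Sm" unfolding Sm_def using less.prems by (intro mult_le_mono power_increasing) auto
      finally show ?thesis .
    qed
    then have le: "n * Sm + (pop (v (X n)) + pop (v (Y n))) \<le> (n + 1) * Sm" by simp
    have "bitset (v n) \<subseteq> Rep (n * Sm + (pop (v (X n)) + pop (v (Y n)))) n"
      unfolding v_simps(3)[OF less.prems 2]
      by (rule Rep_add[OF IH[OF xy(1)] IH[OF xy(2)]]) (use le Sm_bound[OF less.prems] w0_le in linarith)
    also have "\<dots> \<subseteq> Rep ((n + 1) * Sm) (Suc n)" by (rule Rep_mono[OF le]) simp
    finally show ?thesis .
  next
    case 3
    then have xy: "X n < n" "Y n < n" using valid[OF less.prems] by auto
    show ?thesis
    proof
      fix r assume "r \<in> bitset (v n)"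
      then have r: "v (Y n) \<le> r" "bit (v (X n)) (r - v (Y n))" using v_simps(4)[OF less.prems 3] by (auto simp: bit_mult_pow2)
      then obtain u where u: "u < 2 ^ (w + n)" "u mod 2 ^ w \<le> n * Sm" "pv u = r - v (Y n)"
        using IH[OF xy(1)] by (auto simp: Rep_def)
      have "pv (u + 2 ^ (w + n)) = r" using pv_top(1)[OF u(1) less.prems] u(3) r(1) 3 by (simp add: \<beta>_def)
      then show "r \<in> Rep ((n + 1) * Sm) (Suc n)" unfolding Rep_def
        by (intro CollectI exI[of _ "u + 2 ^ (w + n)"]) (use top[OF u(1)] u(2) in simp)
    qed
  next
    case 4
    have "(2::nat) ^ (w + n) = 0 + 2 ^ (w + n)" by simp
    then have "pv (2 ^ (w + n)) = Om n" "(2::nat) ^ (w + n) mod 2 ^ w = 0"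
      using pv_top(1)[of 0 n, OF _ less.prems] pv_small(1)[of 0] 4 top(2)[of 0 n] by (simp_all add: \<beta>_def)
    then show ?thesis unfolding v_simps(2)[OF 4] Rep_def
      by (auto simp: bit_pow2 intro!: exI[of _ "2 ^ (w + n)"])
  next
    case 5
    then have xy: "X n < n" "Y n < n" using valid[OF less.prems] by auto
    have "bitset (v n) \<subseteq> bitset (v (X n)) \<union> bitset (v (Y n))"
      unfolding v_simps(5)[OF less.prems 5] using bop_FF by (auto simp: bit_bitop) (metis (full_types))
    also have "\<dots> \<subseteq> Rep (n * Sm) n" using IH xy by blast
    finally show ?thesis using R by blast
  qed
qed

lemma split_top:
  fixes u :: nat
  assumes "u < 2 ^ (w + Suc L)" "\<not> u < 2 ^ (w + L)"
  obtains u' where "u = u' + 2 ^ (w + L)" "u' < 2 ^ (w + L)"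
  using assms that[of "u - 2 ^ (w + L)"] by auto

text \<open>The key to termination: a shift amount is the value of a strictly earlier node, so the
  number obtained by adding the shift amounts of nodes below \<open>L\<close> has its bits at
  positions of level \<open>L - 1\<close>.\<close>

lemma Rep_pvs:
  assumes "L \<le> N" "u < 2 ^ (w + L)"
  shows "bitset (pvs u) \<subseteq> Rep (Pm + 2 * L * Pm) (L - 1) \<and> pop (pvs u) \<le> w + L * Sm"
  using assms
proof (induction L arbitrary: u)
  case 0
  then have "u < 2 ^ w" by simp
  then have "pvs u < 2 ^ w" by (simp add: pv_small)
  have "bitset (pvs u) \<subseteq> Rep (Pm + 2 * 0 * Pm) (0 - 1)"
  proof
    fix r assume "r \<in> bitset (pvs u)"
    then have "r < w" using bit_less[of "pvs u" r w] \<open>pvs u < 2 ^ w\<close> by simp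
    moreover have "w < 2 ^ w" by (rule less_exp)
    ultimately show "r \<in> Rep (Pm + 2 * 0 * Pm) (0 - 1)" unfolding Rep_def
      using w0_le by (intro CollectI exI[of _ r]) (auto simp: pv_small)
  qed
  then show ?case using pop_less_pow[OF \<open>pvs u < 2 ^ w\<close>] by simp
next
  case (Suc L)
  have R: "Rep (Pm + 2 * L * Pm) (L - 1) \<subseteq> Rep (Pm + 2 * L * Pm) L" by (rule Rep_mono) auto
  have R': "Rep (Pm + 2 * L * Pm) L \<subseteq> Rep (Pm + 2 * Suc L * Pm) (Suc L - 1)" by (rule Rep_mono) auto
  have LS: "L * Sm \<le> Suc L * Sm" by simp
  show ?case
  proof (cases "u < 2 ^ (w + L)")
    case True
    then show ?thesis using Suc.IH[OF _ True] Suc.prems R R' LS by auto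
  next
    case False
    then obtain u' where u: "u = u' + 2 ^ (w + L)" "u' < 2 ^ (w + L)" using split_top Suc.prems by blast
    have LN: "L < N" using Suc.prems by simp
    have IH: "bitset (pvs u') \<subseteq> Rep (Pm + 2 * L * Pm) (L - 1)" "pop (pvs u') \<le> w + L * Sm"
      using Suc.IH[OF _ u(2)] LN by auto
    show ?thesis
    proof (cases "K L = 2")
      case False
      then show ?thesis using pv_top(2)[OF u(2) LN] u(1) IH R R' LS by auto
    next
      case True
      then have p: "pvs u = pvs u' + v (Y L)" using pv_top(2)[OF u(2) LN] u(1) by simp
      have YL: "Y L < L" using valid[OF LN] True by auto
      then have YN: "Y L < N" using LN by simp
      have a: "pop (pvs u') \<le> Pm" using IH(2) LS w0_le mult_le_mono1[of L "N + 1" Sm] LN unfolding Pm_def by linarith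
      have b: "pop (v (Y L)) \<le> Sm" by (rule pop_v_Sm[OF YN])
      then have s: "pop (pvs u') + pop (v (Y L)) \<le> 2 * Pm" using a w0_le by linarith
      have m1: "(Y L + 1) * Sm \<le> Pm" by (rule Sm_bound[OF YN])
      have "Rep ((Y L + 1) * Sm) (Suc (Y L)) \<subseteq> Rep (Pm + 2 * L * Pm) L"
        by (rule Rep_mono) (use YL m1 in auto)
      then have v: "bitset (v (Y L)) \<subseteq> Rep (Pm + 2 * L * Pm) L" using Rep_v[OF YN] by auto
      have "2 * Suc L * Pm \<le> 2 * N * Pm" using LN by (intro mult_le_mono) auto
      moreover have "Pm + 2 * L * Pm + 2 * Pm = Pm + 2 * Suc L * Pm" by (simp add: algebra_simps)
      moreover have "Pm + 2 * N * Pm < 2 ^ w" using big' by (simp add: algebra_simps)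
      ultimately have l: "Pm + 2 * L * Pm + (pop (pvs u') + pop (v (Y L))) \<le> Pm + 2 * Suc L * Pm"
        "Pm + 2 * Suc L * Pm < 2 ^ w" using s by linarith+
      have "bitset (pvs u) \<subseteq> Rep (Pm + 2 * L * Pm + (pop (pvs u') + pop (v (Y L)))) L"
        unfolding p by (rule Rep_add) (use IH(1) R v l in auto)
      also have "\<dots> \<subseteq> Rep (Pm + 2 * Suc L * Pm) (Suc L - 1)" by (rule Rep_mono) (use l in auto)
      finally have "bitset (pvs u) \<subseteq> Rep (Pm + 2 * Suc L * Pm) (Suc L - 1)" .
      moreover have "pop (pvs u) \<le> w + Suc L * Sm" unfolding p using pop_add[of "pvs u'" "v (Y L)"] IH(2) b by simp
      ultimately show ?thesis ..
    qed
  qed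
qed

section \<open>Independence of the exponents of \<open>ALN\<close> values\<close>

lemma hs_mono: "n \<le> m \<Longrightarrow> hs N w z n \<le> hs N w z m" if "N > 0"
proof (induction rule: dec_induct)
  case (step m)
  have "hs N w z m < 2 ^ hs N w z m" by (rule less_exp)
  also have "\<dots> \<le> N * 2 ^ hs N w z m" using that by simp
  finally show ?case using step by simp
qed simp

lemma hs_ge: "N > 0 \<Longrightarrow> z \<le> hs N w z n"
  using hs_mono[of 0 n z] by simp

lemma sum_le_card: "(\<Sum>n<N. if P n then f n else 0) \<le> N * (B::nat)" if "\<And>n. n < N \<Longrightarrow> P n \<Longrightarrow> f n \<le> B"
proof -
  have "(\<Sum>n<N. if P n then f n else 0) \<le> (\<Sum>n<N. B)" by (rule sum_mono) (use that in auto)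
  then show ?thesis by simp
qed

text \<open>A position with a summand of size at least \<open>Om i\<close> lies above
  \<open>Om i\<close>. Otherwise all its summands are small: an \<open>ALN\<close> node with a
  smaller exponent precedes \<open>i\<close>, and a shift amount below \<open>Om i\<close> has only
  bits below \<open>Om i\<close>, hence below the tower by induction. No one is found in the gap in
  between.\<close>

lemma gap_pos: assumes "i < N" "K i = 3" shows "\<exists>z. (\<forall>j<i. K j = 3 \<longrightarrow> Om j \<le> z) \<and> gf N w z < Om i
    \<and> (\<forall>n<N. \<forall>r. bit (v n) r \<longrightarrow> Om i \<le> r \<or> r < hs N w z N)"
proof -
  obtain z where z: "\<forall>j<i. K j = 3 \<longrightarrow> Om j \<le> z" "gf N w z < Om i" using gap assms by blast
  have N0: "N > 0" using assms by simp
  have inc: "Om i < Om m" if im: "i < m" "m < N" "K m = 3" for m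
  proof -
    obtain z' where z': "\<forall>j<m. K j = 3 \<longrightarrow> Om j \<le> z'" "gf N w z' < Om m" using gap[OF im(2,3)] by blast
    have "Om i \<le> z'" using z'(1) im(1) assms(2) by blast
    also have "\<dots> \<le> gf N w z'" using N0 by (simp add: gf_def trans_le_add2)
    finally show ?thesis using z'(2) by simp
  qed
  have D: "\<forall>r. bit (v n) r \<longrightarrow> Om i \<le> r \<or> r < hs N w z (Suc n)" if "n < N" for n
    using that
  proof (induction n rule: less_induct)
    case (less n)
    show ?case
    proof (intro allI impI)
      fix r assume "bit (v n) r"
      then obtain u where u: "u < 2 ^ (w + Suc n)" "pv u = r" using Rep_v[OF less.prems] by (auto simp: Rep_def)
      show "Om i \<le> r \<or> r < hs N w z (Suc n)"
      proof (cases "\<exists>m<N. bit (hi u) m \<and> Om i \<le> \<beta> m")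
        case True
        then obtain m where m: "m < N" "bit (hi u) m" "Om i \<le> \<beta> m" by blast
        have "(if bit (hi u) m then \<beta> m else 0) \<le> (\<Sum>n<N. if bit (hi u) n then \<beta> n else 0)"
          by (rule member_le_sum[of m "{..<N}" "\<lambda>n. if bit (hi u) n then \<beta> n else 0"]) (use m in auto)
        then have "Om i \<le> pv u" using m by (simp add: pv_def trans_le_add2)
        then show ?thesis using u by simp
      next
        case False
        have b: "\<beta> m \<le> 2 ^ hs N w z n" if "m < N" "bit (hi u) m" for m
        proof -
          have lt: "\<beta> m < Om i" using False that by auto
          have mn: "m \<le> n" using bit_less[OF that(2) u(1)[unfolded hi_less]] by simp
          show ?thesis
          proof (cases "K m = 2")
            case True
            then have Ym: "Y m < m" using valid[OF that(1)] by auto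
            have bm: "\<beta> m = v (Y m)" using True by (simp add: \<beta>_def)
            have "v (Y m) < 2 ^ hs N w z n"
            proof (rule less_two_powI)
              fix r' assume r': "bit (v (Y m)) r'"
              have "Om i \<le> r' \<or> r' < hs N w z (Suc (Y m))"
                using less.IH[of "Y m"] Ym mn that(1) r' less.prems by auto
              moreover have "r' < Om i" using bit_imp_le[OF r'] lt less_exp[of r'] unfolding bm by linarith
              moreover have "hs N w z (Suc (Y m)) \<le> hs N w z n" using Ym mn by (intro hs_mono[OF N0]) auto
              ultimately show "r' < hs N w z n" by linarith
            qed
            then show ?thesis unfolding bm by simp
          next
            case F: False
            show ?thesis
            proof (cases "K m = 3")
              case True
              then have bm: "\<beta> m = Om m" by (simp add: \<beta>_def)
              then have "m < i" using inc[of m] that(1) lt True by (metis linorder_neqE_nat less_asym less_irrefl)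
              then have "\<beta> m \<le> z" using z(1) True bm by simp
              also have "\<dots> \<le> hs N w z n" by (rule hs_ge[OF N0])
              also have "\<dots> \<le> 2 ^ hs N w z n" using less_exp less_imp_le by blast
              finally show ?thesis .
            qed (use F in \<open>simp add: \<beta>_def\<close>)
          qed
        qed
        have "u mod 2 ^ w < 2 ^ w" by simp
        then have "pv u < hs N w z (Suc n)"
          using add_less_le_mono[OF _ sum_le_card[of "\<lambda>n. bit (hi u) n" \<beta>, OF b]] unfolding pv_def hs.simps by blast
        then show ?thesis using u by simp
      qed
    qed
  qed
  have "Om i \<le> r \<or> r < hs N w z N" if "n < N" "bit (v n) r" for n r
  proof -
    have "hs N w z (Suc n) \<le> hs N w z N" using that by (intro hs_mono[OF N0]) auto
    then show ?thesis using D that less_le_trans by blast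
  qed
  then show ?thesis using z by blast
qed

definition Ws where "Ws u = (\<Sum>n<N. if bit (hi u) n \<and> K n = 3 then Om n else 0)"

lemma pv_split: "pv u = pvs u + Ws u"
proof -
  have "(\<Sum>n<N. if bit (hi u) n then \<beta> n else 0) =
    (\<Sum>n<N. (if bit (hi u) n \<and> K n = 2 then \<beta> n else 0) + (if bit (hi u) n \<and> K n = 3 then Om n else 0))"
    by (rule sum.cong) (auto simp: \<beta>_def)
  then show ?thesis by (simp add: pv_def pvs_def Ws_def sum.distrib)
qed

text \<open>Here \<open>i\<close> is the largest \<open>ALN\<close> node on which the two sets
  disagree, so larger exponents cancel. Shift amounts may be astronomically large, but modulo
  \<open>2 ^ Om i\<close> they are small because of the gap in their bits. One side is then below
  \<open>Om i\<close>, the other at least \<open>Om i\<close>, and both are too small for the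
  modulus to identify them.\<close>

lemma gap_main:
  assumes i: "i < N" "K i = 3" "bit (hi u') i" "\<not> bit (hi u) i"
    and above: "\<And>n. i < n \<Longrightarrow> n < N \<Longrightarrow> K n = 3 \<Longrightarrow> bit (hi u) n = bit (hi u') n"
    and eq: "pv u = pv u'"
  shows False
proof -
  obtain z where z: "\<forall>j<i. K j = 3 \<longrightarrow> Om j \<le> z" "gf N w z < Om i"
    "\<And>n r. n < N \<Longrightarrow> bit (v n) r \<Longrightarrow> Om i \<le> r \<or> r < hs N w z N"
    using gap_pos[OF i(1,2)] by blast
  define M where "M = (2::nat) ^ Om i"
  define lo where "lo u = (\<Sum>n<N. if bit (hi u) n \<and> K n = 3 \<and> n < i then Om n else 0)" for u
  define up where "up u = (\<Sum>n<N. if bit (hi u) n \<and> K n = 3 \<and> i < n then Om n else 0)" for u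
  define mi where "mi u = (\<Sum>n<N. if n = i then if bit (hi u) n \<and> K n = 3 then Om n else 0 else 0)" for u
  have W: "Ws u = lo u + mi u + up u" for u
    unfolding Ws_def lo_def up_def mi_def sum.distrib[symmetric] by (rule sum.cong) auto
  have mi: "mi u = 0" "mi u' = Om i" using i by (simp_all add: mi_def)
  have up: "up u = up u'" unfolding up_def by (rule sum.cong) (use above in auto)
  have lo: "lo u \<le> N * z" for u unfolding lo_def by (rule sum_le_card) (use z(1) in auto)
  define c where "c u = u mod 2 ^ w + (\<Sum>n<N. if bit (hi u) n \<and> K n = 2 then v (Y n) mod M else 0)" for u
  define d where "d u = (\<Sum>n<N. if bit (hi u) n \<and> K n = 2 then v (Y n) div M else 0)" for u
  have pvs: "pvs u = c u + M * d u" for u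
  proof -
    have "(\<Sum>n<N. if bit (hi u) n \<and> K n = 2 then \<beta> n else 0) = (\<Sum>n<N. (if bit (hi u) n \<and> K n = 2 then v (Y n) mod M else 0) +
      M * (if bit (hi u) n \<and> K n = 2 then v (Y n) div M else 0))"
      by (rule sum.cong) (auto simp: \<beta>_def)
    then show ?thesis by (simp add: pvs_def c_def d_def sum.distrib sum_distrib_left)
  qed
  have vm: "v (Y n) mod M \<le> 2 ^ hs N w z N" if "n < N" "K n = 2" for n
  proof -
    have Yn: "Y n < N" using valid[OF that(1)] that by auto
    have "take_bit (Om i) (v (Y n)) < 2 ^ hs N w z N"
      by (rule less_two_powI) (auto simp: bit_take_bit_iff dest!: z(3)[OF Yn])
    then show ?thesis unfolding M_def by (simp add: take_bit_eq_mod)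
  qed
  have c: "c u < 2 ^ w + N * 2 ^ hs N w z N" for u
  proof -
    have "u mod 2 ^ w < 2 ^ w" by simp
    then show ?thesis unfolding c_def
      using sum_le_card[of "\<lambda>n. bit (hi u) n \<and> K n = 2" "\<lambda>n. v (Y n) mod M" "2 ^ hs N w z N"] vm by (simp add: add_less_le_mono)
  qed
  have small: "c u + lo u < Om i" for u using c[of u] lo[of u] z(2) unfolding gf_def by linarith
  have "c u + lo u + M * d u = c u' + lo u' + Om i + M * d u'"
    using eq unfolding pv_split W mi up pvs by simp
  then have "(c u + lo u) mod M = (c u' + lo u' + Om i) mod M"
    by (metis mod_mult_self2)
  moreover have "2 * Om i \<le> M"
  proof -
    have "Om i > 0" using z(2) by simp
    then obtain k where k: "Om i = Suc k" by (cases "Om i") auto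
    have "Suc k \<le> 2 ^ k" by (rule Suc_leI[OF less_exp])
    then show ?thesis unfolding M_def k by simp
  qed
  ultimately show False using small[of u] small[of u'] by simp
qed

text \<open>Formal independence: the \<open>ALN\<close> parts are compared as sets, and what is left
  is an equality of numbers whose bits live on a lower level.\<close>

lemma pv_eq_iff: "pv u = pv u' \<longleftrightarrow> (\<forall>n<N. K n = 3 \<longrightarrow> bit (hi u) n = bit (hi u') n) \<and> pvs u = pvs u'"
proof
  assume eq: "pv u = pv u'"
  have "\<forall>n<N. K n = 3 \<longrightarrow> bit (hi u) n = bit (hi u') n"
  proof (rule ccontr)
    assume "\<not> ?thesis"
    define D where "D = {n. n < N \<and> K n = 3 \<and> bit (hi u) n \<noteq> bit (hi u') n}"
    have D: "finite D" "D \<noteq> {}" using \<open>\<not> _\<close> by (auto simp: D_def)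
    define i where "i = Max D"
    have i: "i \<in> D" using D by (simp add: i_def)
    have above: "bit (hi u) n = bit (hi u') n" if "i < n" "n < N" "K n = 3" for n
      using Max_ge[OF D(1), of n] that unfolding i_def[symmetric] by (auto simp: D_def)
    show False
    proof (cases "bit (hi u) i")
      case True
      then show ?thesis using gap_main[of i u u'] i above eq by (auto simp: D_def)
    next
      case False
      then show ?thesis using gap_main[of i u' u] i above eq by (auto simp: D_def)
    qed
  qed
  moreover from this have "Ws u = Ws u'" unfolding Ws_def by (intro sum.cong) auto
  ultimately show "(\<forall>n<N. K n = 3 \<longrightarrow> bit (hi u) n = bit (hi u') n) \<and> pvs u = pvs u'"
    using eq by (simp add: pv_split)
next
  assume a: "(\<forall>n<N. K n = 3 \<longrightarrow> bit (hi u) n = bit (hi u') n) \<and> pvs u = pvs u'"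
  then have "Ws u = Ws u'" unfolding Ws_def by (intro sum.cong) auto
  then show "pv u = pv u'" using a by (simp add: pv_split)
qed

end

section \<open>Deciding equality of nodes by a game\<close>

text \<open>States are \<open>(type, level, o1, o2, p, q, m)\<close>; an object \<open>o\<close> is the node \<open>n\<close> if \<open>o = 2 * n + 1\<close> and the
  symbolic position \<open>u\<close> if \<open>o = 2 * u\<close>. Types: 0 the objects differ; 1 bit \<open>p\<close> of \<open>o1\<close> is set; 2 a guess of the
  bits (and possibly the carry) at \<open>p\<close> is wrong; 3 a guess for a shifted bit is wrong; 4 there is a carry into \<open>p\<close>;
  5 a guessed carry chain is wrong; 6 false. Each type is an existential statement about signed children.\<close>

definition stt :: "nat \<Rightarrow> nat \<Rightarrow> nat \<Rightarrow> nat \<Rightarrow> nat \<Rightarrow> nat \<Rightarrow> nat \<Rightarrow> nat" where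
  "stt ty L o1 o2 p q m = pe ty (pe L (pe o1 (pe o2 (pe p (pe q m)))))"

definition "t0 x = pf x"
definition "t1 x = pf (psn x)"
definition "t2 x = pf (psn (psn x))"
definition "t3 x = pf (psn (psn (psn x)))"
definition "t4 x = pf (psn (psn (psn (psn x))))"
definition "t5 x = pf (psn (psn (psn (psn (psn x)))))"
definition "t6 x = psn (psn (psn (psn (psn (psn x)))))"

lemmas t_defs = t0_def t1_def t2_def t3_def t4_def t5_def t6_def

lemma t_stt [simp]:
  "t0 (stt ty L o1 o2 p q m) = ty" "t1 (stt ty L o1 o2 p q m) = L" "t2 (stt ty L o1 o2 p q m) = o1"
  "t3 (stt ty L o1 o2 p q m) = o2" "t4 (stt ty L o1 o2 p q m) = p" "t5 (stt ty L o1 o2 p q m) = q"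
  "t6 (stt ty L o1 o2 p q m) = m"
  by (simp_all add: t_defs stt_def)

lemma stt_t: "stt (t0 x) (t1 x) (t2 x) (t3 x) (t4 x) (t5 x) (t6 x) = x"
  by (simp add: t_defs stt_def)

definition neq0 :: "(nat \<Rightarrow> nat) \<Rightarrow> nat \<Rightarrow> nat \<Rightarrow> nat \<Rightarrow> bool" where
  "neq0 K N w x \<longleftrightarrow> t2 x mod 2 = 0 \<and> t3 x mod 2 = 0 \<and> (\<exists>n<N. K n = 3 \<and> bit (t2 x div 2) (w + n) \<noteq> bit (t3 x div 2) (w + n))"

text \<open>A move for a bit of a sum guesses the two bits of the summands in \<open>pf y\<close>,
  as the first plus twice the second, and the incoming carry in \<open>psn y\<close>. It is legal if
  these make the bit of the sum one.\<close>

definition add_ok :: "nat \<Rightarrow> bool" where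
  "add_ok y \<longleftrightarrow> pf y < 4 \<and> psn y < 2 \<and> ((pf y mod 2 = 1) = (2 \<le> pf y)) = (psn y = 1)"

text \<open>In types 0, 1 and 4 the mover offers a witness, in types 2, 3 and 5 the mover selects
  the part of a guess to be refuted. The argument \<open>PN\<close> only serves as the cap for
  \<open>cpow\<close>.\<close>

definition lgl :: "(nat \<Rightarrow> nat) \<Rightarrow> (nat \<Rightarrow> nat) \<Rightarrow> nat \<Rightarrow> nat \<Rightarrow> nat \<Rightarrow> nat \<Rightarrow> nat \<Rightarrow> bool" where
  "lgl K X N w PN x y =
   (if t0 x = 0 then (if t1 x = 0 then t2 x \<noteq> t3 x else neq0 K N w x \<or> (pf y < cpow PN (w + t1 x - 1) \<and> psn y < 2))
    else if t0 x = 1 then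
      (if t2 x mod 2 = 1 then
         (if K (t2 x div 2) = 0 then pf y < w \<and> bit (X (t2 x div 2)) (pf y)
          else if K (t2 x div 2) = 3 then True
          else if K (t2 x div 2) = 2 then pf y < cpow PN (w + t2 x div 2)
          else if K (t2 x div 2) = 1 then add_ok y
          else pf y < 4 \<and> bop (K (t2 x div 2) - 4) (pf y mod 2 = 1) (2 \<le> pf y))
       else if t2 x div 2 < cpow PN w then pf y < w \<and> bit (t2 x div 2) (pf y)
       else if K (bitlen (t2 x div 2) - Suc w) = 2 then add_ok y
       else True)
    else if t0 x = 2 then pf y < 2 \<or> (pf y = 2 \<and> t6 x < 2)
    else if t0 x = 3 then pf y < 2
    else if t0 x = 4 then pf y < cpow PN (w + t1 x) \<and> 1 \<le> psn y \<and> pf y mod cpow PN w + psn y < cpow PN w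
    else if t0 x = 5 then pf y \<le> t6 x
    else False)"

text \<open>In type 2 the component \<open>q\<close> holds the two guessed bits, coded as in
  \<open>add_ok\<close>, and \<open>m\<close> the guessed carry, with \<open>m = 2\<close> if no
  carry is claimed. In type 1 an even object is taken apart by removing the top node from its
  set.\<close>

definition nxt :: "(nat \<Rightarrow> nat) \<Rightarrow> (nat \<Rightarrow> nat) \<Rightarrow> (nat \<Rightarrow> nat) \<Rightarrow> nat \<Rightarrow> nat \<Rightarrow> nat \<Rightarrow> nat \<Rightarrow> nat \<Rightarrow> nat" where
  "nxt K X Y N w PN x y =
   (if t0 x = 0 then
      (if t1 x = 0 \<or> neq0 K N w x then stt 6 0 0 0 0 0 0
       else stt 2 (t1 x - 1) (t2 x) (t3 x) (pf y) (if psn y = 1 then 1 else 2) 2)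
    else if t0 x = 1 then
      (if t2 x mod 2 = 1 then
         (if K (t2 x div 2) = 0 then stt 0 (t1 x) (2 * t4 x) (2 * pf y) 0 0 0
          else if K (t2 x div 2) = 3 then stt 0 (t1 x) (2 * t4 x) (2 * cpow PN (w + t2 x div 2)) 0 0 0
          else if K (t2 x div 2) = 2 then stt 3 (t1 x) (2 * X (t2 x div 2) + 1) 0 (t4 x) (pf y) (t2 x div 2)
          else if K (t2 x div 2) = 1 then stt 2 (t1 x) (2 * X (t2 x div 2) + 1) (2 * Y (t2 x div 2) + 1) (t4 x) (pf y) (psn y)
          else stt 2 (t1 x) (2 * X (t2 x div 2) + 1) (2 * Y (t2 x div 2) + 1) (t4 x) (pf y) 2)
       else if t2 x div 2 < cpow PN w then stt 0 (t1 x) (2 * t4 x) (2 * pf y) 0 0 0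
       else if K (bitlen (t2 x div 2) - Suc w) = 2 then
         stt 2 (t1 x) (2 * (t2 x div 2 - cpow PN (bitlen (t2 x div 2) - 1))) (2 * Y (bitlen (t2 x div 2) - Suc w) + 1) (t4 x) (pf y) (psn y)
       else stt 1 (t1 x) (2 * (t2 x div 2 - cpow PN (bitlen (t2 x div 2) - 1))) 0 (t4 x) 0 0)
    else if t0 x = 2 then
      (if pf y = 0 then stt 1 (t1 x) (t2 x) 0 (t4 x) 0 0
       else if pf y = 1 then stt 1 (t1 x) (t3 x) 0 (t4 x) 0 0
       else stt 4 (t1 x) (t2 x) (t3 x) (t4 x) 0 0)
    else if t0 x = 3 then
      (if pf y = 0 then stt 0 (t1 x) (2 * t4 x) (2 * (t5 x + cpow PN (w + t6 x))) 0 0 0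
       else stt 1 (t1 x) (t2 x) 0 (t5 x) 0 0)
    else if t0 x = 4 then stt 5 (t1 x) (t2 x) (t3 x) (t4 x) (pf y) (psn y)
    else
      (if pf y = 0 then stt 2 (t1 x) (t2 x) (t3 x) (t5 x) 3 2
       else if pf y < t6 x then stt 2 (t1 x) (t2 x) (t3 x) (t5 x + pf y) 0 2
       else stt 0 (t1 x) (2 * t4 x) (2 * (t5 x + t6 x)) 0 0 0))"

text \<open>The default False negates: a guess leads to a state asserting that the guess is wrong,
  and a claimed equality of positions to one asserting that they differ. In type 1 the sign is True
  only when a node that is no shift is dropped from an even object, which leaves \<open>pvs\<close>
  unchanged.\<close>

definition sg :: "(nat \<Rightarrow> nat) \<Rightarrow> nat \<Rightarrow> nat \<Rightarrow> nat \<Rightarrow> nat \<Rightarrow> bool" where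
  "sg K w PN x y =
   (if t0 x = 1 then t2 x mod 2 = 0 \<and> \<not> t2 x div 2 < cpow PN w \<and> K (bitlen (t2 x div 2) - Suc w) \<noteq> 2
    else if t0 x = 2 then (if pf y = 0 then \<not> t5 x mod 2 = 1 else if pf y = 1 then \<not> 2 \<le> t5 x else t6 x \<noteq> 1)
    else if t0 x = 3 then pf y = 0
    else if t0 x = 5 then pf y = 0 \<or> \<not> pf y < t6 x
    else False)"

section \<open>Well-formed states, their meaning and their rank\<close>

context slp begin

definition "PN = (2::nat) ^ (w + N)"

lemma cpow_PN: "j \<le> w + N \<Longrightarrow> cpow PN j = 2 ^ j"
  unfolding cpow_def PN_def by (simp add: power_increasing)

definition wfo :: "nat \<Rightarrow> nat \<Rightarrow> bool" where
  "wfo L x \<longleftrightarrow> (if x mod 2 = 1 then x div 2 < L else x div 2 < 2 ^ (w + Suc L))"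

text \<open>Outside type 0 an even object stands for the number \<open>pvs u\<close> and not for the
  position \<open>pv u\<close>: once the \<open>ALN\<close> parts agree, comparing positions means
  comparing these numbers bit by bit.\<close>

definition ov :: "nat \<Rightarrow> nat" where
  "ov x = (if x mod 2 = 1 then v (x div 2) else pvs (x div 2))"

definition ro :: "nat \<Rightarrow> nat" where
  "ro x = (if x mod 2 = 1 then x div 2 else N + bitlen (hi (x div 2)))"

text \<open>In type 0 the level bounds both compared objects; in types 1 to 5 it bounds the examined
  position \<open>p\<close>, while even objects may be one level higher. Passing from type 0 to type
  2 lowers the level, which \<open>Rep_v\<close> and \<open>Rep_pvs\<close> justify.\<close>

definition wfs :: "nat \<Rightarrow> bool" where
  "wfs x \<longleftrightarrow> 
    (if t0 x = 0 then t1 x \<le> N \<and> ((t2 x mod 2 = 0 \<and> t3 x mod 2 = 0 \<and> t2 x div 2 < 2 ^ (w + t1 x) \<and> t3 x div 2 < 2 ^ (w + t1 x)) \<or>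
        (t2 x mod 2 = 1 \<and> t3 x mod 2 = 1 \<and> Suc (t2 x div 2) < t1 x \<and> Suc (t3 x div 2) < t1 x)) \<and> t4 x = 0 \<and> t5 x = 0 \<and> t6 x = 0
     else if t0 x = 1 then t1 x < N \<and> wfo (t1 x) (t2 x) \<and> t4 x < 2 ^ (w + t1 x) \<and> t3 x = 0 \<and> t5 x = 0 \<and> t6 x = 0
     else if t0 x = 2 then t1 x < N \<and> wfo (t1 x) (t2 x) \<and> wfo (t1 x) (t3 x) \<and> t4 x < 2 ^ (w + t1 x) \<and> t5 x < 4 \<and> t6 x \<le> 2
     else if t0 x = 3 then t1 x < N \<and> t2 x mod 2 = 1 \<and> t2 x div 2 < t6 x \<and> t6 x < t1 x \<and> t4 x < 2 ^ (w + t1 x) \<and> t5 x < 2 ^ (w + t6 x) \<and> t3 x = 0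
     else if t0 x = 4 then t1 x < N \<and> wfo (t1 x) (t2 x) \<and> wfo (t1 x) (t3 x) \<and> t4 x < 2 ^ (w + t1 x) \<and> t5 x = 0 \<and> t6 x = 0
     else if t0 x = 5 then t1 x < N \<and> wfo (t1 x) (t2 x) \<and> wfo (t1 x) (t3 x) \<and> t4 x < 2 ^ (w + t1 x) \<and> t5 x < 2 ^ (w + t1 x) \<and>
        1 \<le> t6 x \<and> t5 x mod 2 ^ w + t6 x < 2 ^ w
     else t0 x = 6 \<and> t1 x = 0 \<and> t2 x = 0 \<and> t3 x = 0 \<and> t4 x = 0 \<and> t5 x = 0 \<and> t6 x = 0)"

definition sem :: "nat \<Rightarrow> bool" where
  "sem x \<longleftrightarrow>
    (if t0 x = 0 then (if t2 x mod 2 = 0 then pv (t2 x div 2) \<noteq> pv (t3 x div 2) else v (t2 x div 2) \<noteq> v (t3 x div 2))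
     else if t0 x = 1 then bit (ov (t2 x)) (pv (t4 x))
     else if t0 x = 2 then \<not> (bit (ov (t2 x)) (pv (t4 x)) = (t5 x mod 2 = 1) \<and> bit (ov (t3 x)) (pv (t4 x)) = (2 \<le> t5 x) \<and>
        (t6 x < 2 \<longrightarrow> cyc (ov (t2 x)) (ov (t3 x)) (pv (t4 x)) = (t6 x = 1)))
     else if t0 x = 3 then \<not> (pv (t4 x) = pv (t5 x + 2 ^ (w + t6 x)) \<and> bit (ov (t2 x)) (pv (t5 x)))
     else if t0 x = 4 then cyc (ov (t2 x)) (ov (t3 x)) (pv (t4 x))
     else if t0 x = 5 then \<not> (pv (t4 x) = pv (t5 x + t6 x) \<and> bit (ov (t2 x)) (pv (t5 x)) \<and> bit (ov (t3 x)) (pv (t5 x)) \<and>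
        (\<forall>i. 0 < i \<and> i < t6 x \<longrightarrow> bit (ov (t2 x)) (pv (t5 x + i)) \<or> bit (ov (t3 x)) (pv (t5 x + i))))
     else False)"

text \<open>For fixed objects the types run through 2 (with carry), 4, 5, 2 (without carry), 1, with
  summands 7, 5, 4, 3, 2. Taking an object apart lowers its rank, and
  \<open>6 * (r - 1) + 7 < 6 * r + 2\<close>. Object ranks are at most \<open>2 * N\<close>, so
  everything inside one level stays below \<open>12 * N + 10\<close>.\<close>

definition rank :: "nat \<Rightarrow> nat" where
  "rank x = (if t0 x = 6 then 0 else t1 x * (12 * N + 10) +
    (if t0 x = 0 then 1 else if t0 x = 1 then 6 * ro (t2 x) + 2
     else if t0 x = 2 then 6 * max (ro (t2 x)) (ro (t3 x)) + (if t6 x = 2 then 3 else 7)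
     else if t0 x = 3 then 6 * ro (t2 x) + 3
     else if t0 x = 4 then 6 * max (ro (t2 x)) (ro (t3 x)) + 5
     else 6 * max (ro (t2 x)) (ro (t3 x)) + 4))"

lemma bitlen_hi_le: "u < 2 ^ (w + L) \<Longrightarrow> bitlen (hi u) \<le> L"
  by (simp add: bitlen_le_iff hi_less)

lemma ro_le: "wfo L x \<Longrightarrow> L < N \<Longrightarrow> ro x \<le> 2 * N"
  using bitlen_hi_le[of "x div 2" "Suc L"] by (auto simp: wfo_def ro_def split: if_splits)

lemma top_node:
  assumes "u < 2 ^ (w + Suc L)" "\<not> u < 2 ^ w"
  defines "n \<equiv> bitlen u - Suc w"
  shows "n \<le> L" "bitlen u - 1 = w + n" "2 ^ (w + n) \<le> u" "u < 2 ^ (w + Suc n)" "u - 2 ^ (w + n) < 2 ^ (w + n)"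
    "bitlen (hi (u - 2 ^ (w + n))) < bitlen (hi u)"
proof -
  have b1: "bitlen u \<le> w + Suc L" "\<not> bitlen u \<le> w" using assms(1,2) by (simp_all add: bitlen_le_iff)
  then show n: "n \<le> L" "bitlen u - 1 = w + n" by (auto simp: n_def)
  have b: "bitlen u = w + Suc n" using b1 by (simp add: n_def)
  show l: "2 ^ (w + n) \<le> u" using bitlen_le_iff[of u "w + n"] b by (simp add: not_less)
  show g: "u < 2 ^ (w + Suc n)" using bitlen_le_iff[of u "w + Suc n"] b by simp
  then show s: "u - 2 ^ (w + n) < 2 ^ (w + n)" using l by simp
  have "bitlen (hi (u - 2 ^ (w + n))) \<le> n" by (rule bitlen_hi_le[OF s])
  moreover have "\<not> hi u < 2 ^ n" using l hi_less[of u n] by simp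
  then have "n < bitlen (hi u)" using bitlen_le_iff[of "hi u" n] by simp
  ultimately show "bitlen (hi (u - 2 ^ (w + n))) < bitlen (hi u)" by simp
qed

lemma two_pow_w_le: "(2::nat) ^ w \<le> 2 ^ (w + L)" "i \<le> j \<Longrightarrow> (2::nat) ^ (w + i) \<le> 2 ^ (w + j)"
  by (rule power_increasing; simp)+

lemma small_less: "y < w \<Longrightarrow> y < 2 ^ (w + L)"
  using less_exp[of w] two_pow_w_le(1)[of L] by linarith

lemma obj_simps [simp]: "(2 * x) mod 2 = (0::nat)" "(2 * x + 1) mod 2 = (1::nat)" "(2 * x) div 2 = x" "(2 * x + 1) div 2 = (x::nat)"
  by auto

lemma nxt_ok:
  assumes "wfs x" "lgl K X N w PN x y"
  shows "wfs (nxt K X Y N w PN x y) \<and> rank (nxt K X Y N w PN x y) < rank x"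
proof -
  define L where "L = t1 x"
  consider "t0 x = 0" | "t0 x = 1" | "t0 x = 2" | "t0 x = 3" | "t0 x = 4" | "t0 x = 5"
    using assms by (auto simp: wfs_def lgl_def split: if_splits)
  then show ?thesis
  proof cases
    case 1
    show ?thesis
    proof (cases "L = 0 \<or> neq0 K N w x")
      case True
      then show ?thesis using 1 by (simp add: nxt_def wfs_def rank_def L_def)
    next
      case False
      then obtain L' where L': "t1 x = Suc L'" by (cases "t1 x") (auto simp: L_def)
      have wf: "Suc L' \<le> N" "wfo L' (t2 x)" "wfo L' (t3 x)" using assms(1) 1 L' by (auto simp: wfs_def wfo_def)
      have y: "pf y < 2 ^ (w + L')" using assms(2) 1 False L' wf(1) by (simp add: lgl_def L_def cpow_PN)
      have "ro (t2 x) \<le> 2 * N" "ro (t3 x) \<le> 2 * N" using ro_le[of L'] wf by auto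
      then show ?thesis using 1 False L' wf y by (simp add: nxt_def wfs_def rank_def L_def)
    qed
  next
    case 2
    have wf: "L < N" "wfo L (t2 x)" "t4 x < 2 ^ (w + L)" using assms(1) 2 by (auto simp: wfs_def L_def)
    define n where "n = t2 x div 2"
    show ?thesis
    proof (cases "t2 x mod 2 = 1")
      case True
      then have n: "n < L" "n < N" using wf by (auto simp: wfo_def n_def)
      have ro: "ro (t2 x) = n" using True by (simp add: ro_def n_def)
      consider "K n = 0" | "K n = 1" | "K n = 2" | "K n = 3" | "K n \<ge> 4" using kind_cases[of n] by auto
      then show ?thesis
      proof cases
        case a: 1
        then have "pf y < 2 ^ (w + L)" using assms(2) 2 True by (intro small_less) (simp add: lgl_def n_def)
        then show ?thesis using 2 True a wf by (simp add: nxt_def wfs_def rank_def L_def n_def)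
      next
        case a: 2
        then have xy: "X n < n" "Y n < n" using valid[OF n(2)] by auto
        then show ?thesis using assms(2) 2 True a wf n ro
          by (simp add: nxt_def wfs_def rank_def L_def n_def[symmetric] lgl_def add_ok_def wfo_def ro_def)
      next
        case a: 3
        then have xy: "X n < n" "Y n < n" using valid[OF n(2)] by auto
        then show ?thesis using assms(2) 2 True a wf n ro
          by (simp add: nxt_def wfs_def rank_def L_def n_def[symmetric] lgl_def wfo_def ro_def cpow_PN)
      next
        case a: 4
        have "(2::nat) ^ (w + n) < 2 ^ (w + L)" using n by simp
        then show ?thesis using 2 True a wf n by (simp add: nxt_def wfs_def rank_def L_def n_def[symmetric] cpow_PN)
      next
        case a: 5
        then have xy: "X n < n" "Y n < n" using valid[OF n(2)] by auto
        then show ?thesis using assms(2) 2 True a wf n ro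
          by (simp add: nxt_def wfs_def rank_def L_def n_def[symmetric] lgl_def wfo_def ro_def)
      qed
    next
      case False
      then have ev: "t2 x mod 2 = 0" by simp
      have u: "n < 2 ^ (w + Suc L)" using wf(2) ev by (simp add: wfo_def n_def)
      show ?thesis
      proof (cases "n < 2 ^ w")
        case True
        then have "pf y < 2 ^ (w + L)" using assms(2) 2 ev by (intro small_less) (simp add: lgl_def n_def cpow_PN)
        then show ?thesis using 2 True ev wf by (simp add: nxt_def wfs_def rank_def L_def n_def cpow_PN)
      next
        case False
        note tn = top_node[OF u False]
        define m where "m = bitlen n - Suc w"
        note tn = tn[folded m_def]
        have c: "cpow PN (bitlen n - 1) = 2 ^ (w + m)" using tn wf by (simp add: cpow_PN)
        have u': "n - 2 ^ (w + m) < 2 ^ (w + Suc L)" using u by simp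
        show ?thesis
        proof (cases "K m = 2")
          case True
          then have ym: "Y m < m" using valid[of m] tn(1) wf by auto
          have "Y m < N + bitlen (hi n)" using ym tn(1) wf by simp
          then show ?thesis using assms(2) 2 ev False tn c u' wf ym True unfolding n_def[symmetric] m_def[symmetric]
            by (simp add: nxt_def wfs_def rank_def L_def n_def[symmetric] m_def[symmetric] lgl_def wfo_def ro_def add_ok_def cpow_PN)
        next
          case F: False
          show ?thesis using 2 ev False F tn c u' wf
            by (simp add: nxt_def wfs_def rank_def L_def n_def[symmetric] m_def[symmetric] wfo_def ro_def cpow_PN)
        qed
      qed
    qed
  next
    case 3
    then show ?thesis using assms by (auto simp: nxt_def wfs_def rank_def lgl_def less_Suc_eq numeral_2_eq_2)
  next
    case 4
    then have wf: "t1 x < N" "t6 x < t1 x" "t5 x < 2 ^ (w + t6 x)" using assms(1) by (auto simp: wfs_def)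
    have "t5 x + 2 ^ (w + t6 x) < 2 ^ (w + Suc (t6 x))" using wf by simp
    also have "\<dots> \<le> 2 ^ (w + t1 x)" by (rule two_pow_w_le) (use wf in simp)
    finally have a: "t5 x + 2 ^ (w + t6 x) < 2 ^ (w + t1 x)" .
    have "(2::nat) ^ (w + t6 x) \<le> 2 ^ (w + t1 x)" by (rule two_pow_w_le) (use wf in simp)
    then have b: "t5 x < 2 ^ (w + t1 x)" using wf(3) by linarith
    show ?thesis using assms 4 a b wf by (simp add: nxt_def wfs_def rank_def lgl_def wfo_def cpow_PN)
  next
    case 5
    then show ?thesis using assms by (simp add: nxt_def wfs_def rank_def lgl_def cpow_PN)
  next
    case 6
    then have wf: "t1 x < N" "t5 x < 2 ^ (w + t1 x)" "t5 x mod 2 ^ w + t6 x < 2 ^ w" using assms(1) by (auto simp: wfs_def)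
    have "t5 x + i < 2 ^ (w + t1 x)" if "i \<le> t6 x" for i
      by (rule pv_add(3)) (use wf that in auto)
    then show ?thesis using assms 6 by (simp add: nxt_def wfs_def rank_def lgl_def)
  qed
qed

text \<open>Exceeds every component of a well-formed state: levels, offsets, objects with their
  parity bit, and the small constants below 8.\<close>

definition "FF = (2::nat) ^ (w + N + 3)"

lemma wfs_cases:
  assumes "wfs x"
  obtains "t0 x = 0" | "t0 x = 1" | "t0 x = 2" | "t0 x = 3" | "t0 x = 4" | "t0 x = 5" | "t0 x = 6"
proof -
  have "t0 x \<le> 6" by (rule ccontr) (use assms in \<open>simp add: wfs_def\<close>)
  then have "t0 x = 0 \<or> t0 x = 1 \<or> t0 x = 2 \<or> t0 x = 3 \<or> t0 x = 4 \<or> t0 x = 5 \<or> t0 x = 6" by arith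
  then show ?thesis using that by (elim disjE)
qed

lemma obj_rep:
  assumes "wfo L x" "L < N"
  shows "bitset (ov x) \<subseteq> Rep (Pm + 2 * N * Pm) L" "pop (ov x) \<le> Pm"
proof -
  have "bitset (ov x) \<subseteq> Rep (Pm + 2 * N * Pm) L \<and> pop (ov x) \<le> Pm"
  proof (cases "x mod 2 = 1")
    case True
    then have n: "x div 2 < L" "x div 2 < N" using assms by (auto simp: wfo_def)
    have "(x div 2 + 1) * Sm \<le> Pm + 2 * N * Pm" using Sm_bound[OF n(2)] by (rule trans_le_add1)
    then have "Rep ((x div 2 + 1) * Sm) (Suc (x div 2)) \<subseteq> Rep (Pm + 2 * N * Pm) L" using n by (intro Rep_mono) auto
    then show ?thesis using Rep_v[OF n(2)] pop_v_Sm[OF n(2)] w0_le True by (auto simp: ov_def)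
  next
    case False
    then have u: "x div 2 < 2 ^ (w + Suc L)" using assms by (auto simp: wfo_def)
    have "Pm + 2 * Suc L * Pm \<le> Pm + 2 * N * Pm" using assms by (intro add_mono mult_le_mono) auto
    then have "Rep (Pm + 2 * Suc L * Pm) (Suc L - 1) \<subseteq> Rep (Pm + 2 * N * Pm) L" by (intro Rep_mono) auto
    moreover have "Suc L * Sm \<le> (N + 1) * Sm" using assms by (intro mult_le_mono) auto
    then have "w + Suc L * Sm \<le> Pm" by (simp add: Pm_def)
    ultimately show ?thesis using Rep_pvs[of "Suc L" "x div 2"] u assms False by (auto simp: ov_def)
  qed
  then show "bitset (ov x) \<subseteq> Rep (Pm + 2 * N * Pm) L" "pop (ov x) \<le> Pm" by auto
qed

lemma FF_less: "L \<le> N \<Longrightarrow> a < 2 ^ (w + L) \<Longrightarrow> a < FF" "a < w \<Longrightarrow> a < FF" "a < 2 ^ w \<Longrightarrow> a < FF" "a < 8 \<Longrightarrow> a < FF"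
proof -
  have m: "(2::nat) ^ k \<le> FF" if "k \<le> w + N + 3" for k unfolding FF_def by (rule power_increasing) (use that in auto)
  show "L \<le> N \<Longrightarrow> a < 2 ^ (w + L) \<Longrightarrow> a < FF" using m[of "w + L"] by simp
  show w: "a < 2 ^ w \<Longrightarrow> a < FF" using m[of w] by simp
  show "a < w \<Longrightarrow> a < FF" using w less_trans[OF _ less_exp[of w]] by blast
  show "a < 8 \<Longrightarrow> a < FF" using m[of 3] by simp
qed

lemma guess_bits:
  fixes P Q :: bool
  obtains a :: nat where "a < 4" "(a mod 2 = 1) = P" "(2 \<le> a) = Q"
  by (rule that[of "of_bool P + 2 * of_bool Q"]) (cases P; cases Q; simp)+

lemma guess_add:
  "(\<exists>a b. add_ok (pe a b) \<and> P = (a mod 2 = 1) \<and> Q = (2 \<le> a) \<and> C = (b = 1)) \<longleftrightarrow> ((P \<noteq> Q) \<noteq> C)" for P Q C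
proof
  assume r: "(P \<noteq> Q) \<noteq> C"
  obtain a :: nat where a: "a < 4" "(a mod 2 = 1) = P" "(2 \<le> a) = Q" by (rule guess_bits)
  show "\<exists>a b. add_ok (pe a b) \<and> P = (a mod 2 = 1) \<and> Q = (2 \<le> a) \<and> C = (b = 1)"
    by (rule exI[of _ a], rule exI[of _ "of_bool C"]) (use a r in \<open>auto simp: add_ok_def\<close>)
qed (auto simp: add_ok_def)

lemma ex_two: "(\<exists>a (b::nat). a = i \<and> P \<or> a = j \<and> R) \<longleftrightarrow> P \<or> R"
  by blast

lemma ex_three: "(\<exists>a (b::nat). a = i \<and> P \<or> a = j \<and> R \<or> a = k \<and> T \<and> U) \<longleftrightarrow> P \<or> R \<or> T \<and> U"
  by blast

lemma ex_range: "(\<exists>a (b::nat). a = i \<and> P \<or> 0 < a \<and> a < m \<and> R a \<and> T a \<or> a = m \<and> U)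
    \<longleftrightarrow> P \<or> (\<exists>a. 0 < a \<and> a < m \<and> R a \<and> T a) \<or> U" for m :: nat
  by blast

text \<open>Soundness of a guess is local. Completeness is where the symbolic positions are needed:
  a differing bit, a shifted bit or the start of a carry chain has a name within the range of the
  legal moves by \<open>Rep_v\<close>, \<open>Rep_pvs\<close> and \<open>obj_rep\<close>.\<close>

lemma sem_step:
  assumes wf: "wfs x" and B: "\<And>a b. a < FF \<Longrightarrow> b < FF \<Longrightarrow> pe a b < B"
  shows "sem x \<longleftrightarrow> (\<exists>y<B. lgl K X N w PN x y \<and> (sem (nxt K X Y N w PN x y) = sg K w PN x y))"
proof -
  define Q where "Q a b \<longleftrightarrow> lgl K X N w PN x (pe a b) \<and> (sem (nxt K X Y N w PN x (pe a b)) = sg K w PN x (pe a b))" for a b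
  have R: "(\<exists>y<B. lgl K X N w PN x y \<and> (sem (nxt K X Y N w PN x y) = sg K w PN x y)) \<longleftrightarrow> (\<exists>a b. pe a b < B \<and> Q a b)"
    unfolding Q_def by (metis pe_pf_psn)
  define L where "L = t1 x"
  define p where "p = t4 x"
  have wp: "cpow PN w = 2 ^ w" by (simp add: cpow_PN)
  \<comment> \<open>For each type it suffices to characterise the successful guesses and to see that
    one of them has both components below \<open>FF\<close>, so that its pair is below
    \<open>B\<close>.\<close>
  have fin: ?thesis if "sem x \<longleftrightarrow> (\<exists>a b. Q a b)" "\<And>a b. Q a b \<Longrightarrow> \<exists>a' b'. a' < FF \<and> b' < FF \<and> Q a' b'"
    unfolding R using that B by blast
  have F0: "0 < FF" by (rule FF_less(4)) simp
  \<comment> \<open>Used twice: for an addition node and for \<open>pvs\<close> of a position whose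
    top node is a shift, which is again a sum of two objects.\<close>
  have add: ?thesis if q: "\<And>a b. Q a b \<longleftrightarrow> add_ok (pe a b) \<and> bit A (pv p) = (a mod 2 = 1) \<and> bit D (pv p) = (2 \<le> a) \<and>
        (b < 2 \<longrightarrow> cyc A D (pv p) = (b = 1))" and s: "sem x \<longleftrightarrow> bit (A + D) (pv p)" for A D
  proof (rule fin)
    have "Q a b \<longleftrightarrow> add_ok (pe a b) \<and> bit A (pv p) = (a mod 2 = 1) \<and> bit D (pv p) = (2 \<le> a) \<and> cyc A D (pv p) = (b = 1)" for a b
      unfolding q by (auto simp: add_ok_def)
    then show "sem x \<longleftrightarrow> (\<exists>a b. Q a b)" unfolding s bit_add using guess_add by simp
    show "\<exists>a' b'. a' < FF \<and> b' < FF \<and> Q a' b'" if "Q a b" for a b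
      using that FF_less(4)[of a] FF_less(4)[of b] q[of a b] by (intro exI[of _ a] exI[of _ b]) (auto simp: add_ok_def)
  qed
  from wf show ?thesis
  proof (cases rule: wfs_cases)
    case 1
    show ?thesis
    proof (cases "L = 0 \<or> neq0 K N w x")
      case True
      have q: "Q a b \<longleftrightarrow> (L = 0 \<longrightarrow> t2 x \<noteq> t3 x)" for a b
        using 1 True by (auto simp: Q_def lgl_def nxt_def sg_def L_def sem_def)
      have s: "sem x \<longleftrightarrow> (L = 0 \<longrightarrow> t2 x \<noteq> t3 x)"
      proof (cases "L = 0")
        case True
        then have "t2 x mod 2 = 0" "t3 x mod 2 = 0" "t2 x div 2 < 2 ^ w" "t3 x div 2 < 2 ^ w"
          using wf 1 by (auto simp: wfs_def L_def)
        moreover from this have "t2 x = t3 x \<longleftrightarrow> t2 x div 2 = t3 x div 2" by presburger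
        ultimately show ?thesis using 1 True by (simp add: sem_def pv_small)
      next
        case False
        then have "neq0 K N w x" using True by simp
        then have "pv (t2 x div 2) \<noteq> pv (t3 x div 2)" "t2 x mod 2 = 0" by (auto simp: neq0_def pv_eq_iff bit_hi)
        then show ?thesis using 1 False by (simp add: sem_def)
      qed
      show ?thesis by (rule fin) (use q s F0 in auto)
    next
      case False
      then obtain L' where L': "t1 x = Suc L'" by (cases "t1 x") (auto simp: L_def)
      have wf': "Suc L' \<le> N" "wfo L' (t2 x)" "wfo L' (t3 x)" using wf 1 L' by (auto simp: wfs_def wfo_def)
      have q: "Q a b \<longleftrightarrow> a < 2 ^ (w + L') \<and> b < 2 \<and> bit (ov (t2 x)) (pv a) = (b = 1) \<and> bit (ov (t3 x)) (pv a) = (b \<noteq> 1)" for a b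
        using 1 False L' wf'(1) by (auto simp: Q_def lgl_def nxt_def sg_def L_def sem_def cpow_PN)
      have s: "sem x \<longleftrightarrow> ov (t2 x) \<noteq> ov (t3 x)"
        using 1 wf L' False by (auto simp: sem_def wfs_def ov_def L_def neq0_def pv_eq_iff bit_hi)
      show ?thesis
      proof (rule fin)
        show "sem x \<longleftrightarrow> (\<exists>a b. Q a b)"
        proof
          assume "sem x"
          then obtain r where r: "bit (ov (t2 x)) r \<noteq> bit (ov (t3 x)) r" using s by (auto simp: bit_eq_iff)
          then have "r \<in> Rep (Pm + 2 * N * Pm) L'" using obj_rep(1)[OF wf'(2)] obj_rep(1)[OF wf'(3)] wf'(1) by auto
          then obtain a where "a < 2 ^ (w + L')" "pv a = r" by (auto simp: Rep_def)
          then have "Q a (if bit (ov (t2 x)) r then 1 else 0)" unfolding q using r by auto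
          then show "\<exists>a b. Q a b" by blast
        qed (use q s in auto)
        show "\<exists>a' b'. a' < FF \<and> b' < FF \<and> Q a' b'" if "Q a b" for a b
          using that FF_less(1)[of L' a] FF_less(4)[of b] wf'(1) q[of a b] by (intro exI[of _ a] exI[of _ b]) auto
      qed
    qed
  next
    case 2
    have wf': "L < N" "wfo L (t2 x)" "p < 2 ^ (w + L)" using wf 2 by (auto simp: wfs_def L_def p_def)
    define n where "n = t2 x div 2"
    have cst: ?thesis if q: "\<And>a b. Q a b \<longleftrightarrow> a < w \<and> bit c a \<and> pv p = pv a" and s: "sem x \<longleftrightarrow> bit c (pv p)" "c < 2 ^ w" for c :: nat
    proof (rule fin)
      have pa: "pv a = a" if "a < w" for a using pv_small(1)[of a] small_less[OF that, of 0] by simp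
      show "sem x \<longleftrightarrow> (\<exists>a b. Q a b)"
        unfolding q s(1) using pa bit_less[OF _ s(2)] by metis
      show "\<exists>a' b'. a' < FF \<and> b' < FF \<and> Q a' b'" if "Q a b" for a b
        using that q FF_less(2)[of a] F0 by blast
    qed
    show ?thesis
    proof (cases "t2 x mod 2 = 1")
      case True
      then have n: "n < L" "n < N" using wf' by (auto simp: wfo_def n_def)
      have ov: "ov (t2 x) = v n" using True by (simp add: ov_def n_def)
      have ovn: "ov (2 * m + 1) = v m" "ov (Suc (2 * m)) = v m" for m by (simp_all add: ov_def)
      have s: "sem x \<longleftrightarrow> bit (v n) (pv p)" using 2 by (simp add: sem_def ov p_def)
      consider "K n = 0" | "K n = 1" | "K n = 2" | "K n = 3" | "K n \<ge> 4" using kind_cases[of n] by auto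
      then show ?thesis
      proof cases
        case a: 1
        have "X n < 2 ^ w" by (rule less_le_trans[OF const[OF n(2) a]]) (use w0(2) in \<open>auto intro: power_increasing\<close>)
        then show ?thesis
          by (intro cst[of "X n"]) (use 2 True a s v_simps(1)[OF a] in \<open>auto simp: Q_def lgl_def nxt_def sg_def sem_def p_def n_def[symmetric]\<close>)
      next
        case a: 2
        show ?thesis
          by (rule add[of "v (X n)" "v (Y n)"])
            (use 2 True a s v_simps(3)[OF n(2) a] in \<open>auto simp: Q_def lgl_def nxt_def sg_def sem_def p_def n_def[symmetric] ovn\<close>)
      next
        case a: 3
        then have xy: "X n < n" "Y n < n" using valid[OF n(2)] by auto
        have q: "Q a b \<longleftrightarrow> a < 2 ^ (w + n) \<and> pv p = pv (a + 2 ^ (w + n)) \<and> bit (v (X n)) (pv a)" for a b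
          using 2 True a n by (auto simp: Q_def lgl_def nxt_def sg_def sem_def p_def n_def[symmetric] ovn cpow_PN)
        have pt: "pv (a + 2 ^ (w + n)) = pv a + v (Y n)" if "a < 2 ^ (w + n)" for a
          using pv_top(1)[OF that n(2)] a by (simp add: \<beta>_def)
        show ?thesis
        proof (rule fin)
          show "sem x \<longleftrightarrow> (\<exists>a b. Q a b)"
          proof
            assume "sem x"
            then have b: "v (Y n) \<le> pv p" "bit (v (X n)) (pv p - v (Y n))" unfolding s v_simps(4)[OF n(2) a] by (auto simp: bit_mult_pow2)
            then obtain u where u: "u < 2 ^ (w + Suc (X n))" "pv u = pv p - v (Y n)"
              using Rep_v[of "X n"] xy n by (auto simp: Rep_def)
            have "u < 2 ^ (w + n)" using u(1) two_pow_w_le(2)[of "Suc (X n)" n] xy by linarith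
            then have "Q u 0" unfolding q using pt u b by simp
            then show "\<exists>a b. Q a b" by blast
          next
            assume "\<exists>a b. Q a b"
            then show "sem x" unfolding s v_simps(4)[OF n(2) a] q by (auto simp: bit_mult_pow2 pt)
          qed
          show "\<exists>a' b'. a' < FF \<and> b' < FF \<and> Q a' b'" if "Q a b" for a b
            using that q[of a b] q[of a 0] FF_less(1)[of n a] F0 n by (intro exI[of _ a] exI[of _ 0]) auto
        qed
      next
        case a: 4
        have "pv (2 ^ (w + n)) = Om n"
          using pv_top(1)[of 0 n, OF _ n(2)] pv_small(1)[of 0] a by (simp add: \<beta>_def)
        then have q: "Q a b \<longleftrightarrow> pv p = Om n" for a b
          using 2 True a n by (auto simp: Q_def lgl_def nxt_def sg_def sem_def p_def n_def[symmetric] cpow_PN)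
        show ?thesis by (rule fin) (use q s v_simps(2)[OF a] F0 in \<open>auto simp: bit_pow2\<close>)
      next
        case a: 5
        have q: "Q a b \<longleftrightarrow> a < 4 \<and> bop (K n - 4) (a mod 2 = 1) (2 \<le> a) \<and> bit (v (X n)) (pv p) = (a mod 2 = 1) \<and> bit (v (Y n)) (pv p) = (2 \<le> a)" for a b
          using 2 True a by (auto simp: Q_def lgl_def nxt_def sg_def sem_def p_def n_def[symmetric] ovn)
        show ?thesis
        proof (rule fin)
          show "sem x \<longleftrightarrow> (\<exists>a b. Q a b)"
          proof
            assume "sem x"
            then have "bop (K n - 4) (bit (v (X n)) (pv p)) (bit (v (Y n)) (pv p))"
              unfolding s v_simps(5)[OF n(2) a] bit_bitop[of "bop (K n - 4)", OF bop_FF] .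
            moreover obtain a :: nat where "a < 4" "(a mod 2 = 1) = bit (v (X n)) (pv p)" "(2 \<le> a) = bit (v (Y n)) (pv p)" by (rule guess_bits)
            ultimately have "Q a 0" unfolding q by simp
            then show "\<exists>a b. Q a b" by blast
          next
            assume "\<exists>a b. Q a b"
            then show "sem x" unfolding q s v_simps(5)[OF n(2) a] bit_bitop[of "bop (K n - 4)", OF bop_FF] by auto
          qed
          show "\<exists>a' b'. a' < FF \<and> b' < FF \<and> Q a' b'" if "Q a b" for a b
            using that q[of a b] q[of a 0] FF_less(4)[of a] F0 by (intro exI[of _ a] exI[of _ 0]) auto
        qed
      qed
    next
      case False
      then have ev: "t2 x mod 2 = 0" by simp
      have u: "n < 2 ^ (w + Suc L)" using wf'(2) ev by (simp add: wfo_def n_def)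
      have s: "sem x \<longleftrightarrow> bit (pvs n) (pv p)" using 2 ev by (simp add: sem_def ov_def p_def n_def)
      show ?thesis
      proof (cases "n < 2 ^ w")
        case True
        show ?thesis
          by (rule cst[of n]) (use 2 True ev s in \<open>auto simp: Q_def lgl_def nxt_def sg_def sem_def p_def n_def[symmetric] wp pv_small(2)\<close>)
      next
        case False
        note tn = top_node[OF u False]
        define m where "m = bitlen n - Suc w"
        note tn = tn[folded m_def]
        have "cpow PN (bitlen n - 1) = 2 ^ (w + m)" using tn wf' by (simp add: cpow_PN)
        note c = this this[unfolded One_nat_def]
        have mN: "m < N" using tn(1) wf'(1) by simp
        define u' where "u' = n - 2 ^ (w + m)"
        have nu: "n = u' + 2 ^ (w + m)" using tn(3) by (simp add: u'_def)
        have pt: "pvs n = pvs u' + (if K m = 2 then v (Y m) else 0)" using pv_top(2)[OF tn(5) mN] unfolding u'_def[symmetric] nu[symmetric] .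
        have ovu: "ov (2 * u') = pvs u'" "ov (2 * j + 1) = v j" "ov (Suc (2 * j)) = v j" for j by (simp_all add: ov_def)
        show ?thesis
        proof (cases "K m = 2")
          case True
          show ?thesis
            by (rule add[of "pvs u'" "v (Y m)"])
              (use 2 True False ev s pt in \<open>simp_all add: Q_def lgl_def nxt_def sg_def sem_def p_def n_def[symmetric] m_def[symmetric] u'_def[symmetric] wp c ovu\<close>)
        next
          case F: False
          have q: "Q a b \<longleftrightarrow> sem x" for a b
            using 2 F False ev s pt by (auto simp: Q_def lgl_def nxt_def sg_def sem_def p_def n_def[symmetric] m_def[symmetric] u'_def[symmetric] wp c ovu)
          show ?thesis by (rule fin) (use q F0 in auto)
        qed
      qed
    qed
  next
    case 3
    have q: "Q a b \<longleftrightarrow> (a = 0 \<and> bit (ov (t2 x)) (pv p) \<noteq> (t5 x mod 2 = 1)) \<or> (a = 1 \<and> bit (ov (t3 x)) (pv p) \<noteq> (2 \<le> t5 x))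
       \<or> (a = 2 \<and> t6 x < 2 \<and> cyc (ov (t2 x)) (ov (t3 x)) (pv p) \<noteq> (t6 x = 1))" for a b
      using 3 by (auto simp: Q_def lgl_def nxt_def sg_def sem_def p_def)
    show ?thesis
    proof (rule fin)
      show "sem x \<longleftrightarrow> (\<exists>a b. Q a b)" unfolding q ex_three using 3 by (simp add: sem_def p_def)
      show "\<exists>a' b'. a' < FF \<and> b' < FF \<and> Q a' b'" if "Q a b" for a b
        using that q[of a b] q[of a 0] FF_less(4)[of a] F0 by (intro exI[of _ a] exI[of _ 0]) auto
    qed
  next
    case 4
    have wf': "t1 x < N" "t6 x < t1 x" using wf 4 by (auto simp: wfs_def)
    have q: "Q a b \<longleftrightarrow> (a = 0 \<and> pv p \<noteq> pv (t5 x + 2 ^ (w + t6 x))) \<or> (a = 1 \<and> \<not> bit (ov (t2 x)) (pv (t5 x)))" for a b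
      using 4 wf' by (auto simp: Q_def lgl_def nxt_def sg_def sem_def p_def cpow_PN)
    show ?thesis
    proof (rule fin)
      show "sem x \<longleftrightarrow> (\<exists>a b. Q a b)" unfolding q ex_two using 4 by (simp add: sem_def p_def)
      show "\<exists>a' b'. a' < FF \<and> b' < FF \<and> Q a' b'" if "Q a b" for a b
        using that q[of a b] q[of a 0] FF_less(4)[of a] F0 by (intro exI[of _ a] exI[of _ 0]) auto
    qed
  next
    case 5
    have wf': "L < N" "wfo L (t2 x)" "wfo L (t3 x)" using wf 5 by (auto simp: wfs_def L_def)
    let ?a = "ov (t2 x)" and ?b = "ov (t3 x)"
    have q: "Q a b \<longleftrightarrow> a < 2 ^ (w + L) \<and> 1 \<le> b \<and> a mod 2 ^ w + b < 2 ^ w \<and> pv p = pv (a + b) \<and> bit ?a (pv a) \<and> bit ?b (pv a)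
       \<and> (\<forall>i. 0 < i \<and> i < b \<longrightarrow> bit ?a (pv (a + i)) \<or> bit ?b (pv (a + i)))" for a b
      using 5 wf'(1) by (auto simp: Q_def lgl_def nxt_def sg_def sem_def p_def L_def cpow_PN wp)
    show ?thesis
    proof (rule fin)
      show "sem x \<longleftrightarrow> (\<exists>a b. Q a b)"
      proof
        assume "sem x"
        then obtain r m where rm: "m \<ge> 1" "pv p = r + m" "bit ?a r" "bit ?b r"
          "\<And>i. 0 < i \<Longrightarrow> i < m \<Longrightarrow> bit ?a (r + i) \<or> bit ?b (r + i)" using 5 by (auto simp: sem_def cyc_def p_def)
        have "bit ?a (r + i) \<or> bit ?b (r + i)" if "i < m" for i using rm(3) rm(5)[of i] that by (cases "i = 0") auto
        then have "m \<le> pop ?a + pop ?b" by (rule cyc_length)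
        also have "\<dots> \<le> 2 * Pm" using obj_rep(2)[OF wf'(2,1)] obj_rep(2)[OF wf'(3,1)] by simp
        finally have m: "m \<le> 2 * Pm" .
        obtain a where a: "a < 2 ^ (w + L)" "a mod 2 ^ w \<le> Pm + 2 * N * Pm" "pv a = r"
          using obj_rep(1)[OF wf'(2,1)] rm(3) by (auto simp: Rep_def)
        \<comment> \<open>The start has offset at most \<open>Pm + 2 * N * Pm\<close> and the chain
          has length at most \<open>2 * Pm\<close>; this is the origin of the factor
          \<open>2 * N + 3\<close> in the assumption \<open>big\<close>.\<close>
        have l: "a mod 2 ^ w + m < 2 ^ w" using m a(2) big' by (simp add: algebra_simps)
        have pa: "pv (a + i) = r + i" if "i \<le> m" for i using pv_add(1)[of a i] l that a(3) by simp
        have "Q a m" unfolding q using a rm l pa by auto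
        then show "\<exists>a b. Q a b" by blast
      next
        assume "\<exists>a b. Q a b"
        then obtain a m where am: "a < 2 ^ (w + L)" "1 \<le> m" "a mod 2 ^ w + m < 2 ^ w" "pv p = pv (a + m)" "bit ?a (pv a)" "bit ?b (pv a)"
           "\<And>i. 0 < i \<Longrightarrow> i < m \<Longrightarrow> bit ?a (pv (a + i)) \<or> bit ?b (pv (a + i))" unfolding q by blast
        have pa: "pv (a + i) = pv a + i" if "i \<le> m" for i using pv_add(1)[of a i] am(3) that by simp
        have "cyc ?a ?b (pv p)" unfolding cyc_def
          by (rule exI[of _ "pv a"], rule exI[of _ m]) (use am pa in auto)
        then show "sem x" using 5 by (simp add: sem_def p_def)
      qed
      show "\<exists>a' b'. a' < FF \<and> b' < FF \<and> Q a' b'" if "Q a b" for a b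
        using that q[of a b] FF_less(1)[of L a] FF_less(3)[of b] wf'(1) by (intro exI[of _ a] exI[of _ b]) auto
    qed
  next
    case 6
    then have wf': "t1 x < N" "1 \<le> t6 x" "t5 x mod 2 ^ w + t6 x < 2 ^ w" using wf by (auto simp: wfs_def)
    let ?a = "ov (t2 x)" and ?b = "ov (t3 x)"
    have q: "Q a b \<longleftrightarrow> (a = 0 \<and> \<not> (bit ?a (pv (t5 x)) \<and> bit ?b (pv (t5 x)))) \<or> (0 < a \<and> a < t6 x \<and> \<not> bit ?a (pv (t5 x + a)) \<and> \<not> bit ?b (pv (t5 x + a)))
      \<or> (a = t6 x \<and> pv p \<noteq> pv (t5 x + t6 x))" for a b
      using 6 wf'(2) by (auto simp: Q_def lgl_def nxt_def sg_def sem_def p_def)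
    show ?thesis
    proof (rule fin)
      show "sem x \<longleftrightarrow> (\<exists>a b. Q a b)" unfolding q ex_range using 6 by (simp add: sem_def p_def) blast
      show "\<exists>a' b'. a' < FF \<and> b' < FF \<and> Q a' b'" if "Q a b" for a b
        using that q[of a b] q[of a 0] FF_less(3)[of a] F0 wf' by (intro exI[of _ a] exI[of _ 0]) auto
    qed
  next
    case 7
    then show ?thesis by (simp add: sem_def lgl_def)
  qed
qed

lemma pe_bound: "a < c ^ i \<Longrightarrow> b < c ^ i \<Longrightarrow> 4 \<le> c \<Longrightarrow> pe a b < c ^ (2 * i + 1)" for c :: nat
proof -
  assume a: "a < c ^ i" "b < c ^ i" "4 \<le> c"
  have "pe a b < (a + b + 1) ^ 2" by (rule pe_less)
  also have "\<dots> \<le> (2 * c ^ i) ^ 2" using a by (intro power_mono) auto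
  also have "\<dots> = 4 * c ^ (2 * i)" by (simp add: power_mult_distrib power_mult mult.commute)
  also have "\<dots> \<le> c ^ (2 * i + 1)" using a by simp
  finally show ?thesis .
qed

text \<open>Pairing two numbers below \<open>c ^ i\<close> gives one below
  \<open>c ^ (2 * i + 1)\<close>; six pairings lead from exponent 1 through 3, 7, 15, 31, 63 to
  127.\<close>

lemma stt_bound:
  assumes "ty < F" "L < F" "o1 < F" "o2 < F" "p < F" "q < F" "m < F" "4 \<le> F"
  shows "stt ty L o1 o2 p q m < F ^ 127"
proof -
  have m: "a < F ^ i" if "a < F" "i \<ge> 1" for a i using that assms(8) self_le_power[of F i] by linarith
  have "pe q m < F ^ 3" using pe_bound[of q F 1 m] assms by simp
  then have "pe p (pe q m) < F ^ 7" using pe_bound[of p F 3] m[of p 3] assms by simp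
  then have "pe o2 (pe p (pe q m)) < F ^ 15" using pe_bound[of o2 F 7] m[of o2 7] assms by simp
  then have "pe o1 (pe o2 (pe p (pe q m))) < F ^ 31" using pe_bound[of o1 F 15] m[of o1 15] assms by simp
  then have "pe L (pe o1 (pe o2 (pe p (pe q m)))) < F ^ 63" using pe_bound[of L F 31] m[of L 31] assms by simp
  then show ?thesis unfolding stt_def using pe_bound[of ty F 63] m[of ty 63] assms by simp
qed

lemma wfs_bound: assumes "wfs x" shows "x < FF ^ 127"
proof -
  have N: "N < FF" unfolding FF_def using less_exp[of "w + N + 3"] by linarith
  have o: "y < FF" if "wfo L y" "L < N" for L y
  proof -
    have "(2::nat) ^ (w + Suc L) \<le> 2 ^ (w + N)" by (rule two_pow_w_le) (use that in simp)
    then have "y div 2 < 2 ^ (w + N) \<or> y div 2 < N" using that by (auto simp: wfo_def split: if_splits)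
    moreover have "FF = 8 * 2 ^ (w + N)" by (simp add: FF_def power_add)
    moreover have "N < 2 ^ (w + N)" using less_exp[of "w + N"] by linarith
    ultimately show ?thesis by linarith
  qed
  have o0: "y < FF" if "y div 2 < 2 ^ (w + L)" "L \<le> N" for L y
  proof -
    have "(2::nat) ^ (w + L) \<le> 2 ^ (w + N)" by (rule two_pow_w_le) (use that in simp)
    moreover have "FF = 8 * 2 ^ (w + N)" by (simp add: FF_def power_add)
    ultimately show ?thesis using that by linarith
  qed
  have o1: "y < FF" if "y div 2 < N" for y
  proof -
    have "FF = 8 * 2 ^ (w + N)" by (simp add: FF_def power_add)
    moreover have "N < 2 ^ (w + N)" using less_exp[of "w + N"] by linarith
    ultimately show ?thesis using that by linarith
  qed
  have c: "y < 8 \<Longrightarrow> y < FF" for y by (rule FF_less)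
  have pp: "y < FF" if "y < 2 ^ (w + L)" "L < N" for L y using FF_less(1)[of L y] that by simp
  have p2: "y < FF" if "z + y < 2 ^ w" for y z using FF_less(3)[of y] that by simp
  have F4: "4 \<le> FF" using c[of 4] by simp
  have "t0 x < FF \<and> t1 x < FF \<and> t2 x < FF \<and> t3 x < FF \<and> t4 x < FF \<and> t5 x < FF \<and> t6 x < FF"
  proof -
    from assms show ?thesis
    proof (cases rule: wfs_cases)
      case 1
      then show ?thesis using assms N c[of 0] by (auto simp: wfs_def intro: o0 o1)
    next
      case 2
      then show ?thesis using assms N c[of 0] c[of 1] by (auto simp: wfs_def intro: o pp)
    next
      case 3
      then show ?thesis using assms N c[of 2] c[of "t5 x"] c[of "t6 x"] by (auto simp: wfs_def intro: o pp)
    next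
      case 4
      then show ?thesis using assms N c[of 0] c[of 3] by (auto simp: wfs_def intro: o1 pp)
    next
      case 5
      then show ?thesis using assms N c[of 0] c[of 4] by (auto simp: wfs_def intro: o pp)
    next
      case 6
      then show ?thesis using assms N c[of 5] by (auto simp: wfs_def intro: o pp p2)
    next
      case 7
      then show ?thesis using assms c[of 0] c[of 6] by (auto simp: wfs_def)
    qed
  qed
  then show ?thesis using stt_bound[of "t0 x" FF "t1 x" "t2 x" "t3 x" "t4 x" "t5 x" "t6 x"] F4 by (simp add: stt_t)
qed

text \<open>The evaluator wants all successors of legal moves below \<open>Z\<close>, for arbitrary
  numbers as positions. The cut in the legality condition enforces this, and by
  \<open>wfs_bound\<close> well-formed states stay below the cut. The minimum in
  \<open>game_eq\<close> treats the initial state in the same way.\<close>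

theorem game_correct:
  assumes B: "\<And>a b. a < FF \<Longrightarrow> b < FF \<Longrightarrow> pe a b < B" and Z: "FF ^ 127 \<le> Z"
  shows "wfs x \<Longrightarrow> rank x < r \<Longrightarrow>
    gm (\<lambda>x y. lgl K X N w PN x y \<and> nxt K X Y N w PN x y < Z) (nxt K X Y N w PN) (sg K w PN) B r x = sem x"
proof (induction r arbitrary: x)
  case (Suc r)
  have "lgl K X N w PN x y \<and> nxt K X Y N w PN x y < Z \<and>
     (gm (\<lambda>x y. lgl K X N w PN x y \<and> nxt K X Y N w PN x y < Z) (nxt K X Y N w PN) (sg K w PN) B r (nxt K X Y N w PN x y) = sg K w PN x y)
    \<longleftrightarrow> lgl K X N w PN x y \<and> (sem (nxt K X Y N w PN x y) = sg K w PN x y)" for y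
  proof (cases "lgl K X N w PN x y")
    case True
    note ok = nxt_ok[OF Suc.prems(1) True]
    have "nxt K X Y N w PN x y < Z" using wfs_bound[of "nxt K X Y N w PN x y"] ok Z by simp
    then show ?thesis using Suc.IH[of "nxt K X Y N w PN x y"] ok Suc.prems(2) True by simp
  qed simp
  then show ?case using sem_step[OF Suc.prems(1) B] by (simp add: conj_assoc)
qed simp

corollary game_eq:
  assumes B: "\<And>a b. a < FF \<Longrightarrow> b < FF \<Longrightarrow> pe a b < B" and Z: "FF ^ 127 \<le> Z"
    and "Suc i < N" "Suc j < N" "N * (12 * N + 10) + 1 < r"
  shows "gm (\<lambda>x y. lgl K X N w PN x y \<and> nxt K X Y N w PN x y < Z) (nxt K X Y N w PN) (sg K w PN) B r
    (min (stt 0 N (2 * i + 1) (2 * j + 1) 0 0 0) (Z - 1)) \<longleftrightarrow> v i \<noteq> v j"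
proof -
  have wf: "wfs (stt 0 N (2 * i + 1) (2 * j + 1) 0 0 0)" using assms(3,4) unfolding wfs_def t_stt obj_simps by simp
  moreover have "rank (stt 0 N (2 * i + 1) (2 * j + 1) 0 0 0) < r" using assms(5) by (simp add: rank_def)
  moreover have "min (stt 0 N (2 * i + 1) (2 * j + 1) 0 0 0) (Z - 1) = stt 0 N (2 * i + 1) (2 * j + 1) 0 0 0"
    using wfs_bound[OF wf] Z by simp
  ultimately show ?thesis using game_correct[OF B Z wf] by (simp add: sem_def del: One_nat_def mult_Suc_right)
qed

end

section \<open>Simulating a run with symbolic numbers\<close>

text \<open>Dispatch on the program counter. The program is fixed, so this is a finite nest of
  conditionals and computable as soon as each branch is.\<close>

definition pick :: "'a list \<Rightarrow> nat \<Rightarrow> ('a \<Rightarrow> 'b) \<Rightarrow> 'b \<Rightarrow> 'b" where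
  "pick xs p f d = (if p < length xs then f (xs ! p) else d)"

lemma PS_pick:
  assumes "\<And>a. a \<in> set xs \<Longrightarrow> PS k (f a)" "PS k p" "PS k d"
  shows "PS k (\<lambda>e. pick xs (p e) (\<lambda>a. f a e) (d e))"
  using assms
proof (induction xs arbitrary: p)
  case Nil
  then show ?case by (simp add: pick_def)
next
  case (Cons a xs)
  have "PS k (\<lambda>e. if p e = 0 then f a e else pick xs (p e - 1) (\<lambda>a. f a e) (d e))"
    by (intro PS_if PSp_eq PS_const Cons.IH PS_diff Cons.prems) (use Cons.prems in auto)
  moreover have "pick (a # xs) q g z = (if q = 0 then g a else pick xs (q - 1) g z)" for q and g :: "'a \<Rightarrow> nat" and z
    by (cases q) (auto simp: pick_def)
  ultimately show ?case by simp
qed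

fun csts :: "instr \<Rightarrow> nat set" where
  "csts (Const i v) = {i, v}"
| "csts (Copy i j) = {i, j}"
| "csts (Load i j) = {i, j}"
| "csts (Store i j) = {i, j}"
| "csts (Add i j k) = {i, j, k}"
| "csts (Shl i j k) = {i, j, k}"
| "csts (BoolOp f i j k) = {i, j, k}"
| "csts (Jeq i j t) = {i, j, t}"
| "csts Halt = {}"
| "csts (ALN i) = {i}"

definition bcode :: "(bool \<Rightarrow> bool \<Rightarrow> bool) \<Rightarrow> nat" where
  "bcode f = of_bool (f True False) + 2 * of_bool (f False True) + 4 * of_bool (f True True)"

lemma bop_bcode: "\<not> f False False \<Longrightarrow> bop (bcode f) = f"
proof (intro ext)
  fix x y assume f: "\<not> f False False"
  have "bit (bcode f) 0 = f True False" "bit (bcode f) 1 = f False True" "bit (bcode f) 2 = f True True"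
    by (cases "f True False"; cases "f False True"; cases "f True True"; simp add: bcode_def bit_iff_odd)+
  then show "bop (bcode f) x y = f x y" using f unfolding bop_def by (cases x; cases y) auto
qed

lemma bcode_less: "bcode f < 8"
  by (simp add: bcode_def of_bool_def)

text \<open>Nodes below \<open>Cc\<close> are constants, which also name the registers mentioned in
  the program; node \<open>Cc\<close> is the input; node \<open>Cc + 1 + t\<close> is contributed by
  step \<open>t\<close>.\<close>

locale ram =
  fixes P :: program and cT kT Cc :: nat
  assumes Cc: "\<And>ins c. ins \<in> set P \<Longrightarrow> c \<in> csts ins \<Longrightarrow> c < Cc" "length P < Cc"
begin

definition "Tt x = cT * (bitlen x + 1) ^ kT"
definition "NN x = Cc + Tt x + 3"
definition "ww0 x = bitlen x + Cc + 1"
text \<open>Twice \<open>2 * NN x + ww0 x + 4\<close>, chosen so that \<open>big_ok\<close> holds: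
  half of the bits absorb the exponentially long carry chains.\<close>

definition "ww x = 4 * NN x + 2 * ww0 x + 8"
definition "ze x = NN x + Cc + 4"
text \<open>With \<open>FF\<close> from the game, \<open>BB x\<close> is \<open>(2 * FF) ^ 2\<close>
  and bounds pairs of components, \<open>ZZ x\<close> is \<open>FF ^ 127\<close> and bounds states.
  \<open>rr x\<close> exceeds the initial rank, and \<open>Itt x\<close>, \<open>Sbb x\<close> are
  powers of two above the step count and the stack of the evaluator.\<close>

definition "BB x = (2::nat) ^ (2 * (ww x + NN x + 4))"
definition "ZZ x = (2::nat) ^ (127 * (ww x + NN x + 3))"
definition "rr x = NN x * (12 * NN x + 10) + 2"
definition "Itt x = (2::nat) ^ ((2 * (ww x + NN x + 4) + 3) * (rr x + 1))"
definition "Sbb x = (2::nat) ^ ((127 * (ww x + NN x + 3) + 2 * (ww x + NN x + 4) + 2) * (rr x + 1))"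
definition "PNN x = (2::nat) ^ (ww x + NN x)"
definition "Zb x = (2::nat) ^ ze x"
definition "PH x = (2::nat) ^ (ze x * (6 * Tt x + 6))"

lemma PS_Tt: "PS k a \<Longrightarrow> PS k (\<lambda>e. Tt (a e))" unfolding Tt_def by (intro PS_intros)
lemmas [PS_intros] = PS_Tt
lemma PS_NN: "PS k a \<Longrightarrow> PS k (\<lambda>e. NN (a e))" unfolding NN_def by (intro PS_intros)
lemmas [PS_intros] = PS_NN
lemma PS_ww: "PS k a \<Longrightarrow> PS k (\<lambda>e. ww (a e))" unfolding ww_def ww0_def by (intro PS_intros)
lemmas [PS_intros] = PS_ww
lemma PS_ze: "PS k a \<Longrightarrow> PS k (\<lambda>e. ze (a e))" unfolding ze_def by (intro PS_intros)
lemmas [PS_intros] = PS_ze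
lemma PS_rr: "PS k a \<Longrightarrow> PS k (\<lambda>e. rr (a e))" unfolding rr_def by (intro PS_intros)
lemmas [PS_intros] = PS_rr

lemmas pols = pol_add pol_mult pol_const pol_power pol_bitlen_var

lemma PS_BB: "PS k a \<Longrightarrow> PS k (\<lambda>e. BB (a e))"
  by (rule PS_comp1[of BB], unfold BB_def, rule PS_pow2, (intro PS_intros; simp), unfold ww_def NN_def ww0_def Tt_def, intro pols, auto)
lemmas [PS_intros] = PS_BB
lemma PS_ZZ: "PS k a \<Longrightarrow> PS k (\<lambda>e. ZZ (a e))"
  by (rule PS_comp1[of ZZ], unfold ZZ_def, rule PS_pow2, (intro PS_intros; simp), unfold ww_def NN_def ww0_def Tt_def, intro pols, auto)
lemmas [PS_intros] = PS_ZZ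
lemma PS_Itt: "PS k a \<Longrightarrow> PS k (\<lambda>e. Itt (a e))"
  by (rule PS_comp1[of Itt], unfold Itt_def, rule PS_pow2, (intro PS_intros; simp), unfold rr_def ww_def NN_def ww0_def Tt_def, intro pols, auto)
lemmas [PS_intros] = PS_Itt
lemma PS_Sbb: "PS k a \<Longrightarrow> PS k (\<lambda>e. Sbb (a e))"
  by (rule PS_comp1[of Sbb], unfold Sbb_def, rule PS_pow2, (intro PS_intros; simp), unfold rr_def ww_def NN_def ww0_def Tt_def, intro pols, auto)
lemmas [PS_intros] = PS_Sbb
lemma PS_PNN: "PS k a \<Longrightarrow> PS k (\<lambda>e. PNN (a e))"
  by (rule PS_comp1[of PNN], unfold PNN_def, rule PS_pow2, (intro PS_intros; simp), unfold ww_def NN_def ww0_def Tt_def, intro pols, auto)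
lemmas [PS_intros] = PS_PNN
lemma PS_Zb: "PS k a \<Longrightarrow> PS k (\<lambda>e. Zb (a e))"
  by (rule PS_comp1[of Zb], unfold Zb_def, rule PS_pow2, (intro PS_intros; simp), unfold ze_def NN_def Tt_def, intro pols, auto)
lemmas [PS_intros] = PS_Zb
lemma PS_PH: "PS k a \<Longrightarrow> PS k (\<lambda>e. PH (a e))"
  by (rule PS_comp1[of PH], unfold PH_def, rule PS_pow2, (intro PS_intros; simp), unfold ze_def NN_def Tt_def, intro pols, auto)
lemmas [PS_intros] = PS_PH

text \<open>The history \<open>H\<close> is a number in base \<open>Zb x\<close> with six digits per
  step: kind and two operands of the new node, the node of the address written, the node of the
  value written, and the next program counter.\<close>

definition "fld x H t f = shr H (ze x * (6 * t + f)) mod Zb x"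
definition "KK x H n = (if n \<le> Cc then 0 else fld x H (n - Cc - 1) 0)"
definition "XX x H n = (if n < Cc then n else if n = Cc then x else fld x H (n - Cc - 1) 1)"
definition "YY x H n = (if n \<le> Cc then 0 else fld x H (n - Cc - 1) 2)"

lemma PS_fld [PS_intros]: "PS k a \<Longrightarrow> PS k b \<Longrightarrow> PS k c \<Longrightarrow> PS k d \<Longrightarrow> PS k (\<lambda>e. fld (a e) (b e) (c e) (d e))"
  unfolding fld_def by (intro PS_intros)
lemma PS_KK [PS_intros]: "PS k a \<Longrightarrow> PS k b \<Longrightarrow> PS k c \<Longrightarrow> PS k (\<lambda>e. KK (a e) (b e) (c e))"
  unfolding KK_def by (intro PS_intros)
lemma PS_XX [PS_intros]: "PS k a \<Longrightarrow> PS k b \<Longrightarrow> PS k c \<Longrightarrow> PS k (\<lambda>e. XX (a e) (b e) (c e))"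
  unfolding XX_def by (intro PS_intros)
lemma PS_YY [PS_intros]: "PS k a \<Longrightarrow> PS k b \<Longrightarrow> PS k c \<Longrightarrow> PS k (\<lambda>e. YY (a e) (b e) (c e))"
  unfolding YY_def by (intro PS_intros)

definition "EQ x H i j \<longleftrightarrow> \<not> gm (\<lambda>s y. lgl (KK x H) (XX x H) (NN x) (ww x) (PNN x) s y \<and> nxt (KK x H) (XX x H) (YY x H) (NN x) (ww x) (PNN x) s y < ZZ x)
    (nxt (KK x H) (XX x H) (YY x H) (NN x) (ww x) (PNN x)) (sg (KK x H) (ww x) (PNN x)) (BB x) (rr x)
    (min (stt 0 (NN x) (2 * i + 1) (2 * j + 1) 0 0 0) (ZZ x - 1))"

lemma PS_min [PS_intros]: "PS k a \<Longrightarrow> PS k b \<Longrightarrow> PS k (\<lambda>e. min (a e) (b e))"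
  unfolding min_def by (intro PS_intros)

lemma PS_stt [PS_intros]: "PS k a \<Longrightarrow> PS k b \<Longrightarrow> PS k c \<Longrightarrow> PS k d \<Longrightarrow> PS k f \<Longrightarrow> PS k g \<Longrightarrow> PS k h \<Longrightarrow>
   PS k (\<lambda>e. stt (a e) (b e) (c e) (d e) (f e) (g e) (h e))"
  unfolding stt_def by (intro PS_intros)

lemma PS_t [PS_intros]:
  "PS k a \<Longrightarrow> PS k (\<lambda>e. t0 (a e))" "PS k a \<Longrightarrow> PS k (\<lambda>e. t1 (a e))" "PS k a \<Longrightarrow> PS k (\<lambda>e. t2 (a e))"
  "PS k a \<Longrightarrow> PS k (\<lambda>e. t3 (a e))" "PS k a \<Longrightarrow> PS k (\<lambda>e. t4 (a e))" "PS k a \<Longrightarrow> PS k (\<lambda>e. t5 (a e))"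
  "PS k a \<Longrightarrow> PS k (\<lambda>e. t6 (a e))"
  unfolding t_defs by (intro PS_intros; assumption)+

lemma PSp_bop [PS_intros]: "PS k a \<Longrightarrow> PSp k b \<Longrightarrow> PSp k c \<Longrightarrow> PSp k (\<lambda>e. bop (a e) (b e) (c e))"
  unfolding bop_def by (intro PS_intros)

lemma PSp_add_ok [PS_intros]: "PS k a \<Longrightarrow> PSp k (\<lambda>e. add_ok (a e))"
  unfolding add_ok_def by (intro PS_intros)

lemma PSp_neq0 [PS_intros]: 
  assumes "PS k a" "PS k b" "PS k x" shows "PSp k (\<lambda>e. neq0 (KK (a e) (b e)) (NN (a e)) (ww (a e)) (x e))"
  by (rule PSp_comp3[of "\<lambda>a b. neq0 (KK a b) (NN a) (ww a)", OF _ assms]) (unfold neq0_def, intro PS_intros, simp_all)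

lemma bnd_It: "(3 * BB x + 4) ^ Suc (rr x) \<le> Itt x"
proof -
  have "1 \<le> BB x" by (simp add: BB_def)
  then have "3 * BB x + 4 \<le> 8 * BB x" by simp
  also have "\<dots> = 2 ^ (2 * (ww x + NN x + 4) + 3)" by (simp add: BB_def power_add)
  finally have "(3 * BB x + 4) ^ Suc (rr x) \<le> (2 ^ (2 * (ww x + NN x + 4) + 3)) ^ Suc (rr x)" by (rule power_mono) simp
  then show ?thesis unfolding Itt_def power_mult[symmetric] by (simp only: Suc_eq_plus1)
qed

lemma bnd_Sb: "gW (ZZ x) (BB x) ^ Suc (rr x) \<le> Sbb x"
proof -
  have "1 \<le> BB x" "1 \<le> ZZ x" by (simp_all add: BB_def ZZ_def)
  then have "ZZ x * 1 \<le> ZZ x * BB x" "1 * 1 \<le> ZZ x * BB x" by (intro mult_le_mono; simp)+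
  moreover have "gW (ZZ x) (BB x) = ZZ x * BB x + ZZ x * 1 + 1 * 1" by (simp add: gW_def)
  ultimately have "gW (ZZ x) (BB x) \<le> 4 * (ZZ x * BB x)" by linarith
  also have "\<dots> = 2 ^ (127 * (ww x + NN x + 3) + 2 * (ww x + NN x + 4) + 2)" unfolding BB_def ZZ_def power_add by simp
  finally have "gW (ZZ x) (BB x) ^ Suc (rr x) \<le> (2 ^ (127 * (ww x + NN x + 3) + 2 * (ww x + NN x + 4) + 2)) ^ Suc (rr x)" by (rule power_mono) simp
  then show ?thesis unfolding Sbb_def power_mult[symmetric] by (simp only: Suc_eq_plus1)
qed

lemma PSp_EQ0: "PSp 4 (\<lambda>e. EQ (e 0) (e 1) (e 2) (e 3))"
  unfolding EQ_def
proof (rule PSp_not, rule PSp_gm[where Z="\<lambda>e. ZZ (e 0)" and It="\<lambda>e. Itt (e 0)" and Sb="\<lambda>e. Sbb (e 0)"])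
  show n: "PS (Suc (Suc 4)) (\<lambda>e. nxt (KK (e (Suc (Suc 0))) (e (Suc (Suc 1)))) (XX (e (Suc (Suc 0))) (e (Suc (Suc 1)))) (YY (e (Suc (Suc 0))) (e (Suc (Suc 1)))) (NN (e (Suc (Suc 0)))) (ww (e (Suc (Suc 0)))) (PNN (e (Suc (Suc 0)))) (e 0) (e 1))"
    unfolding nxt_def by (intro PS_intros) simp_all
  show "PSp (Suc (Suc 4)) (\<lambda>e. sg (KK (e (Suc (Suc 0))) (e (Suc (Suc 1)))) (ww (e (Suc (Suc 0)))) (PNN (e (Suc (Suc 0)))) (e 0) (e 1))"
    unfolding sg_def by (intro PS_intros) simp_all
  have l: "PSp (Suc (Suc 4)) (\<lambda>e. lgl (KK (e (Suc (Suc 0))) (e (Suc (Suc 1)))) (XX (e (Suc (Suc 0))) (e (Suc (Suc 1)))) (NN (e (Suc (Suc 0)))) (ww (e (Suc (Suc 0)))) (PNN (e (Suc (Suc 0)))) (e 0) (e 1))"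
    unfolding lgl_def by (intro PS_intros) simp_all
  show "PSp (Suc (Suc 4)) (\<lambda>e. lgl (KK (e (Suc (Suc 0))) (e (Suc (Suc 1)))) (XX (e (Suc (Suc 0))) (e (Suc (Suc 1)))) (NN (e (Suc (Suc 0)))) (ww (e (Suc (Suc 0)))) (PNN (e (Suc (Suc 0)))) (e 0) (e 1) \<and>
    nxt (KK (e (Suc (Suc 0))) (e (Suc (Suc 1)))) (XX (e (Suc (Suc 0))) (e (Suc (Suc 1)))) (YY (e (Suc (Suc 0))) (e (Suc (Suc 1)))) (NN (e (Suc (Suc 0)))) (ww (e (Suc (Suc 0)))) (PNN (e (Suc (Suc 0)))) (e 0) (e 1) < ZZ (e (Suc (Suc 0))))"
    by (rule PSp_conj[OF l PSp_less[OF n]]) (intro PS_intros; simp)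
  show "min (stt 0 (NN (e 0)) (2 * e 2 + 1) (2 * e 3 + 1) 0 0 0) (ZZ (e 0) - 1) < ZZ (e 0)" for e
    by (simp add: ZZ_def min_less_iff_disj)
  show "(3 * BB (e 0) + 4) ^ Suc (rr (e 0)) \<le> Itt (e 0)" "gW (ZZ (e 0)) (BB (e 0)) ^ Suc (rr (e 0)) \<le> Sbb (e 0)" for e :: "nat \<Rightarrow> nat"
    by (rule bnd_It, rule bnd_Sb)
qed ((intro PS_intros; simp)+, simp)

lemmas PSp_EQ [PS_intros] = PSp_comp4[OF PSp_EQ0]

text \<open>Memory is never stored, only the log of writes. The node in the register addressed by
  node \<open>i\<close> is found by replaying the log: initially the input for address 0 and the
  constant 0 elsewhere, then every write to an equal address overrides.\<close>

definition "lku x H t i = rec_nat (if EQ x H i 0 then Cc else 0) (\<lambda>s a. if EQ x H (fld x H s 3) i then fld x H s 4 else a) t"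

lemma fld_less: "fld x H t f < Zb x" by (simp add: fld_def Zb_def)

lemma lku_bound: "lku x H t i \<le> Zb x + Cc"
  unfolding lku_def by (induction t) (use fld_less[of x H _ 4] in \<open>auto intro: less_imp_le trans_le_add1\<close>)

lemma PS_lku0: "PS 4 (\<lambda>e. lku (e 0) (e 1) (e 2) (e 3))"
  unfolding lku_def
proof (rule PS_rec_PS[where b = "\<lambda>e. Zb (e 0) + Cc"])
  show "rec_nat (if EQ (e 0) (e 1) (e 3) 0 then Cc else 0) (\<lambda>s a. if EQ (e 0) (e 1) (fld (e 0) (e 1) s 3) (e 3) then fld (e 0) (e 1) s 4 else a) n \<le> Zb (e 0) + Cc" for e n
    using lku_bound[of "e 0" "e 1" n "e 3"] by (simp add: lku_def)
qed (intro PS_intros; simp)+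

lemmas PS_lku [PS_intros] = PS_comp4[OF PS_lku0]

definition "pcs x H t = (if t = 0 then 0 else fld x H (t - 1) 5)"

lemma PS_pcs [PS_intros]: "PS k a \<Longrightarrow> PS k b \<Longrightarrow> PS k c \<Longrightarrow> PS k (\<lambda>e. pcs (a e) (b e) (c e))"
  unfolding pcs_def by (intro PS_intros)

text \<open>Every step adds exactly one node, so node numbers follow time; steps that compute no new
  number add the constant 0 and refer to older nodes.\<close>

definition "eK = (\<lambda>ins. case ins of Add i j k \<Rightarrow> 1 | Shl i j k \<Rightarrow> 2 | ALN i \<Rightarrow> 3 | BoolOp f i j k \<Rightarrow> 4 + bcode f | _ \<Rightarrow> (0::nat))"
definition "eX = (\<lambda>ins x H t. case ins of Add i j k \<Rightarrow> lku x H t j | Shl i j k \<Rightarrow> lku x H t j | BoolOp f i j k \<Rightarrow> lku x H t j | _ \<Rightarrow> 0)"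
definition "eY = (\<lambda>ins x H t. case ins of Add i j k \<Rightarrow> lku x H t k | Shl i j k \<Rightarrow> lku x H t k | BoolOp f i j k \<Rightarrow> lku x H t k | _ \<Rightarrow> 0)"
definition "eA = (\<lambda>ins x H t. case ins of Const i v \<Rightarrow> i | Copy i j \<Rightarrow> i | Load i j \<Rightarrow> i | Store i j \<Rightarrow> lku x H t i | Add i j k \<Rightarrow> i
   | Shl i j k \<Rightarrow> i | BoolOp f i j k \<Rightarrow> i | ALN i \<Rightarrow> i | _ \<Rightarrow> 0)"
definition "eW = (\<lambda>ins x H t. case ins of Const i v \<Rightarrow> v | Copy i j \<Rightarrow> lku x H t j | Load i j \<Rightarrow> lku x H t (lku x H t j) | Store i j \<Rightarrow> lku x H t j
   | Add i j k \<Rightarrow> Cc + 1 + t | Shl i j k \<Rightarrow> Cc + 1 + t | BoolOp f i j k \<Rightarrow> Cc + 1 + t | ALN i \<Rightarrow> Cc + 1 + t | _ \<Rightarrow> lku x H t 0)"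
definition "eP = (\<lambda>ins x H t. case ins of Jeq i j l \<Rightarrow> (if EQ x H (lku x H t i) (lku x H t j) then l else pcs x H t + 1) | Halt \<Rightarrow> pcs x H t
   | _ \<Rightarrow> pcs x H t + 1)"

text \<open>The step at time \<open>t\<close> of the run, with operands given as nodes. A step that writes nothing is treated as
  rewriting register 0 with its own content.\<close>
definition "ent x H t (f::nat) = 
  (if f = 0 then pick P (pcs x H t) eK 0
   else if f = 1 then pick P (pcs x H t) (\<lambda>ins. eX ins x H t) 0
   else if f = 2 then pick P (pcs x H t) (\<lambda>ins. eY ins x H t) 0
   else if f = 3 then pick P (pcs x H t) (\<lambda>ins. eA ins x H t) 0
   else if f = 4 then pick P (pcs x H t) (\<lambda>ins. eW ins x H t) (lku x H t 0)
   else pick P (pcs x H t) (\<lambda>ins. eP ins x H t) (pcs x H t))"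

text \<open>The cut bounds a digit for every \<open>H\<close>, as the recursion defining
  \<open>Hh\<close> requires; the entries of a genuine run are below it by
  \<open>en_eq\<close>.\<close>

definition "entc x H t (f::nat) = min (ent x H t f) (Zb x - 1)"

definition "app x H t = H + (entc x H t 0 * cpow (PH x) (ze x * (6 * t + 0)) + entc x H t 1 * cpow (PH x) (ze x * (6 * t + 1))
   + entc x H t 2 * cpow (PH x) (ze x * (6 * t + 2)) + entc x H t 3 * cpow (PH x) (ze x * (6 * t + 3))
   + entc x H t 4 * cpow (PH x) (ze x * (6 * t + 4)) + entc x H t 5 * cpow (PH x) (ze x * (6 * t + 5)))"

definition "Hh x t = rec_nat 0 (\<lambda>t H. app x H t) t"

lemma PS_entc [PS_intros]:
  assumes "PS k a" "PS k b" "PS k c" shows "PS k (\<lambda>e. entc (a e) (b e) (c e) f)"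
proof (rule PS_comp3[of "\<lambda>x H t. entc x H t f", OF _ assms])
  have e: "PS 3 (\<lambda>e. eX ins (e 0) (e 1) (e 2))" "PS 3 (\<lambda>e. eY ins (e 0) (e 1) (e 2))" "PS 3 (\<lambda>e. eA ins (e 0) (e 1) (e 2))"
    "PS 3 (\<lambda>e. eW ins (e 0) (e 1) (e 2))" "PS 3 (\<lambda>e. eP ins (e 0) (e 1) (e 2))" for ins
    unfolding eX_def eY_def eA_def eW_def eP_def by (cases ins; simp only: instr.case; intro PS_intros; simp)+
  show "PS 3 (\<lambda>e. entc (e 0) (e 1) (e 2) f)"
    unfolding entc_def ent_def by ((intro PS_min PS_if PSp_const PS_pick e), (intro PS_intros; simp)+)
qed

lemma PS_app [PS_intros]: "PS k a \<Longrightarrow> PS k b \<Longrightarrow> PS k c \<Longrightarrow> PS k (\<lambda>e. app (a e) (b e) (c e))"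
  unfolding app_def by (intro PS_intros)

lemma entc_less: "entc x H t f \<le> Zb x - 1" "entc x H t f < Zb x"
  by (auto simp: entc_def Zb_def min_less_iff_disj)

end

section \<open>Reading back the recorded history\<close>

lemma digits:
  fixes d :: "nat \<Rightarrow> nat"
  assumes "\<And>i. d i < 2 ^ z"
  shows "(\<Sum>i<n. d i * 2 ^ (z * i)) < 2 ^ (z * n)"
    "shr (\<Sum>i<n. d i * 2 ^ (z * i)) (z * i) mod 2 ^ z = (if i < n then d i else 0)"
proof -
  define S where "S n = (\<Sum>i<n. d i * 2 ^ (z * i))" for n
  have less: "S n < 2 ^ (z * n)" for n
  proof (induction n)
    case (Suc n)
    have "S (Suc n) < 2 ^ (z * n) + d n * 2 ^ (z * n)" using Suc by (simp add: S_def)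
    also have "\<dots> = Suc (d n) * 2 ^ (z * n)" by simp
    also have "\<dots> \<le> 2 ^ z * 2 ^ (z * n)" using assms[of n] by (intro mult_le_mono) auto
    finally show ?case by (simp add: power_add)
  qed (simp add: S_def)
  have "S n div 2 ^ (z * i) mod 2 ^ z = (if i < n then d i else 0)"
  proof (induction n)
    case (Suc n)
    have S: "S (Suc n) = S n + d n * 2 ^ (z * n)" by (simp add: S_def)
    consider "i < n" | "i = n" | "i > n" by linarith
    then show ?case
    proof cases
      case 1
      then obtain k where k: "n = i + Suc k" using less_imp_Suc_add by auto
      have "z * n = z * k + z + z * i" unfolding k by (simp add: algebra_simps)
      then have "S (Suc n) = S n + (d n * 2 ^ (z * k) * 2 ^ z) * 2 ^ (z * i)" unfolding S by (simp only: power_add mult.assoc)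
      then have "S (Suc n) div 2 ^ (z * i) = S n div 2 ^ (z * i) + d n * 2 ^ (z * k) * 2 ^ z" by simp
      then show ?thesis using Suc 1 by simp
    next
      case 2
      then have "S (Suc n) div 2 ^ (z * i) = d n" unfolding S using less[of n] by simp
      then show ?thesis using 2 assms[of n] by simp
    next
      case 3
      then have "(2::nat) ^ (z * Suc n) \<le> 2 ^ (z * i)" by (intro power_increasing mult_le_mono2) auto
      then have "S (Suc n) < 2 ^ (z * i)" using less[of "Suc n"] by linarith
      then show ?thesis using 3 by simp
    qed
  qed (simp add: S_def)
  then show "shr (\<Sum>i<n. d i * 2 ^ (z * i)) (z * i) mod 2 ^ z = (if i < n then d i else 0)"
    by (simp add: shr_def S_def)
  show "(\<Sum>i<n. d i * 2 ^ (z * i)) < 2 ^ (z * n)" using less by (simp add: S_def)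
qed

text \<open>A node depends on earlier nodes only, so its value survives every extension of the
  history.\<close>

lemma vv_cong:
  assumes "\<And>m. m \<le> n \<Longrightarrow> K m = K' m \<and> X m = X' m \<and> Y m = Y' m"
  shows "vv K X Y Om n = vv K' X' Y' Om n"
  using assms
proof (induction n rule: less_induct)
  case (less n)
  have "vv K X Y Om m = vv K' X' Y' Om m" if "m < n" for m
    by (rule less.IH[OF that]) (use less.prems that in auto)
  then show ?case using less.prems[of n] by (subst (1 2) vv.simps) simp
qed

context ram begin

lemma Hh_simps [simp]: "Hh x 0 = 0" "Hh x (Suc t) = app x (Hh x t) t"
  by (simp_all add: Hh_def)

definition "en x t f = entc x (Hh x t) t f"
definition "dg x i = en x (i div 6) (i mod 6)"

lemma Hh_digits: "t \<le> Suc (Tt x) \<Longrightarrow> Hh x t = (\<Sum>i<6 * t. dg x i * 2 ^ (ze x * i))"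
proof (induction t)
  case (Suc t)
  have c: "cpow (PH x) (ze x * (6 * t + f)) = 2 ^ (ze x * (6 * t + f))" if "f < 6" for f
    unfolding cpow_def PH_def using Suc.prems that by (auto intro!: power_increasing mult_le_mono2)
  have d: "dg x (6 * t + f) = entc x (Hh x t) t f" if "f < 6" for f
    using that by (simp add: dg_def en_def)
  have "{..<6 * Suc t} = {..<6 * t} \<union> {6 * t + 0, 6 * t + 1, 6 * t + 2, 6 * t + 3, 6 * t + 4, 6 * t + 5}" by auto
  then have "(\<Sum>i<6 * Suc t. dg x i * 2 ^ (ze x * i)) = (\<Sum>i<6 * t. dg x i * 2 ^ (ze x * i)) +
    (\<Sum>i\<in>{6 * t + 0, 6 * t + 1, 6 * t + 2, 6 * t + 3, 6 * t + 4, 6 * t + 5}. dg x i * 2 ^ (ze x * i))"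
    by (simp only: ) (rule sum.union_disjoint, auto)
  also have "(\<Sum>i\<in>{6 * t + 0, 6 * t + 1, 6 * t + 2, 6 * t + 3, 6 * t + 4, 6 * t + 5}. dg x i * 2 ^ (ze x * i)) =
    dg x (6 * t + 0) * 2 ^ (ze x * (6 * t + 0)) + dg x (6 * t + 1) * 2 ^ (ze x * (6 * t + 1)) + dg x (6 * t + 2) * 2 ^ (ze x * (6 * t + 2))
    + dg x (6 * t + 3) * 2 ^ (ze x * (6 * t + 3)) + dg x (6 * t + 4) * 2 ^ (ze x * (6 * t + 4)) + dg x (6 * t + 5) * 2 ^ (ze x * (6 * t + 5))"
    by simp
  finally have fin: "(\<Sum>i<6 * Suc t. dg x i * 2 ^ (ze x * i)) = (\<Sum>i<6 * t. dg x i * 2 ^ (ze x * i)) +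
    (dg x (6 * t + 0) * 2 ^ (ze x * (6 * t + 0)) + dg x (6 * t + 1) * 2 ^ (ze x * (6 * t + 1)) + dg x (6 * t + 2) * 2 ^ (ze x * (6 * t + 2))
    + dg x (6 * t + 3) * 2 ^ (ze x * (6 * t + 3)) + dg x (6 * t + 4) * 2 ^ (ze x * (6 * t + 4)) + dg x (6 * t + 5) * 2 ^ (ze x * (6 * t + 5)))" .
  have cs: "cpow (PH x) (ze x * (6 * t + 0)) = 2 ^ (ze x * (6 * t + 0))" "cpow (PH x) (ze x * (6 * t + 1)) = 2 ^ (ze x * (6 * t + 1))"
    "cpow (PH x) (ze x * (6 * t + 2)) = 2 ^ (ze x * (6 * t + 2))" "cpow (PH x) (ze x * (6 * t + 3)) = 2 ^ (ze x * (6 * t + 3))"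
    "cpow (PH x) (ze x * (6 * t + 4)) = 2 ^ (ze x * (6 * t + 4))" "cpow (PH x) (ze x * (6 * t + 5)) = 2 ^ (ze x * (6 * t + 5))"
    by (rule c, simp)+
  have ds: "dg x (6 * t + 0) = entc x (Hh x t) t 0" "dg x (6 * t + 1) = entc x (Hh x t) t 1" "dg x (6 * t + 2) = entc x (Hh x t) t 2"
    "dg x (6 * t + 3) = entc x (Hh x t) t 3" "dg x (6 * t + 4) = entc x (Hh x t) t 4" "dg x (6 * t + 5) = entc x (Hh x t) t 5"
    by (rule d, simp)+
  have IH: "(\<Sum>i<6 * t. dg x i * 2 ^ (ze x * i)) = Hh x t" using Suc by simp
  show ?case unfolding Hh_simps app_def cs fin ds IH ..
qed simp

lemma fld_Hh: "t \<le> Suc (Tt x) \<Longrightarrow> f < 6 \<Longrightarrow> fld x (Hh x t) s f = (if s < t then en x s f else 0)"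
proof -
  assume a: "t \<le> Suc (Tt x)" "f < 6"
  have "dg x i < 2 ^ ze x" for i unfolding dg_def en_def using entc_less(2) by (simp add: Zb_def)
  from digits(2)[where d="dg x" and z="ze x", OF this, where n="6 * t" and i="6 * s + f"]
  have "fld x (Hh x t) s f = (if 6 * s + f < 6 * t then dg x (6 * s + f) else 0)"
    unfolding fld_def Hh_digits[OF a(1)] Zb_def .
  also have "\<dots> = (if s < t then en x s f else 0)" using a(2) by (auto simp: dg_def)
  finally show ?thesis .
qed

definition "fK x n = (if n \<le> Cc then 0 else en x (n - Cc - 1) 0)"
definition "fX x n = (if n < Cc then n else if n = Cc then x else en x (n - Cc - 1) 1)"
definition "fY x n = (if n \<le> Cc then 0 else en x (n - Cc - 1) 2)"

lemma KXY:
  assumes "t \<le> Suc (Tt x)"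
  shows "KK x (Hh x t) n = (if n < Cc + 1 + t then fK x n else 0)"
    "XX x (Hh x t) n = (if n < Cc + 1 + t then fX x n else 0)"
    "YY x (Hh x t) n = (if n < Cc + 1 + t then fY x n else 0)"
  using fld_Hh[OF assms] by (auto simp: KK_def XX_def YY_def fK_def fX_def fY_def)

end

section \<open>Correctness of the recorded run for a sequence of sparse powers of two\<close>

locale ramrun = ram +
  fixes x :: nat and A \<omega> :: "nat \<Rightarrow> nat"
  assumes wfP: "wf_program P"
    and A: "\<And>i. i < Tt x \<Longrightarrow> A i = 2 ^ \<omega> i"
    and \<omega>: "\<And>i j. i < Tt x \<Longrightarrow> j < i \<Longrightarrow> gf (NN x) (ww x) (\<omega> j) < \<omega> i" "\<And>i. i < Tt x \<Longrightarrow> gf (NN x) (ww x) 0 < \<omega> i"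
begin

abbreviation "T \<equiv> Tt x"
abbreviation "c t \<equiv> run P A x t"
text \<open>The number of earlier \<open>ALN\<close> nodes is the index of the call that produced
  node \<open>n\<close>.\<close>

definition "cnt n = card {m. m < n \<and> fK x m = 3}"
definition "Om n = \<omega> (cnt n)"
definition "V = vv (fK x) (fX x) (fY x) Om"

lemma cnt_Suc: "cnt (Suc n) = cnt n + of_bool (fK x n = 3)"
proof -
  have "{m. m < Suc n \<and> fK x m = 3} = {m. m < n \<and> fK x m = 3} \<union> (if fK x n = 3 then {n} else {})"
    by (auto simp: less_Suc_eq)
  then show ?thesis unfolding cnt_def by simp
qed

lemma cnt_mono: "m \<le> n \<Longrightarrow> cnt m \<le> cnt n"
  by (induction rule: dec_induct) (auto simp: cnt_Suc)

lemma cnt_0: "n \<le> Cc + 1 \<Longrightarrow> cnt n = 0"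
  by (simp add: cnt_def fK_def)

lemma cnt_le: "cnt (Cc + 1 + t) \<le> t"
proof (induction t)
  case 0
  show ?case using cnt_0[of "Cc + 1"] by simp
qed (simp add: cnt_Suc)

lemma V_const: "n < Cc \<Longrightarrow> V n = n" "V Cc = x"
  unfolding V_def by (subst vv.simps, simp add: fK_def fX_def)+

text \<open>The value written by step \<open>s\<close> may be the node of that very step, hence the
  bound \<open>Cc + 2 + s\<close>; addresses always refer to older nodes.\<close>

definition J :: "nat \<Rightarrow> bool" where
  "J t \<longleftrightarrow> (\<forall>s<t. (fK x (Cc + 1 + s) \<noteq> 0 \<longrightarrow> fK x (Cc + 1 + s) \<noteq> 3 \<longrightarrow> fX x (Cc + 1 + s) < Cc + 1 + s \<and> fY x (Cc + 1 + s) < Cc + 1 + s)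
     \<and> (fK x (Cc + 1 + s) = 0 \<longrightarrow> fX x (Cc + 1 + s) = 0)
     \<and> en x s 3 < Cc + 1 + s \<and> en x s 4 < Cc + 2 + s
     \<and> regs (c (Suc s)) = (regs (c s))(V (en x s 3) := V (en x s 4))
     \<and> pc (c (Suc s)) = en x s 5 \<and> en x s 5 \<le> Cc
     \<and> ncalls (c (Suc s)) = cnt (Cc + 1 + Suc s))"

text \<open>With \<open>ww x = 2 * y\<close> the two factors are at most \<open>2 ^ (N + 2)\<close>
  and \<open>2 ^ (y + 1)\<close>, and \<open>N + 3 < y\<close>.\<close>

lemma big_ok: "(2 * NN x + 3) * (ww x + (NN x + 1) * (ww0 x * 2 ^ NN x)) < 2 ^ ww x"
proof -
  define N w0 where "N = NN x" and "w0 = ww0 x"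
  define y where "y = 2 * N + w0 + 4"
  have w: "ww x = 2 * y" by (simp add: ww_def y_def N_def w0_def)
  have N3: "N \<ge> 3" by (simp add: N_def NN_def)
  have l: "k + 1 \<le> 2 ^ k" for k :: nat using less_exp[of k] by (simp add: Suc_le_eq)
  have a: "2 * N + 3 \<le> 2 ^ (N + 2)" using l[of N] by simp
  have "(N + 1) * (w0 * 2 ^ N) \<le> 2 ^ N * (2 ^ w0 * 2 ^ N)" using l[of N] l[of w0] by (intro mult_le_mono) auto
  also have "\<dots> = 2 ^ (2 * N + w0)" by (simp add: power_add mult_2)
  also have "\<dots> \<le> 2 ^ y" by (rule power_increasing) (auto simp: y_def)
  finally have b: "(N + 1) * (w0 * 2 ^ N) \<le> 2 ^ y" .
  have "y = Suc (y - 1)" by (simp add: y_def)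
  then have "2 * y \<le> 2 ^ y" using l[of "y - 1"] by (metis Suc_eq_plus1 mult_le_mono2 power_Suc)
  then have "2 * y + (N + 1) * (w0 * 2 ^ N) \<le> 2 ^ (y + 1)" using b by simp
  then have "(2 * N + 3) * (2 * y + (N + 1) * (w0 * 2 ^ N)) \<le> 2 ^ (N + 2) * 2 ^ (y + 1)" using a by (intro mult_le_mono)
  also have "\<dots> = 2 ^ (N + 2 + (y + 1))" by (simp add: power_add)
  also have "\<dots> < 2 ^ (2 * y)" by (rule power_strict_increasing) (use N3 in \<open>auto simp: y_def\<close>)
  finally show ?thesis unfolding w N_def w0_def .
qed

lemma slp_t:
  assumes "J t" "t \<le> T"
  shows "slp (KK x (Hh x t)) (XX x (Hh x t)) (YY x (Hh x t)) Om (NN x) (ww x) (ww0 x)"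
proof
  have t: "t \<le> Suc (Tt x)" using assms by simp
  note K = KXY[OF t]
  have s: "n = Cc + 1 + (n - Cc - 1) \<and> n - Cc - 1 < t" if "n < Cc + 1 + t" "\<not> n \<le> Cc" for n using that by auto
  show "XX x (Hh x t) n < n \<and> YY x (Hh x t) n < n" if "n < NN x" "KK x (Hh x t) n \<noteq> 0" "KK x (Hh x t) n \<noteq> 3" for n
  proof -
    have n: "n < Cc + 1 + t" "fK x n \<noteq> 0" "fK x n \<noteq> 3" using that K by (auto split: if_splits)
    then have "\<not> n \<le> Cc" by (auto simp: fK_def)
    then obtain s where s': "n = Cc + 1 + s" "s < t" using s[OF n(1)] by blast
    have "fX x n < n \<and> fY x n < n" using assms(1) n s'(2) unfolding J_def s'(1) by simp
    then show ?thesis unfolding K using n(1) by simp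
  qed
  show "XX x (Hh x t) n < 2 ^ ww0 x" if "n < NN x" "KK x (Hh x t) n = 0" for n
  proof -
    consider "n < Cc" | "n = Cc" | "Cc < n" "n < Cc + 1 + t" | "\<not> n < Cc + 1 + t" by linarith
    then show ?thesis
    proof cases
      case 1
      have "n < 2 ^ ww0 x" using 1 less_exp[of "ww0 x"] unfolding ww0_def by linarith
      then show ?thesis using 1 by (simp add: K fX_def)
    next
      case 2
      have "x < 2 ^ ww0 x" unfolding ww0_def bitlen_le_iff[symmetric] by simp
      then show ?thesis using 2 by (simp add: K fX_def)
    next
      case 3
      then obtain s where s': "n = Cc + 1 + s" "s < t" using s[of n] by (meson not_le)
      have "fK x n = 0" using that(2) 3(2) unfolding K by simp
      then have "fX x n = 0" using assms(1) s'(2) unfolding J_def s'(1) by simp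
      then show ?thesis using 3 by (simp add: K)
    qed (simp add: K)
  qed
  show "\<exists>z. (\<forall>j<n. KK x (Hh x t) j = 3 \<longrightarrow> Om j \<le> z) \<and> gf (NN x) (ww x) z < Om n"
    if "n < NN x" "KK x (Hh x t) n = 3" for n
  proof -
    have n: "n < Cc + 1 + t" "fK x n = 3" using that K by (auto split: if_splits)
    then have "\<not> n \<le> Cc" by (auto simp: fK_def)
    then have "cnt n \<le> n - Cc - 1" using cnt_le[of "n - Cc - 1"] by simp
    then have cT: "cnt n < T" using n \<open>\<not> n \<le> Cc\<close> assms(2) by simp
    have j: "cnt j < cnt n" if "j < n" "KK x (Hh x t) j = 3" for j
    proof -
      have "fK x j = 3" using that K by (auto split: if_splits)
      then show ?thesis using cnt_mono[of "Suc j" n] that by (simp add: cnt_Suc)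
    qed
    have mono: "\<omega> a \<le> \<omega> b" if "a \<le> b" "b < T" for a b
    proof (cases "a = b")
      case False
      have "\<omega> a \<le> NN x * \<omega> a" by (simp add: NN_def)
      also have "\<dots> \<le> gf (NN x) (ww x) (\<omega> a)" by (simp add: gf_def)
      finally show ?thesis using \<omega>(1)[of b a] that False by simp
    qed simp
    \<comment> \<open>The witness \<open>z\<close> is the exponent of the preceding call, or 0 for
      the first call.\<close>
    show ?thesis
    proof (cases "cnt n = 0")
      case True
      then show ?thesis using j \<omega>(2)[OF cT] by (intro exI[of _ 0]) (auto simp: Om_def)
    next
      case False
      then have "gf (NN x) (ww x) (\<omega> (cnt n - 1)) < Om n" unfolding Om_def using \<omega>(1)[OF cT] by simp
      moreover have "Om j \<le> \<omega> (cnt n - 1)" if "j < n" "KK x (Hh x t) j = 3" for j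
        unfolding Om_def by (rule mono) (use j[OF that] cT in auto)
      ultimately show ?thesis by blast
    qed
  qed
  show "1 \<le> ww0 x" "ww0 x \<le> ww x" by (simp_all add: ww0_def ww_def)
  show "(2 * NN x + 3) * (ww x + (NN x + 1) * (ww0 x * 2 ^ NN x)) < 2 ^ ww x" by (rule big_ok)
qed

lemma vv_t: "t \<le> Suc T \<Longrightarrow> n < Cc + 1 + t \<Longrightarrow> vv (KK x (Hh x t)) (XX x (Hh x t)) (YY x (Hh x t)) Om n = V n"
  unfolding V_def by (rule vv_cong) (auto simp: KXY)

lemma EQ_V:
  assumes "J t" "t \<le> T" "i < Cc + 1 + t" "j < Cc + 1 + t"
  shows "EQ x (Hh x t) i j \<longleftrightarrow> V i = V j"
proof -
  interpret slp "KK x (Hh x t)" "XX x (Hh x t)" "YY x (Hh x t)" Om "NN x" "ww x" "ww0 x" by (rule slp_t[OF assms(1,2)])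
  have P: "PNN x = PN" by (simp add: PNN_def PN_def)
  have B: "pe a b < BB x" if "a < FF" "b < FF" for a b
  proof -
    have "pe a b < (a + b + 1) ^ 2" by (rule pe_less)
    also have "\<dots> \<le> (2 * FF) ^ 2" using that by (intro power_mono) auto
    also have "2 * FF = 2 ^ (ww x + NN x + 4)" by (simp add: FF_def power_add)
    also have "(2 ^ (ww x + NN x + 4))\<^sup>2 = BB x" unfolding BB_def power_mult[symmetric] by (simp only: mult.commute)
    finally show ?thesis .
  qed
  have Z: "FF ^ 127 \<le> ZZ x" unfolding FF_def ZZ_def power_mult[symmetric] by (simp add: mult.commute)
  have "\<not> EQ x (Hh x t) i j \<longleftrightarrow> V i \<noteq> V j"
    unfolding EQ_def P not_not
    using game_eq[OF B Z, of i j "rr x"] assms vv_t[of t] by (simp add: NN_def rr_def)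
  then show ?thesis by blast
qed

lemma run_0: "pc (c 0) = 0" "regs (c 0) = (\<lambda>_. 0)(0 := x)" "ncalls (c 0) = 0"
  by (simp_all add: run_def init_config_def)

lemma run_Suc: "c (Suc t) = step P A (c t)"
  by (simp add: run_def)

text \<open>Addresses are known only as nodes, possibly of huge value; comparing them by
  \<open>EQ\<close> replays the assignments to the actual registers faithfully.\<close>

lemma lku_V:
  assumes "J t" "t \<le> T" "i < Cc + 1 + t" "s \<le> t"
  shows "lku x (Hh x t) s i < Cc + 1 + t \<and> V (lku x (Hh x t) s i) = regs (c s) (V i)"
  using assms(4)
proof (induction s)
  case 0
  have "EQ x (Hh x t) i 0 \<longleftrightarrow> V i = V 0" by (rule EQ_V) (use assms in auto)
  moreover have "V 0 = 0" using V_const(1)[of 0] Cc(2) by simp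
  ultimately show ?case using V_const(2) by (simp add: lku_def run_0)
next
  case (Suc s)
  have IH: "lku x (Hh x t) s i < Cc + 1 + t" "V (lku x (Hh x t) s i) = regs (c s) (V i)" using Suc by auto
  have js: "en x s 3 < Cc + 1 + s" "en x s 4 < Cc + 2 + s" "regs (c (Suc s)) = (regs (c s))(V (en x s 3) := V (en x s 4))"
    using assms(1) Suc.prems unfolding J_def by (auto simp: Suc_le_eq)
  have f: "fld x (Hh x t) s 3 = en x s 3" "fld x (Hh x t) s 4 = en x s 4" using fld_Hh[of t x] assms(2) Suc.prems by auto
  have e: "EQ x (Hh x t) (en x s 3) i \<longleftrightarrow> V (en x s 3) = V i" by (rule EQ_V) (use assms js(1) Suc.prems in auto)
  have "lku x (Hh x t) (Suc s) i = (if V (en x s 3) = V i then en x s 4 else lku x (Hh x t) s i)"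
    by (simp add: lku_def f e)
  then show ?case using IH js Suc.prems by auto
qed

lemma pcs_ok: "J t \<Longrightarrow> t \<le> T \<Longrightarrow> pcs x (Hh x t) t = pc (c t) \<and> pc (c t) \<le> Cc"
proof (cases t)
  case 0
  then show ?thesis by (simp add: pcs_def run_0)
next
  case (Suc s)
  assume "J t" "t \<le> T"
  then show ?thesis using Suc fld_Hh[of t x 5 s] unfolding J_def by (auto simp: pcs_def)
qed

lemma ncalls_ok: "J t \<Longrightarrow> ncalls (c t) = cnt (Cc + 1 + t)"
  by (cases t) (auto simp: run_0 cnt_0 J_def)

lemma Zb_big: "m \<le> Cc + T + 20 \<Longrightarrow> m < Zb x"
proof -
  assume m: "m \<le> Cc + T + 20"
  have e: "ze x = (Cc + T + 2) + (Cc + 5)" by (simp add: ze_def NN_def)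
  have "Cc + T + 20 < (Cc + T + 3) * 32" by simp
  also have "\<dots> \<le> 2 ^ (Cc + T + 2) * 2 ^ (Cc + 5)"
    using less_exp[of "Cc + T + 2"] by (intro mult_le_mono) (auto simp: power_add)
  also have "\<dots> = Zb x" unfolding Zb_def e power_add ..
  finally show ?thesis using m by simp
qed

lemma en_eq: "ent x (Hh x t) t f \<le> Cc + T + 20 \<Longrightarrow> en x t f = ent x (Hh x t) t f"
  unfolding en_def entc_def using Zb_big by (simp add: min_def) (metis Suc_pred less_Suc_eq_le not_less_zero zero_less_iff_neq_zero)

lemma fKXY_t: "fK x (Cc + 1 + t) = en x t 0" "fX x (Cc + 1 + t) = en x t 1" "fY x (Cc + 1 + t) = en x t 2"
  by (simp_all add: fK_def fX_def fY_def)

lemma J_step: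
  assumes J: "J t" and t: "t < T"
  shows "J (Suc t)"
proof -
  let ?H = "Hh x t"
  let ?R = "regs (c t)"
  let ?n = "Cc + 1 + t"
  have tT: "t \<le> T" using t by simp
  have lk: "lku x ?H t i < ?n" "V (lku x ?H t i) = ?R (V i)" if "i < ?n" for i
    using lku_V[OF J tT that, of t] by auto
  have lkc: "lku x ?H t i < ?n" "V (lku x ?H t i) = ?R i" if "i < Cc" for i
    using lk[of i] V_const(1)[OF that] that by auto
  have eqv: "EQ x ?H i j \<longleftrightarrow> V i = V j" if "i < ?n" "j < ?n" for i j by (rule EQ_V[OF J tT that])
  have pcs: "pcs x ?H t = pc (c t)" "pc (c t) \<le> Cc" using pcs_ok[OF J tT] by auto
  have nc: "ncalls (c t) = cnt ?n" by (rule ncalls_ok[OF J])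
  have C0: "0 < Cc" using Cc(2) by simp
  have V0: "V 0 = 0" using V_const(1)[OF C0] .
  let ?e = "\<lambda>f. ent x ?H t f"
  have Vn: "V ?n = (if kk = 3 then 2 ^ Om ?n else if kk = 1 then V xx + V yy
      else if kk = 2 then V xx * 2 ^ V yy else bitop (bop (kk - 4)) (V xx) (V yy))"
    if "en x t 0 = kk" "en x t 1 = xx" "en x t 2 = yy" "kk \<noteq> 0" "kk \<noteq> 3 \<Longrightarrow> xx < ?n \<and> yy < ?n" for kk xx yy
    unfolding V_def by (subst vv.simps) (use that fKXY_t[of t] in auto)
  have V1: "V (Suc (Cc + t)) = V (en x t 1) + V (en x t 2)" if "en x t 0 = 1" "en x t 1 < ?n" "en x t 2 < ?n"
    using Vn[OF that(1) refl refl] that by simp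
  have V2: "V (Suc (Cc + t)) = V (en x t 1) * 2 ^ V (en x t 2)" if "en x t 0 = 2" "en x t 1 < ?n" "en x t 2 < ?n"
    using Vn[OF that(1) refl refl] that by simp
  have V3: "V (Suc (Cc + t)) = 2 ^ Om ?n" if "en x t 0 = 3"
    using Vn[OF that(1) refl refl] that by simp
  have V4: "V (Suc (Cc + t)) = bitop (bop k) (V (en x t 1)) (V (en x t 2))" if "en x t 0 = 4 + k" "en x t 1 < ?n" "en x t 2 < ?n" for k
    using Vn[OF that(1) refl refl] that by simp
  \<comment> \<open>Once the six entries are in range they are stored uncut, so for each instruction
    only its effect on the configuration remains to be compared.\<close>
  have concl: "J (Suc t)" if bnd: "?e 0 \<le> 12" "?e 1 < ?n" "?e 2 < ?n" "?e 3 < ?n" "?e 4 < ?n + 1" "?e 5 \<le> Cc"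
    and k0: "?e 0 = 0 \<Longrightarrow> ?e 1 = 0"
    and main: "\<lbrakk>en x t 0 = ?e 0; en x t 1 = ?e 1; en x t 2 = ?e 2\<rbrakk> \<Longrightarrow> regs (c (Suc t)) = ?R(V (?e 3) := V (?e 4)) \<and> pc (c (Suc t)) = ?e 5
        \<and> ncalls (c (Suc t)) = cnt ?n + of_bool (?e 0 = 3)"
  proof -
    have en: "en x t 0 = ?e 0" "en x t 1 = ?e 1" "en x t 2 = ?e 2" "en x t 3 = ?e 3" "en x t 4 = ?e 4" "en x t 5 = ?e 5"
      by (rule en_eq, use bnd t in linarith)+
    have "cnt (Cc + 1 + Suc t) = cnt ?n + of_bool (?e 0 = 3)" using cnt_Suc[of ?n] fKXY_t(1)[of t] en(1) by simp
    with main[OF en(1-3)] bnd k0 J en show ?thesis unfolding J_def less_Suc_eq fKXY_t by auto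
  qed
  show ?thesis
  proof (cases "halted P (c t)")
    case True
    then have s: "c (Suc t) = c t" by (simp add: run_Suc step_def)
    have p: "pick P (pc (c t)) f d = (if pc (c t) < length P then f Halt else d)" for f and d :: nat
      using True by (auto simp: pick_def halted_def)
    have e: "?e 0 = 0" "?e 1 = 0" "?e 2 = 0" "?e 3 = 0" "?e 4 = lku x ?H t 0" "?e 5 = pc (c t)"
      by (simp_all add: ent_def pcs p eK_def eX_def eY_def eA_def eW_def eP_def)
    show ?thesis
      by (rule concl, unfold e) (use lkc[OF C0] pcs nc s V0 in auto)
  next
    case False
    then have pl: "pc (c t) < length P" and nh: "P ! pc (c t) \<noteq> Halt" by (auto simp: halted_def)
    define ins where "ins = P ! pc (c t)"
    have insP: "ins \<in> set P" using pl by (simp add: ins_def)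
    have cs: "\<And>i. i \<in> csts ins \<Longrightarrow> i < Cc" using Cc(1)[OF insP] .
    have p: "pick P (pc (c t)) f d = f ins" for f and d :: nat using pl by (simp add: pick_def ins_def)
    have e: "?e 0 = eK ins" "?e 1 = eX ins x ?H t" "?e 2 = eY ins x ?H t" "?e 3 = eA ins x ?H t" "?e 4 = eW ins x ?H t" "?e 5 = eP ins x ?H t"
      by (simp_all add: ent_def pcs p)
    note ed = eK_def eX_def eY_def eA_def eW_def eP_def
    have pS: "Suc (pc (c t)) \<le> Cc" using pl Cc(2) by simp
    have st: "c (Suc t) = (let R = ?R; n = pc (c t) + 1 in
      case ins of
        Const i v \<Rightarrow> (c t)\<lparr>pc := n, regs := R(i := v)\<rparr>
      | Copy i j \<Rightarrow> (c t)\<lparr>pc := n, regs := R(i := R j)\<rparr>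
      | Load i j \<Rightarrow> (c t)\<lparr>pc := n, regs := R(i := R (R j))\<rparr>
      | Store i j \<Rightarrow> (c t)\<lparr>pc := n, regs := R(R i := R j)\<rparr>
      | Add i j k \<Rightarrow> (c t)\<lparr>pc := n, regs := R(i := R j + R k)\<rparr>
      | Shl i j k \<Rightarrow> (c t)\<lparr>pc := n, regs := R(i := R j * 2 ^ R k)\<rparr>
      | BoolOp f i j k \<Rightarrow> (c t)\<lparr>pc := n, regs := R(i := bitop f (R j) (R k))\<rparr>
      | Jeq i j l \<Rightarrow> (c t)\<lparr>pc := (if R i = R j then l else n)\<rparr>
      | Halt \<Rightarrow> c t
      | ALN i \<Rightarrow> (c t)\<lparr>pc := n, regs := R(i := A (ncalls (c t))), ncalls := Suc (ncalls (c t))\<rparr>)"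
      unfolding run_Suc step_def ins_def using False by simp
    show ?thesis
    proof (cases ins)
      case (Const i v)
      have ic: "i < Cc" "v < Cc" using cs Const by auto
      show ?thesis by (rule concl, unfold e) (use ic C0 pS pcs nc st in \<open>auto simp: ed Const V_const Let_def\<close>)
    next
      case (Copy i j)
      have ic: "i < Cc" "j < Cc" using cs Copy by auto
      show ?thesis by (rule concl, unfold e) (use ic C0 pS pcs nc st lkc[of j] in \<open>auto simp: ed Copy V_const Let_def\<close>)
    next
      case (Load i j)
      have ic: "i < Cc" "j < Cc" using cs Load by auto
      then have j: "lku x ?H t j < ?n" "V (lku x ?H t j) = ?R j" using lkc[of j] cs[of j] by auto
      show ?thesis by (rule concl, unfold e) (use ic C0 pS pcs nc st j lk[OF j(1)] in \<open>auto simp: ed Load V_const Let_def\<close>)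
    next
      case (Store i j)
      have ic: "i < Cc" "j < Cc" using cs Store by auto
      show ?thesis by (rule concl, unfold e) (use ic C0 pS pcs nc st lkc[of i] lkc[of j] in \<open>auto simp: ed Store V_const Let_def\<close>)
    next
      case (Add i j k)
      have ic: "i < Cc" "j < Cc" "k < Cc" using cs Add by auto
      have l: "lku x ?H t j < ?n" "V (lku x ?H t j) = ?R j" "lku x ?H t k < ?n" "V (lku x ?H t k) = ?R k"
        using lkc[of j] lkc[of k] cs[of j] cs[of k] Add by auto
      show ?thesis by (rule concl, unfold e) (use ic C0 pS pcs nc st l V1 in \<open>auto simp: ed Add V_const Let_def\<close>)
    next
      case (Shl i j k)
      have ic: "i < Cc" "j < Cc" "k < Cc" using cs Shl by auto
      have l: "lku x ?H t j < ?n" "V (lku x ?H t j) = ?R j" "lku x ?H t k < ?n" "V (lku x ?H t k) = ?R k"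
        using lkc[of j] lkc[of k] cs[of j] cs[of k] Shl by auto
      show ?thesis by (rule concl, unfold e) (use ic C0 pS pcs nc st l V2 in \<open>auto simp: ed Shl V_const Let_def\<close>)
    next
      case (BoolOp f i j k)
      have ic: "i < Cc" "j < Cc" "k < Cc" using cs BoolOp by auto
      have l: "lku x ?H t j < ?n" "V (lku x ?H t j) = ?R j" "lku x ?H t k < ?n" "V (lku x ?H t k) = ?R k"
        using lkc[of j] lkc[of k] cs[of j] cs[of k] BoolOp by auto
      have f: "bop (bcode f) = f" using wfP insP BoolOp by (intro bop_bcode) (auto simp: wf_program_def)
      show ?thesis by (rule concl, unfold e) (use ic C0 pS pcs nc st l V4[of "bcode f"] f bcode_less[of f] in \<open>auto simp: ed BoolOp V_const Let_def\<close>)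
    next
      case (Jeq i j l)
      have ic: "i < Cc" "j < Cc" "l < Cc" using cs Jeq by auto
      have lk2: "lku x ?H t i < ?n" "V (lku x ?H t i) = ?R i" "lku x ?H t j < ?n" "V (lku x ?H t j) = ?R j"
        using lkc[of i] lkc[of j] cs[of i] cs[of j] Jeq by auto
      show ?thesis by (rule concl, unfold e) (use ic C0 pS pcs nc st lk2 eqv[OF lk2(1,3)] lkc[OF C0] V0 in \<open>auto simp: ed Jeq V_const Let_def\<close>)
    next
      case Halt
      then show ?thesis using nh by (simp add: ins_def)
    next
      case (ALN i)
      have ic: "i < Cc" using cs ALN by auto
      have "cnt ?n < T" using cnt_le[of t] t by simp
      then have a: "A (cnt ?n) = 2 ^ Om ?n" using A by (simp add: Om_def)
      show ?thesis by (rule concl, unfold e) (use ic C0 pS pcs nc st V3 a in \<open>auto simp: ed ALN V_const Let_def\<close>)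
    qed
  qed
qed

lemma J_T: "t \<le> T \<Longrightarrow> J t"
proof (induction t)
  case 0
  then show ?case by (simp add: J_def)
next
  case (Suc t)
  then show ?case by (intro J_step) auto
qed

lemma acc_correct: "EQ x (Hh x T) (lku x (Hh x T) T 0) 0 \<longleftrightarrow> regs (c T) 0 = 0"
proof -
  have C0: "0 < Cc" using Cc(2) by simp
  have V0: "V 0 = 0" using V_const(1)[OF C0] .
  have "lku x (Hh x T) T 0 < Cc + 1 + T" "V (lku x (Hh x T) T 0) = regs (c T) 0"
    using lku_V[OF J_T[OF order_refl] order_refl, of 0 T] V0 by auto
  then show ?thesis using EQ_V[OF J_T[OF order_refl] order_refl, of "lku x (Hh x T) T 0" 0] V0 by simp
qed

end

section \<open>Choosing a suitable sequence from an ALS set\<close>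

lemma ALS_bump:
  assumes "ALS S" "A \<in> S"
  shows "\<exists>B\<in>S. B i = A i + d \<and> (\<forall>j<i. B j = A j)"
proof (induction d)
  case (Suc d)
  then obtain B where "B \<in> S" "B i = A i + d" "\<forall>j<i. B j = A j" by blast
  moreover from this(1) assms(1) obtain B' where "B' \<in> S" "B' i = B i + 1" "\<forall>j<i. B' j = B j" unfolding ALS_def by blast
  ultimately show ?case by (intro bexI[of _ B']) auto
qed (use assms in auto)

text \<open>Raising entry \<open>i\<close> preserves the entries before it but may change all later
  ones. The entries are therefore settled from left to right, each raised to a power of two whose
  exponent exceeds the requirements of those already chosen.\<close>

lemma ALS_choose:
  assumes "ALS S"
  shows "\<exists>A\<in>S. \<exists>\<omega>. \<forall>i<T. A i = 2 ^ \<omega> i \<and> (\<forall>j<i. g (\<omega> j) < \<omega> i) \<and> g 0 < \<omega> i"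
proof (induction T)
  case 0
  then show ?case using assms by (auto simp: ALS_def)
next
  case (Suc T)
  then obtain A \<omega> where A: "A \<in> S" "\<forall>i<T. A i = 2 ^ \<omega> i \<and> (\<forall>j<i. g (\<omega> j) < \<omega> i) \<and> g 0 < \<omega> i" by blast
  define m where "m = A T + (\<Sum>j<T. g (\<omega> j)) + g 0 + 1"
  have "A T \<le> 2 ^ m" using less_exp[of m] unfolding m_def by linarith
  then obtain B where B: "B \<in> S" "B T = 2 ^ m" "\<forall>j<T. B j = A j"
    using ALS_bump[OF assms A(1), of T "2 ^ m - A T"] by auto
  have gj: "g (\<omega> j) < m" if "j < T" for j
  proof -
    have "g (\<omega> j) \<le> (\<Sum>j<T. g (\<omega> j))" using that by (intro member_le_sum) auto
    then show ?thesis by (simp add: m_def)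
  qed
  show ?case
  proof (intro bexI[OF _ B(1)] exI[of _ "\<omega>(T := m)"] allI impI)
    fix i assume "i < Suc T"
    then show "B i = 2 ^ (\<omega>(T := m)) i \<and> (\<forall>j<i. g ((\<omega>(T := m)) j) < (\<omega>(T := m)) i) \<and> g 0 < (\<omega>(T := m)) i"
      using A(2) B gj by (cases "i = T") (auto simp: m_def)
  qed
qed

context ram begin

lemma app_bound: "t \<le> Suc (Tt x) \<Longrightarrow> Hh x t \<le> PH x"
proof -
  assume t: "t \<le> Suc (Tt x)"
  have "dg x i < 2 ^ ze x" for i unfolding dg_def en_def using entc_less(2) by (simp add: Zb_def)
  from digits(1)[where d="dg x" and z="ze x", OF this, where n="6 * t"] have "Hh x t < 2 ^ (ze x * (6 * t))" unfolding Hh_digits[OF t] .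
  also have "\<dots> \<le> PH x" unfolding PH_def using t by (intro power_increasing mult_le_mono2) auto
  finally show ?thesis by simp
qed

lemma PSp_accept: "PSp 1 (\<lambda>e. \<not> EQ (e 0) (Hh (e 0) (Tt (e 0))) (lku (e 0) (Hh (e 0) (Tt (e 0))) (Tt (e 0)) 0) 0)"
proof -
  have "PS 1 (\<lambda>e. Hh (e 0) (Tt (e 0)))"
    unfolding Hh_def
  proof (rule PS_rec_PS[where b = "\<lambda>e. PH (e 0)"])
    show "rec_nat 0 (\<lambda>t H. app (e 0) H t) n \<le> PH (e 0)" if "n \<le> Tt (e 0)" for e n
      using app_bound[of n "e 0"] that by (simp add: Hh_def)
  qed (intro PS_intros; simp)+
  then show ?thesis by (intro PS_intros) simp_all
qed

end

text \<open>The condition evaluated in polynomial space mentions no sequence at all. For the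
  analysis of a single input one sequence is drawn from the ALS set belonging to that input.\<close>

theorem ASRAM_PTIME_subset: "L \<in> ASRAM_PTIME \<Longrightarrow> bits ` L \<in> PSPACE"
proof -
  assume "L \<in> ASRAM_PTIME"
  then obtain P where P: "wf_program P" "asram_poly_time P" "asram_recognises P L" by (auto simp: ASRAM_PTIME_def)
  obtain cT kT where T: "\<And>inp A. halted P (run P A inp (cT * (bitlen inp + 1) ^ kT))"
    using P(2) by (auto simp: asram_poly_time_def)
  obtain f where f: "asram_computes P f" "\<And>x. f x \<noteq> 0 \<longleftrightarrow> x \<in> L" using P(3) by (auto simp: asram_recognises_def)
  define Cc where "Cc = Suc (Max (insert (length P) (\<Union>(csts ` set P))))"
  have fin: "finite (insert (length P) (\<Union>(csts ` set P)))"
  proof -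
    have "finite (csts ins)" for ins by (cases ins) auto
    then show ?thesis by auto
  qed
  interpret ram P cT kT Cc
    by unfold_locales (use Max_ge[OF fin] in \<open>auto simp: Cc_def less_Suc_eq_le\<close>)
  have acc: "\<not> EQ x (Hh x (Tt x)) (lku x (Hh x (Tt x)) (Tt x) 0) 0 \<longleftrightarrow> x \<in> L" for x
  proof -
    obtain S where S: "ALS S" "\<forall>A\<in>S. \<exists>t. halted P (run P A x t) \<and> regs (run P A x t) 0 = f x"
      using f(1) unfolding asram_computes_def by blast
    obtain A where AS: "A \<in> S" and "\<exists>\<omega>. \<forall>i<Tt x. A i = 2 ^ \<omega> i \<and> (\<forall>j<i. gf (NN x) (ww x) (\<omega> j) < \<omega> i) \<and> gf (NN x) (ww x) 0 < \<omega> i"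
      using ALS_choose[OF S(1), of "Tt x" "gf (NN x) (ww x)"] by (rule bexE)
    from this(2) obtain \<omega> where A: "\<forall>i<Tt x. A i = 2 ^ \<omega> i \<and> (\<forall>j<i. gf (NN x) (ww x) (\<omega> j) < \<omega> i) \<and> gf (NN x) (ww x) 0 < \<omega> i" by (rule exE)
    interpret ramrun P cT kT Cc x A \<omega> by unfold_locales (use P(1) A in auto)
    obtain t where t: "halted P (run P A x t)" "regs (run P A x t) 0 = f x" using S(2) AS by blast
    have fix': "run P A x (s + d) = run P A x s" if "halted P (run P A x s)" for s d
    proof (induction d)
      case (Suc d)
      then show ?case using that run_Suc[of "s + d"] by (simp add: step_def)
    qed simp
    \<comment> \<open>The time bound holds for every sequence, and a halted configuration no longer
      changes, so the state at the clock time carries the result.\<close>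
    have h: "halted P (run P A x (Tt x))" using T by (simp add: Tt_def)
    have "run P A x t = run P A x (Tt x)"
    proof (cases "t \<le> Tt x")
      case True
      then show ?thesis using fix'[OF t(1), of "Tt x - t"] by simp
    next
      case False
      then show ?thesis using fix'[OF h, of "t - Tt x"] by simp
    qed
    then show ?thesis using acc_correct t(2) f(2)[of x] by simp
  qed
  have "PSp 1 (\<lambda>e. e 0 \<in> L)" using PSp_accept unfolding acc .
  then have "PS 1 (\<lambda>e. if e 0 \<in> L then 1 else 0)" by (simp add: PSp_def)
  then show ?thesis by (rule PS_PSPACE[of "\<lambda>x. if x \<in> L then 1 else 0"]) simp
qed

section \<open>A small imperative language with arrays, compiled to RAM code\<close>

datatype com = Set nat nat | Mv nat nat | Ad nat nat nat | Sf nat nat nat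
  | Bo "bool \<Rightarrow> bool \<Rightarrow> bool" nat nat nat | Get nat nat nat | Put nat nat nat
  | Sq com com | For nat nat com | Ife nat nat com com

type_synonym stat = "(nat \<Rightarrow> nat) \<times> (nat \<Rightarrow> nat \<Rightarrow> nat)"

definition upd :: "nat \<Rightarrow> nat \<Rightarrow> stat \<Rightarrow> stat" where
  "upd v n s = ((fst s)(v := n), snd s)"

definition updA :: "nat \<Rightarrow> nat \<Rightarrow> nat \<Rightarrow> stat \<Rightarrow> stat" where
  "updA a i n s = (fst s, (snd s)(a := (snd s a)(i := n)))"

lemma upd_simps [simp]: "fst (upd v n s) = (fst s)(v := n)" "snd (upd v n s) = snd s"
  "fst (updA a i n s) = fst s" "snd (updA a i n s) = (snd s)(a := (snd s a)(i := n))"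
  by (simp_all add: upd_def updA_def)

primrec ev :: "com \<Rightarrow> stat \<Rightarrow> stat" where
  "ev (Set v n) s = upd v n s"
| "ev (Mv v w) s = upd v (fst s w) s"
| "ev (Ad v w u) s = upd v (fst s w + fst s u) s"
| "ev (Sf v w u) s = upd v (fst s w * 2 ^ fst s u) s"
| "ev (Bo f v w u) s = upd v (bitop f (fst s w) (fst s u)) s"
| "ev (Get v a w) s = upd v (snd s a (fst s w)) s"
| "ev (Put a w v) s = updA a (fst s w) (fst s v) s"
| "ev (Sq c d) s = ev d (ev c s)"
| "ev (For i n c) s = ((\<lambda>s. upd i (Suc (fst (ev c s) i)) (ev c s)) ^^ fst s n) (upd i 0 s)"
| "ev (Ife v w c d) s = (if fst s v = fst s w then ev c s else ev d s)"

text \<open>The exact number of instructions executed by the compiled code: six to compute the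
  address of an array element, and four per round of a loop for test, increment and jump
  back.\<close>

primrec tm :: "com \<Rightarrow> stat \<Rightarrow> nat" where
  "tm (Set v n) s = 1"
| "tm (Mv v w) s = 1"
| "tm (Ad v w u) s = 1"
| "tm (Sf v w u) s = 1"
| "tm (Bo f v w u) s = 1"
| "tm (Get v a w) s = 7"
| "tm (Put a w v) s = 7"
| "tm (Sq c d) s = tm c s + tm d (ev c s)"
| "tm (For i n c) s = 2 + (\<Sum>k<fst s n. 4 + tm c (((\<lambda>s. upd i (Suc (fst (ev c s) i)) (ev c s)) ^^ k) (upd i 0 s)))"
| "tm (Ife v w c d) s = (if fst s v = fst s w then 1 + tm c s else 2 + tm d s)"

primrec asg :: "com \<Rightarrow> nat set" where
  "asg (Set v n) = {v}"
| "asg (Mv v w) = {v}"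
| "asg (Ad v w u) = {v}"
| "asg (Sf v w u) = {v}"
| "asg (Bo f v w u) = {v}"
| "asg (Get v a w) = {v}"
| "asg (Put a w v) = {}"
| "asg (Sq c d) = asg c \<union> asg d"
| "asg (For i n c) = insert i (asg c)"
| "asg (Ife v w c d) = asg c \<union> asg d"

primrec wfc :: "nat \<Rightarrow> nat \<Rightarrow> com \<Rightarrow> bool" where
  "wfc NA NV (Set v n) = (v < NV)"
| "wfc NA NV (Mv v w) = (v < NV \<and> w < NV)"
| "wfc NA NV (Ad v w u) = (v < NV \<and> w < NV \<and> u < NV)"
| "wfc NA NV (Sf v w u) = (v < NV \<and> w < NV \<and> u < NV)"
| "wfc NA NV (Bo f v w u) = (v < NV \<and> w < NV \<and> u < NV \<and> \<not> f False False)"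
| "wfc NA NV (Get v a w) = (v < NV \<and> w < NV \<and> a < NA)"
| "wfc NA NV (Put a w v) = (v < NV \<and> w < NV \<and> a < NA)"
| "wfc NA NV (Sq c d) = (wfc NA NV c \<and> wfc NA NV d)"
| "wfc NA NV (For i n c) = (i < NV \<and> n < NV \<and> i \<noteq> n \<and> i \<notin> asg c \<and> n \<notin> asg c \<and> wfc NA NV c)"
| "wfc NA NV (Ife v w c d) = (v < NV \<and> w < NV \<and> wfc NA NV c \<and> wfc NA NV d)"

lemma ev_unasg: "v \<notin> asg c \<Longrightarrow> fst (ev c s) v = fst s v"
proof (induction c arbitrary: s)
  case (For i n c)
  have "fst (((\<lambda>s. upd i (Suc (fst (ev c s) i)) (ev c s)) ^^ k) (upd i 0 s)) v = fst s v" for k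
    by (induction k) (use For in auto)
  then show ?case by simp
qed (auto split: if_splits)

text \<open>The variables that bound loops.\<close>

primrec lv :: "com \<Rightarrow> nat set" where
  "lv (Set v n) = {}"
| "lv (Mv v w) = {}"
| "lv (Ad v w u) = {}"
| "lv (Sf v w u) = {}"
| "lv (Bo f v w u) = {}"
| "lv (Get v a w) = {}"
| "lv (Put a w v) = {}"
| "lv (Sq c d) = lv c \<union> lv d"
| "lv (For i n c) = insert n (lv c)"
| "lv (Ife v w c d) = lv c \<union> lv d"

text \<open>Running time depends on the loop bounds and not on the size of the numbers processed. As
  no loop bound is assigned in the program, all bounds can be read off from the initial
  state.\<close>

lemma time_bound:
  "\<exists>K d. \<forall>s M. asg c \<inter> lv c = {} \<longrightarrow> (\<forall>n\<in>lv c. fst s n \<le> M) \<longrightarrow> tm c s \<le> K * (M + 1) ^ d"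
proof (induction c)
  case (Sq c1 c2)
  then obtain K1 d1 K2 d2 where
    1: "\<And>s M. asg c1 \<inter> lv c1 = {} \<Longrightarrow> (\<forall>n\<in>lv c1. fst s n \<le> M) \<Longrightarrow> tm c1 s \<le> K1 * (M + 1) ^ d1" and
    2: "\<And>s M. asg c2 \<inter> lv c2 = {} \<Longrightarrow> (\<forall>n\<in>lv c2. fst s n \<le> M) \<Longrightarrow> tm c2 s \<le> K2 * (M + 1) ^ d2" by metis
  have "tm (Sq c1 c2) s \<le> (K1 + K2) * (M + 1) ^ (d1 + d2)"
    if a: "asg (Sq c1 c2) \<inter> lv (Sq c1 c2) = {}" "\<forall>n\<in>lv (Sq c1 c2). fst s n \<le> M" for s M
  proof -
    have "fst (ev c1 s) n \<le> M" if "n \<in> lv c2" for n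
    proof -
      have "n \<notin> asg c1" using a(1) that by auto
      then show ?thesis using ev_unasg[of n c1 s] a(2) that by simp
    qed
    then have "tm c1 s \<le> K1 * (M + 1) ^ d1" "tm c2 (ev c1 s) \<le> K2 * (M + 1) ^ d2"
      using 1[of s M] 2[of "ev c1 s" M] a by auto
    moreover have "K1 * (M + 1) ^ d1 \<le> K1 * (M + 1) ^ (d1 + d2)" "K2 * (M + 1) ^ d2 \<le> K2 * (M + 1) ^ (d1 + d2)"
      by (intro mult_le_mono2 power_increasing; simp)+
    ultimately show ?thesis unfolding tm.simps add_mult_distrib by linarith
  qed
  then show ?case by blast
next
  case (For i n c)
  then obtain K d where 1: "\<And>s M. asg c \<inter> lv c = {} \<Longrightarrow> (\<forall>n\<in>lv c. fst s n \<le> M) \<Longrightarrow> tm c s \<le> K * (M + 1) ^ d" by metis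
  have "tm (For i n c) s \<le> (K + 6) * (M + 1) ^ Suc d"
    if a: "asg (For i n c) \<inter> lv (For i n c) = {}" "\<forall>n\<in>lv (For i n c). fst s n \<le> M" for s M
  proof -
    let ?it = "\<lambda>k. ((\<lambda>s. upd i (Suc (fst (ev c s) i)) (ev c s)) ^^ k) (upd i 0 s)"
    have v: "fst (?it k) v = fst s v" if "v \<in> lv c" for k v
    proof -
      have "v \<notin> asg c" "v \<noteq> i" using a(1) that by auto
      then show ?thesis by (induction k) (simp_all add: ev_unasg)
    qed
    have "tm c (?it k) \<le> K * (M + 1) ^ d" for k
      by (rule 1) (use a v[of _ k] in auto)
    then have "(\<Sum>k<fst s n. 4 + tm c (?it k)) \<le> (\<Sum>k<fst s n. 4 + K * (M + 1) ^ d)" by (intro sum_mono add_mono) auto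
    also have "\<dots> \<le> M * (4 + K * (M + 1) ^ d)" using a by simp
    also have "\<dots> + 2 \<le> (M + 1) * ((K + 6) * (M + 1) ^ d)"
    proof -
      have "4 + K * (M + 1) ^ d + 2 \<le> (K + 6) * (M + 1) ^ d" using one_le_power[of "M + 1" d] unfolding add_mult_distrib by linarith
      then have "(M + 1) * (4 + K * (M + 1) ^ d + 2) \<le> (M + 1) * ((K + 6) * (M + 1) ^ d)" by (rule mult_le_mono2)
      moreover have "M * (4 + K * (M + 1) ^ d) + 2 \<le> (M + 1) * (4 + K * (M + 1) ^ d + 2)" by (simp add: algebra_simps)
      ultimately show ?thesis by linarith
    qed
    also have "\<dots> = (K + 6) * (M + 1) ^ Suc d" by (simp only: power_Suc mult.left_commute)
    finally show ?thesis by simp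
  qed
  then show ?case by blast
next
  case (Ife v w c1 c2)
  then obtain K1 d1 K2 d2 where
    1: "\<And>s M. asg c1 \<inter> lv c1 = {} \<Longrightarrow> (\<forall>n\<in>lv c1. fst s n \<le> M) \<Longrightarrow> tm c1 s \<le> K1 * (M + 1) ^ d1" and
    2: "\<And>s M. asg c2 \<inter> lv c2 = {} \<Longrightarrow> (\<forall>n\<in>lv c2. fst s n \<le> M) \<Longrightarrow> tm c2 s \<le> K2 * (M + 1) ^ d2" by metis
  have "tm (Ife v w c1 c2) s \<le> (K1 + K2 + 2) * (M + 1) ^ (d1 + d2)"
    if a: "asg (Ife v w c1 c2) \<inter> lv (Ife v w c1 c2) = {}" "\<forall>n\<in>lv (Ife v w c1 c2). fst s n \<le> M" for s M
  proof -
    have "tm c1 s \<le> K1 * (M + 1) ^ d1" "tm c2 s \<le> K2 * (M + 1) ^ d2"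
      using 1[of s M] 2[of s M] a by auto
    moreover have "K1 * (M + 1) ^ d1 \<le> K1 * (M + 1) ^ (d1 + d2)" "K2 * (M + 1) ^ d2 \<le> K2 * (M + 1) ^ (d1 + d2)"
      by (intro mult_le_mono2 power_increasing; simp)+
    moreover have "1 \<le> (M + 1) ^ (d1 + d2)" by simp
    ultimately have "1 + tm c1 s \<le> (K1 + K2 + 2) * (M + 1) ^ (d1 + d2)" "2 + tm c2 s \<le> (K1 + K2 + 2) * (M + 1) ^ (d1 + d2)"
      unfolding add_mult_distrib by linarith+
    then show ?thesis by (simp only: tm.simps split: if_split) blast
  qed
  then show ?case by blast
qed (rule exI[of _ 7], rule exI[of _ 0], simp)+

text \<open>Element \<open>i\<close> of array \<open>a\<close> has address
  \<open>Suc i * 2 ^ \<kappa> + a\<close>: arrays are interleaved, an address costs one shift and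
  two additions, and registers below \<open>2 ^ \<kappa>\<close> remain for scalars and the
  temporaries \<open>NV\<close>, \<open>NV + 1\<close>. \<open>Jeq 0 0\<close> acts as an
  unconditional jump.\<close>

fun code2 :: "nat \<Rightarrow> nat \<Rightarrow> com \<Rightarrow> nat \<Rightarrow> instr list" where
  "code2 \<kappa> NV (Set v n) off = [Const v n]"
| "code2 \<kappa> NV (Mv v w) off = [Copy v w]"
| "code2 \<kappa> NV (Ad v w u) off = [Add v w u]"
| "code2 \<kappa> NV (Sf v w u) off = [Shl v w u]"
| "code2 \<kappa> NV (Bo f v w u) off = [BoolOp f v w u]"
| "code2 \<kappa> NV (Get v a w) off = [Const NV 1, Add NV NV w, Const (NV + 1) \<kappa>, Shl NV NV (NV + 1), Const (NV + 1) a, Add NV NV (NV + 1), Load v NV]"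
| "code2 \<kappa> NV (Put a w v) off = [Const NV 1, Add NV NV w, Const (NV + 1) \<kappa>, Shl NV NV (NV + 1), Const (NV + 1) a, Add NV NV (NV + 1), Store NV v]"
| "code2 \<kappa> NV (Sq c d) off = (let x = code2 \<kappa> NV c off in x @ code2 \<kappa> NV d (off + length x))"
| "code2 \<kappa> NV (For i n c) off = (let x = code2 \<kappa> NV c (off + 2) in
     [Const i 0, Jeq i n (off + 5 + length x)] @ x @ [Const NV 1, Add i i NV, Jeq 0 0 (off + 1)])"
| "code2 \<kappa> NV (Ife v w c d) off = (let x = code2 \<kappa> NV d (off + 1); y = code2 \<kappa> NV c (off + 2 + length x) in
     [Jeq v w (off + 2 + length x)] @ x @ [Jeq 0 0 (off + 2 + length x + length y)] @ y)"

definition at :: "program \<Rightarrow> nat \<Rightarrow> instr list \<Rightarrow> bool" where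
  "at P off xs \<longleftrightarrow> off + length xs \<le> length P \<and> (\<forall>k<length xs. P ! (off + k) = xs ! k)"

lemma at_Cons [simp]: "at P off (x # xs) \<longleftrightarrow> off < length P \<and> P ! off = x \<and> at P (Suc off) xs"
  by (auto simp: at_def nth_Cons split: nat.splits)

lemma at_append [simp]: "at P off (xs @ ys) \<longleftrightarrow> at P off xs \<and> at P (off + length xs) ys"
proof (induction xs arbitrary: off)
  case Nil
  then show ?case by (auto simp: at_def)
qed simp

definition rel :: "nat \<Rightarrow> nat \<Rightarrow> stat \<Rightarrow> (nat \<Rightarrow> nat) \<Rightarrow> bool" where
  "rel \<kappa> NV s R \<longleftrightarrow> (\<forall>v<NV. R v = fst s v) \<and> (\<forall>a<2 ^ \<kappa>. \<forall>i. R (Suc i * 2 ^ \<kappa> + a) = snd s a i)"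

abbreviation cf :: "nat \<Rightarrow> (nat \<Rightarrow> nat) \<Rightarrow> config" where
  "cf p R \<equiv> \<lparr>pc = p, regs = R, ncalls = 0\<rparr>"

lemma step_simps:
  assumes "p < length P"
  shows "P ! p = Const i v \<Longrightarrow> step P A (cf p R) = cf (Suc p) (R(i := v))"
    "P ! p = Copy i j \<Longrightarrow> step P A (cf p R) = cf (Suc p) (R(i := R j))"
    "P ! p = Load i j \<Longrightarrow> step P A (cf p R) = cf (Suc p) (R(i := R (R j)))"
    "P ! p = Store i j \<Longrightarrow> step P A (cf p R) = cf (Suc p) (R(R i := R j))"
    "P ! p = Add i j k \<Longrightarrow> step P A (cf p R) = cf (Suc p) (R(i := R j + R k))"
    "P ! p = Shl i j k \<Longrightarrow> step P A (cf p R) = cf (Suc p) (R(i := R j * 2 ^ R k))"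
    "P ! p = BoolOp f i j k \<Longrightarrow> step P A (cf p R) = cf (Suc p) (R(i := bitop f (R j) (R k)))"
    "P ! p = Jeq i j t \<Longrightarrow> step P A (cf p R) = cf (if R i = R j then t else Suc p) R"
  using assms by (auto simp: step_def halted_def)

lemma addr_inj: "a < 2 ^ \<kappa> \<Longrightarrow> b < 2 ^ \<kappa> \<Longrightarrow> Suc i * 2 ^ \<kappa> + a = Suc j * 2 ^ \<kappa> + b \<longleftrightarrow> i = j \<and> a = b" for a b :: nat
proof
  assume a: "a < 2 ^ \<kappa>" "b < 2 ^ \<kappa>" and e: "Suc i * 2 ^ \<kappa> + a = Suc j * 2 ^ \<kappa> + b"
  have "(Suc i * 2 ^ \<kappa> + a) div 2 ^ \<kappa> = Suc i" "(Suc j * 2 ^ \<kappa> + b) div 2 ^ \<kappa> = Suc j"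
    using a by (simp_all del: mult_Suc)
  then have "i = j" using e by (metis nat.inject)
  then show "i = j \<and> a = b" using e by simp
qed simp

lemma addr_ge: "2 ^ \<kappa> \<le> Suc i * 2 ^ \<kappa> + (a::nat)" by simp

lemma rel_upd:
  assumes "rel \<kappa> NV s R" "NV + 2 \<le> 2 ^ \<kappa>" "v < NV"
  shows "rel \<kappa> NV (upd v n s) (R(v := n))"
proof -
  have "Suc i * 2 ^ \<kappa> + a \<noteq> v" for i a using addr_ge[of \<kappa> i a] assms(2,3) by linarith
  then show ?thesis using assms(1) by (simp add: rel_def)
qed

lemma rel_tmp:
  assumes "rel \<kappa> NV s R" "NV + 2 \<le> 2 ^ \<kappa>" "v = NV \<or> v = NV + 1"
  shows "rel \<kappa> NV s (R(v := n))"
proof -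
  have "Suc i * 2 ^ \<kappa> + a \<noteq> v" for i a using addr_ge[of \<kappa> i a] assms(2,3) by linarith
  then show ?thesis using assms(1,3) by (auto simp: rel_def)
qed

lemma rel_updA:
  assumes "rel \<kappa> NV s R" "NV + 2 \<le> 2 ^ \<kappa>" "a < 2 ^ \<kappa>"
  shows "rel \<kappa> NV (updA a i n s) (R(Suc i * 2 ^ \<kappa> + a := n))"
proof -
  have "Suc i * 2 ^ \<kappa> + a \<noteq> v" if "v < NV" for v using addr_ge[of \<kappa> i a] assms(2) that by linarith
  then show ?thesis using assms(1) addr_inj[OF _ assms(3)] unfolding rel_def by (simp del: mult_Suc) blast
qed

lemma code_correct:
  assumes "wfc (2 ^ \<kappa>) NV c" "rel \<kappa> NV s R" "at P off (code2 \<kappa> NV c off)" "NV + 2 \<le> 2 ^ \<kappa>"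
  shows "\<exists>R'. rel \<kappa> NV (ev c s) R' \<and> (step P A ^^ tm c s) (cf off R) = cf (off + length (code2 \<kappa> NV c off)) R'"
  using assms
proof (induction c arbitrary: off s R)
  case (Set v n)
  then show ?case using rel_upd[OF Set.prems(2,4), of v n] by (intro exI[of _ "R(v := n)"]) (simp add: step_simps del: fun_upd_apply)
next
  case (Mv v w)
  then have "R w = fst s w" by (simp add: rel_def)
  then show ?case using Mv rel_upd[OF Mv.prems(2,4), of v "R w"] by (intro exI[of _ "R(v := R w)"]) (simp add: step_simps del: fun_upd_apply)
next
  case (Ad v w u)
  then have "R w = fst s w" "R u = fst s u" by (simp_all add: rel_def)
  then show ?case using Ad rel_upd[OF Ad.prems(2,4), of v "R w + R u"] by (intro exI[of _ "R(v := R w + R u)"]) (simp add: step_simps del: fun_upd_apply)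
next
  case (Sf v w u)
  then have "R w = fst s w" "R u = fst s u" by (simp_all add: rel_def)
  then show ?case using Sf rel_upd[OF Sf.prems(2,4), of v "R w * 2 ^ R u"] by (intro exI[of _ "R(v := R w * 2 ^ R u)"]) (simp add: step_simps del: fun_upd_apply)
next
  case (Bo f v w u)
  then have "R w = fst s w" "R u = fst s u" by (simp_all add: rel_def)
  then show ?case using Bo rel_upd[OF Bo.prems(2,4), of v "bitop f (R w) (R u)"]
    by (intro exI[of _ "R(v := bitop f (R w) (R u))"]) (simp add: step_simps del: fun_upd_apply)
next
  case (Get v a w)
  define R1 where "R1 = R(NV := Suc (R w) * 2 ^ \<kappa> + a, NV + 1 := a)"
  have w: "R w = fst s w" "w < NV" "v < NV" "a < 2 ^ \<kappa>" using Get by (simp_all add: rel_def)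
  have r1: "rel \<kappa> NV s R1" unfolding R1_def by (intro rel_tmp Get.prems) auto
  then have "R1 (Suc (fst s w) * 2 ^ \<kappa> + a) = snd s a (fst s w)" using w unfolding rel_def by blast
  moreover have "(step P A ^^ 7) (cf off R) = cf (off + 7) (R1(v := R1 (Suc (fst s w) * 2 ^ \<kappa> + a)))"
    using Get.prems(3) w by (simp add: eval_nat_numeral step_simps R1_def fun_upd_twist)
  ultimately show ?case using rel_upd[OF r1 Get.prems(4) w(3), of "snd s a (fst s w)"] by auto
next
  case (Put a w v)
  define R1 where "R1 = R(NV := Suc (R w) * 2 ^ \<kappa> + a, NV + 1 := a)"
  have w: "R w = fst s w" "R v = fst s v" "w < NV" "v < NV" "a < 2 ^ \<kappa>" using Put by (simp_all add: rel_def)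
  have r1: "rel \<kappa> NV s R1" unfolding R1_def by (intro rel_tmp Put.prems) auto
  moreover have "(step P A ^^ 7) (cf off R) = cf (off + 7) (R1(Suc (fst s w) * 2 ^ \<kappa> + a := fst s v))"
    using Put.prems(3) w by (simp add: eval_nat_numeral step_simps R1_def fun_upd_twist)
  ultimately show ?case using rel_updA[OF r1 Put.prems(4) w(5), of "fst s w" "fst s v"] by auto
next
  case (Sq c d)
  let ?x = "code2 \<kappa> NV c off"
  obtain R1 where R1: "rel \<kappa> NV (ev c s) R1" "(step P A ^^ tm c s) (cf off R) = cf (off + length ?x) R1"
    using Sq.IH(1)[of s R off] Sq.prems by (auto simp: Let_def)
  obtain R2 where R2: "rel \<kappa> NV (ev d (ev c s)) R2" "(step P A ^^ tm d (ev c s)) (cf (off + length ?x) R1)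
     = cf (off + length ?x + length (code2 \<kappa> NV d (off + length ?x))) R2"
    using Sq.IH(2)[OF _ R1(1), of "off + length ?x"] Sq.prems by (auto simp: Let_def)
  have "(step P A ^^ (tm d (ev c s) + tm c s)) (cf off R) = cf (off + length ?x + length (code2 \<kappa> NV d (off + length ?x))) R2"
    unfolding funpow_add o_apply R1(2) R2(2) ..
  then show ?case using R2(1) by (intro exI[of _ R2]) (simp add: Let_def add_ac)
next
  case (For i n c)
  let ?x = "code2 \<kappa> NV c (off + 2)"
  let ?F = "\<lambda>s. upd i (Suc (fst (ev c s) i)) (ev c s)"
  let ?it = "\<lambda>k. (?F ^^ k) (upd i 0 s)"
  have wf: "i < NV" "n < NV" "i \<noteq> n" "i \<notin> asg c" "n \<notin> asg c" "wfc (2 ^ \<kappa>) NV c" using For.prems by auto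
  have at: "off + 5 + length ?x \<le> length P" "P ! off = Const i 0" "P ! (off + 1) = Jeq i n (off + 5 + length ?x)" "at P (off + 2) ?x"
    "P ! (off + 2 + length ?x) = Const NV 1" "P ! (off + 3 + length ?x) = Add i i NV" "P ! (off + 4 + length ?x) = Jeq 0 0 (off + 1)"
    using For.prems(3) by (auto simp: Let_def at_def[of P _ "[]"] numeral_eq_Suc)
  have in_: "fst (?it k) n = fst s n" "fst (?it k) i = k" for k
    by (induction k) (use wf ev_unasg[of n c] ev_unasg[of i c] in auto)
  define tt where "tt k = (\<Sum>j<k. 4 + tm c (?it j))" for k
  have body: "\<exists>R'. rel \<kappa> NV (?it k) R' \<and> (step P A ^^ (1 + tt k)) (cf off R) = cf (off + 1) R'" if "k \<le> fst s n" for k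
    using that
  proof (induction k)
    case 0
    then show ?case using at rel_upd[OF For.prems(2,4) wf(1), of 0]
      by (intro exI[of _ "R(i := 0)"]) (simp add: step_simps tt_def del: fun_upd_apply)
  next
    case (Suc k)
    then obtain R1 where R1: "rel \<kappa> NV (?it k) R1" "(step P A ^^ (1 + tt k)) (cf off R) = cf (off + 1) R1" by auto
    have "R1 i = k" "R1 n = fst s n" using R1(1) wf in_ by (simp_all add: rel_def)
    then have ne: "R1 i \<noteq> R1 n" using Suc.prems by simp
    have j: "step P A (cf (off + 1) R1) = cf (off + 2) R1" using at ne by (simp add: step_simps)
    obtain R2 where R2: "rel \<kappa> NV (ev c (?it k)) R2" "(step P A ^^ tm c (?it k)) (cf (off + 2) R1) = cf (off + 2 + length ?x) R2"
      using For.IH[OF wf(6) R1(1) at(4) For.prems(4)] by blast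
    let ?R3 = "R2(NV := 1, i := Suc (R2 i))"
    have "step P A (step P A (step P A (cf (off + 2 + length ?x) R2))) = cf (off + 1) ?R3"
      using at wf(1) by (simp add: step_simps numeral_eq_Suc)
    then have f1: "(step P A ^^ (3 + (tm c (?it k) + (1 + (1 + tt k))))) (cf off R) = cf (off + 1) ?R3"
      unfolding funpow_add[of 3] funpow_add[of "tm c (?it k)"] funpow_add[of 1 "1 + tt k"] o_apply R1(2)
      using j R2(2) by (simp add: numeral_3_eq_3)
    have f2: "3 + (tm c (?it k) + (1 + (1 + tt k))) = 1 + tt (Suc k)" by (simp add: tt_def)
    have f3: "rel \<kappa> NV (?it (Suc k)) ?R3"
    proof -
      have "R2 i = fst (ev c (?it k)) i" using R2(1) wf(1) by (simp add: rel_def)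
      then show ?thesis using rel_upd[OF rel_tmp[OF R2(1) For.prems(4), of NV 1] For.prems(4) wf(1), of "Suc (R2 i)"] by simp
    qed
    show ?case by (rule exI[of _ ?R3], rule conjI, rule f3, rule f1[unfolded f2])
  qed
  obtain R1 where R1: "rel \<kappa> NV (?it (fst s n)) R1" "(step P A ^^ (1 + tt (fst s n))) (cf off R) = cf (off + 1) R1"
    using body[of "fst s n"] by auto
  have "R1 i = R1 n" using R1(1) wf in_ by (simp add: rel_def)
  then have "step P A (cf (off + 1) R1) = cf (off + 5 + length ?x) R1" using at by (simp add: step_simps)
  then have "(step P A ^^ (1 + (1 + tt (fst s n)))) (cf off R) = cf (off + 5 + length ?x) R1"
    unfolding funpow_add[of 1 "1 + tt (fst s n)"] o_apply R1(2) by simp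
  then show ?case using R1(1) by (intro exI[of _ R1]) (simp add: tt_def Let_def)
next
  case (Ife v w c d)
  let ?x = "code2 \<kappa> NV d (off + 1)"
  let ?y = "code2 \<kappa> NV c (off + 2 + length ?x)"
  have at: "off < length P" "P ! off = Jeq v w (off + 2 + length ?x)" "at P (off + 1) ?x" "off + 1 + length ?x < length P"
    "P ! (off + 1 + length ?x) = Jeq 0 0 (off + 2 + length ?x + length ?y)" "at P (off + 2 + length ?x) ?y"
    using Ife.prems(3) by (auto simp: Let_def)
  have vw: "R v = fst s v" "R w = fst s w" using Ife.prems by (simp_all add: rel_def)
  show ?case
  proof (cases "fst s v = fst s w")
    case True
    then have j: "step P A (cf off R) = cf (off + 2 + length ?x) R" using at vw by (simp add: step_simps)
    obtain R1 where R1: "rel \<kappa> NV (ev c s) R1" "(step P A ^^ tm c s) (cf (off + 2 + length ?x) R) = cf (off + 2 + length ?x + length ?y) R1"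
      using Ife.IH(1)[OF _ Ife.prems(2) at(6) Ife.prems(4)] Ife.prems(1) by auto
    have "(step P A ^^ (tm c s + 1)) (cf off R) = cf (off + 2 + length ?x + length ?y) R1"
      unfolding funpow_add o_apply using j R1(2) by simp
    then show ?thesis using True R1(1) by (intro exI[of _ R1]) (simp add: Let_def add_ac)
  next
    case False
    then have j: "step P A (cf off R) = cf (off + 1) R" using at vw by (simp add: step_simps)
    obtain R1 where R1: "rel \<kappa> NV (ev d s) R1" "(step P A ^^ tm d s) (cf (off + 1) R) = cf (off + 1 + length ?x) R1"
      using Ife.IH(2)[OF _ Ife.prems(2) at(3) Ife.prems(4)] Ife.prems(1) by auto
    have "step P A (cf (off + 1 + length ?x) R1) = cf (off + 2 + length ?x + length ?y) R1" using at by (simp add: step_simps)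
    then have "(step P A ^^ (1 + (tm d s + 1))) (cf off R) = cf (off + 2 + length ?x + length ?y) R1"
      unfolding funpow_add[of 1] funpow_add[of "tm d s"] o_apply using j R1(2) by simp
    then show ?thesis using False R1(1) by (intro exI[of _ R1]) (simp add: Let_def add_ac)
  qed
qed

primrec asgA :: "com \<Rightarrow> nat set" where
  "asgA (Set v n) = {}"
| "asgA (Mv v w) = {}"
| "asgA (Ad v w u) = {}"
| "asgA (Sf v w u) = {}"
| "asgA (Bo f v w u) = {}"
| "asgA (Get v a w) = {}"
| "asgA (Put a w v) = {a}"
| "asgA (Sq c d) = asgA c \<union> asgA d"
| "asgA (For i n c) = asgA c"
| "asgA (Ife v w c d) = asgA c \<union> asgA d"

lemma ev_unasgA: "a \<notin> asgA c \<Longrightarrow> snd (ev c s) a = snd s a"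
proof (induction c arbitrary: s)
  case (For i n c)
  have "snd (((\<lambda>s. upd i (Suc (fst (ev c s) i)) (ev c s)) ^^ k) (upd i 0 s)) a = snd s a" for k
    by (induction k) (use For in auto)
  then show ?case by simp
qed (auto split: if_splits)

text \<open>Invariant rule in which scalars and arrays that the loop does not assign keep their
  values automatically, so that invariants mention only what changes.\<close>

lemma For_rule:
  assumes wf: "i \<notin> asg c" "n \<notin> asg c" "i \<noteq> n"
    and init: "I 0 (upd i 0 s)"
    and step: "\<And>k s'. k < fst s n \<Longrightarrow> fst s' i = k \<Longrightarrow> (\<And>v. v \<notin> asg (For i n c) \<Longrightarrow> fst s' v = fst s v) \<Longrightarrow>
      (\<And>a. a \<notin> asgA c \<Longrightarrow> snd s' a = snd s a) \<Longrightarrow> I k s' \<Longrightarrow> I (Suc k) (upd i (Suc k) (ev c s'))"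
  shows "I (fst s n) (ev (For i n c) s)"
proof -
  let ?it = "\<lambda>k. ((\<lambda>s. upd i (Suc (fst (ev c s) i)) (ev c s)) ^^ k) (upd i 0 s)"
  have "fst (?it k) i = k \<and> (\<forall>v. v \<notin> asg (For i n c) \<longrightarrow> fst (?it k) v = fst s v) \<and> (\<forall>a. a \<notin> asgA c \<longrightarrow> snd (?it k) a = snd s a) \<and> I k (?it k)"
    if "k \<le> fst s n" for k
    using that
  proof (induction k)
    case 0
    then show ?case using init by simp
  next
    case (Suc k)
    then have IH: "fst (?it k) i = k" "\<And>v. v \<notin> asg (For i n c) \<Longrightarrow> fst (?it k) v = fst s v"
      "\<And>a. a \<notin> asgA c \<Longrightarrow> snd (?it k) a = snd s a" "I k (?it k)" by auto
    have "fst (ev c (?it k)) i = k" using ev_unasg[OF wf(1)] IH(1) by simp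
    then have e: "?it (Suc k) = upd i (Suc k) (ev c (?it k))" by simp
    have "I (Suc k) (?it (Suc k))" unfolding e by (rule step) (use Suc.prems IH in auto)
    moreover have "fst (?it (Suc k)) v = fst s v" if "v \<notin> asg (For i n c)" for v
      unfolding e using ev_unasg[of v c] IH(2)[OF that] that by simp
    moreover have "snd (?it (Suc k)) a = snd s a" if "a \<notin> asgA c" for a
      unfolding e using ev_unasgA[OF that] IH(3)[OF that] by simp
    moreover have "fst (?it (Suc k)) i = Suc k" unfolding e by simp
    ultimately show ?case by blast
  qed
  then show ?thesis by simp
qed

section \<open>Computing the bit length of the input, and from commands to acceptors\<close>

definition lencode :: program where
  "lencode = [Const 3 1, Const 5 1, Jeq 2 0 8, BoolOp (\<and>) 4 3 0, Add 2 2 4, Add 3 3 3, Add 1 1 5, Jeq 0 0 2,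
     Const 2 0, Const 3 0, Const 4 0, Const 5 0]"

definition s0 :: "nat \<Rightarrow> stat" where
  "s0 x = ((\<lambda>_. 0)(0 := x, 1 := bitlen x), \<lambda>_ _. 0)"

lemma bitop_and_pow2: "bitop (\<and>) (2 ^ k) x = of_bool (bit x k) * 2 ^ k"
proof (rule bit_eqI)
  fix i
  show "bit (bitop (\<and>) (2 ^ k) x) i = bit (of_bool (bit x k) * 2 ^ k :: nat) i"
    by (cases "bit x k") (auto simp: bit_bitop bit_pow2)
qed

text \<open>Equality is the only test, so the low bits of the input are accumulated in register 2
  until they equal the input. Register 3 holds the next power of two and register 1 the number of
  bits; the other registers are cleared afterwards.\<close>

lemma lencode_run:
  assumes "at P 0 lencode"
  shows "run P A x (7 + 6 * bitlen x) = cf 12 (fst (s0 x))"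
proof -
  have p: "length P \<ge> 12" "P \<noteq> []" "P ! 0 = Const 3 1" "P ! 1 = Const 5 1" "P ! 2 = Jeq 2 0 8" "P ! 3 = BoolOp (\<and>) 4 3 0" "P ! 4 = Add 2 2 4"
    "P ! 5 = Add 3 3 3" "P ! 6 = Add 1 1 5" "P ! 7 = Jeq 0 0 2" "P ! 8 = Const 2 0" "P ! 9 = Const 3 0" "P ! 10 = Const 4 0" "P ! 11 = Const 5 0"
    using assms by (auto simp: at_def lencode_def numeral_eq_Suc All_less_Suc2)
  have b3: "step P A (cf 3 R) = cf 4 (R(4 := bitop (\<and>) (R 3) (R 0)))" for R
    using step_simps(7)[of 3 P "(\<and>)" 4 3 0 A R] p by simp
  define R where "R k t = (\<lambda>_::nat. 0::nat)(0 := x, 1 := k, 2 := take_bit k x, 3 := 2 ^ k, 5 := 1, 4 := t)" for k t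
  have loop: "\<exists>t. run P A x (2 + 6 * k) = cf 2 (R k t)" if "k \<le> bitlen x" for k
    using that
  proof (induction k)
    case 0
    have "run P A x 2 = step P A (step P A (cf 0 ((\<lambda>_. 0)(0 := x))))"
      by (simp add: run_def init_config_def numeral_eq_Suc)
    also have "\<dots> = cf 2 (R 0 0)" using p by (auto simp: step_simps R_def fun_eq_iff)
    finally show ?case by auto
  next
    case (Suc k)
    then obtain t where t: "run P A x (2 + 6 * k) = cf 2 (R k t)" by auto
    have "\<not> x < 2 ^ k" using Suc.prems bitlen_le_iff[of x k] by simp
    then have ne: "take_bit k x \<noteq> x" by (metis take_bit_nat_less_exp)
    have "run P A x (2 + 6 * Suc k) = step P A (step P A (step P A (step P A (step P A (step P A (run P A x (2 + 6 * k)))))))"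
      by (simp add: run_def numeral_eq_Suc)
    also have "\<dots> = cf 2 (R (Suc k) (of_bool (bit x k) * 2 ^ k))"
      unfolding t using p ne by (auto simp: step_simps b3 R_def fun_eq_iff bitop_and_pow2 take_bit_Suc_from_most)
    finally show ?case by blast
  qed
  then obtain t where t: "run P A x (2 + 6 * bitlen x) = cf 2 (R (bitlen x) t)" by blast
  have e: "take_bit (bitlen x) x = x" by (simp add: take_bit_nat_eq_self less_two_power_bitlen)
  have "run P A x (7 + 6 * bitlen x) = step P A (step P A (step P A (step P A (step P A (run P A x (2 + 6 * bitlen x))))))"
    by (simp add: run_def numeral_eq_Suc)
  also have "\<dots> = cf 12 (fst (s0 x))"
    unfolding t using p e by (auto simp: step_simps R_def fun_eq_iff s0_def)
  finally show ?thesis .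
qed

lemma wf_code2: "wfc NA NV c \<Longrightarrow> BoolOp f i j k \<in> set (code2 \<kappa> NV c off) \<Longrightarrow> \<not> f False False"
  by (induction c arbitrary: off) (auto simp: Let_def)

text \<open>The compiled code contains no \<open>ALN\<close> call, so the set of all sequences,
  which is an ALS set, serves every input.\<close>

theorem com_ASRAM:
  assumes wf: "wfc (2 ^ \<kappa>) NV c" "6 \<le> NV" "NV + 2 \<le> 2 ^ \<kappa>"
    and time: "\<And>x. tm c (s0 x) \<le> K * (bitlen x + 1) ^ d"
    and spec: "\<And>x. fst (ev c (s0 x)) 0 \<noteq> 0 \<longleftrightarrow> x \<in> L"
  shows "L \<in> ASRAM_PTIME"
proof -
  define P where "P = lencode @ code2 \<kappa> NV c 12"
  have len: "length lencode = 12" by (simp add: lencode_def)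
  have "at P 0 P" by (simp add: at_def)
  then have at: "at P 0 lencode" "at P 12 (code2 \<kappa> NV c 12)" unfolding P_def at_append len by simp_all
  have "rel \<kappa> NV (s0 x) (fst (s0 x))" for x
  proof -
    have "Suc i * 2 ^ \<kappa> + a \<noteq> 0 \<and> Suc i * 2 ^ \<kappa> + a \<noteq> 1" for i a using addr_ge[of \<kappa> i a] wf(2,3) by linarith
    then show ?thesis by (auto simp: rel_def s0_def simp del: mult_Suc)
  qed
  then have fin: "\<exists>R. regs (run P A x (tm c (s0 x) + (7 + 6 * bitlen x))) 0 = fst (ev c (s0 x)) 0
     \<and> pc (run P A x (tm c (s0 x) + (7 + 6 * bitlen x))) = length P" for A x
  proof -
    obtain R' where R': "rel \<kappa> NV (ev c (s0 x)) R'" "(step P A ^^ tm c (s0 x)) (cf 12 (fst (s0 x))) = cf (12 + length (code2 \<kappa> NV c 12)) R'"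
      using code_correct[OF wf(1) \<open>rel \<kappa> NV (s0 x) (fst (s0 x))\<close> at(2) wf(3)] by blast
    have "run P A x (tm c (s0 x) + (7 + 6 * bitlen x)) = (step P A ^^ tm c (s0 x)) (run P A x (7 + 6 * bitlen x))"
      by (simp add: run_def funpow_add)
    also have "\<dots> = cf (length P) R'" unfolding lencode_run[OF at(1)] R'(2) by (simp add: P_def len)
    finally show ?thesis using R'(1) wf(2) by (simp add: rel_def)
  qed
  let ?t = "\<lambda>x. tm c (s0 x) + (7 + 6 * bitlen x)"
  have halt: "halted P (run P A x (?t x))" for A x using fin[of A x] by (simp add: halted_def)
  have fix': "run P A x (t + j) = run P A x t" if "halted P (run P A x t)" for A x t j
  proof (induction j)
    case (Suc j)
    have "run P A x (t + Suc j) = step P A (run P A x (t + j))" by (simp add: run_def)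
    then show ?case using Suc that by (simp add: step_def)
  qed simp
  have wfP: "wf_program P" unfolding wf_program_def P_def using wf_code2[OF wf(1), of _ _ _ _ \<kappa> 12] by (auto simp: lencode_def)
  have "halted P (run P A x ((K + 13) * (bitlen x + 1) ^ Suc d))" for x A
  proof -
    have "7 + 6 * bitlen x \<le> 13 * (bitlen x + 1) ^ Suc d" using power_increasing[of 1 "Suc d" "bitlen x + 1"] by simp
    moreover have "K * (bitlen x + 1) ^ d \<le> K * (bitlen x + 1) ^ Suc d" by (intro mult_le_mono2 power_increasing) auto
    ultimately have "?t x \<le> (K + 13) * (bitlen x + 1) ^ Suc d" using time[of x] unfolding add_mult_distrib by linarith
    then obtain j where "(K + 13) * (bitlen x + 1) ^ Suc d = ?t x + j" using le_Suc_ex by blast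
    then show ?thesis using fix'[OF halt, of A x j] halt[of A x] by simp
  qed
  then have t: "asram_poly_time P" unfolding asram_poly_time_def by - (rule exI[of _ "K + 13"], rule exI[of _ "Suc d"], intro allI)
  have "asram_computes P (\<lambda>x. fst (ev c (s0 x)) 0)"
  proof -
    have "\<exists>B\<in>UNIV. B i = A i + 1 \<and> (\<forall>j<i. B j = A j)" for i and A :: "nat \<Rightarrow> nat"
      by (rule bexI[of _ "A(i := A i + 1)"]) auto
    then have "ALS UNIV" unfolding ALS_def by simp
    moreover have "\<exists>t. halted P (run P A x t) \<and> regs (run P A x t) 0 = fst (ev c (s0 x)) 0" for x A
      by (rule exI[of _ "?t x"]) (use halt[of A x] fin[of A x] in simp)
    ultimately show ?thesis unfolding asram_computes_def by (intro allI exI[of _ UNIV]) simp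
  qed
  then have "asram_recognises P L"
    unfolding asram_recognises_def using spec by - (rule exI[of _ "\<lambda>x. fst (ev c (s0 x)) 0"], rule conjI, assumption, rule allI, assumption)
  then show ?thesis using wfP t unfolding ASRAM_PTIME_def by blast
qed

section \<open>Boolean functions as numbers\<close>

text \<open>A truth table read as a number: bit \<open>p\<close> is the value under the assignment
  given by the binary digits of \<open>p\<close>. Tables vanish beyond \<open>2 ^ V\<close>, so
  negation is taken relative to the table of the constant True.\<close>

definition isc :: "nat \<Rightarrow> nat \<Rightarrow> ((nat \<Rightarrow> bool) \<Rightarrow> bool) \<Rightarrow> bool" where
  "isc V y F \<longleftrightarrow> (\<forall>p. bit y p \<longleftrightarrow> p < 2 ^ V \<and> F (bit p))"

lemma isc_bitop: "isc V x F \<Longrightarrow> isc V y G \<Longrightarrow> \<not> f False False \<Longrightarrow> isc V (bitop f x y) (\<lambda>\<alpha>. f (F \<alpha>) (G \<alpha>))"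
  unfolding isc_def by (rule allI, rename_tac p, case_tac "p < 2 ^ V") (simp_all add: bit_bitop)

lemma isc_cong: "isc V x F \<Longrightarrow> (\<And>\<alpha>. F \<alpha> = G \<alpha>) \<Longrightarrow> isc V x G"
  by (simp add: isc_def)

lemma isc_0: "isc V 0 (\<lambda>_. False)"
  by (simp add: isc_def)

lemma bit_sub: assumes "bit p k" shows "bit (p - 2 ^ k :: nat) = (bit p)(k := False)"
proof -
  have "p = unset_bit k p + 2 ^ k"
  proof (rule bit_eqI)
    fix i show "bit p i = bit (unset_bit k p + 2 ^ k) i"
      by (subst bit_disjunctive_add_iff) (use assms in \<open>auto simp: bit_unset_bit_iff bit_pow2\<close>)
  qed
  then have "p - 2 ^ k = unset_bit k p" by simp
  then show ?thesis by (auto simp: fun_eq_iff bit_unset_bit_iff)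
qed

lemma bit_top: "p < 2 ^ Suc v \<Longrightarrow> bit p v \<longleftrightarrow> 2 ^ v \<le> p" for p :: nat
proof
  assume "p < 2 ^ Suc v" "2 ^ v \<le> p"
  then have "p div 2 ^ v = 1" by (intro div_nat_eqI) auto
  then show "bit p v" by (simp add: bit_iff_odd)
qed (rule bit_imp_le)

text \<open>The copy shifted by \<open>2 ^ 2 ^ v\<close> fills the half in which the new variable
  \<open>v\<close> is true. The table of \<open>v\<close> itself consists of that half alone, see
  \<open>isc_new\<close>.\<close>

lemma isc_double:
  assumes "isc v y F" "\<And>\<alpha>. F (\<alpha>(v := False)) = F \<alpha>"
  shows "isc (Suc v) (bitop (\<or>) y (y * 2 ^ 2 ^ v)) F"
  unfolding isc_def
proof
  fix p :: nat
  have s: "F (bit (p - 2 ^ v)) = F (bit p)" if "bit p v" using bit_sub[OF that] assms(2) by simp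
  have "bit (bitop (\<or>) y (y * 2 ^ 2 ^ v)) p \<longleftrightarrow> bit y p \<or> (2 ^ v \<le> p \<and> bit y (p - 2 ^ v))"
    by (subst bit_bitop) (auto simp: bit_mult_pow2)
  also have "\<dots> \<longleftrightarrow> p < 2 ^ Suc v \<and> F (bit p)"
  proof -
    have y: "bit y q \<longleftrightarrow> q < 2 ^ v \<and> F (bit q)" for q using assms(1) by (simp add: isc_def)
    consider "p < 2 ^ v" | "2 ^ v \<le> p" "p < 2 ^ Suc v" | "2 ^ Suc v \<le> p" by linarith
    then show ?thesis
    proof cases
      case 1
      then show ?thesis by (simp add: y)
    next
      case 2
      then have "bit p v" using bit_top by blast
      then show ?thesis using 2 s by (simp add: y) linarith
    next
      case 3
      then have "\<not> p - 2 ^ v < 2 ^ v" "\<not> p < 2 ^ v" "\<not> p < 2 ^ Suc v" by auto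
      then show ?thesis by (simp only: y simp_thms)
    qed
  qed
  finally show "bit (bitop (\<or>) y (y * 2 ^ 2 ^ v)) p \<longleftrightarrow> p < 2 ^ Suc v \<and> F (bit p)" .
qed

lemma isc_new: assumes "isc v y (\<lambda>_. True)" shows "isc (Suc v) (y * 2 ^ 2 ^ v) (\<lambda>\<alpha>. \<alpha> v)"
  unfolding isc_def
proof
  fix p
  show "bit (y * 2 ^ 2 ^ v) p \<longleftrightarrow> p < 2 ^ Suc v \<and> bit p v"
  proof -
    have y: "bit y q \<longleftrightarrow> q < 2 ^ v" for q using assms by (simp add: isc_def)
    show ?thesis using bit_top[of p v] bit_imp_le[of p v] by (cases "2 ^ v \<le> p") (auto simp: bit_mult_pow2 y)
  qed
qed

text \<open>Quantifier elimination: after a variable has been eliminated only assignments where it is true are kept.\<close>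

definition isq :: "nat \<Rightarrow> nat \<Rightarrow> nat \<Rightarrow> ((nat \<Rightarrow> bool) \<Rightarrow> bool) \<Rightarrow> bool" where
  "isq V k y F \<longleftrightarrow> isc V y (\<lambda>\<alpha>. (\<forall>i<k. \<alpha> i) \<and> F \<alpha>)"

text \<open>Shifting by \<open>2 ^ k\<close> carries the entry of the assignment with digit
  \<open>k\<close> cleared to the one with digit \<open>k\<close> set, where both can be combined. A
  left shift can align them only there; at assignments with digit \<open>k\<close> clear the result
  is meaningless and is masked out by \<open>x\<close>.\<close>

lemma isq_step:
  assumes "isq V k T F" "isc V x (\<lambda>\<alpha>. \<alpha> k)" "k < V" "op = (\<and>) \<or> op = (\<or>)"
  shows "isq V (Suc k) (bitop (\<and>) (bitop op T (T * 2 ^ 2 ^ k)) x) (\<lambda>\<alpha>. op (F (\<alpha>(k := False))) (F (\<alpha>(k := True))))"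
  unfolding isq_def isc_def
proof
  fix p
  have op: "\<not> op False False" "op a b = op b a" for a b using assms(4) by auto
  have T: "bit T p \<longleftrightarrow> p < 2 ^ V \<and> (\<forall>i<k. bit p i) \<and> F (bit p)" for p using assms(1) by (simp add: isq_def isc_def)
  have x: "bit x p \<longleftrightarrow> p < 2 ^ V \<and> bit p k" using assms(2) by (simp add: isc_def)
  show "bit (bitop (\<and>) (bitop op T (T * 2 ^ 2 ^ k)) x) p \<longleftrightarrow>
    p < 2 ^ V \<and> (\<forall>i<Suc k. bit p i) \<and> op (F ((bit p)(k := False))) (F ((bit p)(k := True)))"
  proof (cases "bit p k \<and> p < 2 ^ V")
    case True
    then have le: "2 ^ k \<le> p" using bit_imp_le by blast
    have t: "(bit p)(k := True) = bit p" using True by (auto simp: fun_eq_iff)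
    have s: "bit T (p - 2 ^ k) \<longleftrightarrow> (\<forall>i<k. bit p i) \<and> F ((bit p)(k := False))"
      unfolding T using True less_imp_diff_less[of p "2 ^ V" "2 ^ k"] by (simp add: bit_sub)
    have "bit (bitop (\<and>) (bitop op T (T * 2 ^ 2 ^ k)) x) p \<longleftrightarrow> op (bit T p) (bit T (p - 2 ^ k))"
      using op True x le by (simp add: bit_bitop bit_mult_pow2)
    then show ?thesis unfolding s T[of p] t using True assms(4) by (auto simp: less_Suc_eq)
  next
    case False
    then show ?thesis using x by (auto simp: bit_bitop)
  qed
qed

text \<open>Variable \<open>k\<close> is quantified outside all smaller ones, universally if
  \<open>Q k\<close> holds, so variable 0 is innermost. This is the order in which
  \<open>isq_step\<close> eliminates.\<close>

primrec psi :: "(nat \<Rightarrow> bool) \<Rightarrow> ((nat \<Rightarrow> bool) \<Rightarrow> bool) \<Rightarrow> nat \<Rightarrow> (nat \<Rightarrow> bool) \<Rightarrow> bool" where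
  "psi Q F 0 \<alpha> = F \<alpha>"
| "psi Q F (Suc k) \<alpha> = (if Q k then psi Q F k (\<alpha>(k := False)) \<and> psi Q F k (\<alpha>(k := True))
      else psi Q F k (\<alpha>(k := False)) \<or> psi Q F k (\<alpha>(k := True)))"

text \<open>A block of consecutive existential variables amounts to one guess of all their
  values.\<close>

lemma psi_ex:
  assumes "\<And>i. k \<le> i \<Longrightarrow> i < k + j \<Longrightarrow> \<not> Q i"
  shows "psi Q F (k + j) \<alpha> \<longleftrightarrow> (\<exists>\<beta>. (\<forall>i. i < k \<or> k + j \<le> i \<longrightarrow> \<beta> i = \<alpha> i) \<and> psi Q F k \<beta>)"
  using assms
proof (induction j arbitrary: \<alpha>)
  case 0
  have "(\<forall>i. i < k \<or> k + 0 \<le> i \<longrightarrow> \<beta> i = \<alpha> i) \<longleftrightarrow> \<beta> = \<alpha>" for \<beta> by (auto simp: fun_eq_iff not_less)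
  then show ?case by simp
next
  case (Suc j)
  have IH: "psi Q F (k + j) \<alpha> \<longleftrightarrow> (\<exists>\<beta>. (\<forall>i. i < k \<or> k + j \<le> i \<longrightarrow> \<beta> i = \<alpha> i) \<and> psi Q F k \<beta>)" for \<alpha>
    by (rule Suc.IH) (use Suc.prems in auto)
  have "psi Q F (k + Suc j) \<alpha> \<longleftrightarrow> (\<exists>b. psi Q F (k + j) (\<alpha>(k + j := b)))"
    using Suc.prems[of "k + j"] by (auto intro: exI[of _ False] exI[of _ True]) (metis (full_types))
  also have "\<dots> \<longleftrightarrow> (\<exists>\<beta>. (\<forall>i. i < k \<or> k + Suc j \<le> i \<longrightarrow> \<beta> i = \<alpha> i) \<and> psi Q F k \<beta>)"
  proof
    assume "\<exists>b. psi Q F (k + j) (\<alpha>(k + j := b))"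
    then obtain b \<beta> where "\<forall>i. i < k \<or> k + j \<le> i \<longrightarrow> \<beta> i = (\<alpha>(k + j := b)) i" "psi Q F k \<beta>" unfolding IH by blast
    then show "\<exists>\<beta>. (\<forall>i. i < k \<or> k + Suc j \<le> i \<longrightarrow> \<beta> i = \<alpha> i) \<and> psi Q F k \<beta>" by (intro exI[of _ \<beta>]) auto
  next
    assume "\<exists>\<beta>. (\<forall>i. i < k \<or> k + Suc j \<le> i \<longrightarrow> \<beta> i = \<alpha> i) \<and> psi Q F k \<beta>"
    then obtain \<beta> where "\<forall>i. i < k \<or> k + Suc j \<le> i \<longrightarrow> \<beta> i = \<alpha> i" "psi Q F k \<beta>" by blast
    moreover from this have "\<beta> i = (\<alpha>(k + j := \<beta> (k + j))) i" if "i < k \<or> k + j \<le> i" for i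
      using that by (cases "i = k + j") auto
    ultimately have "psi Q F (k + j) (\<alpha>(k + j := \<beta> (k + j)))" unfolding IH by blast
    then show "\<exists>b. psi Q F (k + j) (\<alpha>(k + j := b))" by blast
  qed
  finally show ?case .
qed

text \<open>Savitch's trick: \<open>Y = N\<^sup>2\<^sup>t X\<close> is expressed by guessing a middle vector \<open>E\<close> and checking both halves
  with one copy of the formula for \<open>t - 1\<close>; the universal variable selects the half.\<close>

locale savitch =
  fixes m :: nat and Nx :: "(nat \<Rightarrow> bool) \<Rightarrow> (nat \<Rightarrow> bool)" and ini :: "nat \<Rightarrow> bool" and ac :: "(nat \<Rightarrow> bool) \<Rightarrow> bool"
  assumes Nx: "\<And>X k. m \<le> k \<Longrightarrow> \<not> Nx X k" and ini: "\<And>k. m \<le> k \<Longrightarrow> \<not> ini k"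
begin

definition "V = Suc m * Suc m"
text \<open>There are \<open>m + 1\<close> blocks of \<open>m + 1\<close> variables, each a vector
  followed by a selector. Level 0 is outermost, and outer variables have higher numbers, hence the
  count from the top.\<close>

definition "Ev l \<alpha> k \<longleftrightarrow> k < m \<and> \<alpha> (V - 1 - (l * Suc m + k))"

text \<open>After \<open>l\<close> halvings the open goal is that \<open>2 ^ (m - l)\<close> steps
  lead from \<open>XS l\<close> to \<open>YS l\<close>. A true selector picks the half from the
  guessed middle to the end, a false one the half from the start to the middle.\<close>

primrec XS :: "nat \<Rightarrow> (nat \<Rightarrow> bool) \<Rightarrow> nat \<Rightarrow> bool" where
  "XS 0 \<alpha> = ini"
| "XS (Suc l) \<alpha> = (if \<alpha> (V - 1 - (Suc l * Suc m + m)) then Ev (Suc l) \<alpha> else XS l \<alpha>)"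

primrec YS :: "nat \<Rightarrow> (nat \<Rightarrow> bool) \<Rightarrow> nat \<Rightarrow> bool" where
  "YS 0 \<alpha> = Ev 0 \<alpha>"
| "YS (Suc l) \<alpha> = (if \<alpha> (V - 1 - (Suc l * Suc m + m)) then YS l \<alpha> else Ev (Suc l) \<alpha>)"

definition "Qa k \<longleftrightarrow> k mod Suc m = 0"
definition "base \<alpha> \<longleftrightarrow> YS m \<alpha> = Nx (XS m \<alpha>) \<and> ac (YS 0 \<alpha>)"

abbreviation "\<Psi> \<equiv> psi Qa base"

lemma idx: assumes "t < m" shows
  "V - 1 - (Suc (m - Suc t) * Suc m + m) = t * Suc m"
  "k < m \<Longrightarrow> V - 1 - (Suc (m - Suc t) * Suc m + k) = t * Suc m + (m - k)"
proof -
  have "Suc m * Suc m = (t + Suc (m - Suc t) + 1) * Suc m" using assms by simp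
  then have e: "V = t * Suc m + Suc (m - Suc t) * Suc m + Suc m" unfolding V_def by (simp only: add_mult_distrib mult_1)
  show "V - 1 - (Suc (m - Suc t) * Suc m + m) = t * Suc m" unfolding e by simp
  show "k < m \<Longrightarrow> V - 1 - (Suc (m - Suc t) * Suc m + k) = t * Suc m + (m - k)" unfolding e by simp
qed

lemma Ev_dep: assumes "\<And>i. V - Suc l * Suc m \<le> i \<Longrightarrow> \<alpha> i = \<beta> i" "l \<le> m" shows "Ev l \<alpha> = Ev l \<beta>"
proof
  fix k show "Ev l \<alpha> k = Ev l \<beta> k"
  proof (cases "k < m")
    case True
    have "Suc l * Suc m \<le> V" unfolding V_def using assms(2) by (intro mult_le_mono) auto
    then have "V - Suc l * Suc m \<le> V - 1 - (l * Suc m + k)" using True by simp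
    then show ?thesis using assms(1) by (simp add: Ev_def)
  qed (simp add: Ev_def)
qed

lemma XY_dep: assumes "\<And>i. V - Suc l * Suc m \<le> i \<Longrightarrow> \<alpha> i = \<beta> i" "l \<le> m" shows "XS l \<alpha> = XS l \<beta> \<and> YS l \<alpha> = YS l \<beta>"
  using assms
proof (induction l)
  case 0
  then show ?case using Ev_dep[of 0 \<alpha> \<beta>] by simp
next
  case (Suc l)
  have "V - Suc (Suc l) * Suc m \<le> V - Suc l * Suc m" by (intro diff_le_mono2 mult_le_mono) auto
  then have IH: "XS l \<alpha> = XS l \<beta>" "YS l \<alpha> = YS l \<beta>" using Suc by auto
  have "Suc (Suc l) * Suc m \<le> V" unfolding V_def using Suc.prems(2) by (intro mult_le_mono) auto
  then have "V - Suc (Suc l) * Suc m \<le> V - 1 - (Suc l * Suc m + m)" by simp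
  then have b: "\<alpha> (V - 1 - (Suc l * Suc m + m)) = \<beta> (V - 1 - (Suc l * Suc m + m))" by (rule Suc.prems(1))
  show ?case using IH Ev_dep[of "Suc l" \<alpha> \<beta>] Suc.prems b by simp
qed

lemma Qa_not: assumes "t * Suc m < i" "i < Suc t * Suc m" shows "\<not> Qa i"
proof
  assume "Qa i"
  then obtain j where j: "i = j * Suc m" unfolding Qa_def by (metis dvd_div_mult_self mod_eq_0_iff_dvd)
  have "t < j" using assms(1) unfolding j by (simp only: mult_less_cancel2)
  moreover have "j < Suc t" using assms(2) unfolding j by (simp only: mult_less_cancel2)
  ultimately show False by simp
qed

lemma block:
  "\<Psi> (Suc t * Suc m) \<alpha> \<longleftrightarrow> (\<exists>\<beta>. (\<forall>i. i \<le> t * Suc m \<or> Suc t * Suc m \<le> i \<longrightarrow> \<beta> i = \<alpha> i) \<and>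
     \<Psi> (t * Suc m) (\<beta>(t * Suc m := False)) \<and> \<Psi> (t * Suc m) (\<beta>(t * Suc m := True)))"
proof -
  have e: "Suc t * Suc m = Suc (t * Suc m) + m" by simp
  have q: "Qa (t * Suc m)" unfolding Qa_def by (rule mod_mult_self2_is_0)
  have "\<Psi> (Suc t * Suc m) \<alpha> \<longleftrightarrow> (\<exists>\<beta>. (\<forall>i. i < Suc (t * Suc m) \<or> Suc (t * Suc m) + m \<le> i \<longrightarrow> \<beta> i = \<alpha> i) \<and> \<Psi> (Suc (t * Suc m)) \<beta>)"
    unfolding e by (rule psi_ex) (use Qa_not[of t] in \<open>auto simp: Suc_le_eq\<close>)
  then show ?thesis unfolding e using q by (simp add: less_Suc_eq_le)
qed

text \<open>One block further out the existential part guesses a vector and the selector demands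
  both halves. The first half forces the vector to be the middle one, so the number of steps
  doubles.\<close>

lemma levels: "t \<le> m \<Longrightarrow> \<Psi> (t * Suc m) \<alpha> \<longleftrightarrow> YS (m - t) \<alpha> = (Nx ^^ 2 ^ t) (XS (m - t) \<alpha>) \<and> ac (YS 0 \<alpha>)"
proof (induction t arbitrary: \<alpha>)
  case 0
  then show ?case by (simp add: base_def)
next
  case (Suc t)
  define l where "l = m - Suc t"
  have tm: "t < m" using Suc.prems by simp
  have ml: "m - t = Suc l" using tm by (simp add: l_def)
  note idx = idx[OF tm, folded l_def]
  have lV: "V - Suc l * Suc m = Suc t * Suc m"
  proof -
    have "Suc m * Suc m = (Suc t + Suc l) * Suc m" using tm by (simp add: l_def)
    then show ?thesis unfolding V_def by (simp only: add_mult_distrib diff_add_inverse2)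
  qed
  have V0: "Suc t * Suc m \<le> V - Suc 0 * Suc m"
  proof -
    have "V = m * Suc m + Suc m" by (simp add: V_def)
    moreover have "Suc t * Suc m \<le> m * Suc m" using tm by (intro mult_le_mono) auto
    ultimately show ?thesis by simp
  qed
  have IH: "\<Psi> (t * Suc m) \<alpha> \<longleftrightarrow> (if \<alpha> (t * Suc m) then YS l \<alpha> else Ev (Suc l) \<alpha>) = (Nx ^^ 2 ^ t) (if \<alpha> (t * Suc m) then Ev (Suc l) \<alpha> else XS l \<alpha>) \<and> ac (YS 0 \<alpha>)" for \<alpha>
    using Suc.IH[of \<alpha>] tm unfolding ml XS.simps YS.simps idx(1) by simp
  have dep: "XS l \<beta> = XS l \<alpha>" "YS l \<beta> = YS l \<alpha>" "YS 0 \<beta> = YS 0 \<alpha>" if "\<And>i. Suc t * Suc m \<le> i \<Longrightarrow> \<beta> i = \<alpha> i" for \<beta> \<alpha>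
    using XY_dep[of l \<beta> \<alpha>] XY_dep[of 0 \<beta> \<alpha>] that lV V0 tm by (auto simp: l_def)
  have Evb: "Ev (Suc l) (\<beta>(t * Suc m := b)) = Ev (Suc l) \<beta>" for \<beta> b
    unfolding Ev_def using idx(2) by (auto simp: fun_eq_iff)
  have two: "(Nx ^^ 2 ^ Suc t) X = (Nx ^^ 2 ^ t) ((Nx ^^ 2 ^ t) X)" for X
    by (simp add: mult_2 funpow_add)
  have nz: "\<not> (Nx ^^ 2 ^ t) X k" if "m \<le> k" for X k
  proof -
    obtain j where "(2::nat) ^ t = Suc j" by (metis not0_implies_Suc power_not_zero zero_neq_numeral)
    then show ?thesis using Nx[OF that] by simp
  qed
  let ?R = "\<lambda>E. E = (Nx ^^ 2 ^ t) (XS l \<alpha>) \<and> YS l \<alpha> = (Nx ^^ 2 ^ t) E \<and> ac (YS 0 \<alpha>)"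
  have "\<Psi> (Suc t * Suc m) \<alpha> \<longleftrightarrow> (\<exists>\<beta>. (\<forall>i. i \<le> t * Suc m \<or> Suc t * Suc m \<le> i \<longrightarrow> \<beta> i = \<alpha> i) \<and> ?R (Ev (Suc l) \<beta>))"
  proof -
    have "\<Psi> (t * Suc m) (\<beta>(t * Suc m := False)) \<and> \<Psi> (t * Suc m) (\<beta>(t * Suc m := True)) \<longleftrightarrow> ?R (Ev (Suc l) \<beta>)"
      if "\<forall>i. i \<le> t * Suc m \<or> Suc t * Suc m \<le> i \<longrightarrow> \<beta> i = \<alpha> i" for \<beta>
      unfolding IH Evb using dep[of "\<beta>(t * Suc m := False)" \<alpha>] dep[of "\<beta>(t * Suc m := True)" \<alpha>] that by auto
    then show ?thesis unfolding block by blast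
  qed
  also have "\<dots> \<longleftrightarrow> ?R ((Nx ^^ 2 ^ t) (XS l \<alpha>))"
  proof
    assume r: "?R ((Nx ^^ 2 ^ t) (XS l \<alpha>))"
    define E where "E = (Nx ^^ 2 ^ t) (XS l \<alpha>)"
    \<comment> \<open>The middle vector is written into the block in reverse order, matching the
      indices used by \<open>Ev\<close>.\<close>
    define \<beta> where "\<beta> i = (if t * Suc m < i \<and> i < Suc t * Suc m then E (Suc t * Suc m - 1 - i) else \<alpha> i)" for i
    have "Ev (Suc l) \<beta> = E"
    proof
      fix k show "Ev (Suc l) \<beta> k = E k"
      proof (cases "k < m")
        case True
        then have "t * Suc m < t * Suc m + (m - k)" "t * Suc m + (m - k) < Suc t * Suc m" "Suc t * Suc m - 1 - (t * Suc m + (m - k)) = k" by auto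
        then have "\<beta> (t * Suc m + (m - k)) = E k" by (simp only: \<beta>_def if_True simp_thms)
        then show ?thesis unfolding Ev_def idx(2)[OF True] using True by simp
      qed (use nz in \<open>simp add: Ev_def E_def\<close>)
    qed
    then show "\<exists>\<beta>. (\<forall>i. i \<le> t * Suc m \<or> Suc t * Suc m \<le> i \<longrightarrow> \<beta> i = \<alpha> i) \<and> ?R (Ev (Suc l) \<beta>)"
      using r by (intro exI[of _ \<beta>]) (auto simp: \<beta>_def E_def)
  qed auto
  finally show ?case unfolding l_def[symmetric] two by auto
qed

theorem savitch: "\<Psi> V \<alpha> \<longleftrightarrow> ac ((Nx ^^ 2 ^ m) ini)"
proof -
  have dep: "YS 0 \<beta> = YS 0 \<alpha>" if "\<And>i. m * Suc m < i \<Longrightarrow> \<beta> i = \<alpha> i" for \<alpha> \<beta>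
  proof
    fix k have "m * Suc m < V - 1 - k" if "k < m" using that by (simp add: V_def)
    then show "YS 0 \<beta> k = YS 0 \<alpha> k" using that by (auto simp: Ev_def)
  qed
  have L: "\<Psi> (m * Suc m) \<beta> \<longleftrightarrow> YS 0 \<beta> = (Nx ^^ 2 ^ m) ini \<and> ac (YS 0 \<beta>)" for \<beta> using levels[of m \<beta>] by simp
  \<comment> \<open>Block 0 guesses the final vector; its selector keeps the blocks of equal size,
    and \<open>YS 0\<close> does not depend on it.\<close>
  have b: "YS 0 (\<beta>(m * Suc m := b)) = YS 0 \<beta>" for \<beta> b by (rule dep) simp
  have "\<Psi> V \<alpha> \<longleftrightarrow> (\<exists>\<beta>. (\<forall>i. i \<le> m * Suc m \<or> V \<le> i \<longrightarrow> \<beta> i = \<alpha> i) \<and> YS 0 \<beta> = (Nx ^^ 2 ^ m) ini \<and> ac (YS 0 \<beta>))"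
    unfolding V_def block L b by blast
  also have "\<dots> \<longleftrightarrow> ac ((Nx ^^ 2 ^ m) ini)"
  proof
    assume a: "ac ((Nx ^^ 2 ^ m) ini)"
    define E where "E = (Nx ^^ 2 ^ m) ini"
    define \<beta> where "\<beta> i = (if m * Suc m < i \<and> i < V then E (V - 1 - i) else \<alpha> i)" for i
    have nz: "\<not> E k" if "m \<le> k" for k
    proof -
      obtain j where "(2::nat) ^ m = Suc j" by (metis not0_implies_Suc power_not_zero zero_neq_numeral)
      then show ?thesis using Nx[OF that] by (simp add: E_def)
    qed
    have "YS 0 \<beta> = E"
    proof
      fix k show "YS 0 \<beta> k = E k"
      proof (cases "k < m")
        case True
        then have "m * Suc m < V - 1 - k" "V - 1 - k < V" "V - 1 - (V - 1 - k) = k" by (auto simp: V_def)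
        then show ?thesis using True by (simp add: Ev_def \<beta>_def)
      qed (use nz in \<open>simp add: Ev_def\<close>)
    qed
    then show "\<exists>\<beta>. (\<forall>i. i \<le> m * Suc m \<or> V \<le> i \<longrightarrow> \<beta> i = \<alpha> i) \<and> YS 0 \<beta> = (Nx ^^ 2 ^ m) ini \<and> ac (YS 0 \<beta>)"
      using a by (intro exI[of _ \<beta>]) (auto simp: \<beta>_def E_def)
  qed auto
  finally show ?thesis .
qed

end

section \<open>One-hot encoding of Turing machine configurations\<close>

datatype bx = BV nat nat nat | BF | BB "bool \<Rightarrow> bool \<Rightarrow> bool" bx bx

primrec bsem :: "(nat \<Rightarrow> nat \<Rightarrow> nat \<Rightarrow> bool) \<Rightarrow> bx \<Rightarrow> bool" where
  "bsem \<rho> (BV v a c) = \<rho> v a c"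
| "bsem \<rho> BF = False"
| "bsem \<rho> (BB f x y) = f (bsem \<rho> x) (bsem \<rho> y)"

definition bors :: "bx list \<Rightarrow> bx" where
  "bors xs = foldr (BB (\<or>)) xs BF"

lemma bsem_bors [simp]: "bsem \<rho> (bors xs) \<longleftrightarrow> (\<exists>x\<in>set xs. bsem \<rho> x)"
  by (induction xs) (auto simp: bors_def)

text \<open>By the pigeonhole principle two of the first \<open>N + 1\<close> iterates agree, so the
  orbit is periodic from there on. It also ends in a fixed point, hence the repeated iterate already
  is that fixed point.\<close>

lemma funpow_fixpoint:
  assumes fin: "finite A" "card A \<le> N" and A: "\<And>t. (f ^^ t) x \<in> A" and fix': "f ((f ^^ T) x) = (f ^^ T) x"
  shows "(f ^^ N) x = (f ^^ T) x"
proof -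
  have late: "(f ^^ (T + t)) x = (f ^^ T) x" for t
    by (induction t) (simp_all add: fix')
  have stay: "(f ^^ (t + u)) x = (f ^^ T) x" if "(f ^^ t) x = (f ^^ T) x" for t u
    using that by (induction u) (simp_all add: fix')
  have "\<not> inj_on (\<lambda>t. (f ^^ t) x) {..N}"
  proof
    assume "inj_on (\<lambda>t. (f ^^ t) x) {..N}"
    then have "card {..N} \<le> card A" using A fin(1) by (intro card_inj_on_le) auto
    then show False using fin(2) by simp
  qed
  then obtain i' j' where ij': "(f ^^ i') x = (f ^^ j') x" "i' \<noteq> j'" "i' \<le> N" "j' \<le> N" unfolding inj_on_def by auto
  obtain i d where i: "(f ^^ i) x = (f ^^ (i + d)) x" "d > 0" "i \<le> N"
  proof (cases "i' < j'")
    case True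
    then show ?thesis using that[of i' "j' - i'"] ij' by simp
  next
    case False
    then show ?thesis using that[of j' "i' - j'"] ij' by simp
  qed
  have per: "(f ^^ (i + r * d)) x = (f ^^ i) x" for r
  proof (induction r)
    case (Suc r)
    have "(f ^^ (i + Suc r * d)) x = (f ^^ (r * d)) ((f ^^ (i + d)) x)" by (simp add: funpow_add[symmetric] add_ac flip: funpow_add o_apply[of "f ^^ _" "f ^^ _"])
    also have "\<dots> = (f ^^ (i + r * d)) x" unfolding i(1)[symmetric] by (simp add: funpow_add[symmetric] add_ac flip: o_apply[of "f ^^ _" "f ^^ _"])
    finally show ?case using Suc by simp
  qed simp
  have "T \<le> i + T * d" using i(2) by (cases d) auto
  then have "(f ^^ (i + T * d)) x = (f ^^ T) x" using late[of "i + T * d - T"] by simp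
  then have "(f ^^ i) x = (f ^^ T) x" using per by simp
  then show ?thesis using stay[of i "N - i"] i(3) by simp
qed

lemma coord_inj: "e < g \<Longrightarrow> e' < g \<Longrightarrow> i * g + e = i' * g + e' \<longleftrightarrow> i = i' \<and> e = e'" for i i' e e' g :: nat
proof
  assume "e < g" "e' < g" "i * g + e = i' * g + e'"
  then have "(i * g + e) div g = (i' * g + e') div g" "(i * g + e) mod g = (i' * g + e') mod g" by simp_all
  then show "i = i' \<and> e = e'" using \<open>e < g\<close> \<open>e' < g\<close> by simp
qed simp

locale tmenc =
  fixes M :: TM
  assumes wf: "wf_tm M"
begin

definition "g = nsym M + nst M"

text \<open>Accepting and rejecting states are made to rewrite their symbol and stay, so that a step
  is given by local rules without exceptions.\<close>

definition dl :: "nat \<Rightarrow> nat \<Rightarrow> nat \<times> nat \<times> int" where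
  "dl q a = (if q = qacc M \<or> q = qrej M then (q, a, 0) else dlt M q a)"

lemma dl: assumes "q < nst M" "a < nsym M" shows
  "fst (dl q a) < nst M" "fst (snd (dl q a)) < nsym M" "snd (snd (dl q a)) \<in> {-1, 0, 1}"
proof -
  obtain q' b d where e: "dlt M q a = (q', b, d)" by (metis prod_cases3)
  have "case dlt M q a of (q', b, d) \<Rightarrow> q' < nst M \<and> b < nsym M \<and> d \<in> {-1, 0, 1}"
    using wf assms unfolding wf_tm_def by simp
  then have "q' < nst M" "b < nsym M" "d \<in> {-1, 0, 1}" unfolding e by simp_all
  then show "fst (dl q a) < nst M" "fst (snd (dl q a)) < nsym M" "snd (snd (dl q a)) \<in> {-1, 0, 1}"
    using assms by (simp_all add: dl_def e)
qed

lemma tm_step_dl: "tm_step M (q, tp, h) = (fst (dl q (tp h)), tp(h := fst (snd (dl q (tp h)))), h + snd (snd (dl q (tp h))))"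
  by (simp add: tm_step_def dl_def split: prod.splits)

text \<open>Scalars 30, 20 and 31 of the program hold the base addresses of the left neighbour, the cell itself and the right neighbour.\<close>

definition rules :: "nat \<Rightarrow> (nat \<Rightarrow> nat \<Rightarrow> bool) \<Rightarrow> bx list" where
  "rules v P = [BB (\<and>) (BV v 0 (nsym M + q)) (BV v 0 a). q \<leftarrow> [0..<nst M], a \<leftarrow> [0..<nsym M], P q a]"

text \<open>A symbol bit persists where the head is absent and is otherwise given by the symbol
  written. A state bit arrives from the left neighbour by a move to the right, from the cell itself,
  or from the right neighbour by a move to the left.\<close>

definition phi :: "nat \<Rightarrow> bx" where
  "phi e = (if e < nsym M then
      BB (\<or>) (BB (\<lambda>a b. a \<and> \<not> b) (BV 20 0 e) (bors [BV 20 0 (nsym M + q). q \<leftarrow> [0..<nst M]]))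
        (bors (rules 20 (\<lambda>q a. fst (snd (dl q a)) = e)))
    else bors (rules 30 (\<lambda>q a. fst (dl q a) = e - nsym M \<and> snd (snd (dl q a)) = 1) @
        rules 20 (\<lambda>q a. fst (dl q a) = e - nsym M \<and> snd (snd (dl q a)) = 0) @
        rules 31 (\<lambda>q a. fst (dl q a) = e - nsym M \<and> snd (snd (dl q a)) = -1)))"

lemma bsem_rules: "(\<exists>x\<in>set (rules v P). bsem \<rho> x) \<longleftrightarrow> (\<exists>q<nst M. \<exists>a<nsym M. P q a \<and> \<rho> v 0 (nsym M + q) \<and> \<rho> v 0 a)"
  unfolding rules_def by fastforce

text \<open>A border cell of \<open>g\<close> false bits provides the left neighbour of the first
  cell. On the right the vectors in question are false beyond their length anyway.\<close>

definition pad :: "(nat \<Rightarrow> bool) \<Rightarrow> nat \<Rightarrow> bool" where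
  "pad X a \<longleftrightarrow> g \<le> a \<and> X (a - g)"

definition rd :: "(nat \<Rightarrow> nat \<Rightarrow> bool) \<Rightarrow> nat \<Rightarrow> nat \<Rightarrow> nat \<Rightarrow> nat \<Rightarrow> bool" where
  "rd X i v arr c = X arr ((if v = 30 then i - 1 else if v = 20 then i else i + 1) * g + c)"

definition Nx :: "nat \<Rightarrow> (nat \<Rightarrow> bool) \<Rightarrow> nat \<Rightarrow> bool" where
  "Nx m X k \<longleftrightarrow> k < m \<and> bsem (rd (\<lambda>_. pad X) (Suc (k div g))) (phi (k mod g))"

definition ac :: "nat \<Rightarrow> (nat \<Rightarrow> bool) \<Rightarrow> bool" where
  "ac S E \<longleftrightarrow> (\<exists>i<S. pad E (Suc i * g + nsym M + qacc M))"

definition cellb :: "tm_conf \<Rightarrow> int \<Rightarrow> nat \<Rightarrow> bool" where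
  "cellb c pos e \<longleftrightarrow> (if e < nsym M then fst (snd c) pos = e else snd (snd c) = pos \<and> fst c = e - nsym M)"

text \<open>The tape cells from \<open>-s\<close> to \<open>s\<close> with \<open>g\<close> bits
  each: a one-hot symbol, followed by one bit per state, all clear except at the head.\<close>

definition enc :: "nat \<Rightarrow> tm_conf \<Rightarrow> nat \<Rightarrow> bool" where
  "enc s c k \<longleftrightarrow> k < (2 * s + 1) * g \<and> cellb c (int (k div g) - int s) (k mod g)"

lemma g_pos: "0 < g"
  using wf by (simp add: g_def wf_tm_def)

lemma pad_enc: assumes "e < g" shows
  "pad (enc s c) (i * g + e) \<longleftrightarrow> 1 \<le> i \<and> i \<le> 2 * s + 1 \<and> cellb c (int i - 1 - int s) e"
proof (cases i)
  case 0
  then show ?thesis using assms by (simp add: pad_def)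
next
  case (Suc j)
  have "j * g + e < (2 * s + 1) * g \<longleftrightarrow> j < 2 * s + 1"
  proof
    assume "j * g + e < (2 * s + 1) * g"
    then have "j * g < (2 * s + 1) * g" by linarith
    then show "j < 2 * s + 1" by (simp only: mult_less_cancel2)
  next
    assume "j < 2 * s + 1"
    then have "Suc j * g \<le> (2 * s + 1) * g" by (intro mult_le_mono) auto
    moreover have "j * g + e < Suc j * g" using assms by simp
    ultimately show "j * g + e < (2 * s + 1) * g" by (rule less_le_trans[rotated])
  qed
  then show ?thesis using assms Suc unfolding pad_def enc_def by (simp del: mult_Suc_right) auto
qed

lemma enc_step:
  assumes q: "q < nst M" and tp: "\<And>i. tp i < nsym M" and h: "\<bar>h\<bar> \<le> int s" "\<bar>snd (snd (tm_step M (q, tp, h)))\<bar> \<le> int s"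
  shows "Nx ((2 * s + 1) * g) (enc s (q, tp, h)) = enc s (tm_step M (q, tp, h))"
proof
  fix k
  define i e where "i = k div g" and "e = k mod g"
  have e: "e < g" using g_pos by (simp add: e_def)
  let ?c = "(q, tp, h)"
  let ?pos = "int i - int s"
  obtain q' b d where dlq: "dl q (tp h) = (q', b, d)" by (metis prod_cases3)
  have D: "q' < nst M" "b < nsym M" "d = -1 \<or> d = 0 \<or> d = 1" using dl[OF q tp[of h]] dlq by auto
  show "Nx ((2 * s + 1) * g) (enc s ?c) k = enc s (tm_step M ?c) k"
  proof (cases "k < (2 * s + 1) * g")
    case False
    then show ?thesis by (simp add: Nx_def enc_def)
  next
    case True
    then have i: "i < 2 * s + 1" unfolding i_def using g_pos by (simp add: less_mult_imp_div_less)
    define r where "r = rd (\<lambda>_. pad (enc s ?c)) (Suc i)"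
    have r20: "r 20 0 x \<longleftrightarrow> cellb ?c ?pos x" if "x < g" for x
      unfolding r_def rd_def using pad_enc[OF that, of s ?c "Suc i"] i by simp
    have r30: "r 30 0 x \<longleftrightarrow> 1 \<le> i \<and> cellb ?c (?pos - 1) x" if "x < g" for x
      unfolding r_def rd_def using pad_enc[OF that, of s ?c "Suc i - 1"] i by (simp add: algebra_simps)
    have r31: "r 31 0 x \<longleftrightarrow> i < 2 * s \<and> cellb ?c (?pos + 1) x" if "x < g" for x
      unfolding r_def rd_def using pad_enc[OF that, of s ?c "Suc i + 1"] i by (simp add: algebra_simps Suc_le_eq)
    have st: "x < nst M \<Longrightarrow> nsym M + x < g" and sy: "x < nsym M \<Longrightarrow> x < g" for x by (auto simp: g_def)
    have cst: "cellb ?c p (nsym M + x) \<longleftrightarrow> h = p \<and> q = x" and csy: "x < nsym M \<Longrightarrow> cellb ?c p x \<longleftrightarrow> tp p = x" for p x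
      by (simp_all add: cellb_def)
    have rule: "(\<exists>x<nst M. \<exists>a<nsym M. P x a \<and> r v 0 (nsym M + x) \<and> r v 0 a) \<longleftrightarrow> B \<and> h = p \<and> P q (tp h)"
      if rv: "\<And>x. x < g \<Longrightarrow> r v 0 x \<longleftrightarrow> B \<and> cellb ?c p x" for v B p P
    proof -
      have e1: "r v 0 (nsym M + x) \<longleftrightarrow> B \<and> h = p \<and> q = x" if "x < nst M" for x unfolding rv[OF st[OF that]] cst ..
      have e2: "r v 0 x \<longleftrightarrow> B \<and> tp p = x" if "x < nsym M" for x unfolding rv[OF sy[OF that]] csy[OF that] ..
      have "(\<exists>x<nst M. \<exists>a<nsym M. P x a \<and> r v 0 (nsym M + x) \<and> r v 0 a) \<longleftrightarrow>
          (\<exists>x<nst M. \<exists>a<nsym M. P x a \<and> (B \<and> h = p \<and> q = x) \<and> B \<and> tp p = a)"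
        using e1 e2 by (simp cong: conj_cong)
      also have "\<dots> \<longleftrightarrow> B \<and> h = p \<and> P q (tp h)" using q tp[of h] by auto
      finally show ?thesis .
    qed
    have rule20: "(\<exists>x<nst M. \<exists>a<nsym M. P x a \<and> r 20 0 (nsym M + x) \<and> r 20 0 a) \<longleftrightarrow> h = ?pos \<and> P q (tp h)" for P
      using rule[of 20 True ?pos P] r20 by simp
    note rule30 = rule[of 30, OF r30] and rule31 = rule[of 31, OF r31]
    have "bsem r (phi e) \<longleftrightarrow> cellb (tm_step M ?c) ?pos e"
    proof (cases "e < nsym M")
      case e': True
      have "(\<exists>x<nst M. r 20 0 (nsym M + x)) \<longleftrightarrow> h = ?pos"
      proof -
        have "r 20 0 (nsym M + x) \<longleftrightarrow> h = ?pos \<and> q = x" if "x < nst M" for x unfolding r20[OF st[OF that]] cst ..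
        then show ?thesis using q by blast
      qed
      then have "(\<exists>x\<in>{0..<nst M}. r 20 0 (nsym M + x)) \<longleftrightarrow> h = ?pos" by (simp add: Bex_def)
      then have "bsem r (phi e) \<longleftrightarrow> tp ?pos = e \<and> h \<noteq> ?pos \<or> h = ?pos \<and> fst (snd (dl q (tp h))) = e"
        using e' by (simp add: phi_def bsem_rules rule20 r20 e csy)
      also have "\<dots> \<longleftrightarrow> cellb (tm_step M ?c) ?pos e"
        using e' by (auto simp: tm_step_dl cellb_def)
      finally show ?thesis .
    next
      case e': False
      have "bsem r (phi e) \<longleftrightarrow>
          (1 \<le> i \<and> h = ?pos - 1 \<and> q' = e - nsym M \<and> d = 1) \<or> (h = ?pos \<and> q' = e - nsym M \<and> d = 0) \<or>
          (i < 2 * s \<and> h = ?pos + 1 \<and> q' = e - nsym M \<and> d = -1)"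
        using e' rule30[of "\<lambda>q a. fst (dl q a) = e - nsym M \<and> snd (snd (dl q a)) = 1"]
          rule20[of "\<lambda>q a. fst (dl q a) = e - nsym M \<and> snd (snd (dl q a)) = 0"]
          rule31[of "\<lambda>q a. fst (dl q a) = e - nsym M \<and> snd (snd (dl q a)) = -1"]
        by (simp add: phi_def bex_Un bsem_rules dlq)
      also have "\<dots> \<longleftrightarrow> h + d = ?pos \<and> q' = e - nsym M" using D(3) h(1) by auto
      also have "\<dots> \<longleftrightarrow> cellb (tm_step M ?c) ?pos e" using e' by (auto simp: tm_step_dl cellb_def dlq)
      finally show ?thesis .
    qed
    then show ?thesis using True by (simp add: Nx_def enc_def i_def e_def r_def)
  qed
qed

lemma ac_enc: assumes "fst c < nst M" "\<bar>snd (snd c)\<bar> \<le> int s" shows "ac (2 * s + 1) (enc s c) \<longleftrightarrow> fst c = qacc M"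
proof -
  have a: "nsym M + qacc M < g" using wf by (simp add: g_def wf_tm_def)
  have "ac (2 * s + 1) (enc s c) \<longleftrightarrow> (\<exists>i<2 * s + 1. snd (snd c) = int i - int s \<and> fst c = qacc M)"
  proof -
    have "pad (enc s c) (Suc i * g + nsym M + qacc M) \<longleftrightarrow> i < 2 * s + 1 \<and> snd (snd c) = int i - int s \<and> fst c = qacc M" for i
      using pad_enc[OF a, of s c "Suc i"] by (simp add: cellb_def add.assoc less_Suc_eq_le)
    then show ?thesis unfolding ac_def by auto
  qed
  also have "\<dots> \<longleftrightarrow> fst c = qacc M"
    using assms(2) by (auto intro!: exI[of _ "nat (snd (snd c) + int s)"])
  finally show ?thesis .
qed

text \<open>There are at most \<open>2 ^ m\<close> vectors of length \<open>m\<close>, and the run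
  reaches a fixed point when it halts. By \<open>funpow_fixpoint\<close> the fixed number
  \<open>2 ^ m\<close> of steps replaces the unknown halting time.\<close>

lemma ac_run:
  assumes n: "length w \<le> s" and dec: "tm_decides_in_space M L f" "f (length w) \<le> s"
  shows "ac (2 * s + 1) ((Nx ((2 * s + 1) * g) ^^ 2 ^ ((2 * s + 1) * g)) (enc s (tm_init M w))) \<longleftrightarrow> w \<in> L"
proof -
  let ?m = "(2 * s + 1) * g"
  have bd: "\<bar>snd (snd (tm_run M w t))\<bar> \<le> int s" for t
    using dec unfolding tm_decides_in_space_def by (metis of_nat_mono order_trans)
  have ok: "fst (tm_run M w t) < nst M \<and> (\<forall>i. fst (snd (tm_run M w t)) i < nsym M)" for t
  proof (induction t)
    case 0
    then show ?case using wf by (auto simp: tm_run_def tm_init_def wf_tm_def)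
  next
    case (Suc t)
    obtain q tp h where c: "tm_run M w t = (q, tp, h)" by (metis prod_cases3)
    have "tm_run M w (Suc t) = tm_step M (q, tp, h)" using c by (simp add: tm_run_def)
    then show ?case using Suc dl[of q "tp h"] unfolding c tm_step_dl by simp
  qed
  have N: "(Nx ?m ^^ t) (enc s (tm_init M w)) = enc s (tm_run M w t)" for t
  proof (induction t)
    case 0
    then show ?case by (simp add: tm_run_def)
  next
    case (Suc t)
    obtain q tp h where c: "tm_run M w t = (q, tp, h)" by (metis prod_cases3)
    have r: "tm_run M w (Suc t) = tm_step M (q, tp, h)" using c by (simp add: tm_run_def)
    show ?case using enc_step[of q tp h s] ok[of t] bd[of t] bd[of "Suc t"] Suc unfolding r c by simp
  qed
  obtain T where T: "fst (tm_run M w T) = qacc M \<or> fst (tm_run M w T) = qrej M" "fst (tm_run M w T) = qacc M \<longleftrightarrow> w \<in> L"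
    using dec(1) unfolding tm_decides_in_space_def by blast
  let ?A = "(\<lambda>B k. k \<in> B) ` Pow {..<?m}"
  have "(Nx ?m ^^ 2 ^ ?m) (enc s (tm_init M w)) = (Nx ?m ^^ T) (enc s (tm_init M w))"
  proof (rule funpow_fixpoint)
    show "finite ?A" by simp
    show "card ?A \<le> 2 ^ ?m" using card_image_le[of "Pow {..<?m}" "\<lambda>B k. k \<in> B"] by (simp add: card_Pow)
    show "(Nx ?m ^^ t) (enc s (tm_init M w)) \<in> ?A" for t
    proof (rule image_eqI)
      show "(Nx ?m ^^ t) (enc s (tm_init M w)) = (\<lambda>k. k \<in> Collect (enc s (tm_run M w t)))" unfolding N by simp
      show "Collect (enc s (tm_run M w t)) \<in> Pow {..<?m}" by (auto simp: enc_def)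
    qed
    have "tm_run M w (Suc T) = tm_run M w T" using T(1) by (auto simp: tm_run_def tm_step_def split: prod.splits)
    then show "Nx ?m ((Nx ?m ^^ T) (enc s (tm_init M w))) = (Nx ?m ^^ T) (enc s (tm_init M w))"
      using N[of "Suc T"] N[of T] by simp
  qed
  then show ?thesis using ac_enc[of "tm_run M w T" s] ok bd T(2) unfolding N by simp
qed

end

section \<open>The program evaluating the quantified formula\<close>

fun seq :: "com list \<Rightarrow> com" where
  "seq [] = Set 5 0"
| "seq [c] = c"
| "seq (c # d # cs) = Sq c (seq (d # cs))"

text \<open>The language has no multiplication; a loop of additions takes its place.\<close>

lemma For_Ad:
  assumes "i \<noteq> n" "a \<noteq> i" "a \<noteq> n" "b \<noteq> a" "b \<noteq> i"
  shows "ev (For i n (Ad a a b)) s = upd i (fst s n) (upd a (fst s a + fst s n * fst s b) s)"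
proof -
  have "((\<lambda>s. upd i (Suc (fst (ev (Ad a a b) s) i)) (ev (Ad a a b) s)) ^^ k) (upd i 0 s) = upd i k (upd a (fst s a + k * fst s b) s)" for k
  proof (induction k)
    case 0
    then show ?case using assms by (simp add: upd_def fun_eq_iff)
  next
    case (Suc k)
    then show ?case using assms by (simp add: upd_def fun_eq_iff)
  qed
  then show ?thesis by simp
qed

text \<open>Expressions are evaluated with the scalars from \<open>d\<close> upward as a
  stack.\<close>

primrec cb :: "nat \<Rightarrow> bx \<Rightarrow> com" where
  "cb d (BV v a c) = seq [Set d c, Ad d d v, Get d a d]"
| "cb d BF = Set d 0"
| "cb d (BB f x y) = seq [cb d x, cb (Suc d) y, Bo f d d (Suc d)]"

primrec bok :: "bx \<Rightarrow> bool" where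
  "bok (BV v a c) \<longleftrightarrow> v \<in> {20, 30, 31} \<and> a \<in> {0, 1}"
| "bok BF \<longleftrightarrow> True"
| "bok (BB f x y) \<longleftrightarrow> \<not> f False False \<and> bok x \<and> bok y"

primrec bx_depth :: "bx \<Rightarrow> nat" where
  "bx_depth (BV v a c) = 0"
| "bx_depth BF = 0"
| "bx_depth (BB f x y) = Suc (max (bx_depth x) (bx_depth y))"

lemma cb_frame: "asg (cb d x) \<subseteq> {d..}" "asgA (cb d x) = {}" "lv (cb d x) = {}"
proof -
  show "asg (cb d x) \<subseteq> {d..}"
  proof (induction x arbitrary: d)
    case (BB f x y)
    from BB(1)[of d] BB(2)[of "Suc d"] show ?case by auto
  qed auto
qed (induction x arbitrary: d; simp)+

lemma cb_wf: "bok x \<Longrightarrow> 40 \<le> d \<Longrightarrow> d + bx_depth x < NV \<Longrightarrow> 2 \<le> NA \<Longrightarrow> wfc NA NV (cb d x)"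
  by (induction x arbitrary: d) auto

lemma cb_unasg: "v < d \<Longrightarrow> fst (ev (cb d x) s) v = fst s v" "snd (ev (cb d x) s) a = snd s a"
proof -
  show "fst (ev (cb d x) s) v = fst s v" if "v < d" by (rule ev_unasg) (use cb_frame(1)[of d x] that in auto)
  show "snd (ev (cb d x) s) a = snd s a" by (rule ev_unasgA) (simp add: cb_frame)
qed

lemma cb_correct:
  assumes "bok x" "40 \<le> d"
    and "\<And>v a c. v \<in> {20, 30, 31} \<Longrightarrow> a \<in> {0, 1} \<Longrightarrow> isc V (snd s a (fst s v + c)) (\<lambda>\<alpha>. \<rho> \<alpha> v a c)"
  shows "isc V (fst (ev (cb d x) s) d) (\<lambda>\<alpha>. bsem (\<rho> \<alpha>) x)"
  using assms
proof (induction x arbitrary: d s)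
  case (BV v a c)
  have "v \<noteq> d" using BV.prems by auto
  then have "fst (ev (cb d (BV v a c)) s) d = snd s a (fst s v + c)" by (simp add: add.commute)
  then show ?case using BV.prems(3)[of v a c] BV.prems(1) by simp
next
  case BF
  then show ?case by (simp add: isc_0)
next
  case (BB f x y)
  define t where "t = ev (cb d x) s"
  define u where "u = ev (cb (Suc d) y) t"
  have x: "isc V (fst t d) (\<lambda>\<alpha>. bsem (\<rho> \<alpha>) x)" unfolding t_def by (rule BB.IH(1)) (use BB.prems in simp_all)
  have y: "isc V (fst u (Suc d)) (\<lambda>\<alpha>. bsem (\<rho> \<alpha>) y)"
    unfolding u_def
  proof (rule BB.IH(2))
    fix v a c assume v: "v \<in> {20, 30, 31::nat}" "a \<in> {0, 1::nat}"
    have "snd t a = snd s a" "fst t v = fst s v" unfolding t_def using v BB.prems(2) by (auto simp: cb_unasg)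
    then show "isc V (snd t a (fst t v + c)) (\<lambda>\<alpha>. \<rho> \<alpha> v a c)" using BB.prems(3)[OF v] by simp
  qed (use BB.prems in simp_all)
  have "fst u d = fst t d" unfolding u_def by (simp add: cb_unasg)
  then have "fst (ev (cb d (BB f x y)) s) d = bitop f (fst t d) (fst u (Suc d))" by (simp add: t_def[symmetric] u_def[symmetric])
  then show ?case using isc_bitop[OF x y, of f] BB.prems(1) by simp
qed

abbreviation "andn \<equiv> (\<lambda>a b. a \<and> \<not> b)"

primrec pw :: "nat \<Rightarrow> com" where
  "pw 0 = Set 4 1"
| "pw (Suc k) = seq [pw k, Set 5 0, For 6 2 (Ad 5 5 4), Mv 4 5]"

lemma pw_frame: "asg (pw k) \<subseteq> {4, 5, 6}" "asgA (pw k) = {}" "lv (pw k) \<subseteq> {2}"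
  by (induction k) auto

lemma pw_ev: "v \<noteq> 4 \<Longrightarrow> v \<noteq> 5 \<Longrightarrow> v \<noteq> 6 \<Longrightarrow> fst (ev (pw k) s) v = fst s v" "snd (ev (pw k) s) a = snd s a"
proof -
  show "fst (ev (pw k) s) v = fst s v" if "v \<noteq> 4" "v \<noteq> 5" "v \<noteq> 6" by (rule ev_unasg) (use pw_frame(1)[of k] that in auto)
  show "snd (ev (pw k) s) a = snd s a" by (rule ev_unasgA) (simp add: pw_frame)
qed

lemma pw_val: "fst (ev (pw k) s) 4 = fst s 2 ^ k"
  by (induction k) (simp_all add: For_Ad pw_ev del: ev.simps(9))

lemma pw_wf: "40 \<le> NV \<Longrightarrow> wfc NA NV (pw k)"
proof (induction k)
  case (Suc k)
  then show ?case by simp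
qed simp

text \<open>Doubles the tables of all variables, including those not yet created; these are 0 and
  doubling keeps them so.\<close>

definition "L3 = For 14 11 (seq [Get 16 2 14, Sf 17 16 13, Bo (\<or>) 16 16 17, Put 2 14 16])"
definition "P3 = seq [Set 12 1, Set 13 1, For 15 11 (seq [L3, Sf 16 12 13, Put 2 15 16, Bo (\<or>) 12 12 16, Put 3 15 13, Ad 13 13 13])]"

lemma L3: "snd (ev L3 s) 2 j = (if j < fst s 11 then bitop (\<or>) (snd s 2 j) (snd s 2 j * 2 ^ fst s 13) else snd s 2 j)"
proof -
  define I where "I k s' \<longleftrightarrow> (\<forall>j. snd s' 2 j = (if j < k then bitop (\<or>) (snd s 2 j) (snd s 2 j * 2 ^ fst s 13) else snd s 2 j))" for k :: nat and s' :: stat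
  have "I (fst s 11) (ev L3 s)"
    unfolding L3_def
  proof (rule For_rule[where I = I])
    fix k s' assume a: "fst s' 14 = k" "I k s'"
      and "\<And>v. v \<notin> asg (For 14 11 (seq [Get 16 2 14, Sf 17 16 13, Bo (\<or>) 16 16 17, Put 2 14 16])) \<Longrightarrow> fst s' v = fst s v"
    then have "fst s' 13 = fst s 13" by simp
    then show "I (Suc k) (upd 14 (Suc k) (ev (seq [Get 16 2 14, Sf 17 16 13, Bo (\<or>) 16 16 17, Put 2 14 16]) s'))"
      using a unfolding I_def by simp
  qed (simp_all add: I_def)
  then show ?thesis by (simp add: I_def)
qed

lemma L3_frame: "asg L3 = {14, 16, 17}" "asgA L3 = {2}" "lv L3 = {11}"
  by (auto simp: L3_def)

text \<open>After \<open>v\<close> rounds the first \<open>v\<close> tables and the constant True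
  range over \<open>v\<close> variables. A round doubles them all and adds the table of variable
  \<open>v\<close>, while scalar 13 holds the needed exponent \<open>2 ^ v\<close>.\<close>

lemma P3:
  assumes V: "fst s 11 = V" and z: "snd s 2 = (\<lambda>_. 0)" and s': "s' = ev P3 s"
  shows "k < V \<Longrightarrow> isc V (snd s' 2 k) (\<lambda>\<alpha>. \<alpha> k)" "k < V \<Longrightarrow> snd s' 3 k = 2 ^ k" "isc V (fst s' 12) (\<lambda>_. True)"
proof -
  define I where "I v s' \<longleftrightarrow> fst s' 13 = 2 ^ v \<and> isc v (fst s' 12) (\<lambda>_. True) \<and>
     (\<forall>i<v. isc v (snd s' 2 i) (\<lambda>\<alpha>. \<alpha> i) \<and> snd s' 3 i = 2 ^ i) \<and> (\<forall>i\<ge>v. snd s' 2 i = 0)" for v :: nat and s' :: stat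
  let ?B = "seq [L3, Sf 16 12 13, Put 2 15 16, Bo (\<or>) 12 12 16, Put 3 15 13, Ad 13 13 13]"
  have "I (fst (upd 13 1 (upd 12 1 s)) 11) (ev (For 15 11 ?B) (upd 13 1 (upd 12 1 s)))"
  proof (rule For_rule[where I = I])
    show "I 0 (upd 15 0 (upd 13 1 (upd 12 1 s)))"
      by (auto simp: I_def z isc_def bit_Suc_0_iff)
    fix v s' assume v: "v < fst (upd 13 1 (upd 12 1 s)) 11" "fst s' 15 = v" and I: "I v s'"
      and "\<And>w. w \<notin> asg (For 15 11 ?B) \<Longrightarrow> fst s' w = fst (upd 13 1 (upd 12 1 s)) w"
    then have V': "fst s' 11 = V" using V by (simp add: L3_frame)
    define t where "t = ev L3 s'"
    have t: "w \<notin> {14, 16, 17} \<Longrightarrow> fst t w = fst s' w" "a \<noteq> 2 \<Longrightarrow> snd t a = snd s' a" for w a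
      unfolding t_def by (simp_all add: ev_unasg ev_unasgA L3_frame)
    have t2: "snd t 2 j = (if j < V then bitop (\<or>) (snd s' 2 j) (snd s' 2 j * 2 ^ 2 ^ v) else snd s' 2 j)" for j
      unfolding t_def L3 V' using I by (simp add: I_def)
    have d: "isc (Suc v) (bitop (\<or>) (snd s' 2 i) (snd s' 2 i * 2 ^ 2 ^ v)) (\<lambda>\<alpha>. \<alpha> i)" if "i < v" for i
      by (rule isc_double) (use I that in \<open>auto simp: I_def\<close>)
    have n: "isc (Suc v) (fst s' 12 * 2 ^ 2 ^ v) (\<lambda>\<alpha>. \<alpha> v)" by (rule isc_new) (use I in \<open>simp add: I_def\<close>)
    have f: "isc (Suc v) (bitop (\<or>) (fst s' 12) (fst s' 12 * 2 ^ 2 ^ v)) (\<lambda>_. True)"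
      by (rule isc_double) (use I in \<open>simp_all add: I_def\<close>)
    have p: "fst s' 13 = 2 ^ v" "\<And>i. i < v \<Longrightarrow> snd s' 3 i = 2 ^ i" "\<And>i. v \<le> i \<Longrightarrow> snd s' 2 i = 0" using I by (simp_all add: I_def)
    have z0: "bitop (\<or>) 0 0 = 0" by (simp add: bitop_def)
    have e: "upd 15 (Suc v) (ev ?B s') =
        ((fst t)(16 := fst s' 12 * 2 ^ 2 ^ v, 12 := bitop (\<or>) (fst s' 12) (fst s' 12 * 2 ^ 2 ^ v), 13 := 2 ^ v + 2 ^ v, 15 := Suc v),
         (snd t)(2 := (snd t 2)(v := fst s' 12 * 2 ^ 2 ^ v), 3 := (snd s' 3)(v := 2 ^ v)))"
      by (simp add: t_def[symmetric] t v p upd_def updA_def fun_upd_twist)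
    show "I (Suc v) (upd 15 (Suc v) (ev ?B s'))"
      unfolding e I_def
    proof (intro conjI allI impI)
      fix i assume i: "i < Suc v"
      show "isc (Suc v) (snd ((fst t)(16 := fst s' 12 * 2 ^ 2 ^ v, 12 := bitop (\<or>) (fst s' 12) (fst s' 12 * 2 ^ 2 ^ v), 13 := 2 ^ v + 2 ^ v, 15 := Suc v),
         (snd t)(2 := (snd t 2)(v := fst s' 12 * 2 ^ 2 ^ v), 3 := (snd s' 3)(v := 2 ^ v))) 2 i) (\<lambda>\<alpha>. \<alpha> i)"
        using i d[of i] n v V by (cases "i = v") (simp_all add: t2)
    qed (use f p v V in \<open>auto simp: t2 z0 less_Suc_eq\<close>)
  qed (simp_all add: L3_frame)
  then have "I V s'" unfolding s' P3_def using V by (simp del: ev.simps(9))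
  then show "k < V \<Longrightarrow> isc V (snd s' 2 k) (\<lambda>\<alpha>. \<alpha> k)" "k < V \<Longrightarrow> snd s' 3 k = 2 ^ k" "isc V (fst s' 12) (\<lambda>_. True)"
    by (simp_all add: I_def)
qed

text \<open>Subtraction and downward loops are missing; the predecessor of scalar 32 is found by
  searching upward for the number whose successor it is. With it \<open>P4\<close> fills array 4
  from its end.\<close>

definition "L4 = For 15 11 (seq [Ad 16 15 3, Ife 16 32 (Mv 28 15) (Mv 16 16)])"
definition "P4 = seq [Mv 32 11, For 14 11 (seq [Set 28 0, L4, Mv 32 28, Get 16 2 14, Put 4 32 16])]"

lemma L4_frame: "asg L4 = {15, 16, 28}" "asgA L4 = {}" "lv L4 = {11}"
  by (auto simp: L4_def)

lemma L4: assumes "fst s 3 = 1" "0 < fst s 32" "fst s 32 \<le> fst s 11" shows "fst (ev L4 s) 28 = fst s 32 - 1"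
proof -
  define I where "I k s' \<longleftrightarrow> (fst s 32 \<le> k \<longrightarrow> fst s' 28 = fst s 32 - 1)" for k :: nat and s' :: stat
  have "I (fst s 11) (ev L4 s)"
    unfolding L4_def
  proof (rule For_rule[where I = I])
    fix k s' assume a: "fst s' 15 = k" "I k s'"
      and f: "\<And>v. v \<notin> asg (For 15 11 (seq [Ad 16 15 3, Ife 16 32 (Mv 28 15) (Mv 16 16)])) \<Longrightarrow> fst s' v = fst s v"
    have "fst s' 3 = 1" "fst s' 32 = fst s 32" using f[of 3] f[of 32] assms(1) by simp_all
    then show "I (Suc k) (upd 15 (Suc k) (ev (seq [Ad 16 15 3, Ife 16 32 (Mv 28 15) (Mv 16 16)]) s'))"
      using a unfolding I_def by auto
  qed (use assms in \<open>simp_all add: I_def\<close>)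
  then show ?thesis using assms(3) by (simp add: I_def)
qed

lemma P4:
  assumes V: "fst s 11 = V" and one: "fst s 3 = 1" and j: "j < V"
  shows "snd (ev P4 s) 4 j = snd s 2 (V - 1 - j)"
proof -
  define I where "I k s' \<longleftrightarrow> fst s' 32 = V - k \<and> (\<forall>i<k. snd s' 4 (V - 1 - i) = snd s 2 i)" for k :: nat and s' :: stat
  let ?B = "seq [Set 28 0, L4, Mv 32 28, Get 16 2 14, Put 4 32 16]"
  have "I (fst (upd 32 V s) 11) (ev (For 14 11 ?B) (upd 32 V s))"
  proof (rule For_rule[where I = I])
    fix k s' assume k: "k < fst (upd 32 V s) 11" "fst s' 14 = k" and I: "I k s'"
      and f: "\<And>w. w \<notin> asg (For 14 11 ?B) \<Longrightarrow> fst s' w = fst (upd 32 V s) w"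
      and fa: "\<And>a. a \<notin> asgA ?B \<Longrightarrow> snd s' a = snd (upd 32 V s) a"
    have c: "fst s' 3 = 1" "fst s' 11 = V" "snd s' 2 = snd s 2" using f[of 3] f[of 11] fa[of 2] one V by (simp_all add: L4_frame)
    define t where "t = ev L4 (upd 28 0 s')"
    have t: "fst t 28 = V - Suc k" "fst t 14 = k" "snd t = snd s'"
      unfolding t_def using I k V c L4[of "upd 28 0 s'"] by (auto simp: ev_unasg ev_unasgA L4_frame I_def fun_eq_iff)
    have "V - Suc k \<noteq> V - Suc i" if "i < k" for i using that k V by simp
    then show "I (Suc k) (upd 14 (Suc k) (ev ?B s'))"
      using I k V unfolding I_def by (auto simp: t_def[symmetric] t c less_Suc_eq)
  qed (simp_all add: I_def L4_frame)
  then have "I V (ev P4 s)" unfolding P4_def using V by (simp del: ev.simps(9))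
  moreover have "V - 1 - j < V" "V - 1 - (V - 1 - j) = j" using j by auto
  ultimately show ?thesis unfolding I_def by metis
qed

text \<open>Eliminates the variable whose index is in scalar 18 from the table in scalar 25,
  following \<open>isq_step\<close>.\<close>

definition "stp op = seq [Get 16 2 18, Get 17 3 18, Sf 5 25 17, Bo op 25 25 5, Bo (\<and>) 25 25 16]"
definition "P9 = seq [Set 18 0, For 27 10 (seq [stp (\<and>), Ad 18 18 3, For 14 9 (seq [stp (\<or>), Ad 18 18 3])])]"

lemma stp:
  assumes "isq V k (fst s 25) (psi Q F k)" "isc V (snd s 2 k) (\<lambda>\<alpha>. \<alpha> k)" "snd s 3 k = 2 ^ k" "fst s 18 = k" "k < V"
    and op: "op = (if Q k then (\<and>) else (\<or>))"
  shows "isq V (Suc k) (fst (ev (stp op) s) 25) (psi Q F (Suc k))"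
proof -
  have e: "fst (ev (stp op) s) 25 = bitop (\<and>) (bitop op (fst s 25) (fst s 25 * 2 ^ 2 ^ k)) (snd s 2 k)"
    using assms(3,4) by (simp add: stp_def)
  have p: "psi Q F (Suc k) = (\<lambda>\<alpha>. op (psi Q F k (\<alpha>(k := False))) (psi Q F k (\<alpha>(k := True))))"
    unfolding op by (rule ext) simp
  show ?thesis unfolding e p by (rule isq_step) (use assms in auto)
qed

lemma stp_frame: "asg (stp op) = {5, 16, 17, 25}" "asgA (stp op) = {}" "lv (stp op) = {}"
  by (auto simp: stp_def)

text \<open>The variable index runs upward through blocks of length \<open>m + 1\<close>: one
  universal selector at a multiple of \<open>m + 1\<close>, then \<open>m\<close> existential
  variables.\<close>

lemma P9:
  assumes c: "fst s 3 = 1" "fst s 9 = m" "fst s 10 = Suc m" and V: "V = Suc m * Suc m"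
    and x: "\<And>k. k < V \<Longrightarrow> isc V (snd s 2 k) (\<lambda>\<alpha>. \<alpha> k)" "\<And>k. k < V \<Longrightarrow> snd s 3 k = 2 ^ k"
    and T: "isc V (fst s 25) F"
    and Q: "\<And>k. Q k \<longleftrightarrow> k mod Suc m = 0"
  shows "isq V V (fst (ev P9 s) 25) (psi Q F V)"
proof -
  let ?J = "\<lambda>j s'. fst s' 18 = j \<and> isq V j (fst s' 25) (psi Q F j)"
  let ?C = "seq [stp (\<or>), Ad 18 18 3]"
  let ?B = "seq [stp (\<and>), Ad 18 18 3, For 14 9 ?C]"
  let ?s = "upd 18 0 s"
  have one: "?J (Suc j) (ev (Ad 18 18 3) (ev (stp op) s'))"
    if "?J j s'" "j < V" "fst s' 3 = 1" "snd s' 2 = snd s 2" "snd s' 3 = snd s 3" "op = (if Q j then (\<and>) else (\<or>))" for j s' op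
  proof -
    have "isq V (Suc j) (fst (ev (stp op) s') 25) (psi Q F (Suc j))"
      by (rule stp) (use that x in auto)
    then show ?thesis using that by (simp add: ev_unasg stp_frame del: psi.simps)
  qed
  have "?J (fst ?s 10 * Suc m) (ev (For 27 10 ?B) ?s)"
  proof (rule For_rule[where I = "\<lambda>t. ?J (t * Suc m)"])
    show "?J (0 * Suc m) (upd 27 0 ?s)" using T by (simp add: isq_def)
    fix t s' assume t: "t < fst ?s 10" and J: "?J (t * Suc m) s'"
      and f: "\<And>w. w \<notin> asg (For 27 10 ?B) \<Longrightarrow> fst s' w = fst ?s w"
      and fa: "\<And>a. a \<notin> asgA ?B \<Longrightarrow> snd s' a = snd ?s a"
    have c': "fst s' 3 = 1" "fst s' 9 = m" "snd s' 2 = snd s 2" "snd s' 3 = snd s 3"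
      using f[of 3] f[of 9] fa[of 2] fa[of 3] c by (simp_all add: stp_frame)
    have lt: "t * Suc m + i < V" if "i \<le> m" for i
    proof -
      have "Suc t * Suc m \<le> V" unfolding V using t c by (intro mult_le_mono) auto
      then show ?thesis using that by simp
    qed
    define u where "u = ev (Ad 18 18 3) (ev (stp (\<and>)) s')"
    have u: "fst u 3 = 1" "fst u 9 = m" "snd u 2 = snd s 2" "snd u 3 = snd s 3"
      unfolding u_def using c' by (simp_all add: ev_unasg ev_unasgA stp_frame)
    have Ju: "?J (Suc (t * Suc m)) u"
      unfolding u_def by (rule one[OF J]) (use lt[of 0] c' in \<open>auto simp: Q simp del: mult_Suc_right\<close>)
    have "?J (Suc (t * Suc m) + fst u 9) (ev (For 14 9 ?C) u)"
    proof (rule For_rule[where I = "\<lambda>i. ?J (Suc (t * Suc m) + i)"])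
      show "?J (Suc (t * Suc m) + 0) (upd 14 0 u)" using Ju by (simp del: psi.simps mult_Suc_right)
      fix i s'' assume i: "i < fst u 9" and J: "?J (Suc (t * Suc m) + i) s''"
        and f: "\<And>w. w \<notin> asg (For 14 9 ?C) \<Longrightarrow> fst s'' w = fst u w"
        and fa: "\<And>a. a \<notin> asgA ?C \<Longrightarrow> snd s'' a = snd u a"
      have c'': "fst s'' 3 = 1" "snd s'' 2 = snd s 2" "snd s'' 3 = snd s 3"
        using f[of 3] fa[of 2] fa[of 3] u by (simp_all add: stp_frame)
      have nq: "\<not> Q (Suc (t * Suc m) + i)"
      proof -
        have "Suc (t * Suc m) + i = Suc i + t * Suc m" by simp
        then have "(Suc (t * Suc m) + i) mod Suc m = Suc i" using i u(2) by (simp only: mod_mult_self1) simp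
        then show ?thesis unfolding Q by simp
      qed
      have "?J (Suc (Suc (t * Suc m) + i)) (ev (Ad 18 18 3) (ev (stp (\<or>)) s''))"
        by (rule one[OF J]) (use lt[of "Suc i"] i u c'' nq in \<open>simp_all del: mult_Suc_right\<close>)
      then show "?J (Suc (t * Suc m) + Suc i) (upd 14 (Suc i) (ev ?C s''))" by (simp del: psi.simps mult_Suc_right)
    qed (simp_all add: stp_frame)
    moreover have "Suc (t * Suc m) + fst u 9 = Suc t * Suc m" using u by simp
    ultimately show "?J (Suc t * Suc m) (upd 27 (Suc t) (ev ?B s'))" by (simp only: seq.simps ev.simps(8) u_def[symmetric] upd_simps) simp
  qed (simp_all add: stp_frame)
  then show ?thesis unfolding P9_def using c V by (simp del: ev.simps(9) psi.simps)
qed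

lemma bits_nth: "p < bitlen x \<Longrightarrow> bits x ! p = bit x p"
proof (induction p arbitrary: x)
  case 0
  then have "x > 0" by (cases x) auto
  then show ?case by (simp add: bits_pos bit_0)
next
  case (Suc p)
  then have x: "x > 0" by (cases x) auto
  then have "p < bitlen (x div 2)" using Suc.prems by (simp add: bitlen_def bits_pos)
  then show ?case using Suc.IH[of "x div 2"] x by (simp add: bits_pos bit_Suc)
qed

lemma cb_notin [simp]: "v < d \<Longrightarrow> v \<notin> asg (cb d x)"
  using cb_frame(1)[of d x] by auto

lemma pw_notin [simp]: "v \<noteq> 4 \<Longrightarrow> v \<noteq> 5 \<Longrightarrow> v \<noteq> 6 \<Longrightarrow> v \<notin> asg (pw k)"
  using pw_frame(1)[of k] by auto

section \<open>The program for a given Turing machine\<close>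

locale prg = tmenc M for M + fixes c k :: nat
begin

text \<open>The space bound of the machine, enlarged by the input length so that the whole input
  lies within the encoded cells.\<close>

definition "sx x = c * (bitlen x + 1) ^ k + bitlen x"
definition "Sx x = 2 * sx x + 1"
definition "mx x = Sx x * g"
definition "Vx x = Suc (mx x) * Suc (mx x)"
definition "ini x = enc (sx x) (tm_init M (bits x))"

definition env :: "nat \<Rightarrow> stat \<Rightarrow> bool" where
  "env x s \<longleftrightarrow> fst s 0 = x \<and> fst s 1 = bitlen x \<and> fst s 3 = 1 \<and> fst s 8 = Sx x \<and> fst s 9 = mx x \<and>
     fst s 10 = Suc (mx x) \<and> fst s 11 = Vx x \<and> fst s 21 = g \<and> fst s 22 = sx x + 1"

lemma env_ev: assumes "asg p \<inter> {0, 1, 3, 8, 9, 10, 11, 21, 22} = {}" "env x s" shows "env x (ev p s)"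
proof -
  have "fst (ev p s) v = fst s v" if "v \<in> {0, 1, 3, 8, 9, 10, 11, 21, 22}" for v
    by (rule ev_unasg) (use assms(1) that in blast)
  then show ?thesis using assms(2) by (simp add: env_def)
qed

lemma env_D: assumes "env x s" "\<And>v. v \<notin> W \<Longrightarrow> fst s' v = fst s v" "W \<inter> {0, 1, 3, 8, 9, 10, 11, 21, 22} = {}" shows "env x s'"
proof -
  have "fst s' v = fst s v" if "v \<in> {0, 1, 3, 8, 9, 10, 11, 21, 22}" for v
    by (rule assms(2)) (use assms(3) that in blast)
  then show ?thesis using assms(1) by (simp add: env_def)
qed

text \<open>Scalars: 0 input and output, 1 bit length of the input, 3 the constant 1, 8 number of cells, 9 bits \<open>m\<close> of a configuration,
  10 \<open>m + 1\<close>, 11 number \<open>V\<close> of variables, 12 the true function, 13 powers of two, 18 index of a variable, 21 bits of a cell,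
  22 central cell, 23 acceptance, 24 errors, 25 the formula, 20, 30, 31 base addresses, 40 and above expressions.
  Arrays: 0 and 1 the vectors \<open>XS\<close> and \<open>YS\<close> shifted by one border cell, 2 the variables, 3 their
  powers \<open>2\<^sup>k\<close>, 4 the variables in reverse order.\<close>

definition "P1a = seq [Set 3 1, Ad 2 1 3, Set 7 c, Set 21 g]"
definition "P1c = seq [Set 5 0, For 6 7 (Ad 5 5 4), Mv 4 5, Ad 4 4 1, Ad 8 4 4, Ad 8 8 3, Ad 22 4 3]"
definition "P1d = seq [Set 9 0, For 6 21 (Ad 9 9 8), Ad 10 9 3]"
definition "P1b = seq [pw k, P1c, P1d]"
definition "P2 = seq [Set 11 0, For 6 10 (Ad 11 11 10)]"

lemma P1: "fst (ev P1b (ev P1a (s0 x))) 10 = Suc (mx x)"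
  "env x (ev P2 (ev P1b (ev P1a (s0 x))))" "snd (ev P2 (ev P1b (ev P1a (s0 x)))) a = (\<lambda>_. 0)"
proof -
  define t where "t = ev (pw k) (ev P1a (s0 x))"
  have t: "fst t 0 = x" "fst t 1 = bitlen x" "fst t 3 = 1" "fst t 7 = c" "fst t 21 = g" "fst t 4 = (bitlen x + 1) ^ k" "snd t a = (\<lambda>_. 0)" for a
    unfolding t_def by (simp_all add: pw_ev pw_val P1a_def s0_def fun_eq_iff)
  define u where "u = ev P1c t"
  have f: "v \<notin> {4, 5, 6, 8, 22} \<Longrightarrow> fst u v = fst t v" "snd u = snd t" for v
    unfolding u_def by (auto simp: P1c_def ev_unasg ev_unasgA fun_eq_iff simp del: ev.simps)
  have u4: "fst u 8 = fst t 7 * fst t 4 + fst t 1 + (fst t 7 * fst t 4 + fst t 1) + fst t 3" "fst u 22 = fst t 7 * fst t 4 + fst t 1 + fst t 3"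
    unfolding u_def P1c_def by (simp_all add: For_Ad del: ev.simps(9))
  have u: "fst u 8 = Sx x" "fst u 22 = sx x + 1" unfolding u4 t Sx_def sx_def by simp_all
  define v where "v = ev P1d u"
  have fv: "w \<notin> {6, 9, 10} \<Longrightarrow> fst v w = fst u w" "snd v = snd u" for w
    unfolding v_def by (auto simp: P1d_def ev_unasg ev_unasgA fun_eq_iff simp del: ev.simps)
  have v9: "fst v 9 = fst u 21 * fst u 8" "fst v 10 = fst u 21 * fst u 8 + fst u 3"
    unfolding v_def P1d_def by (simp_all add: For_Ad del: ev.simps(9))
  have v: "fst v 9 = mx x" "fst v 10 = Suc (mx x)" unfolding v9 using f u t by (simp_all add: mx_def mult.commute)
  have e: "ev P1b (ev P1a (s0 x)) = v" by (simp add: P1b_def t_def u_def v_def)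
  have w: "ev P2 v = upd 6 (fst v 10) (upd 11 (fst v 10 * fst v 10) (upd 11 0 v))" unfolding P2_def by (simp add: For_Ad del: ev.simps(9))
  show "fst (ev P1b (ev P1a (s0 x))) 10 = Suc (mx x)" unfolding e by (rule v)
  show "env x (ev P2 (ev P1b (ev P1a (s0 x))))" unfolding e w env_def
    using f fv u v t by (simp add: Vx_def del: mult_Suc mult_Suc_right)
  show "snd (ev P2 (ev P1b (ev P1a (s0 x)))) a = (\<lambda>_. 0)" unfolding e w by (simp add: fv f t)
qed

text \<open>The input bit is isolated with the mask in scalar 13; the blank set beforehand in the
  cell is cleared, and symbol 1 or 2 is set instead.\<close>

definition "B5 = seq [Bo (\<and>) 16 13 0, Set 17 0, Put 0 20 17, Ife 16 17 (seq [Set 5 1, Ad 5 5 20, Put 0 5 12]) (seq [Set 5 2, Ad 5 5 20, Put 0 5 12]), Ad 20 20 21, Ad 13 13 13]"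
definition "P5a = seq [Set 20 0, For 6 8 (seq [Ad 20 20 21, Put 0 20 12])]"
definition "P5b = seq [Set 20 0, For 6 22 (Ad 20 20 21), Mv 31 20, Set 13 1]"
definition "P5 = seq [P5a, P5b, For 14 1 B5, Set 5 (nsym M + q0 M), Ad 5 5 31, Put 0 5 12]"

lemma upd_at: "e < g \<Longrightarrow> e' < g \<Longrightarrow> (A(i' * g + e' := y)) (i * g + e) = (if i = i' \<and> e = e' then y else A (i * g + e))"
  using coord_inj[of e g e' i i'] by simp

definition "P6a = seq [Set 18 0, For 14 9 (seq [Ad 29 14 21, Get 16 4 18, Put 1 29 16, Ad 18 18 3]), Ad 18 18 3]"
definition "P6b = seq [Set 23 0, Set 20 0, For 6 8 (seq [Ad 20 20 21, Set 5 (nsym M + qacc M), Ad 5 5 20, Get 16 1 5, Bo (\<or>) 23 23 16])]"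
text \<open>A multiplexer controlled by the selector in scalar 19. Complementation exists only as
  conjunction with a negated argument, since operations must map two zeros to zero.\<close>

definition "B7 = seq [Ad 29 14 21, Get 16 4 18, Get 17 0 29, Get 5 1 29, Bo (\<and>) 28 16 19, Bo andn 17 17 19, Bo (\<or>) 17 17 28, Put 0 29 17,
  Bo (\<and>) 5 5 19, Bo andn 16 16 19, Bo (\<or>) 5 5 16, Put 1 29 5, Ad 18 18 3]"
definition "L7 = For 14 9 B7"
text \<open>The selector stands behind the vector in its block but is needed for every bit of it, so
  it is fetched in advance at distance \<open>m\<close>.\<close>

definition "P7 = For 27 9 (seq [Ad 26 18 9, Get 19 4 26, L7, Ad 18 18 3])"

text \<open>True at a cell where some bit of the second vector differs from the successor of the
  first.\<close>

definition "cmp = bors (map (\<lambda>e. BB (\<lambda>a b. a \<noteq> b) (phi e) (BV 20 1 e)) [0..<g])"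
definition "P8 = seq [Set 24 0, Set 30 0, Mv 20 21, Ad 31 21 21,
  For 6 8 (seq [cb 40 cmp, Bo (\<or>) 24 24 40, Ad 30 30 21, Ad 20 20 21, Ad 31 31 21]), Bo andn 25 12 24, Bo (\<and>) 25 25 23]"

lemma bok_bors: "bok (bors xs) \<longleftrightarrow> (\<forall>x\<in>set xs. bok x)"
  by (induction xs) (auto simp: bors_def)

lemma bok_cmp: "bok cmp"
  by (auto simp: cmp_def bok_bors phi_def rules_def)

lemma phi_cong: "A 0 = A' 0 \<Longrightarrow> bsem (rd A i) (phi e) = bsem (rd A' i) (phi e)"
  by (simp add: phi_def bex_Un bsem_rules rd_def)

definition "PC = seq [P3, P4, P5, P6a, P6b, P7, P8, P9, Mv 0 25]"
definition "prog = seq [P1a, P1b, P2, PC]"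

end

section \<open>Correctness of the program pieces for a fixed input\<close>

locale prgx = prg M c k for M c k + fixes x :: nat

sublocale prgx \<subseteq> sv: savitch "mx x" "Nx (mx x)" "ini x" "ac (Sx x)"
  by unfold_locales (auto simp: Nx_def ini_def enc_def mx_def Sx_def)

context prgx
begin

abbreviation "m \<equiv> mx x"
abbreviation "V \<equiv> sv.V"

lemma Vx: "Vx x = V"
  by (simp only: Vx_def sv.V_def)

lemma P5a:
  assumes env: "env x s" and z: "snd s 0 = (\<lambda>_. 0)" and e: "e < g"
  shows "snd (ev P5a s) 0 (i * g + e) = (if 1 \<le> i \<and> i \<le> Sx x \<and> e = 0 then fst s 12 else 0)"
proof -
  define I where "I j s' \<longleftrightarrow> fst s' 20 = j * g \<and> (\<forall>i e. e < g \<longrightarrow> snd s' 0 (i * g + e) = (if 1 \<le> i \<and> i \<le> j \<and> e = 0 then fst s 12 else 0))"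
    for j :: nat and s' :: stat
  let ?B = "seq [Ad 20 20 21, Put 0 20 12]"
  have "I (fst (upd 20 0 s) 8) (ev (For 6 8 ?B) (upd 20 0 s))"
  proof (rule For_rule[where I = I])
    fix j s' assume I: "I j s'" and f: "\<And>w. w \<notin> asg (For 6 8 ?B) \<Longrightarrow> fst s' w = fst (upd 20 0 s) w"
    have c: "fst s' 12 = fst s 12" "fst s' 21 = g" using f[of 12] f[of 21] env by (simp_all add: env_def)
    have a: "snd (upd 6 (Suc j) (ev ?B s')) 0 = (snd s' 0)(Suc j * g + 0 := fst s 12)" using I c by (simp add: I_def add.commute)
    show "I (Suc j) (upd 6 (Suc j) (ev ?B s'))"
      unfolding I_def
    proof (intro conjI allI impI)
      show "fst (upd 6 (Suc j) (ev ?B s')) 20 = Suc j * g" using I c by (simp add: I_def)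
      fix i e assume e: "e < g"
      have "snd s' 0 (i * g + e) = (if 1 \<le> i \<and> i \<le> j \<and> e = 0 then fst s 12 else 0)" using I e by (simp add: I_def)
      then show "snd (upd 6 (Suc j) (ev ?B s')) 0 (i * g + e) = (if 1 \<le> i \<and> i \<le> Suc j \<and> e = 0 then fst s 12 else 0)"
        unfolding a upd_at[OF e g_pos] by auto
    qed
  qed (use z in \<open>auto simp: I_def\<close>)
  then show ?thesis using env e unfolding P5a_def by (simp add: env_def I_def del: ev.simps(9))
qed

lemma P5:
  assumes env: "env x s" and z: "snd s 0 = (\<lambda>_. 0)" and one: "isc V (fst s 12) (\<lambda>_. True)"
  shows "isc V (snd (ev P5 s) 0 a) (\<lambda>\<alpha>. pad (ini x) a)"
proof -
  define F where "F = fst s 12"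
  define sy :: "nat \<Rightarrow> nat" where "sy p = (if bit x p then 2 else 1)" for p
  have q0: "nsym M + q0 M < g" "3 \<le> nsym M" using wf by (simp_all add: g_def wf_tm_def)
  have sy: "sy p < g" for p using q0 by (simp add: sy_def)
  define s1 where "s1 = ev P5b (ev P5a s)"
  have fa: "v \<notin> {6, 20} \<Longrightarrow> fst (ev P5a s) v = fst s v" for v by (rule ev_unasg) (simp add: P5a_def)
  have s1: "fst s1 20 = (sx x + 1) * g" "fst s1 31 = (sx x + 1) * g" "fst s1 13 = 1" "snd s1 = snd (ev P5a s)"
    "fst s1 12 = F" "fst s1 0 = x" "fst s1 1 = bitlen x" "fst s1 21 = g"
    using env unfolding s1_def P5b_def by (simp_all add: For_Ad fa env_def F_def del: ev.simps(9))
  define I where "I p s' \<longleftrightarrow> fst s' 20 = (sx x + 1 + p) * g \<and> fst s' 13 = 2 ^ p \<and>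
     (\<forall>i e. e < g \<longrightarrow> snd s' 0 (i * g + e) = (if 1 \<le> i \<and> i \<le> Sx x \<and>
        e = (if sx x + 1 \<le> i \<and> i < sx x + 1 + p then sy (i - (sx x + 1)) else 0) then F else 0))" for p :: nat and s' :: stat
  define s2 where "s2 = ev (For 14 1 B5) s1"
  have "I (fst s1 1) s2"
    unfolding s2_def
  proof (rule For_rule[where I = I])
    show "I 0 (upd 14 0 s1)" using s1 P5a[OF env z] by (simp add: I_def F_def)
    fix p s' assume p: "p < fst s1 1" and I: "I p s'" and f: "\<And>w. w \<notin> asg (For 14 1 B5) \<Longrightarrow> fst s' w = fst s1 w"
    have c: "fst s' 12 = F" "fst s' 21 = g" "fst s' 0 = x" using f[of 12] f[of 21] f[of 0] s1 by (simp_all add: B5_def)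
    have a: "snd (upd 14 (Suc p) (ev B5 s')) 0 = (snd s' 0)((sx x + 1 + p) * g + 0 := 0, (sx x + 1 + p) * g + sy p := F)"
      using I c unfolding B5_def by (cases "bit x p") (simp_all add: I_def sy_def bitop_and_pow2 add.commute)
    show "I (Suc p) (upd 14 (Suc p) (ev B5 s'))"
      unfolding I_def
    proof (intro conjI allI impI)
      show "fst (upd 14 (Suc p) (ev B5 s')) 20 = (sx x + 1 + Suc p) * g" "fst (upd 14 (Suc p) (ev B5 s')) 13 = 2 ^ Suc p"
        using I c by (simp_all add: I_def B5_def)
      fix i e assume e: "e < g"
      have o: "snd s' 0 (i * g + e) = (if 1 \<le> i \<and> i \<le> Sx x \<and> e = (if sx x + 1 \<le> i \<and> i < sx x + 1 + p then sy (i - (sx x + 1)) else 0) then F else 0)"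
        using I e by (simp add: I_def)
      have "sx x + 1 + p \<le> Sx x" using p s1 by (simp add: Sx_def sx_def)
      then show "snd (upd 14 (Suc p) (ev B5 s')) 0 (i * g + e) = (if 1 \<le> i \<and> i \<le> Sx x \<and>
        e = (if sx x + 1 \<le> i \<and> i < sx x + 1 + Suc p then sy (i - (sx x + 1)) else 0) then F else 0)"
        unfolding a upd_at[OF e sy] upd_at[OF e g_pos] o by (cases "i = sx x + 1 + p") auto
    qed
  qed (simp_all add: B5_def)
  then have I2: "snd s2 0 (i * g + e) = (if 1 \<le> i \<and> i \<le> Sx x \<and>
        e = (if sx x + 1 \<le> i \<and> i < sx x + 1 + bitlen x then sy (i - (sx x + 1)) else 0) then F else 0)" if "e < g" for i e
    using that s1 by (simp add: I_def)
  have s2: "fst s2 12 = F" "fst s2 31 = (sx x + 1) * g"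
    unfolding s2_def using s1 by (simp_all add: ev_unasg B5_def del: ev.simps)
  have fin: "snd (ev P5 s) 0 = (snd s2 0)((sx x + 1) * g + (nsym M + q0 M) := F)"
    using s2 unfolding P5_def s2_def s1_def by (simp add: add_ac del: ev.simps(9))
  define i e where "i = a div g" and "e = a mod g"
  have e: "e < g" and a: "a = i * g + e" using g_pos by (simp_all add: i_def e_def)
  have "snd (ev P5 s) 0 a = (if pad (ini x) a then F else 0)"
  proof (cases "e < nsym M")
    case True
    have t: "fst (snd (tm_init M (bits x))) (int i - 1 - int (sx x)) =
      (if sx x + 1 \<le> i \<and> i < sx x + 1 + bitlen x then sy (i - (sx x + 1)) else 0)"
    proof (cases "sx x + 1 \<le> i \<and> i < sx x + 1 + bitlen x")
      case True
      define p where "p = i - (sx x + 1)"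
      have "int i - 1 - int (sx x) = int p" "p < bitlen x" "i - Suc (sx x) = p" using True by (auto simp: p_def)
      then show ?thesis using True bits_nth[of p x] by (simp add: tm_init_def sy_def bitlen_def)
    next
      case False
      then show ?thesis by (auto simp: tm_init_def bitlen_def)
    qed
    show ?thesis unfolding fin a upd_at[OF e q0(1)] I2[OF e] ini_def pad_enc[OF e]
      using True t by (auto simp: cellb_def Sx_def)
  next
    case False
    have "sy (i - (sx x + 1)) \<noteq> e" "0 \<noteq> e" using False q0 by (auto simp: sy_def)
    then show ?thesis unfolding fin a upd_at[OF e q0(1)] I2[OF e] ini_def pad_enc[OF e]
      using False by (auto simp: cellb_def Sx_def tm_init_def)
  qed
  then show ?thesis using one by (simp add: F_def isc_0 isc_def)
qed

lemma P6a:
  assumes env: "env x s" and z: "snd s 1 = (\<lambda>_. 0)" and r: "\<And>j. j < V \<Longrightarrow> isc V (snd s 4 j) (\<lambda>\<alpha>. \<alpha> (V - 1 - j))"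
  shows "fst (ev P6a s) 18 = Suc m" "isc V (snd (ev P6a s) 1 a) (\<lambda>\<alpha>. pad (sv.YS 0 \<alpha>) a)"
proof -
  let ?B = "seq [Ad 29 14 21, Get 16 4 18, Put 1 29 16, Ad 18 18 3]"
  define I where "I k s' \<longleftrightarrow> fst s' 18 = k \<and> (\<forall>a. isc V (snd s' 1 a) (\<lambda>\<alpha>. a < g + k \<and> pad (sv.YS 0 \<alpha>) a))" for k :: nat and s' :: stat
  have mV: "k < m \<Longrightarrow> k < V" for k by (simp add: sv.V_def)
  have "I (fst (upd 18 0 s) 9) (ev (For 14 9 ?B) (upd 18 0 s))"
  proof (rule For_rule[where I = I])
    show "I 0 (upd 14 0 (upd 18 0 s))" using z by (auto simp: I_def pad_def isc_def)
    fix k s' assume k: "k < fst (upd 18 0 s) 9" "fst s' 14 = k" and I: "I k s'" and f: "\<And>w. w \<notin> asg (For 14 9 ?B) \<Longrightarrow> fst s' w = fst (upd 18 0 s) w"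
      and fa: "\<And>a. a \<notin> asgA ?B \<Longrightarrow> snd s' a = snd (upd 18 0 s) a"
    have c: "fst s' 21 = g" "fst s' 3 = 1" "snd s' 4 = snd s 4" "k < m" using f[of 21] f[of 3] fa[of 4] env k by (simp_all add: env_def)
    have a: "fst (upd 14 (Suc k) (ev ?B s')) 18 = Suc k" "snd (upd 14 (Suc k) (ev ?B s')) 1 = (snd s' 1)(g + k := snd s 4 k)"
      using I k c by (simp_all add: I_def add.commute)
    have new: "isc V (snd s 4 k) (\<lambda>\<alpha>. g + k < g + Suc k \<and> pad (sv.YS 0 \<alpha>) (g + k))"
      by (rule isc_cong[OF r[OF mV[OF c(4)]]]) (use c(4) in \<open>simp add: pad_def sv.Ev_def\<close>)
    have old: "isc V (snd s' 1 a) (\<lambda>\<alpha>. a < g + Suc k \<and> pad (sv.YS 0 \<alpha>) a)" if "a \<noteq> g + k" for a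
    proof -
      have "a < g + Suc k \<longleftrightarrow> a < g + k" using that by auto
      then show ?thesis using I by (simp add: I_def)
    qed
    show "I (Suc k) (upd 14 (Suc k) (ev ?B s'))"
      unfolding I_def a using new old by (simp only: fun_upd_apply) auto
  qed simp_all
  moreover define t where "t = ev (For 14 9 ?B) (upd 18 0 s)"
  ultimately have I: "I m t" using env by (simp add: env_def)
  have "fst t 3 = 1" unfolding t_def using env by (simp add: ev_unasg env_def del: ev.simps)
  then have e: "fst (ev P6a s) 18 = Suc (fst t 18)" "snd (ev P6a s) = snd t" unfolding P6a_def t_def by (simp_all del: ev.simps(9))
  then show "fst (ev P6a s) 18 = Suc m" using I by (simp add: I_def)
  have "isc V (snd t 1 a) (\<lambda>\<alpha>. a < g + m \<and> pad (sv.YS 0 \<alpha>) a)" using I by (simp add: I_def)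
  then show "isc V (snd (ev P6a s) 1 a) (\<lambda>\<alpha>. pad (sv.YS 0 \<alpha>) a)"
    unfolding e by (rule isc_cong) (auto simp: pad_def sv.Ev_def)
qed

lemma P6b:
  assumes env: "env x s" and y: "\<And>a. isc V (snd s 1 a) (\<lambda>\<alpha>. pad (sv.YS 0 \<alpha>) a)"
  shows "isc V (fst (ev P6b s) 23) (\<lambda>\<alpha>. ac (Sx x) (sv.YS 0 \<alpha>))"
proof -
  let ?B = "seq [Ad 20 20 21, Set 5 (nsym M + qacc M), Ad 5 5 20, Get 16 1 5, Bo (\<or>) 23 23 16]"
  let ?s = "upd 20 0 (upd 23 0 s)"
  define I where "I j s' \<longleftrightarrow> fst s' 20 = j * g \<and> isc V (fst s' 23) (\<lambda>\<alpha>. ac j (sv.YS 0 \<alpha>))" for j :: nat and s' :: stat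
  have "I (fst ?s 8) (ev (For 6 8 ?B) ?s)"
  proof (rule For_rule[where I = I])
    show "I 0 (upd 6 0 ?s)" by (simp add: I_def ac_def isc_0)
    fix j s' assume I: "I j s'" and f: "\<And>w. w \<notin> asg (For 6 8 ?B) \<Longrightarrow> fst s' w = fst ?s w"
      and fa: "\<And>a. a \<notin> asgA ?B \<Longrightarrow> snd s' a = snd ?s a"
    have c: "fst s' 21 = g" "snd s' 1 = snd s 1" using f[of 21] fa[of 1] env by (simp_all add: env_def)
    have e: "fst (upd 6 (Suc j) (ev ?B s')) 20 = Suc j * g"
      "fst (upd 6 (Suc j) (ev ?B s')) 23 = bitop (\<or>) (fst s' 23) (snd s 1 (Suc j * g + nsym M + qacc M))"
      using I c by (simp_all add: I_def add_ac)
    have "isc V (bitop (\<or>) (fst s' 23) (snd s 1 (Suc j * g + nsym M + qacc M)))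
      (\<lambda>\<alpha>. ac j (sv.YS 0 \<alpha>) \<or> pad (sv.YS 0 \<alpha>) (Suc j * g + nsym M + qacc M))"
      by (rule isc_bitop) (use I y in \<open>simp_all add: I_def\<close>)
    then have "isc V (bitop (\<or>) (fst s' 23) (snd s 1 (Suc j * g + nsym M + qacc M))) (\<lambda>\<alpha>. ac (Suc j) (sv.YS 0 \<alpha>))"
      by (rule isc_cong) (auto simp: ac_def less_Suc_eq simp del: mult_Suc sv.YS.simps)
    then show "I (Suc j) (upd 6 (Suc j) (ev ?B s'))" unfolding I_def e by blast
  qed simp_all
  then show ?thesis using env unfolding P6b_def by (simp add: env_def I_def del: ev.simps(9))
qed

lemma XY_nz: "m \<le> i \<Longrightarrow> \<not> sv.XS l \<alpha> i" "m \<le> i \<Longrightarrow> \<not> sv.YS l \<alpha> i"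
  by (induction l) (auto simp: sv.Ev_def sv.ini)

lemma L7:
  assumes l: "l < m" and env: "env x s" and j: "fst s 18 = Suc l * Suc m"
    and r: "\<And>j. j < V \<Longrightarrow> isc V (snd s 4 j) (\<lambda>\<alpha>. \<alpha> (V - 1 - j))"
    and b: "isc V (fst s 19) (\<lambda>\<alpha>. \<alpha> (V - 1 - (Suc l * Suc m + m)))"
    and X: "\<And>a. isc V (snd s 0 a) (\<lambda>\<alpha>. pad (sv.XS l \<alpha>) a)"
    and Y: "\<And>a. isc V (snd s 1 a) (\<lambda>\<alpha>. pad (sv.YS l \<alpha>) a)"
  shows "fst (ev L7 s) 18 = Suc l * Suc m + m" "isc V (snd (ev L7 s) 0 a) (\<lambda>\<alpha>. pad (sv.XS (Suc l) \<alpha>) a)"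
    "isc V (snd (ev L7 s) 1 a) (\<lambda>\<alpha>. pad (sv.YS (Suc l) \<alpha>) a)"
proof -
  define j0 where "j0 = Suc l * Suc m"
  define bb where "bb \<alpha> = \<alpha> (V - 1 - (j0 + m))" for \<alpha> :: "nat \<Rightarrow> bool"
  \<comment> \<open>In the middle of the loop the first \<open>k\<close> bits of the vectors already
    belong to the next level; \<open>XX\<close> and \<open>YY\<close> describe this mixture.\<close>
  define XX where "XX k \<alpha> a = pad (if a < g + k then sv.XS (Suc l) \<alpha> else sv.XS l \<alpha>) a" for k \<alpha> a
  define YY where "YY k \<alpha> a = pad (if a < g + k then sv.YS (Suc l) \<alpha> else sv.YS l \<alpha>) a" for k \<alpha> a
  define I where "I k s' \<longleftrightarrow> fst s' 18 = j0 + k \<and> (\<forall>a. isc V (snd s' 0 a) (\<lambda>\<alpha>. XX k \<alpha> a)) \<and> (\<forall>a. isc V (snd s' 1 a) (\<lambda>\<alpha>. YY k \<alpha> a))"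
    for k :: nat and s' :: stat
  have "j0 + k < V" if "k < m" for k
  proof -
    have "Suc (Suc l) * Suc m \<le> V" unfolding sv.V_def using l by (intro mult_le_mono) auto
    then show ?thesis using that by (simp add: j0_def)
  qed
  note r = r[OF this]
  have XS: "sv.XS (Suc l) \<alpha> k \<longleftrightarrow> sv.XS l \<alpha> k \<and> \<not> bb \<alpha> \<or> \<alpha> (V - 1 - (j0 + k)) \<and> bb \<alpha>"
    and YS: "sv.YS (Suc l) \<alpha> k \<longleftrightarrow> sv.YS l \<alpha> k \<and> bb \<alpha> \<or> \<alpha> (V - 1 - (j0 + k)) \<and> \<not> bb \<alpha>" if "k < m" for k \<alpha>
    unfolding sv.XS.simps sv.YS.simps sv.Ev_def bb_def j0_def using that by auto
  have "I (fst s 9) (ev L7 s)"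
    unfolding L7_def
  proof (rule For_rule[where I = I])
    have "XX 0 \<alpha> a = pad (sv.XS l \<alpha>) a" "YY 0 \<alpha> a = pad (sv.YS l \<alpha>) a" for \<alpha> a
      by (cases "a < g"; simp add: XX_def YY_def pad_def del: sv.XS.simps sv.YS.simps)+
    then show "I 0 (upd 14 0 s)" using j X Y unfolding I_def j0_def by simp
    fix k s' assume k: "k < fst s 9" "fst s' 14 = k" and I: "I k s'" and f: "\<And>w. w \<notin> asg (For 14 9 B7) \<Longrightarrow> fst s' w = fst s w"
      and fa: "\<And>a. a \<notin> asgA B7 \<Longrightarrow> snd s' a = snd s a"
    have c: "fst s' 21 = g" "fst s' 3 = 1" "fst s' 19 = fst s 19" "snd s' 4 = snd s 4" "k < m"
      using f[of 21] f[of 3] f[of 19] fa[of 4] env k by (simp_all add: env_def B7_def)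
    let ?E = "snd s 4 (j0 + k)" let ?X = "snd s' 0 (g + k)" let ?Y = "snd s' 1 (g + k)" let ?b = "fst s 19"
    let ?X' = "bitop (\<or>) (bitop andn ?X ?b) (bitop (\<and>) ?E ?b)" let ?Y' = "bitop (\<or>) (bitop (\<and>) ?Y ?b) (bitop andn ?E ?b)"
    have e: "fst (upd 14 (Suc k) (ev B7 s')) 18 = j0 + Suc k" "snd (upd 14 (Suc k) (ev B7 s')) 0 = (snd s' 0)(g + k := ?X')"
      "snd (upd 14 (Suc k) (ev B7 s')) 1 = (snd s' 1)(g + k := ?Y')"
      using I k c unfolding B7_def by (simp_all add: I_def add.commute)
    have E: "isc V ?E (\<lambda>\<alpha>. \<alpha> (V - 1 - (j0 + k)))" by (rule r) (rule c)
    have B: "isc V ?b bb" using b unfolding bb_def j0_def .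
    have X0: "isc V ?X (\<lambda>\<alpha>. XX k \<alpha> (g + k))" and Y0: "isc V ?Y (\<lambda>\<alpha>. YY k \<alpha> (g + k))" using I unfolding I_def by blast+
    have "isc V ?X' (\<lambda>\<alpha>. XX k \<alpha> (g + k) \<and> \<not> bb \<alpha> \<or> \<alpha> (V - 1 - (j0 + k)) \<and> bb \<alpha>)"
      by (rule isc_bitop[OF isc_bitop[OF X0 B, of andn] isc_bitop[OF E B, of "(\<and>)"], of "(\<or>)"]) simp_all
    then have X': "isc V ?X' (\<lambda>\<alpha>. XX (Suc k) \<alpha> (g + k))"
      by (rule isc_cong) (simp add: XX_def pad_def XS[OF c(5)] del: sv.XS.simps)
    have "isc V ?Y' (\<lambda>\<alpha>. YY k \<alpha> (g + k) \<and> bb \<alpha> \<or> \<alpha> (V - 1 - (j0 + k)) \<and> \<not> bb \<alpha>)"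
      by (rule isc_bitop[OF isc_bitop[OF Y0 B, of "(\<and>)"] isc_bitop[OF E B, of andn], of "(\<or>)"]) simp_all
    then have Y': "isc V ?Y' (\<lambda>\<alpha>. YY (Suc k) \<alpha> (g + k))"
      by (rule isc_cong) (simp add: YY_def pad_def YS[OF c(5)] del: sv.YS.simps)
    have old: "XX (Suc k) \<alpha> a = XX k \<alpha> a" "YY (Suc k) \<alpha> a = YY k \<alpha> a" if "a \<noteq> g + k" for a \<alpha>
    proof -
      have "a < g + Suc k \<longleftrightarrow> a < g + k" using that by auto
      then show "XX (Suc k) \<alpha> a = XX k \<alpha> a" "YY (Suc k) \<alpha> a = YY k \<alpha> a" by (simp_all only: XX_def YY_def)
    qed
    show "I (Suc k) (upd 14 (Suc k) (ev B7 s'))"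
      unfolding I_def e
    proof (intro conjI allI)
      fix a
      show "isc V (((snd s' 0)(g + k := ?X')) a) (\<lambda>\<alpha>. XX (Suc k) \<alpha> a)"
        using X' I old(1)[of a] by (cases "a = g + k") (simp_all add: I_def)
      show "isc V (((snd s' 1)(g + k := ?Y')) a) (\<lambda>\<alpha>. YY (Suc k) \<alpha> a)"
        using Y' I old(2)[of a] by (cases "a = g + k") (simp_all add: I_def)
    qed simp
  qed (simp_all add: B7_def)
  then have I: "I m (ev L7 s)" using env by (simp add: env_def)
  then show "fst (ev L7 s) 18 = Suc l * Suc m + m" unfolding I_def j0_def by blast
  have "isc V (snd (ev L7 s) 0 a) (\<lambda>\<alpha>. XX m \<alpha> a)" "isc V (snd (ev L7 s) 1 a) (\<lambda>\<alpha>. YY m \<alpha> a)" using I unfolding I_def by blast+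
  moreover have "XX m \<alpha> a = pad (sv.XS (Suc l) \<alpha>) a" "YY m \<alpha> a = pad (sv.YS (Suc l) \<alpha>) a" for \<alpha>
  proof -
    have "XX m \<alpha> a = pad (sv.XS (Suc l) \<alpha>) a \<and> YY m \<alpha> a = pad (sv.YS (Suc l) \<alpha>) a"
    proof (cases "a < g + m")
      case True
      then show ?thesis by (simp only: XX_def YY_def if_True simp_thms)
    next
      case False
      then have "m \<le> a - g" by simp
      note nz = XY_nz(1)[OF this] XY_nz(2)[OF this]
      show ?thesis unfolding XX_def YY_def pad_def if_not_P[OF False] using nz by (simp del: sv.XS.simps sv.YS.simps)
    qed
    then show "XX m \<alpha> a = pad (sv.XS (Suc l) \<alpha>) a" "YY m \<alpha> a = pad (sv.YS (Suc l) \<alpha>) a" by simp_all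
  qed
  ultimately show "isc V (snd (ev L7 s) 0 a) (\<lambda>\<alpha>. pad (sv.XS (Suc l) \<alpha>) a)"
    "isc V (snd (ev L7 s) 1 a) (\<lambda>\<alpha>. pad (sv.YS (Suc l) \<alpha>) a)" by simp_all
qed

lemma L7_frame: "asg L7 = {5, 14, 16, 17, 18, 28, 29}" "asgA L7 = {0, 1}" "lv L7 = {9}"
  by (auto simp: L7_def B7_def)

lemma P7:
  assumes env: "env x s" and j: "fst s 18 = Suc m"
    and r: "\<And>j. j < V \<Longrightarrow> isc V (snd s 4 j) (\<lambda>\<alpha>. \<alpha> (V - 1 - j))"
    and X: "\<And>a. isc V (snd s 0 a) (\<lambda>\<alpha>. pad (ini x) a)"
    and Y: "\<And>a. isc V (snd s 1 a) (\<lambda>\<alpha>. pad (sv.YS 0 \<alpha>) a)"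
  shows "isc V (snd (ev P7 s) 0 a) (\<lambda>\<alpha>. pad (sv.XS m \<alpha>) a)" "isc V (snd (ev P7 s) 1 a) (\<lambda>\<alpha>. pad (sv.YS m \<alpha>) a)"
proof -
  define I where "I l s' \<longleftrightarrow> fst s' 18 = Suc l * Suc m \<and> (\<forall>a. isc V (snd s' 0 a) (\<lambda>\<alpha>. pad (sv.XS l \<alpha>) a)) \<and>
     (\<forall>a. isc V (snd s' 1 a) (\<lambda>\<alpha>. pad (sv.YS l \<alpha>) a))" for l :: nat and s' :: stat
  let ?B = "seq [Ad 26 18 9, Get 19 4 26, L7, Ad 18 18 3]"
  have "I (fst s 9) (ev P7 s)"
    unfolding P7_def
  proof (rule For_rule[where I = I])
    show "I 0 (upd 27 0 s)" using j X Y by (simp add: I_def)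
    fix l s' assume l: "l < fst s 9" and I: "I l s'" and f: "\<And>w. w \<notin> asg (For 27 9 ?B) \<Longrightarrow> fst s' w = fst s w"
      and fa: "\<And>a. a \<notin> asgA ?B \<Longrightarrow> snd s' a = snd s a"
    have lm: "l < m" using l env by (simp add: env_def)
    have env': "env x s'" by (rule env_D[where W = "asg (For 27 9 ?B)", OF env f]) (auto simp: L7_frame)
    have a4: "snd s' 4 = snd s 4" using fa[of 4] by (simp add: L7_frame)
    define t where "t = upd 19 (snd s 4 (Suc l * Suc m + m)) (upd 26 (Suc l * Suc m + m) s')"
    have t': "ev (Get 19 4 26) (ev (Ad 26 18 9) s') = t" using I env' a4 by (simp add: t_def I_def env_def)
    have envt: "env x t" using env' by (simp add: t_def env_def)
    have lV: "Suc l * Suc m + m < V"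
    proof -
      have "Suc (Suc l) * Suc m \<le> V" unfolding sv.V_def using lm by (intro mult_le_mono) auto
      then show ?thesis by simp
    qed
    have t: "fst t 18 = Suc l * Suc m" "snd t 4 = snd s 4" "fst t 19 = snd s 4 (Suc l * Suc m + m)" "snd t 0 = snd s' 0" "snd t 1 = snd s' 1"
      using I a4 unfolding I_def by (simp_all add: t_def)
    have 7: "fst (ev L7 t) 18 = Suc l * Suc m + m" "isc V (snd (ev L7 t) 0 a) (\<lambda>\<alpha>. pad (sv.XS (Suc l) \<alpha>) a)"
      "isc V (snd (ev L7 t) 1 a) (\<lambda>\<alpha>. pad (sv.YS (Suc l) \<alpha>) a)" for a
      using L7[OF lm envt t(1), unfolded t, OF r r[OF lV]] I unfolding I_def by blast+
    have "fst (ev L7 t) 3 = 1" using envt by (simp add: ev_unasg L7_frame env_def)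
    then have e: "fst (upd 27 (Suc l) (ev ?B s')) 18 = Suc (Suc l * Suc m + m)" "snd (upd 27 (Suc l) (ev ?B s')) = snd (ev L7 t)"
      unfolding seq.simps ev.simps(8) t' using 7(1) by (simp_all del: mult_Suc mult_Suc_right)
    show "I (Suc l) (upd 27 (Suc l) (ev ?B s'))" unfolding I_def e using 7(2,3) by simp
  qed (simp_all add: L7_frame)
  then have "I m (ev P7 s)" using env by (simp add: env_def)
  then show "isc V (snd (ev P7 s) 0 a) (\<lambda>\<alpha>. pad (sv.XS m \<alpha>) a)" "isc V (snd (ev P7 s) 1 a) (\<lambda>\<alpha>. pad (sv.YS m \<alpha>) a)"
    unfolding I_def by blast+
qed

text \<open>Mismatches are collected over all cells and removed from the table of True at the end;
  intersecting with the acceptance table gives the matrix of the formula.\<close>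

lemma P8:
  assumes env: "env x s"
    and X: "\<And>a. isc V (snd s 0 a) (\<lambda>\<alpha>. pad (sv.XS m \<alpha>) a)"
    and Y: "\<And>a. isc V (snd s 1 a) (\<lambda>\<alpha>. pad (sv.YS m \<alpha>) a)"
    and one: "isc V (fst s 12) (\<lambda>_. True)" and acc: "isc V (fst s 23) (\<lambda>\<alpha>. ac (Sx x) (sv.YS 0 \<alpha>))"
  shows "isc V (fst (ev P8 s) 25) sv.base"
proof -
  define A where "A \<alpha> arr = (if arr = (0::nat) then pad (sv.XS m \<alpha>) else pad (sv.YS m \<alpha>))" for \<alpha> arr
  define bad where "bad i \<alpha> \<longleftrightarrow> bsem (rd (A \<alpha>) (Suc i)) cmp" for i \<alpha>
  define I where "I j s' \<longleftrightarrow> fst s' 30 = j * g \<and> fst s' 20 = Suc j * g \<and> fst s' 31 = Suc (Suc j) * g \<and> isc V (fst s' 24) (\<lambda>\<alpha>. \<exists>i<j. bad i \<alpha>)"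
    for j :: nat and s' :: stat
  let ?B = "seq [cb 40 cmp, Bo (\<or>) 24 24 40, Ad 30 30 21, Ad 20 20 21, Ad 31 31 21]"
  let ?s = "upd 31 (g + g) (upd 20 g (upd 30 0 (upd 24 0 s)))"
  define t where "t = ev (For 6 8 ?B) ?s"
  have "I (fst ?s 8) t"
    unfolding t_def
  proof (rule For_rule[where I = I])
    show "I 0 (upd 6 0 ?s)" by (simp add: I_def isc_0)
    fix j s' assume I: "I j s'" and f: "\<And>w. w \<notin> asg (For 6 8 ?B) \<Longrightarrow> fst s' w = fst ?s w"
      and fa: "\<And>a. a \<notin> asgA ?B \<Longrightarrow> snd s' a = snd ?s a"
    have c: "fst s' 21 = g" "snd s' = snd s" using f[of 21] fa env by (auto simp: env_def cb_frame fun_eq_iff)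
    define u where "u = ev (cb 40 cmp) s'"
    have u: "fst u v = fst s' v" if "v < 40" for v unfolding u_def using that by (rule cb_unasg)
    have "isc V (fst u 40) (bad j)"
      unfolding u_def bad_def
    proof (rule cb_correct[OF bok_cmp order_refl])
      fix v a' c' assume v: "v \<in> {20, 30, 31::nat}" and a': "a' \<in> {0, 1::nat}"
      have e: "fst s' v = (if v = 30 then Suc j - 1 else if v = 20 then Suc j else Suc j + 1) * g"
        using v I by (auto simp: I_def)
      show "isc V (snd s' a' (fst s' v + c')) (\<lambda>\<alpha>. rd (A \<alpha>) (Suc j) v a' c')"
        unfolding rd_def e[symmetric] c A_def using a' X Y by auto
    qed
    then have "isc V (bitop (\<or>) (fst s' 24) (fst u 40)) (\<lambda>\<alpha>. (\<exists>i<j. bad i \<alpha>) \<or> bad j \<alpha>)"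
      by (intro isc_bitop) (use I in \<open>simp_all add: I_def\<close>)
    then have n: "isc V (bitop (\<or>) (fst s' 24) (fst u 40)) (\<lambda>\<alpha>. \<exists>i<Suc j. bad i \<alpha>)"
      by (rule isc_cong) (auto simp: less_Suc_eq)
    show "I (Suc j) (upd 6 (Suc j) (ev ?B s'))"
      using I n c by (simp add: I_def u_def[symmetric] u add_ac)
  qed simp_all
  then have I: "isc V (fst t 24) (\<lambda>\<alpha>. \<exists>i<Sx x. bad i \<alpha>)" using env by (simp add: env_def I_def)
  have t: "fst t 12 = fst s 12" "fst t 23 = fst s 23" unfolding t_def by (simp_all add: ev_unasg del: ev.simps)
  have "fst s 21 = g" using env by (simp add: env_def)
  then have e: "fst (ev P8 s) 25 = bitop (\<and>) (bitop andn (fst s 12) (fst t 24)) (fst s 23)"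
    using t unfolding P8_def t_def by (simp del: ev.simps(9))
  have "isc V (fst (ev P8 s) 25) (\<lambda>\<alpha>. (True \<and> \<not> (\<exists>i<Sx x. bad i \<alpha>)) \<and> ac (Sx x) (sv.YS 0 \<alpha>))"
    unfolding e by (rule isc_bitop[OF isc_bitop[OF one I, of andn] acc, of "(\<and>)"]) simp_all
  then show ?thesis
  proof (rule isc_cong)
    fix \<alpha>
    have b: "bad i \<alpha> \<longleftrightarrow> (\<exists>e<g. Nx m (sv.XS m \<alpha>) (i * g + e) \<noteq> sv.YS m \<alpha> (i * g + e))" if i: "i < Sx x" for i
    proof -
      have "bsem (rd (A \<alpha>) (Suc i)) (phi e) = Nx m (sv.XS m \<alpha>) (i * g + e)" "rd (A \<alpha>) (Suc i) 20 1 e = sv.YS m \<alpha> (i * g + e)" if e: "e < g" for e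
      proof -
        have "Suc i * g \<le> m" unfolding mx_def using i by (intro mult_le_mono) auto
        then have "i * g + e < m" using e by simp
        then show "bsem (rd (A \<alpha>) (Suc i)) (phi e) = Nx m (sv.XS m \<alpha>) (i * g + e)"
          unfolding Nx_def using e phi_cong[of "A \<alpha>" "\<lambda>_. pad (sv.XS m \<alpha>)"] by (simp add: A_def)
        show "rd (A \<alpha>) (Suc i) 20 1 e = sv.YS m \<alpha> (i * g + e)" by (simp add: rd_def pad_def A_def)
      qed
      note E = this
      have "bad i \<alpha> \<longleftrightarrow> (\<exists>e\<in>set [0..<g]. bsem (rd (A \<alpha>) (Suc i)) (phi e) \<noteq> rd (A \<alpha>) (Suc i) 20 1 e)"
        unfolding bad_def cmp_def bsem_bors by simp
      also have "\<dots> \<longleftrightarrow> (\<exists>e\<in>set [0..<g]. Nx m (sv.XS m \<alpha>) (i * g + e) \<noteq> sv.YS m \<alpha> (i * g + e))"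
        by (rule bex_cong[OF refl]) (simp only: E set_upt atLeastLessThan_iff)
      finally show ?thesis by (simp add: Bex_def)
    qed
    have "(\<not> (\<exists>i<Sx x. bad i \<alpha>)) \<longleftrightarrow> sv.YS m \<alpha> = Nx m (sv.XS m \<alpha>)"
    proof
      assume n: "\<not> (\<exists>i<Sx x. bad i \<alpha>)"
      show "sv.YS m \<alpha> = Nx m (sv.XS m \<alpha>)"
      proof
        fix j show "sv.YS m \<alpha> j = Nx m (sv.XS m \<alpha>) j"
        proof (cases "j < m")
          case True
          then have "j div g < Sx x" unfolding mx_def by (rule less_mult_imp_div_less)
          then have "Nx m (sv.XS m \<alpha>) (j div g * g + j mod g) = sv.YS m \<alpha> (j div g * g + j mod g)"
            using n b g_pos by (metis mod_less_divisor)
          then show ?thesis by (simp only: div_mult_mod_eq)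
        qed (use XY_nz(2)[of j m \<alpha>] in \<open>simp add: Nx_def\<close>)
      qed
    qed (simp add: b)
    then show "((True \<and> \<not> (\<exists>i<Sx x. bad i \<alpha>)) \<and> ac (Sx x) (sv.YS 0 \<alpha>)) = sv.base \<alpha>" by (simp add: sv.base_def del: sv.YS.simps)
  qed
qed

end

section \<open>Running time and correctness of the whole program\<close>

lemma tm_pol:
  assumes "asg p \<inter> lv p = {}" "pol 1 (\<lambda>e. B (e 0))" "\<And>x n. n \<in> lv p \<Longrightarrow> fst (S x) n \<le> B x"
  shows "pol 1 (\<lambda>e. tm p (S (e 0)))"
proof -
  obtain K d where t: "\<And>s M. \<forall>n\<in>lv p. fst s n \<le> M \<Longrightarrow> tm p s \<le> K * (M + 1) ^ d" using time_bound[of p] assms(1) by blast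
  have "pol 1 (\<lambda>e. K * (B (e 0) + 1) ^ d)" by (intro pol_mult pol_const pol_power pol_add assms(2))
  then show ?thesis by (rule pol_mono) (use t assms(3) in blast)
qed

context prg
begin

lemma pol_params: "pol 1 (\<lambda>e. sx (e 0))" "pol 1 (\<lambda>e. Sx (e 0))" "pol 1 (\<lambda>e. mx (e 0))" "pol 1 (\<lambda>e. Vx (e 0))"
  "pol 1 (\<lambda>e. bitlen (e 0) + 1)"
proof -
  show n: "pol 1 (\<lambda>e. bitlen (e 0) + 1)" by (intro pol_add pol_bitlen_var pol_const) simp
  then show s: "pol 1 (\<lambda>e. sx (e 0))" unfolding sx_def by (intro pol_add pol_mult pol_power pol_const pol_bitlen_var) simp_all
  then show S: "pol 1 (\<lambda>e. Sx (e 0))" unfolding Sx_def by (intro pol_add pol_mult pol_const)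
  then show m: "pol 1 (\<lambda>e. mx (e 0))" unfolding mx_def by (intro pol_mult pol_const)
  have "pol 1 (\<lambda>e. mx (e 0) + 1)" by (intro pol_add m pol_const)
  then show "pol 1 (\<lambda>e. Vx (e 0))" unfolding Vx_def Suc_eq_plus1 by (intro pol_mult)
qed

text \<open>\<open>tm_pol\<close> wants loop bounds fixed from the start of a program, but later
  loops are bounded by scalars that earlier ones compute. The program is therefore cut into four
  parts, each with constant bounds.\<close>

lemma prog_time: "pol 1 (\<lambda>e. tm prog (s0 (e 0)))"
proof -
  define B where "B x = bitlen x + 1 + (c + (g + (sx x + 1 + (Sx x + (mx x + 1 + Vx x)))))" for x
  have B: "pol 1 (\<lambda>e. B (e 0))" unfolding B_def by (intro pol_add pol_params pol_const)
  let ?a = "\<lambda>x. ev P1a (s0 x)"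
  let ?b = "\<lambda>x. ev P1b (?a x)"
  let ?c = "\<lambda>x. ev P2 (?b x)"
  have a: "pol 1 (\<lambda>e. tm P1a (s0 (e 0)))" by (rule tm_pol[OF _ B]) (simp_all add: P1a_def)
  have b: "pol 1 (\<lambda>e. tm P1b (?a (e 0)))"
  proof (rule tm_pol[OF _ B])
    show "asg P1b \<inter> lv P1b = {}" using pw_frame[of k] by (auto simp: P1b_def P1c_def P1d_def)
    have "lv P1b \<subseteq> {2, 7, 21}" using pw_frame(3)[of k] by (auto simp: P1b_def P1c_def P1d_def)
    moreover have "fst (?a x) 2 \<le> B x" "fst (?a x) 7 \<le> B x" "fst (?a x) 21 \<le> B x" for x by (simp_all add: P1a_def s0_def B_def)
    ultimately show "n \<in> lv P1b \<Longrightarrow> fst (?a x) n \<le> B x" for x n by blast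
  qed
  have c: "pol 1 (\<lambda>e. tm P2 (?b (e 0)))"
  proof (rule tm_pol[OF _ B])
    show "n \<in> lv P2 \<Longrightarrow> fst (?b x) n \<le> B x" for x n using P1(1)[of x] by (simp add: P2_def B_def)
  qed (simp add: P2_def)
  have d: "pol 1 (\<lambda>e. tm PC (?c (e 0)))"
  proof (rule tm_pol[OF _ B])
    have l: "lv PC \<subseteq> {1, 8, 9, 10, 11, 22}"
      by (auto simp: PC_def P3_def L3_def P4_def L4_def P5_def P5a_def P5b_def B5_def P6a_def P6b_def P7_def L7_def B7_def P8_def P9_def stp_def cb_frame)
    have "asg PC \<inter> {1, 8, 9, 10, 11, 22} = {}"
      by (auto simp: PC_def P3_def L3_def P4_def L4_def P5_def P5a_def P5b_def B5_def P6a_def P6b_def P7_def L7_def B7_def P8_def P9_def stp_def)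
    then show "asg PC \<inter> lv PC = {}" using l by blast
    have "fst (?c x) n \<le> B x" if "n \<in> {1, 8, 9, 10, 11, 22}" for x n
      using P1(2)[of x] that unfolding env_def B_def by auto
    then show "n \<in> lv PC \<Longrightarrow> fst (?c x) n \<le> B x" for x n using l by blast
  qed
  have "tm prog (s0 x) = tm P1a (s0 x) + (tm P1b (?a x) + (tm P2 (?b x) + tm PC (?c x)))" for x by (simp add: prog_def)
  then show ?thesis by (simp only:) (intro pol_add a b c d)
qed

lemma prog_wf: "5 \<le> NA \<Longrightarrow> 41 + bx_depth cmp \<le> NV \<Longrightarrow> wfc NA NV prog"
  by (simp add: prog_def P1a_def P1b_def P1c_def P1d_def P2_def PC_def P3_def L3_def P4_def L4_def P5_def P5a_def P5b_def B5_def
    P6a_def P6b_def P7_def L7_def B7_def P8_def P9_def stp_def pw_wf cb_wf bok_cmp)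

end

context prgx
begin

lemma prog_correct: "fst (ev prog (s0 x)) 0 \<noteq> 0 \<longleftrightarrow> ac (Sx x) ((Nx m ^^ 2 ^ m) (ini x))"
proof -
  note defs = P3_def L3_def P4_def L4_def P5_def P5a_def P5b_def B5_def P6a_def P6b_def P7_def L7_def B7_def P8_def P9_def stp_def
  define t2 where "t2 = ev P2 (ev P1b (ev P1a (s0 x)))"
  define t3 where "t3 = ev P3 t2"
  define t4 where "t4 = ev P4 t3"
  define t5 where "t5 = ev P5 t4"
  define t6 where "t6 = ev P6a t5"
  define t6' where "t6' = ev P6b t6"
  define t7 where "t7 = ev P7 t6'"
  define t8 where "t8 = ev P8 t7"
  have f3: "snd t3 a = snd t2 a" if "a \<notin> {2, 3}" for a unfolding t3_def by (rule ev_unasgA) (use that in \<open>simp add: defs\<close>)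
  have f4: "snd t4 a = snd t3 a" if "a \<notin> {4}" for a unfolding t4_def by (rule ev_unasgA) (use that in \<open>simp add: defs\<close>)
  have f5: "snd t5 a = snd t4 a" if "a \<notin> {0}" for a unfolding t5_def by (rule ev_unasgA) (use that in \<open>simp add: defs\<close>)
  have f6: "snd t6 a = snd t5 a" if "a \<notin> {1}" for a unfolding t6_def by (rule ev_unasgA) (use that in \<open>simp add: defs\<close>)
  have f6': "snd t6' a = snd t6 a" for a unfolding t6'_def by (rule ev_unasgA) (simp add: defs)
  have f7: "snd t7 a = snd t6' a" if "a \<notin> {0, 1}" for a unfolding t7_def by (rule ev_unasgA) (use that in \<open>simp add: defs\<close>)
  have f8: "snd t8 a = snd t7 a" for a unfolding t8_def by (rule ev_unasgA) (simp add: defs cb_frame)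
  have e2: "env x t2" "snd t2 a = (\<lambda>_. 0)" for a unfolding t2_def by (rule P1)+
  have e3: "env x t3" unfolding t3_def by (rule env_ev[OF _ e2(1)]) (simp add: defs)
  have e4: "env x t4" unfolding t4_def by (rule env_ev[OF _ e3]) (simp add: defs)
  have e5: "env x t5" unfolding t5_def by (rule env_ev[OF _ e4]) (simp add: defs)
  have e6: "env x t6" unfolding t6_def by (rule env_ev[OF _ e5]) (simp add: defs)
  have e6': "env x t6'" unfolding t6'_def by (rule env_ev[OF _ e6]) (simp add: defs)
  have e7: "env x t7" unfolding t7_def by (rule env_ev[OF _ e6']) (simp add: defs)
  have e8: "env x t8" unfolding t8_def by (rule env_ev[OF _ e7]) (simp add: defs)
  have p3: "i < V \<Longrightarrow> isc V (snd t3 2 i) (\<lambda>\<alpha>. \<alpha> i)" "i < V \<Longrightarrow> snd t3 3 i = 2 ^ i" "isc V (fst t3 12) (\<lambda>_. True)" for i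
    using P3(1,2)[of t2 V t3 i] P3(3)[of t2 V t3] e2 unfolding t3_def by (simp_all add: env_def Vx)
  have r: "isc V (snd t4 4 j) (\<lambda>\<alpha>. \<alpha> (V - 1 - j))" if "j < V" for j
  proof -
    have "snd t4 4 j = snd t3 2 (V - 1 - j)" unfolding t4_def by (rule P4) (use e3 that in \<open>simp_all add: env_def Vx\<close>)
    then show ?thesis using p3(1)[of "V - 1 - j"] that by simp
  qed
  have o4: "isc V (fst t4 12) (\<lambda>_. True)"
    using p3(3) unfolding t4_def by (simp add: ev_unasg defs del: ev.simps)
  have X5: "isc V (snd t5 0 a) (\<lambda>\<alpha>. pad (ini x) a)" for a unfolding t5_def by (rule P5[OF e4 _ o4]) (simp add: f4 f3 e2)
  have o7: "isc V (fst t7 12) (\<lambda>_. True)"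
    using o4 unfolding t7_def t6'_def t6_def t5_def by (simp add: ev_unasg defs del: ev.simps)
  have y0: "snd t5 1 = (\<lambda>_. 0)" by (simp add: f5 f4 f3 e2)
  have r5: "isc V (snd t5 4 j) (\<lambda>\<alpha>. \<alpha> (V - 1 - j))" if "j < V" for j using r[OF that] by (simp add: f5)
  have Y6: "fst t6 18 = Suc m" "isc V (snd t6 1 a) (\<lambda>\<alpha>. pad (sv.YS 0 \<alpha>) a)" for a
    unfolding t6_def by (rule P6a[OF e5 y0 r5], assumption)+
  have a6: "isc V (fst t6' 23) (\<lambda>\<alpha>. ac (Sx x) (sv.YS 0 \<alpha>))" unfolding t6'_def by (rule P6b[OF e6 Y6(2)])
  have j6: "fst t6' 18 = Suc m" using Y6(1) unfolding t6'_def by (simp add: ev_unasg defs del: ev.simps)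
  have a7: "isc V (fst t7 23) (\<lambda>\<alpha>. ac (Sx x) (sv.YS 0 \<alpha>))" using a6 unfolding t7_def by (simp add: ev_unasg defs del: ev.simps sv.YS.simps)
  have r6: "isc V (snd t6' 4 j) (\<lambda>\<alpha>. \<alpha> (V - 1 - j))" if "j < V" for j using r5[OF that] by (simp add: f6' f6)
  have X6: "isc V (snd t6' 0 a) (\<lambda>\<alpha>. pad (ini x) a)" for a using X5[of a] by (simp add: f6' f6)
  have Y6': "isc V (snd t6' 1 a) (\<lambda>\<alpha>. pad (sv.YS 0 \<alpha>) a)" for a using Y6(2)[of a] unfolding f6' .
  note p7 = P7[OF e6' j6 r6 X6 Y6', folded t7_def]
  have b8: "isc V (fst t8 25) sv.base" unfolding t8_def by (rule P8[OF e7 p7 o7 a7])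
  have "isq V V (fst (ev P9 t8) 25) (psi sv.Qa sv.base V)"
  proof (rule P9)
    show "fst t8 3 = 1" "fst t8 9 = m" "fst t8 10 = Suc m" using e8 by (simp_all add: env_def)
    show "V = Suc m * Suc m" by (rule sv.V_def)
    show "isc V (snd t8 2 i) (\<lambda>\<alpha>. \<alpha> i)" "snd t8 3 i = 2 ^ i" if "i < V" for i
      using p3(1,2)[OF that] by (simp_all add: f8 f7 f6' f6 f5 f4)
  qed (use b8 sv.Qa_def in auto)
  then have q: "bit (fst (ev P9 t8) 25) p \<longleftrightarrow> p < 2 ^ V \<and> (\<forall>i<V. bit p i) \<and> ac (Sx x) ((Nx m ^^ 2 ^ m) (ini x))" for p
    unfolding isq_def isc_def sv.savitch by blast
  have "ev prog (s0 x) = ev (Mv 0 25) (ev P9 t8)"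
    by (simp add: prog_def PC_def t2_def t3_def t4_def t5_def t6_def t6'_def t7_def t8_def)
  then have e: "fst (ev prog (s0 x)) 0 = fst (ev P9 t8) 25" by simp
  have "fst (ev P9 t8) 25 \<noteq> 0 \<longleftrightarrow> (\<exists>p. bit (fst (ev P9 t8) 25) p)" by (metis bit_0_eq bit_eqI bot_apply bot_bool_def)
  also have "\<dots> \<longleftrightarrow> ac (Sx x) ((Nx m ^^ 2 ^ m) (ini x))"
  proof
    assume "ac (Sx x) ((Nx m ^^ 2 ^ m) (ini x))"
    \<comment> \<open>After all eliminations only the all-true assignment can survive, so the number
      is nonzero exactly if the closed formula holds.\<close>
    moreover have "mask V < (2::nat) ^ V" "\<forall>i<V. bit (mask V :: nat) i" by (simp_all add: mask_nat_less_exp bit_mask_iff)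
    ultimately show "\<exists>p. bit (fst (ev P9 t8) 25) p" using q by blast
  qed (use q in blast)
  finally show ?thesis unfolding e .
qed

end

lemma PSPACE_subset_ASRAM:
  assumes "bits ` L \<in> PSPACE"
  shows "L \<in> ASRAM_PTIME"
proof -
  obtain M c k where M: "wf_tm M" and dec: "tm_decides_in_space M (bits ` L) (\<lambda>n. c * (n + 1) ^ k)"
    using assms unfolding PSPACE_def by blast
  interpret prg M c k by unfold_locales (rule M)
  obtain K d where t: "\<And>e. tm prog (s0 (e 0)) \<le> K * (lk 1 e + 1) ^ d" using prog_time unfolding pol_def by blast
  define NV where "NV = 41 + bx_depth cmp"
  \<comment> \<open>Taking \<open>\<kappa> = NV + 2\<close> leaves room below
    \<open>2 ^ \<kappa>\<close> for all scalars and the two temporaries, and it admits all five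
    arrays.\<close>
  have "NV + 2 < 2 ^ (NV + 2)" by (rule less_exp)
  moreover have "41 \<le> NV" by (simp add: NV_def)
  ultimately have lt: "5 \<le> (2::nat) ^ (NV + 2)" "6 \<le> NV" "NV + 2 \<le> 2 ^ (NV + 2)" by linarith+
  show ?thesis
  proof (rule com_ASRAM[of "NV + 2" NV prog K d])
    show "wfc (2 ^ (NV + 2)) NV prog" by (rule prog_wf) (use lt(1) in \<open>simp_all only: NV_def order_refl\<close>)
    show "6 \<le> NV" "NV + 2 \<le> 2 ^ (NV + 2)" by (rule lt)+
    fix x
    show "tm prog (s0 x) \<le> K * (bitlen x + 1) ^ d" using t[of "\<lambda>_. x"] by (simp add: lk_def)
    interpret prgx M c k x by unfold_locales
    have "fst (ev prog (s0 x)) 0 \<noteq> 0 \<longleftrightarrow> bits x \<in> bits ` L"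
      unfolding prog_correct unfolding Sx_def mx_def ini_def
      by (rule ac_run[OF _ dec]) (simp_all add: sx_def bitlen_def)
    also have "\<dots> \<longleftrightarrow> x \<in> L" by (metis image_iff val_bits)
    finally show "fst (ev prog (s0 x)) 0 \<noteq> 0 \<longleftrightarrow> x \<in> L" .
  qed
qed

theorem theorem2:
  shows "ASRAM_PTIME = {L. bits ` L \<in> PSPACE}"
  using ASRAM_PTIME_subset PSPACE_subset_ASRAM by blast

end
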